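(* Fix $m\ge 2$. Let $Q(z)=\sum_{k\ge2}q_kz^{k-1}$, let $w=w(x,\mathbf{q},u)\in\mathbb{Q}[\mathbf{q},u][[x]]$ be the unique solution of $w=x\,e^{uQ(w)}$, and set $w_i=w(x_i,\mathbf{q},u)$ for $i=1,\ldots,m$. Let $\Psi_m$ be the generating series for cycle factorizations of permutations with $m$ cycles, $$\Psi_m(\mathbf{x},\mathbf{q},u)=\sum_{n\ge1}\ \sum_{\mathbf{i}\ge\mathbf{0}}\ \sum_{\substack{\alpha\models n\\ \ell(\alpha)=m}}H_\alpha(\mathbf{i})\,\mathbf{q}^{\mathbf{i}}\,\frac{x_1^{\alpha_1}}{\alpha_1}\cdots\frac{x_m^{\alpha_m}}{\alpha_m}\,\frac{u^{r(\mathbf{i})}}{r(\mathbf{i})!},$$ and let $\Gamma_m$ be the generating series for smooth proper polymaps with $m$ labelled faces, $$\Gamma_m(\mathbf{x},\mathbf{q},u)=\sum_{n\ge1}\ \sum_{\mathbf{i}\ge\mathbf{0}}\ \sum_{\substack{\theta\models n\\ \ell(\theta)=m}}S_\theta(\mathbf{i})\,\mathbf{q}^{\mathbf{i}}\,\mathbf{x}^{\theta}\,\frac{u^{r(\mathbf{i})}}{r(\mathbf{i})!},$$ where $S_\theta(\mathbf{i})$ is the number of smooth $\theta$-proper polymaps of poly-index $\mathbf{i}$. Then $$\Psi_m(\mathbf{x},\mathbf{q},u)=\Gamma_m(\mathbf{w},\mathbf{q},u),$$ where $\mathbf{x}=(x_1,\ldots,x_m)$ and $\mathbf{w}=(w_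1,\ldots,w_m)$.
   Context: Notation. $\alpha\models n$ means $\alpha$ is a composition of $n$ (a sequence of positive integers with sum $n$), $\ell(\alpha)$ is its number of parts; $\mathbf{i}=(i_2,i_3,\ldots)$ is a sequence of nonnegative integers with finitely many nonzero entries; $\mathbf{q}=(q_2,q_3,\ldots)$ are indeterminates, $\mathbf{q}^{\mathbf{i}}=\prod_{k\ge2}q_k^{i_k}$, $\mathbf{x}^\theta=\prod_j x_j^{\theta_j}$, and $r(\mathbf{i})=i_2+i_3+\cdots$. Factorizations. A transitive factorization of $\pi\in S_n$ is a tuple $(\sigma_r,\ldots,\sigma_1)$ of permutations in $S_n$ with $\pi=\sigma_r\cdots\sigma_1$ such that $\langle\sigma_1,\ldots,\sigma_r\rangle$ acts transitively on $\{1,\ldots,n\}$. It is minimal transitive if $nr-\sum_{i=1}^r\ell(\sigma_i)=n+\ell(\pi)-2$, where $\ell(\sigma)$ is the number of cycles (including fixed points) of $\sigma$. A cycle factorization is a minimal transitive factorization all of whose factors are $k$-cycles with $k\ge2$ (one cycle of length $k$, all other points fixed). $H_\alpha(\mathbf{i})$ is the number of cycle factorizations of any fixed permutation with cycle lengths $\alpha_1,\ldots,\alpha_m$ into exactly $i_2$ 2-cycles, $i_3$ 3-cycles, etc. (in any order). Polymaps. A planar map is a cellular decomposition of the sphere into vertices, edges and faces; maps are considered up to orientation-preserving homeomorphism preserving cells, incidence, colours and all labels. A polymap is a planar map whose faces are coloured black and white so that every edge is incident with one black and one white face, and such that the boundary walk of every black face is a cycle (no repeated vertices or edges). Black faces are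 called polygons (a $k$-gon is a polygon of degree $k$); the white faces are called simply faces. The rotator of a vertex $v$ is the cyclic list (sequence up to cyclic shift) of polygons encountered on a small clockwise tour about $v$. When polygons are labelled by integers, each edge inherits the label of the unique polygon it borders. A cyclic list of numbers is increasing if some representative sequence is strictly increasing. The boundary walk of a face $f$ is the cyclic list $(v_0,e_0),\ldots,(v_k,e_k)$ of vertices and edges met traversing the boundary counterclockwise (with $f$ on the left); the index $i$ gives a descent of $f$ if the labels satisfy $e_{i-1}\ge e_i$ (indices cyclic), and descents are counted by position in the boundary walk. A loopless polymap with $r$ polygons is proper if its polygons are labelled bijectively with $1,\ldots,r$ so that the rotator of every vertex is increasing. The poly-index of a loopless polymap is $\mathbf{i}=(i_2,i_3,\ldots)$, where $i_k$ is the number of $k$-gons. For a composition $\theta=(\theta_1,\ldots,\theta_m)$, a proper polymap is $\theta$-proper if its (white) faces are labelled $1,\ldots,m$ so that face $j$ has $\theta_j$ descents for $1\le j\le m$ (vertices are unlabelled). A leaf of a polymap is a polygon exactly one of whose vertices is shared with other polygons; a polymap is smooth if it has no leaves. *)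

theory Defs
  imports
    "HOL-Algebra.Sym_Groups"
    "HOL-Combinatorics.Orbits"
    "HOL-Computational_Algebra.Formal_Power_Series"
    "HOL-Computational_Algebra.Polynomial"
    "HOL-Library.Poly_Mapping"
begin

section \<open>Formal power series in several variables\<close>

text \<open>
  The variables are indexed by \<^typ>\<open>nat\<close>, and a monomial is given by its exponent
  vector of type \<^typ>\<open>nat \<Rightarrow>\<^sub>0 nat\<close>. The variables \<open>x\<^sub>1, \<dots>, x\<^sub>m\<close> are numbered
  \<open>0, \<dots>, m - 1\<close>, in accordance with the indexing of lists.
\<close>

typedef 'a mpser = "UNIV :: ((nat \<Rightarrow>\<^sub>0 nat) \<Rightarrow> 'a) set"
  morphisms mcoeff Abs_mpser ..

lemma mcoeff_Abs [simp]: "mcoeff (Abs_mpser f) = f"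
  by (simp add: Abs_mpser_inverse)

lemma mpser_eqI: "(\<And>e. mcoeff f e = mcoeff g e) \<Longrightarrow> f = g"
  by (metis mcoeff_inject ext)

definition antidiag :: "(nat \<Rightarrow>\<^sub>0 nat) \<Rightarrow> ((nat \<Rightarrow>\<^sub>0 nat) \<times> (nat \<Rightarrow>\<^sub>0 nat)) set" where
  "antidiag e = {(a, b). a + b = e}"

lemma finite_antidiag [simp]: "finite (antidiag e)"
proof -
  let ?F = "{f. \<forall>x. (x \<in> Poly_Mapping.keys e \<longrightarrow> f x \<in> {..Max (insert 0 (Poly_Mapping.lookup e ` Poly_Mapping.keys e))})
                  \<and> (x \<notin> Poly_Mapping.keys e \<longrightarrow> f x = 0)}"
  have fin: "finite ?F"
    by (rule finite_set_of_finite_funs) auto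
  have sub: "Poly_Mapping.lookup ` {a. \<exists>b. a + b = e} \<subseteq> ?F"
  proof (clarify, intro conjI impI)
    fix a b :: "nat \<Rightarrow>\<^sub>0 nat" and x assume e: "e = a + b" "x \<in> Poly_Mapping.keys (a + b)"
    have "Poly_Mapping.lookup a x \<le> Poly_Mapping.lookup (a + b) x" by (simp add: lookup_add)
    also have "\<dots> \<le> Max (insert 0 (Poly_Mapping.lookup (a + b) ` Poly_Mapping.keys (a + b)))"
      using e by (intro Max_ge) auto
    finally show "Poly_Mapping.lookup a x \<in> {..Max (insert 0 (Poly_Mapping.lookup (a + b) ` Poly_Mapping.keys (a + b)))}" by simp
  next
    fix a b :: "nat \<Rightarrow>\<^sub>0 nat" and x assume "x \<notin> Poly_Mapping.keys (a + b)"
    then show "Poly_Mapping.lookup a x = 0" by (simp add: in_keys_iff lookup_add)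
  qed
  have fin1: "finite {a. \<exists>b. a + b = e}"
    using finite_subset[OF sub fin] by (rule finite_imageD) (auto intro: inj_onI poly_mapping_eqI)
  have "antidiag e \<subseteq> {a. \<exists>b. a + b = e} \<times> {b. \<exists>a. b + a = e}"
    unfolding antidiag_def using add.commute by fastforce
  then show ?thesis using fin1 finite_subset by blast
qed

instantiation mpser :: (comm_ring_1) comm_ring_1
begin

definition "0 = Abs_mpser (\<lambda>e. 0)"
definition "1 = Abs_mpser (\<lambda>e. if e = 0 then 1 else 0)"
definition "f + g = Abs_mpser (\<lambda>e. mcoeff f e + mcoeff g e)"
definition "f - g = Abs_mpser (\<lambda>e. mcoeff f e - mcoeff g e)"
definition "- f = Abs_mpser (\<lambda>e. - mcoeff f e)"
definition "f * g = Abs_mpser (\<lambda>e. \<Sum>(a, b)\<in>antidiag e. mcoeff f a * mcoeff g b)"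

instance
proof
  fix f g h :: "'a mpser"
  note defs = zero_mpser_def one_mpser_def plus_mpser_def minus_mpser_def uminus_mpser_def
    times_mpser_def
  show "f + g + h = f + (g + h)" "f + g = g + f" "0 + f = f" "- f + f = 0" "f - g = f + - g"
    by (auto intro!: mpser_eqI simp: defs add_ac)
  show "(f + g) * h = f * h + g * h"
    by (auto intro!: mpser_eqI simp: defs distrib_right sum.distrib case_prod_unfold)
  show comm: "f * g = g * f"
  proof (rule mpser_eqI)
    fix e
    have "(\<Sum>(a, b)\<in>antidiag e. mcoeff f a * mcoeff g b)
        = (\<Sum>(a, b)\<in>antidiag e. mcoeff g a * mcoeff f b)"
      by (rule sum.reindex_bij_witness[of _ "\<lambda>(a, b). (b, a)" "\<lambda>(a, b). (b, a)"])
         (auto simp: antidiag_def add.commute mult.commute)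
    then show "mcoeff (f * g) e = mcoeff (g * f) e" by (simp add: defs)
  qed
  show "1 * f = f"
  proof (rule mpser_eqI)
    fix e
    have "(\<Sum>(a, b)\<in>antidiag e. (if a = 0 then 1 else 0) * mcoeff f b)
        = (\<Sum>p\<in>antidiag e. if p = (0, e) then mcoeff f e else 0)"
      by (rule sum.cong) (auto simp: antidiag_def split: if_splits)
    also have "\<dots> = mcoeff f e"
      by (subst sum.delta[OF finite_antidiag]) (auto simp: antidiag_def)
    finally show "mcoeff (1 * f) e = mcoeff f e" by (simp add: defs)
  qed
  show "f * g * h = f * (g * h)"
  proof (rule mpser_eqI)
    fix e
    have "mcoeff (f * g * h) e
        = (\<Sum>p\<in>antidiag e. \<Sum>q\<in>antidiag (fst p).
             mcoeff f (fst q) * mcoeff g (snd q) * mcoeff h (snd p))"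
      by (simp add: defs case_prod_unfold sum_distrib_right)
    also have "\<dots> = (\<Sum>(p, q)\<in>Sigma (antidiag e) (\<lambda>p. antidiag (fst p)).
             mcoeff f (fst q) * mcoeff g (snd q) * mcoeff h (snd p))"
      by (subst sum.Sigma) auto
    also have "\<dots> = (\<Sum>(p, q)\<in>Sigma (antidiag e) (\<lambda>p. antidiag (snd p)).
             mcoeff f (fst p) * (mcoeff g (fst q) * mcoeff h (snd q)))"
      by (rule sum.reindex_bij_witness[of _
            "\<lambda>(p, q). ((fst p + fst q, snd q), (fst p, fst q))"
            "\<lambda>(p, q). ((fst q, snd q + snd p), (snd q, snd p))"])
         (auto simp: antidiag_def add_ac mult_ac)
    also have "\<dots> = (\<Sum>p\<in>antidiag e. \<Sum>q\<in>antidiag (snd p).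
             mcoeff f (fst p) * (mcoeff g (fst q) * mcoeff h (snd q)))"
      by (subst sum.Sigma) auto
    also have "\<dots> = mcoeff (f * (g * h)) e"
      by (simp add: defs case_prod_unfold sum_distrib_left)
    finally show "mcoeff (f * g * h) e = mcoeff (f * (g * h)) e" .
  qed
  show "(0 :: 'a mpser) \<noteq> 1"
  proof
    assume "(0 :: 'a mpser) = 1"
    then have "mcoeff (0 :: 'a mpser) 0 = mcoeff 1 0" by simp
    then show False by (simp add: defs)
  qed
qed

end

definition mconst :: "'a \<Rightarrow> 'a::comm_ring_1 mpser" where
  "mconst c = Abs_mpser (\<lambda>e. if e = 0 then c else 0)"

definition mvar :: "nat \<Rightarrow> 'a::comm_ring_1 mpser" where
  "mvar j = Abs_mpser (\<lambda>e. if e = Poly_Mapping.single j 1 then 1 else 0)"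

text \<open>
  Formal sum of a family of series in which every monomial occurs in only finitely many
  members of the family. The coefficient of a monomial for which this fails is \<open>0\<close> by the
  convention for \<^const>\<open>sum\<close>, but this does not happen in any of the sums below: the
  minimality condition for factorizations and Euler's formula for maps each determine
  \<open>\<Sum>k\<ge>2. (k - 1) i\<^sub>k\<close> from the exponents of the variables.
\<close>

definition msum :: "'i set \<Rightarrow> ('i \<Rightarrow> 'a::comm_ring_1 mpser) \<Rightarrow> 'a mpser" where
  "msum I F = Abs_mpser (\<lambda>e. \<Sum>t\<in>{t \<in> I. mcoeff (F t) e \<noteq> 0}. mcoeff (F t) e)"

text \<open>Substitutions; the series that are substituted must have constant term \<open>0\<close>.\<close>

definition fps_subst :: "'a::comm_ring_1 fps \<Rightarrow> 'a mpser \<Rightarrow> 'a mpser" where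
  "fps_subst f y = msum UNIV (\<lambda>k. mconst (fps_nth f k) * y ^ k)"

definition msubst :: "'a::comm_ring_1 mpser \<Rightarrow> (nat \<Rightarrow> 'a mpser) \<Rightarrow> 'a mpser" where
  "msubst F y = msum UNIV (\<lambda>e. mconst (mcoeff F e) * (\<Prod>j\<in>Poly_Mapping.keys e. y j ^ Poly_Mapping.lookup e j))"


section \<open>The coefficient ring and the series \<open>w\<close>\<close>

text \<open>
  The ring of polynomials in the indeterminates \<open>q\<^sub>k\<close> and \<open>u\<close>, realised as the ring
  of polynomials in \<open>u\<close> whose coefficients are polynomials in the \<open>q\<^sub>k\<close>. The superfluous
  \<open>q\<^sub>0\<close> and \<open>q\<^sub>1\<close> are never used.
\<close>

type_synonym qu_poly = "((nat \<Rightarrow>\<^sub>0 nat) \<Rightarrow>\<^sub>0 rat) poly"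

definition qvar :: "nat \<Rightarrow> qu_poly" where
  "qvar k = [:Poly_Mapping.single (Poly_Mapping.single k 1) 1:]"

definition uvar :: qu_poly where
  "uvar = [:0, 1:]"

definition ratc :: "rat \<Rightarrow> qu_poly" where
  "ratc c = [:Poly_Mapping.single 0 c:]"

text \<open>
  A sequence \<open>(i\<^sub>2, i\<^sub>3, \<dots>)\<close> of natural numbers with finitely many nonzero entries is
  given by a finitely supported function that vanishes at \<open>0\<close> and \<open>1\<close>.
\<close>

definition index_seqs :: "(nat \<Rightarrow>\<^sub>0 nat) set" where
  "index_seqs = {i. Poly_Mapping.keys i \<subseteq> {2..}}"

definition qmon :: "(nat \<Rightarrow>\<^sub>0 nat) \<Rightarrow> qu_poly" where
  "qmon i = (\<Prod>k\<in>Poly_Mapping.keys i. qvar k ^ Poly_Mapping.lookup i k)"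

definition rsize :: "(nat \<Rightarrow>\<^sub>0 nat) \<Rightarrow> nat" where
  "rsize i = (\<Sum>k\<in>Poly_Mapping.keys i. Poly_Mapping.lookup i k)"

definition Qser :: "qu_poly fps" where
  "Qser = Abs_fps (\<lambda>n. if n = 0 then 0 else qvar (n + 1))"

definition expser :: "qu_poly fps" where
  "expser = Abs_fps (\<lambda>n. ratc (1 / fact n))"

text \<open>
  Every solution of \<open>w = x exp(u Q(w))\<close> has constant term \<open>0\<close>, so that both compositions
  are meaningful.
\<close>

definition w_equation :: "qu_poly fps \<Rightarrow> bool" where
  "w_equation w \<longleftrightarrow> w = fps_X * (expser oo (fps_const uvar * (Qser oo w)))"

lemma fps_power_cong_below:
  fixes f g :: "'a::comm_ring_1 fps"
  assumes "\<And>j. j \<le> n \<Longrightarrow> fps_nth f j = fps_nth g j" "j \<le> n"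
  shows "fps_nth (f ^ k) j = fps_nth (g ^ k) j"
  using assms(2)
proof (induction k arbitrary: j)
  case (Suc k)
  have "fps_nth (f ^ k) (j - i) = fps_nth (g ^ k) (j - i)" for i
    using Suc.prems by (intro Suc.IH) simp
  then show ?case
    using assms(1) Suc.prems by (auto simp: fps_mult_nth intro!: sum.cong)
qed simp

lemma fps_compose_cong_below:
  fixes f g a :: "'a::comm_ring_1 fps"
  assumes "\<And>j. j \<le> n \<Longrightarrow> fps_nth f j = fps_nth g j" "j \<le> n"
  shows "fps_nth (a oo f) j = fps_nth (a oo g) j"
  using fps_power_cong_below[OF assms] by (simp add: fps_compose_nth)

lemma w_equation_ex1: "\<exists>!w. w_equation w"
proof -
  define T where "T w = fps_X * (expser oo (fps_const uvar * (Qser oo w)))" for w :: "qu_poly fps"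
  have T0: "fps_nth (T w) 0 = 0" for w by (simp add: T_def)
  have TS: "fps_nth (T w) (Suc n) = fps_nth (T v) (Suc n)"
    if "\<And>j. j \<le> n \<Longrightarrow> fps_nth w j = fps_nth v j" for w v n
  proof -
    have *: "fps_nth (fps_const uvar * (Qser oo w)) j = fps_nth (fps_const uvar * (Qser oo v)) j"
      if "j \<le> n" for j
      using fps_compose_cong_below[OF \<open>\<And>j. j \<le> n \<Longrightarrow> fps_nth w j = fps_nth v j\<close> that]
      by simp
    show ?thesis
      using fps_compose_cong_below[OF *, of n n expser] by (simp add: T_def)
  qed
  have step: "fps_nth (T w) j = fps_nth (T v) j"
    if "\<And>j. j < n \<Longrightarrow> fps_nth w j = fps_nth v j" "j < Suc n" for w v n j
  proof (cases j)
    case 0 then show ?thesis by (simp add: T0)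
  next
    case (Suc i)
    show ?thesis unfolding Suc by (rule TS) (use that Suc in auto)
  qed
  have uniq: "w = v" if "w = T w" "v = T v" for w v
  proof -
    have "\<forall>j < n. fps_nth w j = fps_nth v j" for n
    proof (induction n)
      case (Suc n)
      then have "\<forall>j < Suc n. fps_nth (T w) j = fps_nth (T v) j" using step by blast
      then show ?case using that by metis
    qed simp
    then show ?thesis by (auto simp: fps_eq_iff)
  qed
  define a where "a k = (T ^^ k) 0" for k
  have aS: "a (Suc k) = T (a k)" for k by (simp add: a_def)
  have agree: "\<forall>j < n. fps_nth (a (Suc n)) j = fps_nth (a n) j" for n
  proof (induction n)
    case (Suc n)
    then show ?case using step aS by metis
  qed simp
  have stable: "fps_nth (a (n + k)) j = fps_nth (a n) j" if "j < n" for n k j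
  proof (induction k)
    case (Suc k)
    then show ?case using agree[of "n + k"] that by simp
  qed simp
  define w where "w = Abs_fps (\<lambda>n. fps_nth (a (Suc n)) n)"
  have w_a: "fps_nth w j = fps_nth (a n) j" if "j < n" for n j
    using stable[of j "Suc j" "n - Suc j"] that by (simp add: w_def)
  have "fps_nth w n = fps_nth (T w) n" for n
  proof -
    have "fps_nth w n = fps_nth (T (a n)) n" by (simp add: w_def aS)
    also have "\<dots> = fps_nth (T w) n" by (rule step[of n]) (auto simp: w_a)
    finally show ?thesis .
  qed
  then have "w = T w" by (simp add: fps_eq_iff)
  then show ?thesis unfolding w_equation_def T_def[symmetric] using uniq by blast
qed

definition wser :: "qu_poly fps" where
  "wser = (THE w. w_equation w)"

lemma w_equation_wser: "w_equation wser"
  unfolding wser_def using w_equation_ex1 by (rule theI')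


section \<open>Cycle factorizations\<close>

definition composition :: "nat list \<Rightarrow> nat \<Rightarrow> bool" where
  "composition \<alpha> n \<longleftrightarrow> (\<forall>a\<in>set \<alpha>. a > 0) \<and> sum_list \<alpha> = n"

text \<open>For a permutation \<open>\<pi>\<close> of a finite set, \<open>orbit \<pi> x\<close> is the cycle containing \<open>x\<close>.\<close>

definition num_cycles :: "nat \<Rightarrow> (nat \<Rightarrow> nat) \<Rightarrow> nat" where
  "num_cycles n \<pi> = card (orbit \<pi> ` {1..n})"

definition has_cycle_lengths :: "nat \<Rightarrow> (nat \<Rightarrow> nat) \<Rightarrow> nat list \<Rightarrow> bool" where
  "has_cycle_lengths n \<pi> \<alpha> \<longleftrightarrow>
     \<pi> permutes {1..n} \<and> image_mset card (mset_set (orbit \<pi> ` {1..n})) = mset \<alpha>"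

definition is_k_cycle :: "nat \<Rightarrow> nat \<Rightarrow> (nat \<Rightarrow> nat) \<Rightarrow> bool" where
  "is_k_cycle n k \<sigma> \<longleftrightarrow>
     (\<exists>cs. distinct cs \<and> set cs \<subseteq> {1..n} \<and> length cs = k \<and> \<sigma> = cycle_of_list cs)"

definition transitive_factorization ::
  "nat \<Rightarrow> (nat \<Rightarrow> nat) \<Rightarrow> (nat \<Rightarrow> nat) list \<Rightarrow> bool" where
  "transitive_factorization n \<pi> \<sigma>s \<longleftrightarrow>
     (\<forall>\<sigma>\<in>set \<sigma>s. \<sigma> permutes {1..n}) \<and>
     \<pi> = foldr (\<circ>) \<sigma>s id \<and>
     (\<forall>a\<in>{1..n}. \<forall>b\<in>{1..n}. \<exists>g\<in>generate (sym_group n) (set \<sigma>s). g a = b)"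

definition minimal_transitive_factorization ::
  "nat \<Rightarrow> (nat \<Rightarrow> nat) \<Rightarrow> (nat \<Rightarrow> nat) list \<Rightarrow> bool" where
  "minimal_transitive_factorization n \<pi> \<sigma>s \<longleftrightarrow>
     transitive_factorization n \<pi> \<sigma>s \<and>
     int n * int (length \<sigma>s) - (\<Sum>\<sigma>\<leftarrow>\<sigma>s. int (num_cycles n \<sigma>)) = int n + int (num_cycles n \<pi>) - 2"

definition cycle_factorization ::
  "nat \<Rightarrow> (nat \<Rightarrow> nat) \<Rightarrow> (nat \<Rightarrow> nat) list \<Rightarrow> bool" where
  "cycle_factorization n \<pi> \<sigma>s \<longleftrightarrow>
     minimal_transitive_factorization n \<pi> \<sigma>s \<and> (\<forall>\<sigma>\<in>set \<sigma>s. \<exists>k\<ge>2. is_k_cycle n k \<sigma>)"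

definition cycle_factorizations ::
  "nat \<Rightarrow> (nat \<Rightarrow> nat) \<Rightarrow> (nat \<Rightarrow>\<^sub>0 nat) \<Rightarrow> (nat \<Rightarrow> nat) list set" where
  "cycle_factorizations n \<pi> i =
     {\<sigma>s. cycle_factorization n \<pi> \<sigma>s \<and>
          (\<forall>k\<ge>2. length (filter (is_k_cycle n k) \<sigma>s) = Poly_Mapping.lookup i k)}"

text \<open>
  Conjugation shows that the number does not depend on the permutation that is fixed here.
\<close>

definition H_num :: "nat list \<Rightarrow> (nat \<Rightarrow>\<^sub>0 nat) \<Rightarrow> nat" where
  "H_num \<alpha> i = card (cycle_factorizations (sum_list \<alpha>)
                   (SOME \<pi>. has_cycle_lengths (sum_list \<alpha>) \<pi> \<alpha>) i)"

text \<open>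
  \<open>\<Psi>\<^sub>m\<close>. The term with index \<open>(n, i, \<alpha>)\<close> has the coefficient
  \<open>H\<^sub>\<alpha>(i) q\<^sup>i u\<^sup>r / (\<alpha>\<^sub>1 \<cdots> \<alpha>\<^sub>m r!)\<close>.
\<close>

definition Psi :: "nat \<Rightarrow> qu_poly mpser" where
  "Psi m = msum {(n, i, \<alpha>). n \<ge> 1 \<and> i \<in> index_seqs \<and> composition \<alpha> n \<and> length \<alpha> = m}
     (\<lambda>(n, i, \<alpha>).
        mconst (of_nat (H_num \<alpha> i) * qmon i * (\<Prod>j<m. ratc (1 / of_nat (\<alpha> ! j)))
                  * uvar ^ rsize i * ratc (1 / fact (rsize i)))
        * (\<Prod>j<m. mvar j ^ (\<alpha> ! j)))"


section \<open>Planar maps\<close>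

text \<open>
  Cellular decompositions of the oriented sphere are encoded by rotation systems. The darts
  are the edges with a choice of direction, \<open>flip\<close> reverses a dart, and \<open>rot d\<close> is the next
  dart after \<open>d\<close> on a clockwise tour about its origin. Then \<open>rot (flip d)\<close> follows \<open>d\<close>
  on the boundary walk of the face on the left of \<open>d\<close>: on arriving at a vertex along an
  edge, the corner on the left lies between that edge and the next one in clockwise
  order. So vertices, edges and faces are the cycles of \<open>rot\<close>, \<open>flip\<close> and \<open>rot \<circ> flip\<close>,
  considered as sets of darts, and \<open>d\<close> belongs to its origin and to the face on its left.
  The sphere is recognised by connectedness and Euler's formula. The map that consists of a
  single vertex has no darts and is not represented; it has only one face, hence it
  cannot contribute to a count of maps with \<open>m \<ge> 2\<close> white faces.
\<close>

record 'd map =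
  darts :: "'d set"
  rot :: "'d \<Rightarrow> 'd"
  flip :: "'d \<Rightarrow> 'd"

definition face_perm :: "('d, 'z) map_scheme \<Rightarrow> 'd \<Rightarrow> 'd" where
  "face_perm M = rot M \<circ> flip M"

definition vertex :: "('d, 'z) map_scheme \<Rightarrow> 'd \<Rightarrow> 'd set" where
  "vertex M d = orbit (rot M) d"

definition edge :: "('d, 'z) map_scheme \<Rightarrow> 'd \<Rightarrow> 'd set" where
  "edge M d = orbit (flip M) d"

definition face :: "('d, 'z) map_scheme \<Rightarrow> 'd \<Rightarrow> 'd set" where
  "face M d = orbit (face_perm M) d"

definition vertices :: "('d, 'z) map_scheme \<Rightarrow> 'd set set" where
  "vertices M = vertex M ` darts M"

definition edges :: "('d, 'z) map_scheme \<Rightarrow> 'd set set" where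
  "edges M = edge M ` darts M"

definition faces :: "('d, 'z) map_scheme \<Rightarrow> 'd set set" where
  "faces M = face M ` darts M"

definition planar_map :: "('d, 'z) map_scheme \<Rightarrow> bool" where
  "planar_map M \<longleftrightarrow>
     finite (darts M) \<and> darts M \<noteq> {} \<and>
     rot M permutes darts M \<and> flip M permutes darts M \<and>
     (\<forall>d\<in>darts M. flip M d \<noteq> d \<and> flip M (flip M d) = d) \<and>
     (\<forall>a\<in>darts M. \<forall>b\<in>darts M. (a, b) \<in> {(c, d). d = rot M c \<or> d = flip M c}\<^sup>*) \<and>
     int (card (vertices M)) - int (card (edges M)) + int (card (faces M)) = 2"

definition loopless :: "('d, 'z) map_scheme \<Rightarrow> bool" where
  "loopless M \<longleftrightarrow> (\<forall>d\<in>darts M. vertex M d \<noteq> vertex M (flip M d))"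


section \<open>Polymaps\<close>

record 'd polymap = "'d map" +
  polygons :: "'d set set"  \<comment> \<open>the black faces\<close>

text \<open>The two faces incident with the edge of \<open>d\<close> are those on the left of \<open>d\<close> and of \<open>flip d\<close>.\<close>

definition polymap :: "('d, 'z) polymap_scheme \<Rightarrow> bool" where
  "polymap M \<longleftrightarrow>
     planar_map M \<and> polygons M \<subseteq> faces M \<and>
     (\<forall>d\<in>darts M. face M d \<in> polygons M \<longleftrightarrow> face M (flip M d) \<notin> polygons M) \<and>
     (\<forall>f\<in>polygons M. inj_on (vertex M) f \<and> inj_on (edge M) f)"

definition white_faces :: "('d, 'z) polymap_scheme \<Rightarrow> 'd set set" where
  "white_faces M = faces M - polygons M"

text \<open>The boundary walk of a face \<open>f\<close> has length \<open>card f\<close>.\<close>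

definition has_poly_index :: "('d, 'z) polymap_scheme \<Rightarrow> (nat \<Rightarrow>\<^sub>0 nat) \<Rightarrow> bool" where
  "has_poly_index M i \<longleftrightarrow> (\<forall>k\<ge>2. Poly_Mapping.lookup i k = card {p \<in> polygons M. card p = k})"

definition leaf :: "('d, 'z) polymap_scheme \<Rightarrow> 'd set \<Rightarrow> bool" where
  "leaf M p \<longleftrightarrow> p \<in> polygons M \<and>
     card {v \<in> vertices M. v \<inter> p \<noteq> {} \<and> (\<exists>p'\<in>polygons M. p' \<noteq> p \<and> v \<inter> p' \<noteq> {})} = 1"

definition smooth :: "('d, 'z) polymap_scheme \<Rightarrow> bool" where
  "smooth M \<longleftrightarrow> (\<nexists>p. leaf M p)"

record 'd labelled_polymap = "'d polymap" +
  polygon_label :: "'d set \<Rightarrow> nat"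
  face_label :: "'d set \<Rightarrow> nat"

text \<open>
  The corner between \<open>d\<close> and the dart that precedes it in clockwise order lies in the face
  on the left of \<open>d\<close>. Hence \<open>rotator_from M d\<close> is the representative of the rotator of
  the origin of \<open>d\<close> that starts at this corner. The list \<open>support (rot M) d\<close> is
  \<open>[d, rot d, rot (rot d), \<dots>]\<close>, ending just before the first return to \<open>d\<close>.
\<close>

definition rotator_from :: "('d, 'z) polymap_scheme \<Rightarrow> 'd \<Rightarrow> 'd set list" where
  "rotator_from M d = filter (\<lambda>f. f \<in> polygons M) (map (face M) (support (rot M) d))"

definition increasing_rotator :: "('d, 'z) labelled_polymap_scheme \<Rightarrow> 'd set \<Rightarrow> bool" where
  "increasing_rotator M v \<longleftrightarrow>
     (\<exists>d\<in>v. sorted_wrt (<) (map (polygon_label M) (rotator_from M d)))"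

definition proper :: "('d, 'z) labelled_polymap_scheme \<Rightarrow> bool" where
  "proper M \<longleftrightarrow>
     polymap M \<and> loopless M \<and>
     bij_betw (polygon_label M) (polygons M) {1..card (polygons M)} \<and>
     (\<forall>v\<in>vertices M. increasing_rotator M v)"

text \<open>The label inherited by the edge of the dart \<open>d\<close> from the polygon it borders.\<close>

definition edge_label :: "('d, 'z) labelled_polymap_scheme \<Rightarrow> 'd \<Rightarrow> nat" where
  "edge_label M d =
     polygon_label M (if face M d \<in> polygons M then face M d else face M (flip M d))"

text \<open>
  The positions in the boundary walk of \<open>f\<close> correspond to the darts \<open>d \<in> f\<close>; the position
  of \<open>d\<close> is followed by that of \<open>face_perm M d\<close>. A descent is counted at its first edge.
\<close>

definition descents :: "('d, 'z) labelled_polymap_scheme \<Rightarrow> 'd set \<Rightarrow> nat" where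
  "descents M f = card {d \<in> f. edge_label M d \<ge> edge_label M (face_perm M d)}"

definition theta_proper :: "nat list \<Rightarrow> ('d, 'z) labelled_polymap_scheme \<Rightarrow> bool" where
  "theta_proper \<theta> M \<longleftrightarrow>
     proper M \<and>
     bij_betw (face_label M) (white_faces M) {1..length \<theta>} \<and>
     (\<forall>f\<in>white_faces M. descents M f = \<theta> ! (face_label M f - 1))"

text \<open>
  Orientation-preserving homeomorphisms that preserve cells, incidence, colours and labels
  correspond to the following bijections of darts.
\<close>

definition polymap_iso ::
  "('d, 'z) labelled_polymap_scheme \<Rightarrow> ('e, 'y) labelled_polymap_scheme \<Rightarrow> bool" where
  "polymap_iso M N \<longleftrightarrow>
     (\<exists>h. bij_betw h (darts M) (darts N) \<and>
          (\<forall>d\<in>darts M. h (rot M d) = rot N (h d) \<and> h (flip M d) = flip N (h d)) \<and>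
          (\<forall>f\<in>faces M. f \<in> polygons M \<longleftrightarrow> h ` f \<in> polygons N) \<and>
          (\<forall>f\<in>polygons M. polygon_label N (h ` f) = polygon_label M f) \<and>
          (\<forall>f\<in>white_faces M. face_label N (h ` f) = face_label M f))"

text \<open>
  \<open>S\<^sub>\<theta>(i)\<close> is the number of isomorphism classes. Since maps are finite, each class is
  represented by maps whose darts are natural numbers.
\<close>

definition smooth_theta_proper_polymaps ::
  "nat list \<Rightarrow> (nat \<Rightarrow>\<^sub>0 nat) \<Rightarrow> nat labelled_polymap set" where
  "smooth_theta_proper_polymaps \<theta> i = {M. theta_proper \<theta> M \<and> smooth M \<and> has_poly_index M i}"

definition S_num :: "nat list \<Rightarrow> (nat \<Rightarrow>\<^sub>0 nat) \<Rightarrow> nat" where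
  "S_num \<theta> i = card (smooth_theta_proper_polymaps \<theta> i //
     {(M, N). M \<in> smooth_theta_proper_polymaps \<theta> i \<and> N \<in> smooth_theta_proper_polymaps \<theta> i \<and>
              polymap_iso M N})"

definition Gamma :: "nat \<Rightarrow> qu_poly mpser" where
  "Gamma m = msum {(n, i, \<theta>). n \<ge> 1 \<and> i \<in> index_seqs \<and> composition \<theta> n \<and> length \<theta> = m}
     (\<lambda>(n, i, \<theta>).
        mconst (of_nat (S_num \<theta> i) * qmon i * uvar ^ rsize i * ratc (1 / fact (rsize i)))
        * (\<Prod>j<m. mvar j ^ (\<theta> ! j)))"

end

(*
  A minimal transitive cycle factorization together with a labelling of the cycles of the
  product is the same as a proper polymap whose n vertices are labelled: the factors are the
  polygons, and the cycle of the product with label j has as many elements as face j has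
  descents. For m >= 2 no relabelling of the vertices other than the identity fixes such an
  object, so that forgetting the vertex labels divides the count by n!. A leaf polygon is a
  factor all but one of whose points are moved by no other factor. Inclusion-exclusion
  over a set of leaves expresses the count of smooth objects by that of all objects; a leaf
  with k vertices can be attached anywhere in the factorization and lengthens the cycle of one
  point by k - 1. Hence attaching leaves to a cycle of length a amounts, after summation,
  to the substitution of x exp(- u Q(x)) for x, whose inverse is w.
*)

theory Submission
  imports Defs "HOL-Library.Countable"
begin

section \<open>Power series for rooted leaves\<close>

text \<open>Removing all leaves may create new ones, so a direct decomposition would have to recurse
  through rooted trees of polygons. Signed removal of one marked layer avoids this: it gives the
  smooth series as the full series at x exp(-uQ(x)), and the recursion is left to the inverse series
  w. The exponential comes from the positions. A list of r factors carries the weight 1/r!, and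
  interleaving s leaves with the other factors gives a binomial coefficient that splits this weight
  into one for the core and one for the leaves. The power exp(-uQ)^e for a cycle with e points comes
  from the anchors: at a fixed position, the map from anchors to the points behind which the new
  points are inserted is a bijection, so exactly e anchors lengthen that cycle. The hypothesis m >=
  2 excludes a single cycle on all points, the one factorization in which a factor shares no point,
  and it makes the symmetric group act freely.\<close>

lemma pderiv_ratc [simp]: "pderiv (ratc c) = 0"
  by (simp add: ratc_def pderiv_pCons)

lemma pderiv_qvar [simp]: "pderiv (qvar k) = 0"
  by (simp add: qvar_def pderiv_pCons)

lemma pderiv_uvar [simp]: "pderiv uvar = 1"
  by (simp add: uvar_def pderiv_pCons)

lemma smult_of_nat: "smult (of_nat n) p = of_nat n * p"
  by (simp add: of_nat_poly)

lemma ratc_mult: "ratc a * ratc b = ratc (a * b)"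
  by (simp add: ratc_def mult_single mult.commute)

lemma ratc_1 [simp]: "ratc 1 = 1"
  by (simp add: ratc_def one_pCons)

lemma ratc_of_nat: "ratc (of_nat n) = of_nat n"
  by (induction n) (auto simp: ratc_def single_add of_nat_poly zero_poly.rep_eq pCons_one)

lemma ratc_fact_Suc: "ratc (1 / fact (Suc n)) * of_nat (Suc n) = ratc (1 / fact n)"
proof -
  have "1 / fact (Suc n) * of_nat (Suc n) = (1 / fact n :: rat)"
    unfolding fact_Suc by (simp add: divide_simps del: of_nat_Suc)
  then show ?thesis by (simp only: ratc_of_nat[symmetric] ratc_mult)
qed

text \<open>Characteristic zero: a polynomial in u is determined by its derivative and its value at
  u = 0. The exponential identities below rest on this uniqueness for differential equations in
  u.\<close>

lemma qu_pderiv_cancel: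
  fixes p q :: qu_poly
  assumes "pderiv p = pderiv q" "coeff p 0 = coeff q 0"
  shows "p = q"
proof -
  have "pderiv (p - q) = 0" using assms by (simp add: pderiv_diff)
  then have "degree (p - q) = 0" by (simp add: pderiv_eq_0_iff)
  then obtain c where "p - q = [:c:]" by (metis degree_eq_zeroE)
  moreover have "coeff (p - q) 0 = 0" using assms by simp
  ultimately show ?thesis by simp
qed

text \<open>The derivation d/du on series in x; x and the \<open>qvar k\<close> are its
  constants.\<close>

definition coeff_pderiv :: "qu_poly fps \<Rightarrow> qu_poly fps" where
  "coeff_pderiv f = Abs_fps (\<lambda>n. pderiv (fps_nth f n))"

lemma coeff_pderiv_nth [simp]: "fps_nth (coeff_pderiv f) n = pderiv (fps_nth f n)"
  by (simp add: coeff_pderiv_def)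

lemma pderiv_sum: "pderiv (sum f A) = (\<Sum>x\<in>A. pderiv (f x))"
  by (induction A rule: infinite_finite_induct) (auto simp: pderiv_add)

lemma coeff_pderiv_mult: "coeff_pderiv (f * g) = coeff_pderiv f * g + f * coeff_pderiv g"
  by (rule fps_ext) (simp add: fps_mult_nth pderiv_sum pderiv_mult sum.distrib mult.commute[of "pderiv _"] add.commute)

lemma Qser_nth: "fps_nth Qser n = (if n = 0 then 0 else qvar (n + 1))"
  by (simp add: Qser_def)

lemma Qser_power_nth_less: "t < n \<Longrightarrow> fps_nth (Qser ^ n) t = 0"
  by (rule startsby_zero_power_prefix[rule_format, of Qser]) (simp_all add: Qser_nth)

text \<open>Powers \<open>Qser ^ n\<close> with n > t have no coefficient at t, so the sum may be
  cut off at any bound N. A bound independent of t allows sums to be interchanged.\<close>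

lemma expser_compose_nth:
  assumes "t \<le> N"
  shows "fps_nth (expser oo (fps_const c * Qser)) t
       = (\<Sum>n\<le>N. ratc (1 / fact n) * c ^ n * fps_nth (Qser ^ n) t)"
proof -
  have "fps_nth (expser oo (fps_const c * Qser)) t
      = (\<Sum>n\<in>{0..t}. ratc (1 / fact n) * c ^ n * fps_nth (Qser ^ n) t)"
    by (simp add: fps_compose_nth expser_def power_mult_distrib fps_const_power mult.assoc)
  also have "\<dots> = (\<Sum>n\<le>N. ratc (1 / fact n) * c ^ n * fps_nth (Qser ^ n) t)"
    using assms by (intro sum.mono_neutral_left) (auto simp: Qser_power_nth_less)
  finally show ?thesis .
qed

text \<open>The chain rule d/du exp(cQ) = c' Q exp(cQ), checked on coefficients: the factor n from
  deriving c^n turns 1/n! into 1/(n-1)!.\<close>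

lemma coeff_pderiv_expser_compose:
  assumes "pderiv c = s"
  shows "coeff_pderiv (expser oo (fps_const c * Qser))
       = fps_const s * (Qser * (expser oo (fps_const c * Qser)))"
proof (rule fps_ext)
  fix t
  have fact: "ratc (1 / fact (Suc n)) * of_nat (Suc n) = ratc (1 / fact n)" for n
    by (rule ratc_fact_Suc)
  have const: "pderiv (fps_nth (Qser ^ n) t) = 0" for n t
  proof (induction n arbitrary: t)
    case (Suc n)
    show ?case
      by (auto simp: fps_mult_nth pderiv_sum pderiv_mult Suc Qser_nth intro!: sum.neutral)
  qed (simp add: fps_one_def pderiv_1)
  \<comment> \<open>The cut-off is \<open>Suc t\<close> so that the sum still reaches t after n has
    been shifted by one.\<close>
  have "fps_nth (coeff_pderiv (expser oo (fps_const c * Qser))) t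
      = (\<Sum>n\<le>Suc t. ratc (1 / fact n) * (of_nat n * c ^ (n - 1) * s) * fps_nth (Qser ^ n) t)"
    unfolding coeff_pderiv_nth expser_compose_nth[OF le_SucI[OF order_refl]]
    by (simp add: pderiv_sum pderiv_mult const pderiv_power smult_of_nat assms mult_ac del: sum.atMost_Suc)
  also have "\<dots> = (\<Sum>n\<le>t. s * (ratc (1 / fact n) * c ^ n * fps_nth (Qser ^ Suc n) t))"
  proof -
    have "ratc (1 / fact (Suc n)) * (of_nat (Suc n) * a * s) * b = s * (ratc (1 / fact n) * a * b)"
      for n a b
      unfolding fact[of n, symmetric] by (simp only: mult_ac)
    note h = this
    show ?thesis
      by (subst sum.atMost_Suc_shift) (simp only: diff_Suc_1 h, simp)
  qed
  also have "\<dots> = s * (\<Sum>n\<le>t. \<Sum>i=0..t. ratc (1 / fact n) * c ^ n * (fps_nth Qser i * fps_nth (Qser ^ n) (t - i)))"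
    by (simp add: sum_distrib_left fps_mult_nth)
  also have "\<dots> = s * (\<Sum>i=0..t. fps_nth Qser i * (\<Sum>n\<le>t. ratc (1 / fact n) * c ^ n * fps_nth (Qser ^ n) (t - i)))"
    by (subst sum.swap) (simp add: sum_distrib_left mult_ac)
  also have "\<dots> = s * (\<Sum>i=0..t. fps_nth Qser i * fps_nth (expser oo (fps_const c * Qser)) (t - i))"
    by (simp add: expser_compose_nth[of _ t])
  finally show "fps_nth (coeff_pderiv (expser oo (fps_const c * Qser))) t
      = fps_nth (fps_const s * (Qser * (expser oo (fps_const c * Qser)))) t"
    by (simp only: fps_mult_left_const_nth fps_mult_nth[of Qser])
qed

text \<open>The series exp(-uQ(x)); the sign is that of inclusion-exclusion, a factor -1 for every
  leaf.\<close>

definition Vser :: "qu_poly fps" where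
  "Vser = expser oo (fps_const (- uvar) * Qser)"

definition Vinv :: "qu_poly fps" where
  "Vinv = expser oo (fps_const uvar * Qser)"

lemma coeff_pderiv_Vser: "coeff_pderiv Vser = - (Qser * Vser)"
  unfolding Vser_def by (subst coeff_pderiv_expser_compose[of _ "-1"]) (auto simp: pderiv_minus fps_eq_iff)

lemma coeff_pderiv_Vinv: "coeff_pderiv Vinv = Qser * Vinv"
  unfolding Vinv_def by (subst coeff_pderiv_expser_compose[of _ "1"]) (auto simp: pderiv_minus fps_eq_iff)

lemma coeff_pderiv_Vser_power: "coeff_pderiv (Vser ^ e) = - (of_nat e * Qser * Vser ^ e)"
proof (induction e)
  case 0 then show ?case by (auto simp: fps_eq_iff fps_one_def pderiv_1)
next
  case (Suc e)
  then show ?case by (simp add: coeff_pderiv_mult coeff_pderiv_Vser algebra_simps)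
qed

lemma expser_compose_coeff0:
  assumes "coeff c 0 = 0"
  shows "coeff (fps_nth (expser oo (fps_const c * Qser)) t) 0 = (if t = 0 then 1 else 0)"
proof -
  have "coeff (ratc (1 / fact n) * c ^ n * fps_nth (Qser ^ n) t) 0
      = (if n = 0 then (if t = 0 then 1 else 0) else 0)" for n
    using assms by (auto simp: coeff_mult_0 coeff_0_power zero_power)
  then show ?thesis
    by (simp add: expser_compose_nth[OF order_refl] coeff_sum)
qed

lemma Vser_coeff0: "coeff (fps_nth Vser t) 0 = (if t = 0 then 1 else 0)"
  unfolding Vser_def by (rule expser_compose_coeff0) (simp add: uvar_def)

lemma Vinv_coeff0: "coeff (fps_nth Vinv t) 0 = (if t = 0 then 1 else 0)"
  unfolding Vinv_def by (rule expser_compose_coeff0) (simp add: uvar_def)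

text \<open>By the product rule the u-derivative of the product vanishes, and at u = 0 both factors
  are 1.\<close>

lemma Vser_mult_Vinv: "Vser * Vinv = 1"
proof (rule fps_ext)
  fix t
  have "coeff_pderiv (Vser * Vinv) = 0"
    by (simp add: coeff_pderiv_mult coeff_pderiv_Vser coeff_pderiv_Vinv algebra_simps)
  then have 1: "pderiv (fps_nth (Vser * Vinv) t) = 0"
    by (metis coeff_pderiv_nth fps_zero_nth)
  have 2: "coeff (fps_nth (Vser * Vinv) t) 0 = (if t = 0 then 1 else 0)"
    by (auto simp: fps_mult_nth coeff_sum coeff_mult_0 Vser_coeff0 Vinv_coeff0 sum.delta intro!: sum.neutral)
  show "fps_nth (Vser * Vinv) t = fps_nth 1 t"
    by (rule qu_pderiv_cancel) (use 1 2 in \<open>auto simp: fps_one_def pderiv_1\<close>)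
qed

lemma wser_nth_0: "fps_nth wser 0 = 0"
  using arg_cong[OF w_equation_wser[unfolded w_equation_def], of "\<lambda>f. fps_nth f 0"] by simp

text \<open>Dividing w = x exp(uQ(w)) by exp(uQ(w)) shows that w inverts x exp(-uQ(x)) under
  composition.\<close>

lemma wser_Vser: "wser * (Vser oo wser) = fps_X"
proof -
  have "(fps_const uvar * Qser) oo wser = fps_const uvar * (Qser oo wser)"
    using wser_nth_0 by (simp add: fps_compose_mult_distrib)
  moreover have "Vinv oo wser = expser oo ((fps_const uvar * Qser) oo wser)"
    unfolding Vinv_def by (rule fps_compose_assoc[symmetric]) (simp_all add: wser_nth_0 Qser_nth)
  ultimately have w: "wser = fps_X * (Vinv oo wser)"
    using w_equation_wser unfolding w_equation_def by simp
  have "(Vser oo wser) * (Vinv oo wser) = 1"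
    using fps_compose_mult_distrib[OF wser_nth_0, of Vser Vinv] by (simp add: Vser_mult_Vinv)
  then show ?thesis by (subst w) (simp add: mult_ac)
qed

lemma XV_power_compose_wser: "((fps_X * Vser) ^ e) oo wser = fps_X ^ e"
proof -
  have "((fps_X * Vser) ^ e) oo wser = ((fps_X * Vser) oo wser) ^ e"
    using fps_compose_power[OF wser_nth_0] by metis
  also have "(fps_X * Vser) oo wser = fps_X"
    by (simp add: fps_compose_mult_distrib[OF wser_nth_0] wser_nth_0 wser_Vser)
  finally show ?thesis .
qed

text \<open>The coefficient matrices of the powers of x exp(-uQ(x)) and of the powers of w are
  inverse to each other. In this form the substitution is undone, one variable at a time.\<close>

lemma wser_power_inverts:
  "(\<Sum>a\<le>b. fps_nth ((fps_X * Vser) ^ e) a * fps_nth (wser ^ a) b) = (if b = e then 1 else 0)"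
  using arg_cong[OF XV_power_compose_wser[of e], of "\<lambda>f. fps_nth f b"]
  by (simp add: fps_compose_nth atMost_atLeast0 fps_X_power_nth)

text \<open>Weighted number of sequences of s leaves, each given by a cycle j, one of
  \<open>e j\<close> anchors for it and the number t of its new points, such that cycle j receives
  \<open>\<delta> j\<close> new points in all.\<close>

primrec leaf_coeff :: "nat \<Rightarrow> (nat \<Rightarrow> nat) \<Rightarrow> nat \<Rightarrow> (nat \<Rightarrow> nat) \<Rightarrow> qu_poly" where
  "leaf_coeff m e 0 \<delta> = (if \<forall>j<m. \<delta> j = 0 then 1 else 0)"
| "leaf_coeff m e (Suc s) \<delta> =
     (\<Sum>j<m. \<Sum>t=1..\<delta> j. of_nat (e j) * qvar (t + 1) * leaf_coeff m e s (\<delta>(j := \<delta> j - t)))"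

lemma sum_fun_upd_less:
  fixes \<delta> :: "nat \<Rightarrow> nat"
  assumes "j < m" "1 \<le> t" "t \<le> \<delta> j"
  shows "(\<Sum>i<m. (\<delta>(j := \<delta> j - t)) i) + t = (\<Sum>i<m. \<delta> i)"
proof -
  have "(\<Sum>i\<in>{..<m} - {j}. (\<delta>(j := \<delta> j - t)) i) = (\<Sum>i\<in>{..<m} - {j}. \<delta> i)"
    by (rule sum.cong) auto
  moreover have "(\<Sum>i<m. \<gamma> i) = \<gamma> j + (\<Sum>i\<in>{..<m} - {j}. \<gamma> i)" for \<gamma> :: "nat \<Rightarrow> nat"
    using assms(1) by (simp add: sum.remove[of "{..<m}" j])
  ultimately show ?thesis using assms(2,3) by simp
qed

lemma pderiv_leaf_coeff [simp]: "pderiv (leaf_coeff m e s \<delta>) = 0"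
  by (induction s arbitrary: \<delta>) (auto simp: pderiv_sum pderiv_mult pderiv_1 pderiv_of_nat)

text \<open>Both sides satisfy the same equation in u: deriving V^e multiplies it by -eQ, and
  deriving the left side splits off one leaf, which is the recursion of \<open>leaf_coeff\<close>. A
  leaf has at least one new point, so the total of \<delta> decreases and N leaves suffice.\<close>

lemma leaf_coeff_exp:
  assumes "(\<Sum>j<m. \<delta> j) \<le> N"
  shows "(\<Sum>s\<le>N. (- uvar) ^ s * ratc (1 / fact s) * leaf_coeff m e s \<delta>)
       = (\<Prod>j<m. fps_nth (Vser ^ e j) (\<delta> j))"
  using assms
proof (induction "\<Sum>j<m. \<delta> j" arbitrary: \<delta> N rule: less_induct)
  case less
  have V0: "coeff (fps_nth (Vser ^ k) t) 0 = (if t = 0 then 1 else 0)" for k t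
  proof (induction k arbitrary: t)
    case (Suc k)
    show ?case
      by (auto simp: fps_mult_nth coeff_sum coeff_mult_0 Vser_coeff0 Suc intro!: sum.neutral)
  qed (simp add: fps_one_def)
  have fact: "of_nat (Suc n) * ratc (1 / fact (Suc n)) = ratc (1 / fact n)" for n
    using ratc_fact_Suc[of n] by (simp only: mult.commute)
  let ?L = "\<lambda>N \<delta>. \<Sum>s\<le>N. (- uvar) ^ s * ratc (1 / fact s) * leaf_coeff m e s \<delta>"
  let ?R = "\<lambda>\<delta>. \<Prod>j<m. fps_nth (Vser ^ e j) (\<delta> j)"
  show ?case
  proof (rule qu_pderiv_cancel)
    have "coeff (?L N \<delta>) 0 = coeff (leaf_coeff m e 0 \<delta>) 0"
      by (subst sum.atMost_shift) (simp add: coeff_sum coeff_mult_0 uvar_def)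
    also have "\<dots> = coeff (?R \<delta>) 0"
    proof -
      have "coeff (prod f A) 0 = (\<Prod>x\<in>A. coeff (f x) 0)" for f :: "nat \<Rightarrow> qu_poly" and A
        by (induction A rule: infinite_finite_induct) (auto simp: coeff_mult_0)
      then show ?thesis by (auto simp: V0)
    qed
    finally show "coeff (?L N \<delta>) 0 = coeff (?R \<delta>) 0" .
  next
    have dV: "pderiv (fps_nth (Vser ^ k) d)
        = - (\<Sum>t=1..d. of_nat k * qvar (t + 1) * fps_nth (Vser ^ k) (d - t))" for k d
    proof -
      have "pderiv (fps_nth (Vser ^ k) d) = fps_nth (coeff_pderiv (Vser ^ k)) d" by simp
      also have "\<dots> = - (of_nat k * (\<Sum>t=0..d. fps_nth Qser t * fps_nth (Vser ^ k) (d - t)))"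
        by (simp only: coeff_pderiv_Vser_power fps_of_nat[symmetric] mult.assoc fps_mult_left_const_nth
             fps_neg_nth fps_mult_nth[of Qser])
      \<comment> \<open>Q has no constant term, so t starts at 1, as in
        \<open>leaf_coeff\<close>.\<close>
      also have "(\<Sum>t=0..d. fps_nth Qser t * fps_nth (Vser ^ k) (d - t))
          = (\<Sum>t=1..d. qvar (t + 1) * fps_nth (Vser ^ k) (d - t))"
        by (rule sum.mono_neutral_cong_right) (auto simp: Qser_nth)
      finally show ?thesis by (simp add: sum_distrib_left mult.assoc)
    qed
    have "pderiv (?R \<delta>) = (\<Sum>j<m. (\<Prod>i\<in>{..<m} - {j}. fps_nth (Vser ^ e i) (\<delta> i))
        * pderiv (fps_nth (Vser ^ e j) (\<delta> j)))"
      by (simp add: pderiv_prod)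
    also have "\<dots> = - (\<Sum>j<m. \<Sum>t=1..\<delta> j. of_nat (e j) * qvar (t + 1) * ?R (\<delta>(j := \<delta> j - t)))"
    proof -
      have "?R (\<delta>(j := \<delta> j - t)) = fps_nth (Vser ^ e j) (\<delta> j - t)
          * (\<Prod>i\<in>{..<m} - {j}. fps_nth (Vser ^ e i) (\<delta> i))" if "j < m" for j t
        using that by (simp add: prod.remove[of "{..<m}" j] cong: prod.cong)
          (rule disjI2, rule prod.cong, auto)
      then show ?thesis
        by (simp add: dV sum_negf sum_distrib_left sum_distrib_right mult_ac del: fun_upd_apply)
    qed
    also have "\<dots> = pderiv (?L N \<delta>)"
    proof (cases N)
      case 0
      then show ?thesis using less.prems by (simp add: pderiv_1)
    next
      case (Suc M)
      have "pderiv (?L N \<delta>) = (\<Sum>s\<le>Suc M. of_nat s * (- uvar) ^ (s - 1) * (-1) * ratc (1 / fact s) * leaf_coeff m e s \<delta>)"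
        unfolding Suc by (simp add: pderiv_sum pderiv_mult pderiv_power smult_of_nat pderiv_minus mult_ac
             del: leaf_coeff.simps sum.atMost_Suc)
      also have "\<dots> = - (\<Sum>s\<le>M. (- uvar) ^ s * ratc (1 / fact s) * leaf_coeff m e (Suc s) \<delta>)"
      proof -
        have "of_nat (Suc n) * a * (-1) * ratc (1 / fact (Suc n)) * b = - (a * ratc (1 / fact n) * b)"
          for n a b
          unfolding fact[of n, symmetric] by (simp add: mult_ac del: fact_Suc of_nat_Suc)
        note h = this
        show ?thesis
          by (subst sum.atMost_Suc_shift) (simp only: diff_Suc_1 h, simp add: sum_negf del: leaf_coeff.simps)
      qed
      also have "(\<Sum>s\<le>M. (- uvar) ^ s * ratc (1 / fact s) * leaf_coeff m e (Suc s) \<delta>)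
          = (\<Sum>j<m. \<Sum>t=1..\<delta> j. of_nat (e j) * qvar (t + 1) * ?L M (\<delta>(j := \<delta> j - t)))"
        by (simp add: sum_distrib_left mult_ac sum.swap[of _ "{..M}"] del: fun_upd_apply)
      also have "\<dots> = (\<Sum>j<m. \<Sum>t=1..\<delta> j. of_nat (e j) * qvar (t + 1) * ?R (\<delta>(j := \<delta> j - t)))"
      proof (intro sum.cong refl arg_cong2[of _ _ _ _ "(*)"])
        fix j t assume "j \<in> {..<m}" "t \<in> {1..\<delta> j}"
        with sum_fun_upd_less[of j m t \<delta>] less.prems Suc
        show "?L M (\<delta>(j := \<delta> j - t)) = ?R (\<delta>(j := \<delta> j - t))"
          by (intro less.hyps) auto
      qed
      finally show ?thesis by simp
    qed
    finally show "pderiv (?L N \<delta>) = pderiv (?R \<delta>)" by simp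
  qed
qed

section \<open>Cycle factorizations with labelled cycles\<close>

text \<open>The rightmost factor acts first. The type is arbitrary because products are also formed
  on a set of orbits.\<close>

definition prodl :: "('a \<Rightarrow> 'a) list \<Rightarrow> 'a \<Rightarrow> 'a" where
  "prodl ss = foldr (\<circ>) ss id"

lemma prodl_simps [simp]: "prodl [] = id" "prodl (s # ss) = s \<circ> prodl ss"
  by (simp_all add: prodl_def)

lemma prodl_append: "prodl (ss @ ts) = prodl ss \<circ> prodl ts"
  by (induction ss) auto

lemma prodl_permutes: "(\<And>s. s \<in> set ss \<Longrightarrow> s permutes A) \<Longrightarrow> prodl ss permutes A"
proof (induction ss)
  case (Cons s ss)
  then have "s \<circ> prodl ss permutes A" by (intro permutes_compose) simp_all
  then show ?case by (simp only: prodl_simps)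
qed (simp add: permutes_id)

definition is_cyc :: "'a set \<Rightarrow> ('a \<Rightarrow> 'a) \<Rightarrow> bool" where
  "is_cyc A s \<longleftrightarrow> (\<exists>cs. distinct cs \<and> set cs \<subseteq> A \<and> length cs \<ge> 2 \<and> s = cycle_of_list cs)"

definition supp :: "('a \<Rightarrow> 'a) \<Rightarrow> 'a set" where
  "supp s = {x. s x \<noteq> x}"

definition csize :: "('a \<Rightarrow> 'a) \<Rightarrow> nat" where
  "csize s = card (supp s)"

lemma cycle_of_list_nth:
  assumes "distinct cs" "i < length cs"
  shows "cycle_of_list cs (cs ! i) = cs ! (Suc i mod length cs)"
proof -
  have "map (cycle_of_list cs ^^ 1) cs = rotate 1 cs"
    using assms by (intro cyclic_rotation)
  then have "map (cycle_of_list cs) cs ! i = rotate1 cs ! i" by simp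
  then show ?thesis using assms by (simp add: nth_rotate1)
qed

lemma funpow_cycle_of_list:
  assumes "distinct cs" "cs \<noteq> []" "i < length cs"
  shows "(cycle_of_list cs ^^ n) (cs ! i) = cs ! ((i + n) mod length cs)"
  using assms by (induction n) (simp_all add: cycle_of_list_nth mod_Suc_eq)

lemma supp_cycle_of_list:
  assumes "distinct cs" "length cs \<ge> 2"
  shows "supp (cycle_of_list cs) = set cs"
proof -
  have "cycle_of_list cs x \<noteq> x" if "x \<in> set cs" for x
  proof -
    obtain i where i: "i < length cs" "x = cs ! i" using \<open>x \<in> set cs\<close> by (metis in_set_conv_nth)
    have "Suc i mod length cs \<noteq> i" using assms(2) i(1) by (cases "Suc i = length cs") auto
    moreover have "Suc i mod length cs < length cs" using i(1) by (intro mod_less_divisor) linarith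
    ultimately show ?thesis
      using assms i by (simp add: cycle_of_list_nth nth_eq_iff_index_eq)
  qed
  then show ?thesis unfolding supp_def using id_outside_supp by fast
qed

lemma csize_cycle_of_list:
  "distinct cs \<Longrightarrow> length cs \<ge> 2 \<Longrightarrow> csize (cycle_of_list cs) = length cs"
  by (simp add: csize_def supp_cycle_of_list distinct_card)

lemma orbit_cycle_of_list:
  assumes "distinct cs" "x \<in> set cs"
  shows "orbit (cycle_of_list cs) x = set cs"
proof -
  obtain i where i: "i < length cs" "x = cs ! i" using assms by (metis in_set_conv_nth)
  have "cs ! j \<in> orbit (cycle_of_list cs) x" if "j < length cs" for j
  proof -
    have "(cycle_of_list cs ^^ (length cs - i + j)) x = cs ! ((i + (length cs - i + j)) mod length cs)"
      using assms i by (subst i(2), subst funpow_cycle_of_list) auto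
    also have "\<dots> = cs ! j" using i that by (simp add: add.assoc[symmetric])
    finally show ?thesis using i unfolding orbit_altdef by (metis (mono_tags, lifting) mem_Collect_eq zero_less_diff add_pos_nonneg zero_le)
  qed
  then show ?thesis
    using permutes_orbit_subset[OF cycle_permutes assms(2)] by (auto simp: in_set_conv_nth)
qed

lemma is_cyc_permutes: "is_cyc A s \<Longrightarrow> s permutes A"
  unfolding is_cyc_def using cycle_permutes permutes_subset by blast

lemma is_cyc_supp: "is_cyc A s \<Longrightarrow> supp s \<subseteq> A"
  unfolding is_cyc_def by (auto simp: supp_cycle_of_list)

lemma is_cyc_csize: "is_cyc A s \<Longrightarrow> csize s \<ge> 2"
  unfolding is_cyc_def by (auto simp: csize_cycle_of_list)

lemma is_cyc_mono: "is_cyc A s \<Longrightarrow> A \<subseteq> B \<Longrightarrow> is_cyc B s"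
  unfolding is_cyc_def by blast

lemma is_cyc_orbit: "is_cyc A s \<Longrightarrow> x \<in> supp s \<Longrightarrow> orbit s x = supp s"
  unfolding is_cyc_def by (auto simp: supp_cycle_of_list orbit_cycle_of_list)

lemma set_support_eq_orbit:
  assumes "permutation p" shows "set (support p a) = orbit p a"
  by (subst support_set[OF assms]) (auto simp: orbit_altdef_permutation[OF assms])

lemma length_support_eq_card_orbit:
  assumes "permutation p" shows "least_power p a = card (orbit p a)"
  using distinct_card[OF cycle_of_permutation[OF assms, of a]]
  by (simp only: set_support_eq_orbit[OF assms] length_map length_upt diff_zero)

lemma cycle_of_list_support:
  assumes "permutation p" "supp p \<subseteq> orbit p a"
  shows "p = cycle_of_list (support p a)"
proof
  fix x show "p x = cycle_of_list (support p a) x"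
  proof (cases "x \<in> orbit p a")
    case True
    then show ?thesis using cycle_restrict[OF assms(1)] by (metis set_support_eq_orbit[OF assms(1)])
  next
    case False
    then have "p x = x" using assms(2) by (auto simp: supp_def)
    then show ?thesis
      using False id_outside_supp by (metis set_support_eq_orbit[OF assms(1)])
  qed
qed

lemma is_cycI:
  assumes "finite A" "s permutes A" "s a \<noteq> a" "supp s \<subseteq> orbit s a"
  shows "is_cyc A s"
  unfolding is_cyc_def
proof (intro exI[of _ "support s a"] conjI)
  have p: "permutation s" using assms(1,2) permutation_permutes by blast
  show "distinct (support s a)" by (rule cycle_of_permutation[OF p])
  show "length (support s a) \<ge> 2" using least_power_gt_one[OF p assms(3)] by simp
  show "s = cycle_of_list (support s a)" by (rule cycle_of_list_support[OF p assms(4)])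
  have "a \<in> A" using assms(2,3) by (auto simp: permutes_def)
  then show "set (support s a) \<subseteq> A"
    unfolding set_support_eq_orbit[OF p] by (rule permutes_orbit_subset[OF assms(2)])
qed

text \<open>Transitivity of the generated group in terms of invariant sets. On a finite set every
  factor maps an invariant set onto itself, so closure under inverses is automatic.\<close>

definition conn :: "'a set \<Rightarrow> ('a \<Rightarrow> 'a) list \<Rightarrow> bool" where
  "conn A ss \<longleftrightarrow> (\<forall>S. S \<subseteq> A \<and> S \<noteq> {} \<and> (\<forall>s\<in>set ss. s ` S \<subseteq> S) \<longrightarrow> S = A)"

lemma connD:
  assumes "conn A ss" "S \<subseteq> A" "x \<in> S" "\<And>s. s \<in> set ss \<Longrightarrow> s ` S \<subseteq> S"
  shows "S = A"
proof -
  have "S \<subseteq> A \<and> S \<noteq> {} \<and> (\<forall>s\<in>set ss. s ` S \<subseteq> S)" using assms(2-4) by auto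
  then show ?thesis using assms(1) unfolding conn_def by simp
qed

text \<open>The fibres of c are the cycles of p: c is constant along p, and an invariant set
  contains every fibre that it meets. As for \<open>conn\<close>, the formulation by invariant sets
  makes it easy to pass to more or fewer points. Membership in \<open>extensional A\<close> makes c
  determined by its values on A, so that labellings can be counted.\<close>

definition cycle_labelling :: "'a set \<Rightarrow> nat \<Rightarrow> ('a \<Rightarrow> 'a) \<Rightarrow> ('a \<Rightarrow> nat) \<Rightarrow> bool" where
  "cycle_labelling A m p c \<longleftrightarrow>
     c \<in> extensional A \<and> c ` A = {..<m} \<and> (\<forall>x\<in>A. c (p x) = c x) \<and>
     (\<forall>S\<subseteq>A. p ` S \<subseteq> S \<longrightarrow> (\<forall>x\<in>S. \<forall>y\<in>A. c y = c x \<longrightarrow> y \<in> S))"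

lemma cycle_labelling_orbit_iff:
  assumes "cycle_labelling A m p c" "p permutes A" "finite A" "x \<in> A" "y \<in> A"
  shows "c y = c x \<longleftrightarrow> y \<in> orbit p x"
proof
  assume "c y = c x"
  moreover have "orbit p x \<subseteq> A" "p ` orbit p x \<subseteq> orbit p x"
    using permutes_orbit_subset[OF assms(2,4)] by (auto intro: orbit.step)
  moreover have "x \<in> orbit p x"
    using assms(2,3) permutation_self_in_orbit permutation_permutes by metis
  ultimately show "y \<in> orbit p x"
    using assms(1,5) unfolding cycle_labelling_def by blast
next
  assume "y \<in> orbit p x"
  then have "c y = c x \<and> y \<in> A"
  proof induction
    case base
    then show ?case using assms permutes_in_image[OF assms(2)] unfolding cycle_labelling_def by blast
  next
    case (step y)
    then show ?case using assms permutes_in_image[OF assms(2)] unfolding cycle_labelling_def by metis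
  qed
  then show "c y = c x" ..
qed

lemma cycle_labellingI:
  assumes "p permutes A" "finite A" "c \<in> extensional A" "c ` A = {..<m}"
    "\<And>x y. x \<in> A \<Longrightarrow> y \<in> A \<Longrightarrow> c y = c x \<longleftrightarrow> y \<in> orbit p x"
  shows "cycle_labelling A m p c"
  unfolding cycle_labelling_def
proof (intro conjI ballI allI impI)
  fix x assume "x \<in> A"
  then show "c (p x) = c x"
    using assms(5) permutes_in_image[OF assms(1)] orbit.base by metis
next
  fix S x y assume S: "S \<subseteq> A" "p ` S \<subseteq> S" "x \<in> S" "y \<in> A" "c y = c x"
  then have "y \<in> orbit p x" using assms(5) by blast
  then show "y \<in> S" by induction (use S in auto)
qed (use assms in auto)

text \<open>A k-cycle on A has \<open>card A\<close> - k + 1 cycles, so the final equation is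
  minimality, that is, genus 0.\<close>

definition Fac :: "'a set \<Rightarrow> nat \<Rightarrow> (('a \<Rightarrow> 'a) list \<times> ('a \<Rightarrow> nat)) set" where
  "Fac A m = {(ss, c). (\<forall>s\<in>set ss. is_cyc A s) \<and> conn A ss \<and> cycle_labelling A m (prodl ss) c \<and>
                       card A + m = (\<Sum>s\<leftarrow>ss. csize s - 1) + 2}"

section \<open>Genus inequality for products of transpositions\<close>

definition num_orbits :: "'a set \<Rightarrow> ('a \<Rightarrow> 'a) \<Rightarrow> nat" where
  "num_orbits A p = card (orbit p ` A)"

lemma orbit_eq_if_mem:
  assumes "p permutes A" "finite A" "y \<in> orbit p x"
  shows "orbit p y = orbit p x"
  using orbit_cyclic_eq3[OF cyclic_on_orbit[OF assms(1,2)] assms(3)] .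

lemma self_in_orbit: "p permutes A \<Longrightarrow> finite A \<Longrightarrow> x \<in> orbit p x"
  using permutation_self_in_orbit permutation_permutes by metis

context
  fixes A :: "'a set" and p :: "'a \<Rightarrow> 'a" and a b :: 'a
  assumes p: "p permutes A" and fin: "finite A" and ab: "a \<in> A" "b \<in> A"
begin

private definition q where "q = Transposition.transpose a b \<circ> p"

private lemma q: "q permutes A"
  unfolding q_def using p ab by (intro permutes_compose permutes_swap_id)

private lemma q_eq: "p x \<noteq> a \<Longrightarrow> p x \<noteq> b \<Longrightarrow> q x = p x" "p x = a \<Longrightarrow> q x = b" "p x = b \<Longrightarrow> q x = a"
  by (auto simp: q_def Transposition.transpose_def)

text \<open>q differs from p only where p takes the value a or b. So an orbit of q that avoids both
  points is an orbit of p, and every other orbit of q is that of a or of b.\<close>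

private lemma orbit_q_cases:
  assumes "x \<in> A"
  shows "orbit q x = orbit p x \<and> a \<notin> orbit p x \<and> b \<notin> orbit p x \<or> orbit q x \<in> {orbit q a, orbit q b}"
proof (cases "a \<in> orbit q x \<or> b \<in> orbit q x")
  case True
  then show ?thesis using orbit_eq_if_mem[OF q fin] by blast
next
  case False
  have *: "y \<in> orbit q x" if "y \<in> orbit p x" for y
    using that
  proof induction
    case base then show ?case using False orbit.base[of q x] q_eq[of x] by metis
  next
    case (step y)
    then show ?case using False orbit.step[of y q x] q_eq[of y] by metis
  qed
  moreover have "y \<in> orbit p x" if "y \<in> orbit q x" for y
    using that
  proof induction
    case base then show ?case using False orbit.base[of p x] orbit.base[of q x] q_eq[of x] by metis
  next
    case (step y)
    then show ?case using False orbit.step[of y p x] orbit.step[of y q x] q_eq[of y] by metis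
  qed
  ultimately show ?thesis using False by blast
qed

private lemma orbits_q_subset:
  "orbit q ` A \<subseteq> (orbit p ` A - {orbit p a, orbit p b}) \<union> {orbit q a, orbit q b}"
  using orbit_q_cases self_in_orbit[OF p fin] by blast

private lemma card_orbits_minus:
  "card (orbit p ` A - {orbit p a, orbit p b}) + card {orbit p a, orbit p b} = num_orbits A p"
proof -
  have "{orbit p a, orbit p b} \<subseteq> orbit p ` A" using ab by auto
  then show ?thesis unfolding num_orbits_def using fin
    by (metis add.commute card_Diff_subset card_mono finite_imageI finite_subset le_add_diff_inverse)
qed

private lemma num_orbits_q:
  "num_orbits A q + card {orbit p a, orbit p b} \<le> num_orbits A p + card {orbit q a, orbit q b}"
proof -
  have "num_orbits A q \<le> card ((orbit p ` A - {orbit p a, orbit p b}) \<union> {orbit q a, orbit q b})"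
    unfolding num_orbits_def by (rule card_mono[OF _ orbits_q_subset]) (use fin in auto)
  also have "\<dots> \<le> card (orbit p ` A - {orbit p a, orbit p b}) + card {orbit q a, orbit q b}"
    by (rule card_Un_le)
  finally show ?thesis using card_orbits_minus by linarith
qed

lemma num_orbits_transpose_le: "num_orbits A (Transposition.transpose a b \<circ> p) \<le> Suc (num_orbits A p)"
proof -
  have "card {orbit q a, orbit q b} \<le> 2" by (simp add: card_insert_if)
  moreover have "card {orbit p a, orbit p b} \<ge> 1" by (simp add: Suc_leI card_gt_0_iff)
  ultimately show ?thesis using num_orbits_q unfolding q_def[symmetric] by linarith
qed

text \<open>Started at a, q runs along the p-cycle of a until p would return to a; there it steps to
  b instead. So the two cycles are merged.\<close>

lemma num_orbits_transpose_join:
  assumes "b \<notin> orbit p a"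
  shows "Suc (num_orbits A (Transposition.transpose a b \<circ> p)) \<le> num_orbits A p"
proof -
  have "y \<in> orbit q a \<and> y \<noteq> a \<or> b \<in> orbit q a" if "y \<in> orbit p a" for y
    using that
  proof induction
    case base
    have "p a \<noteq> b" using assms orbit.base by metis
    then show ?case using orbit.base[of q a] q_eq[of a] by (cases "p a = a") auto
  next
    case (step y)
    have "p y \<noteq> b" using assms orbit.step step.hyps by metis
    then show ?case using step.IH orbit.step[of y q a] q_eq[of y] by (cases "p y = a") auto
  qed
  from this[OF self_in_orbit[OF p fin]] have "b \<in> orbit q a" by blast
  then have "orbit q b = orbit q a" by (rule orbit_eq_if_mem[OF q fin])
  then have "card {orbit q a, orbit q b} = 1" by simp
  moreover have "orbit p a \<noteq> orbit p b" using assms self_in_orbit[OF p fin] by blast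
  then have "card {orbit p a, orbit p b} = 2" by simp
  ultimately show ?thesis using num_orbits_q unfolding q_def[symmetric] by linarith
qed

end

definition swap_of :: "'a \<times> 'a \<Rightarrow> 'a \<Rightarrow> 'a" where
  "swap_of e = Transposition.transpose (fst e) (snd e)"

lemma swap_of_permutes: "fst e \<in> A \<Longrightarrow> snd e \<in> A \<Longrightarrow> swap_of e permutes A"
  unfolding swap_of_def by (rule permutes_swap_id)

text \<open>
  The function \<open>k\<close> names the connected components of the graph formed by the transpositions.
  A transposition that joins two components also joins two cycles.
\<close>

lemma transposition_components:
  assumes "finite A" "set es \<subseteq> A \<times> A"
  shows "\<exists>k :: 'a \<Rightarrow> 'a. (\<forall>e\<in>set es. k (fst e) = k (snd e)) \<and>
     num_orbits A (prodl (map swap_of es)) + card A \<le> length es + 2 * card (k ` A)"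
  using assms(2)
proof (induction es)
  case Nil
  have "num_orbits A id \<le> card A"
    unfolding num_orbits_def by (rule card_image_le[OF assms(1)])
  then show ?case by (intro exI[of _ id]) (auto simp: id_def)
next
  case (Cons e es)
  then obtain k :: "'a \<Rightarrow> 'a" where k: "\<And>e. e \<in> set es \<Longrightarrow> k (fst e) = k (snd e)"
    "num_orbits A (prodl (map swap_of es)) + card A \<le> length es + 2 * card (k ` A)"
    by (metis (no_types, lifting) insert_subset list.simps(15))
  obtain a b where e: "e = (a, b)" "a \<in> A" "b \<in> A" using Cons.prems by auto
  define p where "p = prodl (map swap_of es)"
  have p: "p permutes A"
    unfolding p_def using Cons.prems by (intro prodl_permutes) (auto intro!: swap_of_permutes)
  have pe: "prodl (map swap_of (e # es)) = Transposition.transpose a b \<circ> p"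
    by (simp add: e p_def swap_of_def)
  have kp: "k (p x) = k x" for x
  proof -
    have "k (prodl (map swap_of es) x) = k x" if "\<And>e. e \<in> set es \<Longrightarrow> k (fst e) = k (snd e)" for es
      using that
    proof (induction es)
      case (Cons e es)
      have "k (swap_of e y) = k y" for y
        using Cons.prems[of e] by (auto simp: swap_of_def Transposition.transpose_def)
      then show ?case using Cons by simp
    qed simp
    then show ?thesis using k(1) p_def by blast
  qed
  have korb: "k y = k x" if "y \<in> orbit p x" for x y
    using that by induction (simp_all add: kp)
  show ?case
  \<comment> \<open>Inside one component there is at most one more cycle, paid for by the new
    transposition. Between two components the number of cycles drops by 1, while the right side
    gains 1 from the length and loses at most 2 from the components.\<close>
  proof (cases "k a = k b")
    case True
    have "num_orbits A (Transposition.transpose a b \<circ> p) \<le> Suc (num_orbits A p)"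
      by (rule num_orbits_transpose_le[OF p assms(1) e(2,3)])
    then have "num_orbits A (prodl (map swap_of (e # es))) + card A \<le> length (e # es) + 2 * card (k ` A)"
      using k(2) unfolding pe by (simp add: p_def)
    moreover have "\<forall>e'\<in>set (e # es). k (fst e') = k (snd e')" using k(1) True e(1) by simp
    ultimately show ?thesis by blast
  next
    case False
    then have "b \<notin> orbit p a" using korb by metis
    then have le: "Suc (num_orbits A (Transposition.transpose a b \<circ> p)) \<le> num_orbits A p"
      by (rule num_orbits_transpose_join[OF p assms(1) e(2,3)])
    define k' where "k' x = (if k x = k b then k a else k x)" for x
    have "k ` A \<subseteq> insert (k b) (k' ` A)" by (auto simp: k'_def)
    then have "card (k ` A) \<le> card (insert (k b) (k' ` A))"
      by (rule card_mono[rotated]) (use assms(1) in auto)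
    also have "\<dots> \<le> Suc (card (k' ` A))" by (rule card_insert_le_m1) auto
    finally have "num_orbits A (prodl (map swap_of (e # es))) + card A \<le> length (e # es) + 2 * card (k' ` A)"
      using k(2) le unfolding pe by (simp add: p_def)
    moreover have "\<forall>e'\<in>set (e # es). k' (fst e') = k' (snd e')"
      using k(1) e(1) by (simp add: k'_def)
    ultimately show ?thesis by blast
  qed
qed

text \<open>A fibre of the component map is invariant under all transpositions, so connectedness
  leaves a single component.\<close>

lemma transposition_genus:
  assumes "finite A" "set es \<subseteq> A \<times> A" "conn A (map swap_of es)"
  shows "num_orbits A (prodl (map swap_of es)) + card A \<le> length es + 2"
proof -
  obtain k :: "'a \<Rightarrow> 'a" where k: "\<And>e. e \<in> set es \<Longrightarrow> k (fst e) = k (snd e)"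
    "num_orbits A (prodl (map swap_of es)) + card A \<le> length es + 2 * card (k ` A)"
    using transposition_components[OF assms(1,2)] by blast
  have "k x = k y" if "x \<in> A" "y \<in> A" for x y
  proof -
    define S where "S = {z\<in>A. k z = k x}"
    have "s ` S \<subseteq> S" if s: "s \<in> set (map swap_of es)" for s
    proof -
      obtain e where e: "e \<in> set es" "s = swap_of e" using s by auto
      have "fst e \<in> A" "snd e \<in> A" using assms(2) e(1) by auto
      then show ?thesis using k(1)[OF e(1)]
        by (auto simp: S_def e(2) swap_of_def Transposition.transpose_def)
    qed
    moreover have "S \<subseteq> A" "S \<noteq> {}" using that by (auto simp: S_def)
    ultimately have "S = A" using assms(3) unfolding conn_def by metis
    then have "y \<in> S" using that by simp
    then show ?thesis by (simp add: S_def)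
  qed
  then have "\<forall>u\<in>k ` A. \<forall>v\<in>k ` A. u = v" by blast
  then have "card (k ` A) \<le> Suc 0"
    by (simp only: card_le_Suc0_iff_eq[OF finite_imageI[OF assms(1)]])
  then show ?thesis using k(2) by linarith
qed

text \<open>Writing a k-cycle as a path of k - 1 transpositions carries the genus inequality over
  from transpositions to cycles.\<close>

lemma cycle_of_list_eq_prodl:
  "cycle_of_list cs = prodl (map swap_of (zip cs (tl cs)))"
  by (induction cs rule: cycle_of_list.induct) (auto simp: swap_of_def)

lemma prodl_concat: "prodl (concat sss) = prodl (map prodl sss)"
  by (induction sss) (auto simp: prodl_append)

lemma prodl_invariant: "(\<And>s. s \<in> set ss \<Longrightarrow> s ` S \<subseteq> S) \<Longrightarrow> prodl ss ` S \<subseteq> S"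
  by (induction ss) (auto simp: image_subset_iff)

lemma commute_funpow: "g \<circ> s = s \<circ> g \<Longrightarrow> (g ^^ n) (s x) = s ((g ^^ n) x)"
  by (induction n) (auto simp: fun_eq_iff)

text \<open>
  If a nontrivial \<open>g\<close> centralised the factors and preserved the cycles of the product, all its
  orbits would have the same size, and passing to the quotient by \<open>g\<close> would give a
  factorization that violates the genus inequality.
\<close>

lemma Fac_centralizer_trivial:
  assumes "finite A" "(ss, c) \<in> Fac A m" "2 \<le> m" "g permutes A"
    and comm: "\<And>s. s \<in> set ss \<Longrightarrow> g \<circ> s = s \<circ> g" and cg: "\<And>x. x \<in> A \<Longrightarrow> c (g x) = c x"
  shows "g = id"
proof (rule ccontr)
  assume "g \<noteq> id"
  then obtain x0 where x0: "g x0 \<noteq> x0" by (auto simp: fun_eq_iff)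
  then have x0A: "x0 \<in> A" using assms(4) by (auto simp: permutes_def)
  note F = assms(2)[unfolded Fac_def]
  have cn: "conn A ss" using F by simp
  have cyc: "is_cyc A s" if "s \<in> set ss" for s using F that by auto
  have perm: "s permutes A" if "s \<in> set ss" for s using is_cyc_permutes[OF cyc[OF that]] .
  have gp: "permutation g" using assms(1,4) permutation_permutes by blast
  \<comment> \<open>The points fixed by the power of g that fixes x form a set invariant under the
    factors, hence all of A. By symmetry all orbits of g have the same length p.\<close>
  have lp_dvd: "least_power g y dvd least_power g x" if "x \<in> A" "y \<in> A" for x y
  proof -
    define S where "S = {z\<in>A. (g ^^ least_power g x) z = z}"
    have "S \<subseteq> A" "x \<in> S" using that least_power_of_permutation[OF gp] by (auto simp: S_def)
    moreover have "s ` S \<subseteq> S" if "s \<in> set ss" for s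
      using permutes_in_image[OF perm[OF that]] commute_funpow[OF comm[OF that]] by (auto simp: S_def)
    ultimately have "S = A" using cn by (intro connD[of A ss S x])
    then have "y \<in> S" using that by simp
    then show ?thesis using least_power_dvd[OF gp] by (simp add: S_def)
  qed
  define p where "p = least_power g x0"
  define G where "G = orbit g"
  have card_G: "card (G x) = p" if "x \<in> A" for x
    using dvd_antisym[OF lp_dvd[OF that x0A] lp_dvd[OF x0A that]]
    by (simp add: G_def p_def length_support_eq_card_orbit[OF gp])
  have p2: "p \<ge> 2" using least_power_gt_one[OF gp x0] by (simp add: p_def)
  have self: "x \<in> G x" for x unfolding G_def by (rule self_in_orbit[OF assms(4,1)])
  have Geq: "G y = G x" if "y \<in> G x" for x y
    using that unfolding G_def by (rule orbit_eq_if_mem[OF assms(4,1)])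
  have GA: "G x \<subseteq> A" if "x \<in> A" for x
    unfolding G_def by (rule permutes_orbit_subset[OF assms(4) that])
  \<comment> \<open>A set stable under g is a disjoint union of orbits, each with p
    elements.\<close>
  have card_closed: "card S = p * card (G ` S)" if "S \<subseteq> A" "\<And>x. x \<in> S \<Longrightarrow> g x \<in> S" for S
  proof -
    have "G x \<subseteq> S" if x: "x \<in> S" for x
    proof
      fix y assume "y \<in> G x" then show "y \<in> S"
        unfolding G_def by induction (use that x \<open>\<And>x. x \<in> S \<Longrightarrow> g x \<in> S\<close> in auto)
    qed
    then have U: "\<Union> (G ` S) = S" using self by blast
    have fS: "finite S" using \<open>S \<subseteq> A\<close> assms(1) finite_subset by blast
    have "p * card (G ` S) = card (\<Union> (G ` S))"
    proof (rule card_partition)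
      show "finite (G ` S)" "finite (\<Union> (G ` S))" using fS by (simp_all only: U finite_imageI)
      show "card O' = p" if "O' \<in> G ` S" for O' using that card_G \<open>S \<subseteq> A\<close> by auto
      show "O1 \<inter> O2 = {}" if "O1 \<in> G ` S" "O2 \<in> G ` S" "O1 \<noteq> O2" for O1 O2
        using that Geq by blast
    qed
    then show ?thesis by (simp only: U)
  qed
  define Q where "Q = G ` A"
  have finQ: "finite Q" using assms(1) by (simp add: Q_def)
  have imG: "s ` G x = G (s x)" if "s \<in> set ss" for s x
    unfolding G_def
    by (rule orbit_inverse) (use self[unfolded G_def] comm[OF that] in \<open>auto simp: fun_eq_iff\<close>)
  \<comment> \<open>The permutation of the set Q of orbits induced by s, continued by the identity
    as \<open>permutes\<close> demands.\<close>
  define hat where "hat s = (\<lambda>X. if X \<in> Q then s ` X else X)" for s :: "'a \<Rightarrow> 'a"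
  have hatG: "hat s (G x) = G (s x)" if "s \<in> set ss" "x \<in> A" for s x
    using that imG by (simp add: hat_def Q_def)
  have hat_perm: "hat s permutes Q" if "s \<in> set ss" for s
  proof (rule bij_imp_permutes)
    have "hat s ` Q = Q"
    proof -
      have "hat s ` Q = G ` (s ` A)" unfolding Q_def using hatG[OF that] by force
      then show ?thesis using permutes_image[OF perm[OF that]] by (simp add: Q_def)
    qed
    then show "bij_betw (hat s) Q Q" using finQ by (simp add: bij_betw_def finite_surj_inj)
  qed (simp add: hat_def)
  \<comment> \<open>The induced permutation is one cycle through the orbits that meet the support of
    s, possibly of length 1. It is a product of one transposition fewer than there are such
    orbits.\<close>
  have ex: "\<exists>es. set es \<subseteq> Q \<times> Q \<and> Suc (length es) = card (G ` supp s) \<and>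
      prodl (map swap_of es) = hat s" if s: "s \<in> set ss" for s
  proof -
    obtain a where a: "a \<in> supp s"
      using is_cyc_csize[OF cyc[OF s]] by (fastforce simp: csize_def)
    then have aA: "a \<in> A" using is_cyc_supp[OF cyc[OF s]] by blast
    have o: "orbit s a = supp s" by (rule is_cyc_orbit[OF cyc[OF s] a])
    have orb: "orbit (hat s) (G a) = G ` supp s"
    proof -
      have "G ` orbit s a = orbit (hat s) (G a)"
      proof (rule orbit_inverse)
        show "a \<in> orbit s a" using a o by simp
        show "hat s (G x) = G (s x)" if "x \<in> orbit s a" for x
          using that o is_cyc_supp[OF cyc[OF s]] by (intro hatG[OF s]) auto
      qed
      then show ?thesis by (simp add: o)
    qed
    have hp: "permutation (hat s)" using hat_perm[OF s] finQ permutation_permutes by blast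
    have "supp (hat s) \<subseteq> orbit (hat s) (G a)"
    proof
      fix X assume "X \<in> supp (hat s)"
      then have X: "hat s X \<noteq> X" "X \<in> Q" by (auto simp: supp_def hat_def split: if_splits)
      then obtain x where x: "x \<in> A" "X = G x" by (auto simp: Q_def)
      have "G (s x) \<noteq> G x" using X(1) hatG[OF s x(1)] x(2) by simp
      then have "x \<in> supp s" unfolding supp_def by force
      then show "X \<in> orbit (hat s) (G a)" unfolding orb x(2) by (rule imageI)
    qed
    from cycle_of_list_support[OF hp this]
    have h: "hat s = cycle_of_list (support (hat s) (G a))" .
    define L where "L = support (hat s) (G a)"
    have setL: "set L = G ` supp s" unfolding L_def set_support_eq_orbit[OF hp] by (rule orb)
    have lenL: "length L = card (G ` supp s)"
      using length_support_eq_card_orbit[OF hp, of "G a"] by (simp add: L_def orb)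
    have "L \<noteq> []" using setL a by auto
    have "set L \<subseteq> Q" unfolding setL Q_def using is_cyc_supp[OF cyc[OF s]] by blast
    then have "set (zip L (tl L)) \<subseteq> Q \<times> Q"
      using \<open>L \<noteq> []\<close> by (auto dest: set_zip_leftD set_zip_rightD list.set_sel(2))
    moreover have "Suc (length (zip L (tl L))) = card (G ` supp s)"
      using \<open>L \<noteq> []\<close> lenL by (cases L) auto
    moreover have "prodl (map swap_of (zip L (tl L))) = hat s"
      by (subst cycle_of_list_eq_prodl[symmetric]) (simp only: L_def h[symmetric])
    ultimately show ?thesis by blast
  qed
  then obtain es where es: "\<And>s. s \<in> set ss \<Longrightarrow> set (es s) \<subseteq> Q \<times> Q"
    "\<And>s. s \<in> set ss \<Longrightarrow> Suc (length (es s)) = card (G ` supp s)"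
    "\<And>s. s \<in> set ss \<Longrightarrow> prodl (map swap_of (es s)) = hat s" by metis
  define E where "E = concat (map es ss)"
  have EQ: "set E \<subseteq> Q \<times> Q" using es(1) by (auto simp: E_def)
  have prodE: "prodl (map swap_of E) = prodl (map hat ss)"
  proof -
    have "prodl (map swap_of E) = prodl (map (\<lambda>s. prodl (map swap_of (es s))) ss)"
      by (simp add: E_def map_concat prodl_concat comp_def)
    also have "map (\<lambda>s. prodl (map swap_of (es s))) ss = map hat ss" using es(3) by simp
    finally show ?thesis .
  qed
  have P_G: "prodl (map hat ss) (G x) = G (prodl ss x) \<and> prodl ss x \<in> A" if "x \<in> A" for x
  proof -
    have "prodl (map hat ts) (G x) = G (prodl ts x) \<and> prodl ts x \<in> A" if "set ts \<subseteq> set ss" for ts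
      using that
    proof (induction ts)
      case (Cons t ts)
      then show ?case using hatG permutes_in_image[OF perm] by simp
    qed (simp add: \<open>x \<in> A\<close>)
    then show ?thesis by blast
  qed
  have "conn Q (map swap_of E)"
    unfolding conn_def
  proof (intro allI impI; elim conjE)
    fix S assume S: "S \<subseteq> Q" "S \<noteq> {}" "\<forall>t\<in>set (map swap_of E). t ` S \<subseteq> S"
    have hatS: "hat s ` S \<subseteq> S" if "s \<in> set ss" for s
      unfolding es(3)[OF that, symmetric]
      by (rule prodl_invariant) (use S(3) that in \<open>auto simp: E_def\<close>)
    have "s ` \<Union> S \<subseteq> \<Union> S" if "s \<in> set ss" for s
    proof
      fix y assume "y \<in> s ` \<Union> S"
      then obtain X x where X: "X \<in> S" "x \<in> X" "y = s x" by blast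
      then have "hat s X = s ` X" using S(1) by (auto simp: hat_def)
      then show "y \<in> \<Union> S" using hatS[OF that] X by blast
    qed
    moreover have "\<Union> S \<subseteq> A" using S(1) GA by (auto simp: Q_def)
    moreover obtain X x where "X \<in> S" "X = G x" using S(1,2) unfolding Q_def by blast
    then have "x \<in> \<Union> S" using self by blast
    ultimately have "\<Union> S = A" using cn by (intro connD[of A ss "\<Union> S" x])
    have "Q \<subseteq> S"
    proof
      fix X assume "X \<in> Q"
      then obtain x where x: "x \<in> A" "X = G x" by (auto simp: Q_def)
      then obtain Y where Y: "Y \<in> S" "x \<in> Y" using \<open>\<Union> S = A\<close> by blast
      then obtain y where "Y = G y" using S(1) by (auto simp: Q_def)
      then show "X \<in> S" using Y x Geq by metis
    qed
    then show "S = Q" using S(1) by blast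
  qed
  then have genus: "num_orbits Q (prodl (map hat ss)) + card Q \<le> length E + 2"
    using transposition_genus[OF finQ EQ] by (simp only: prodE)
  have lab: "c ` A = {..<m}" "\<And>x. x \<in> A \<Longrightarrow> c (prodl ss x) = c x"
    using F by (auto simp: cycle_labelling_def)
  \<comment> \<open>Labels are constant on orbits of g and along the induced product, so each of the
    m labels has a cycle of its own on Q.\<close>
  have m_le: "m \<le> num_orbits Q (prodl (map hat ss))"
  proof -
    let ?P = "prodl (map hat ss)"
    have cG: "c y = c x" if "x \<in> A" "y \<in> G x" for x y
    proof -
      have "y \<in> A \<and> c y = c x"
        using that(2) unfolding G_def
        by induction (use that(1) cg permutes_in_image[OF assms(4)] in auto)
      then show ?thesis ..
    qed
    have corb: "c y = c x" if "x \<in> A" "y \<in> A" and Gy: "G y \<in> orbit ?P (G x)" for x y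
    proof -
      have "\<exists>z\<in>A. X = G z \<and> c z = c x" if "X \<in> orbit ?P (G x)" for X
        using that
      proof induction
        case base then show ?case using P_G[OF \<open>x \<in> A\<close>] lab(2)[OF \<open>x \<in> A\<close>] by blast
      next
        case (step X)
        then obtain z where "z \<in> A" "X = G z" "c z = c x" by blast
        then show ?case using P_G[of z] lab(2)[of z] by metis
      qed
      from this[OF Gy] obtain z where "z \<in> A" "G y = G z" "c z = c x" by blast
      then show ?thesis using cG self by metis
    qed
    have Pp: "?P permutes Q" using hat_perm by (intro prodl_permutes) auto
    \<comment> \<open>One point is chosen for each cycle of the induced product; by
      \<open>corb\<close> its label depends on the cycle only.\<close>
    define rep where "rep X = (SOME x. x \<in> A \<and> orbit ?P (G x) = X)" for X
    have "c ` A \<subseteq> (\<lambda>X. c (rep X)) ` (orbit ?P ` Q)"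
    proof
      fix k assume "k \<in> c ` A"
      then obtain x where x: "x \<in> A" "k = c x" by auto
      have r: "rep (orbit ?P (G x)) \<in> A \<and> orbit ?P (G (rep (orbit ?P (G x)))) = orbit ?P (G x)"
        unfolding rep_def by (rule someI[of _ x]) (simp add: x)
      then have "c (rep (orbit ?P (G x))) = c x"
        using corb[OF x(1)] self_in_orbit[OF Pp finQ] by blast
      then show "k \<in> (\<lambda>X. c (rep X)) ` (orbit ?P ` Q)"
        using x unfolding Q_def by (intro image_eqI[of _ _ "orbit ?P (G x)"]) auto
    qed
    then have "card (c ` A) \<le> card ((\<lambda>X. c (rep X)) ` (orbit ?P ` Q))"
      using finQ by (intro card_mono) auto
    also have "\<dots> \<le> card (orbit ?P ` Q)" using finQ by (intro card_image_le) auto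
    finally show ?thesis by (simp add: num_orbits_def lab(1))
  qed
  have lenE: "length E + length ss = (\<Sum>s\<leftarrow>ss. card (G ` supp s))"
  proof -
    have "length E = (\<Sum>s\<leftarrow>ss. length (es s))" by (simp add: E_def length_concat comp_def)
    also have "\<dots> + length ss = (\<Sum>s\<leftarrow>ss. Suc (length (es s)))" by (induction ss) auto
    also have "map (\<lambda>s. Suc (length (es s))) ss = map (\<lambda>s. card (G ` supp s)) ss" using es(2) by simp
    finally show ?thesis .
  qed
  have cs: "csize s = p * card (G ` supp s)" if "s \<in> set ss" for s
    unfolding csize_def
  proof (rule card_closed)
    show "supp s \<subseteq> A" by (rule is_cyc_supp[OF cyc[OF that]])
    show "g x \<in> supp s" if "x \<in> supp s" for x
      using that comm[OF \<open>s \<in> set ss\<close>] permutes_inj[OF assms(4)]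
      by (auto simp: supp_def fun_eq_iff dest: injD) (metis injD)
  qed
  have "(\<Sum>s\<leftarrow>ss. csize s - 1) + length ss = p * (\<Sum>s\<leftarrow>ss. card (G ` supp s))"
  proof -
    have "(\<Sum>s\<leftarrow>ts. csize s - 1) + length ts = p * (\<Sum>s\<leftarrow>ts. card (G ` supp s))"
      if "set ts \<subseteq> set ss" for ts
      using that
    proof (induction ts)
      case (Cons t ts)
      then show ?case using cs[of t] is_cyc_csize[OF cyc, of t] by (simp add: algebra_simps)
    qed simp
    then show ?thesis by blast
  qed
  moreover have "card A = p * card Q"
    unfolding Q_def using permutes_in_image[OF assms(4)] by (intro card_closed) auto
  moreover have "card A + m = (\<Sum>s\<leftarrow>ss. csize s - 1) + 2" using F by simp
  moreover define K where "K = (\<Sum>s\<leftarrow>ss. card (G ` supp s))"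
  \<comment> \<open>With r factors, minimality on A gives this equation. Compared with p times the
    genus inequality on Q it leaves (p - 1)(m + r) <= 2(p - 1), so m >= 2 forces r = 0.\<close>
  ultimately have 1: "p * card Q + m + length ss = p * K + 2" by simp
  have "m + card Q + length ss \<le> K + 2"
    using genus m_le lenE unfolding K_def by linarith
  then have "p * (m + card Q + length ss) \<le> p * (K + 2)" by (rule mult_left_mono) simp
  then have "p * (m + length ss) + 2 \<le> (m + length ss) + 2 * p"
    using 1 by (simp add: algebra_simps)
  then have "(p - 1) * (m + length ss) \<le> (p - 1) * 2"
    using p2 by (simp add: algebra_simps)
  then have "m + length ss \<le> 2" using p2 by simp
  then have "length ss = 0" using assms(3) by linarith
  then have "ss = []" by simp
  \<comment> \<open>Without factors every set is invariant, so A is a single point, which g must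
    fix.\<close>
  then have "{x0} = A" using F x0A by (auto simp: conn_def)
  moreover have "g x0 \<in> A" using permutes_in_image[OF assms(4), of x0] x0A by simp
  ultimately show False using x0 by blast
qed

section \<open>Conjugation and relabelling of the points\<close>

lemma bij_inj_on: "bij g \<Longrightarrow> inj_on g S"
  using bij_is_inj inj_on_subset by blast

definition conjugate :: "('a \<Rightarrow> 'a) \<Rightarrow> ('a \<Rightarrow> 'a) \<Rightarrow> 'a \<Rightarrow> 'a" where
  "conjugate g s = g \<circ> s \<circ> inv' g"

lemma conjugate_apply [simp]: "bij g \<Longrightarrow> conjugate g s (g x) = g (s x)"
  by (simp add: conjugate_def bij_is_inj)

lemma prodl_conjugate: "bij g \<Longrightarrow> prodl (map (conjugate g) ss) = conjugate g (prodl ss)"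
  by (induction ss) (auto simp: conjugate_def fun_eq_iff bij_is_inj bij_is_surj surj_f_inv_f)

lemma supp_conjugate: "bij g \<Longrightarrow> supp (conjugate g s) = g ` supp s"
proof -
  assume g: "bij g"
  show ?thesis
  proof (intro Set.set_eqI iffI)
    fix x assume x: "x \<in> supp (conjugate g s)"
    obtain y where "x = g y" using g by (metis bij_is_surj surjD)
    then show "x \<in> g ` supp s" using g x by (auto simp: supp_def)
  next
    fix x assume "x \<in> g ` supp s"
    then show "x \<in> supp (conjugate g s)" using g by (auto simp: supp_def bij_def dest: injD)
  qed
qed

lemma csize_conjugate: "bij g \<Longrightarrow> csize (conjugate g s) = csize s"
  by (simp add: csize_def supp_conjugate card_image bij_inj_on)

lemma is_cyc_conjugate:
  assumes "bij g" "is_cyc A s" shows "is_cyc (g ` A) (conjugate g s)"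
proof -
  obtain cs where cs: "distinct cs" "set cs \<subseteq> A" "length cs \<ge> 2" "s = cycle_of_list cs"
    using assms(2) by (auto simp: is_cyc_def)
  have "conjugate g s = cycle_of_list (map g cs)"
    unfolding conjugate_def cs(4) by (rule conjugation_of_cycle[OF cs(1) assms(1)])
  moreover have "distinct (map g cs)"
    using cs(1) assms(1) by (simp add: distinct_map bij_inj_on)
  ultimately show ?thesis unfolding is_cyc_def using cs(2,3) by (intro exI[of _ "map g cs"]) auto
qed

definition relabel :: "('a \<Rightarrow> 'a) \<Rightarrow> 'a set \<Rightarrow> ('a \<Rightarrow> nat) \<Rightarrow> 'a \<Rightarrow> nat" where
  "relabel g A c = restrict (c \<circ> inv' g) (g ` A)"

lemma relabel_apply: "bij g \<Longrightarrow> x \<in> A \<Longrightarrow> relabel g A c (g x) = c x"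
  by (simp add: relabel_def bij_is_inj)

lemma conn_conjugate:
  assumes "bij g" "conn A ss" shows "conn (g ` A) (map (conjugate g) ss)"
  unfolding conn_def
proof (intro allI impI; elim conjE)
  fix S assume S: "S \<subseteq> g ` A" "S \<noteq> {}" "\<forall>s\<in>set (map (conjugate g) ss). s ` S \<subseteq> S"
  obtain x where x: "x \<in> A" "g x \<in> S" using S by blast
  have "{z\<in>A. g z \<in> S} = A"
  proof (rule connD[OF assms(2), of _ x])
    show "s ` {z \<in> A. g z \<in> S} \<subseteq> {z \<in> A. g z \<in> S}" if "s \<in> set ss" for s
    proof (rule image_subsetI)
      fix z assume "z \<in> {z\<in>A. g z \<in> S}"
      then have "conjugate g s (g z) \<in> S" using S(3) that by (auto simp del: conjugate_apply)
      then have "g (s z) \<in> S" using assms(1) by simp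
      moreover from this have "s z \<in> A" using S(1) assms(1) by (auto simp: bij_def dest: injD)
      ultimately show "s z \<in> {z\<in>A. g z \<in> S}" by simp
    qed
  qed (use x in auto)
  then show "S = g ` A" using S(1) by blast
qed

lemma cycle_labelling_conjugate:
  assumes g: "bij g" and p: "p permutes A" and c: "cycle_labelling A m p c"
  shows "cycle_labelling (g ` A) m (conjugate g p) (relabel g A c)"
  unfolding cycle_labelling_def
proof (intro conjI ballI allI impI)
  show "relabel g A c \<in> extensional (g ` A)" by (simp add: relabel_def)
  have "relabel g A c ` g ` A = (\<lambda>x. relabel g A c (g x)) ` A" by (rule image_image)
  also have "\<dots> = c ` A" by (rule image_cong) (simp_all add: relabel_apply[OF g])
  finally have "relabel g A c ` g ` A = c ` A" .
  then show "relabel g A c ` g ` A = {..<m}" using c by (simp add: cycle_labelling_def)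
next
  fix x assume "x \<in> g ` A"
  then obtain y where y: "y \<in> A" "x = g y" by blast
  then have "p y \<in> A" "c (p y) = c y" using c permutes_in_image[OF p] by (auto simp: cycle_labelling_def)
  then show "relabel g A c (conjugate g p x) = relabel g A c x"
    using y g relabel_apply[OF g] by simp
next
  fix S x y
  assume S: "S \<subseteq> g ` A" "conjugate g p ` S \<subseteq> S" "x \<in> S" "y \<in> g ` A" "relabel g A c y = relabel g A c x"
  define S' where "S' = {z\<in>A. g z \<in> S}"
  obtain x' y' where xy: "x' \<in> A" "x = g x'" "y' \<in> A" "y = g y'" using S by blast
  have "p ` S' \<subseteq> S'"
  proof (rule image_subsetI)
    fix z assume z: "z \<in> S'"
    then have "conjugate g p (g z) \<in> S" using S(2) unfolding S'_def by blast
    then show "p z \<in> S'" using z g permutes_in_image[OF p] by (simp add: S'_def)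
  qed
  moreover have "S' \<subseteq> A" "x' \<in> S'" using xy S(3) by (auto simp: S'_def)
  moreover have "c y' = c x'" using S(5) xy relabel_apply[OF g] by simp
  ultimately have "y' \<in> S'" using c xy(3) unfolding cycle_labelling_def by blast
  then show "y \<in> S" by (simp add: S'_def xy)
qed

lemma Fac_permutes:
  assumes "(ss, c) \<in> Fac A m"
  shows "s \<in> set ss \<Longrightarrow> s permutes A" "prodl ss permutes A"
  using assms is_cyc_permutes[of A] by (auto simp: Fac_def intro: prodl_permutes)

lemma Fac_conjugate:
  assumes g: "bij g" and x: "(ss, c) \<in> Fac A m"
  shows "(map (conjugate g) ss, relabel g A c) \<in> Fac (g ` A) m"
proof -
  have "card (g ` A) = card A" using g by (simp add: card_image bij_inj_on)
  moreover have "map (\<lambda>s. csize s - 1) (map (conjugate g) ss) = map (\<lambda>s. csize s - 1) ss"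
    using csize_conjugate[OF g] by simp
  ultimately show ?thesis
    using x cycle_labelling_conjugate[OF g Fac_permutes(2)[OF x]] conn_conjugate[OF g] is_cyc_conjugate[OF g]
    by (auto simp: Fac_def prodl_conjugate[OF g] simp del: map_map)
qed

definition FacS :: "'a set \<Rightarrow> nat \<Rightarrow> (nat \<Rightarrow> nat) \<Rightarrow> (('a \<Rightarrow> 'a) list \<times> ('a \<Rightarrow> nat)) set" where
  "FacS A m e = {(ss, c) \<in> Fac A m. \<forall>j<m. card {x\<in>A. c x = j} = e j}"

lemma relabel_class:
  assumes "bij g"
  shows "card {x\<in>g ` A. relabel g A c x = j} = card {x\<in>A. c x = j}"
proof -
  have "{x\<in>g ` A. relabel g A c x = j} = g ` {x\<in>A. c x = j}"
    using relabel_apply[OF assms] by auto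
  then show ?thesis using assms by (simp add: card_image bij_inj_on)
qed

lemma FacS_conjugate:
  "bij g \<Longrightarrow> (ss, c) \<in> FacS A m e \<Longrightarrow> (map (conjugate g) ss, relabel g A c) \<in> FacS (g ` A) m e"
  using relabel_class[of g A c] by (auto simp: FacS_def Fac_conjugate)

lemma conjugate_inv: "bij g \<Longrightarrow> conjugate (inv' g) (conjugate g s) = s"
  by (auto simp: conjugate_def fun_eq_iff inv_inv_eq bij_is_inj)

lemma relabel_inv:
  assumes "bij g" "c \<in> extensional A"
  shows "relabel (inv' g) (g ` A) (relabel g A c) = c"
proof
  fix x
  have "inv' g ` g ` A = A" using assms(1) by (simp add: image_image bij_is_inj)
  then have "relabel (inv' g) (g ` A) (relabel g A c) x = (if x \<in> A then relabel g A c (g x) else undefined)"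
    using assms(1) by (simp add: relabel_def[of "inv' g"] inv_inv_eq)
  then show "relabel (inv' g) (g ` A) (relabel g A c) x = c x"
    using assms by (simp add: relabel_apply extensional_arb[of c A])
qed

lemma Fac_extensional: "(ss, c) \<in> Fac A m \<Longrightarrow> c \<in> extensional A"
  by (simp add: Fac_def cycle_labelling_def)

lemma bij_betw_FacS:
  assumes g: "bij g"
  shows "bij_betw (\<lambda>(ss, c). (map (conjugate g) ss, relabel g A c)) (FacS A m e) (FacS (g ` A) m e)"
proof (rule bij_betw_byWitness)
  let ?i = "\<lambda>(ss, c). (map (conjugate (inv' g)) ss, relabel (inv' g) (g ` A) c)"
  have gi: "bij (inv' g)" using g by (rule bij_imp_bij_inv)
  have ii: "inv' (inv' g) = g" using g by (rule inv_inv_eq)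
  have im: "inv' g ` g ` A = A" using g by (simp add: image_image bij_is_inj)
  show "\<forall>x\<in>FacS A m e. ?i (case x of (ss, c) \<Rightarrow> (map (conjugate g) ss, relabel g A c)) = x"
  proof
    fix x assume "x \<in> FacS A m e"
    moreover obtain ss c where x: "x = (ss, c)" by fastforce
    ultimately have "c \<in> extensional A" using Fac_extensional by (auto simp: FacS_def)
    then show "?i (case x of (ss, c) \<Rightarrow> (map (conjugate g) ss, relabel g A c)) = x"
      by (simp add: relabel_inv[OF g] conjugate_inv[OF g] comp_def x)
  qed
  show "\<forall>x\<in>FacS (g ` A) m e. (case ?i x of (ss, c) \<Rightarrow> (map (conjugate g) ss, relabel g A c)) = x"
  proof
    fix x assume "x \<in> FacS (g ` A) m e"
    moreover obtain ss c where x: "x = (ss, c)" by fastforce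
    ultimately have "c \<in> extensional (g ` A)" using Fac_extensional by (auto simp: FacS_def)
    then show "(case ?i x of (ss, c) \<Rightarrow> (map (conjugate g) ss, relabel g A c)) = x"
      using relabel_inv[OF gi, of c "g ` A"] conjugate_inv[OF gi] unfolding ii im x
      by (simp add: comp_def)
  qed
  show "(\<lambda>(ss, c). (map (conjugate g) ss, relabel g A c)) ` FacS A m e \<subseteq> FacS (g ` A) m e"
    using FacS_conjugate[OF g] by auto
  show "?i ` FacS (g ` A) m e \<subseteq> FacS A m e"
    using FacS_conjugate[OF gi, of _ _ "g ` A" m e] unfolding im by auto
qed

text \<open>Conjugation is by a bijection of the whole type. A bijection from A to B is completed
  inside \<open>A \<union> B\<close>, where the two complements have equal size, and is the identity
  elsewhere.\<close>

lemma ex_bij_image: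
  fixes A B :: "'a set"
  assumes "finite A" "finite B" "card A = card B"
  shows "\<exists>g. bij g \<and> g ` A = B"
proof -
  let ?U = "A \<union> B"
  obtain f1 where f1: "bij_betw f1 A B" using assms finite_same_card_bij by metis
  have "card (?U - A) = card (?U - B)" using assms by (simp add: card_Diff_subset)
  then obtain f2 where f2: "bij_betw f2 (?U - A) (?U - B)"
    using assms finite_same_card_bij[of "?U - A" "?U - B"] by auto
  define g where "g x = (if x \<in> A then f1 x else if x \<in> ?U then f2 x else x)" for x
  have 1: "bij_betw g A B" using f1 by (rule bij_betw_cong[THEN iffD1, rotated]) (simp add: g_def)
  have 2: "bij_betw g (?U - A) (?U - B)"
    using f2 by (rule bij_betw_cong[THEN iffD1, rotated]) (auto simp: g_def)
  have 3: "bij_betw g (- ?U) (- ?U)"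
    by (auto simp: bij_betw_def inj_on_def g_def)
  have "bij_betw g (A \<union> (?U - A)) (B \<union> (?U - B))" by (rule bij_betw_combine[OF 1 2]) auto
  then have "bij_betw g ?U ?U" by (simp add: Un_absorb1 Un_commute)
  then have "bij_betw g (?U \<union> - ?U) (?U \<union> - ?U)" by (rule bij_betw_combine[OF _ 3]) blast
  then have "bij g" by (simp only: Compl_partition)
  moreover have "g ` A = B" using 1 by (simp add: bij_betw_def)
  ultimately show ?thesis by blast
qed

lemma sum_FacS_cong:
  assumes "finite A" "finite B" "card A = card B"
    and "\<And>g ss c. bij g \<Longrightarrow> (ss, c) \<in> FacS A m e \<Longrightarrow> f (map (conjugate g) ss) = f ss"
  shows "(\<Sum>(ss, c)\<in>FacS A m e. f ss) = (\<Sum>(ss, c)\<in>FacS B m e. f ss)"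
proof -
  obtain g where g: "bij g" "g ` A = B" using ex_bij_image[OF assms(1-3)] by blast
  have "(\<Sum>(ss, c)\<in>FacS A m e. f ss) = (\<Sum>(ss, c)\<in>FacS A m e. f (map (conjugate g) ss))"
    using assms(4)[OF g(1)] by (intro sum.cong) auto
  also have "\<dots> = (\<Sum>(ss, c)\<in>FacS B m e. f ss)"
    using sum.reindex_bij_betw[OF bij_betw_FacS[OF g(1), of A m e], of "\<lambda>(ss, c). f ss"] g(2)
    by (simp add: case_prod_unfold)
  finally show ?thesis .
qed

section \<open>Removing and inserting leaves\<close>

text \<open>A single leaf is put between \<open>ss1\<close> and \<open>ss2\<close>: apart from its
  anchor v, its points \<open>xs\<close> are fixed by all other factors.\<close>

locale leaf_insertion =
  fixes A0 :: "'a set" and v :: 'a and xs :: "'a list" and ss1 ss2 :: "('a \<Rightarrow> 'a) list"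
  assumes fin: "finite A0" and v: "v \<in> A0" and xs: "xs \<noteq> []" "distinct xs" "set xs \<inter> A0 = {}"
    and cyc: "\<And>s. s \<in> set (ss1 @ ss2) \<Longrightarrow> is_cyc A0 s"
begin

definition "C = cycle_of_list (v # xs)"
definition "p0 = prodl (ss1 @ ss2)"
definition "p = prodl (ss1 @ C # ss2)"
text \<open>The point that the factors acting before the leaf carry to v. The product with the leaf
  visits all of \<open>xs\<close> between x and its former image, so the leaf lengthens the cycle of
  x, which need not be that of v.\<close>

definition "x = inv' (prodl ss2) v"
definition "A = A0 \<union> set xs"

lemma dist: "distinct (v # xs)"
  using v xs by auto

lemma is_cyc_C: "is_cyc A C"
  unfolding is_cyc_def C_def using dist v xs by (intro exI[of _ "v # xs"]) (auto simp: A_def Suc_le_eq)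

lemma C_v: "C v = xs ! 0"
  using cycle_of_list_nth[OF dist, of 0] xs by (simp add: C_def)

lemma C_nth: "i < length xs \<Longrightarrow> C (xs ! i) = (if Suc i < length xs then xs ! Suc i else v)"
proof -
  assume i: "i < length xs"
  have "C (xs ! i) = (v # xs) ! (Suc (Suc i) mod Suc (length xs))"
    using cycle_of_list_nth[OF dist, of "Suc i"] i by (simp add: C_def)
  then show ?thesis using i by (cases "Suc i = length xs") auto
qed

lemma C_other: "y \<noteq> v \<Longrightarrow> y \<notin> set xs \<Longrightarrow> C y = y"
  unfolding C_def by (rule id_outside_supp) simp

lemma csize_C: "csize C = Suc (length xs)"
  unfolding C_def using csize_cycle_of_list[OF dist] xs by (simp add: Suc_le_eq)

lemma perm: "s \<in> set (ss1 @ ss2) \<Longrightarrow> s permutes A0"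
  using cyc is_cyc_permutes by blast

lemma perm12: "prodl ss1 permutes A0" "prodl ss2 permutes A0" "p0 permutes A0"
  unfolding p0_def using perm by (intro prodl_permutes; auto)+

lemma xs_A0: "i < length xs \<Longrightarrow> xs ! i \<notin> A0"
  using xs(3) nth_mem by blast

lemma fixed: "q permutes A0 \<Longrightarrow> i < length xs \<Longrightarrow> q (xs ! i) = xs ! i"
  using xs_A0 by (simp add: permutes_def)

lemma p_eq: "p y = prodl ss1 (C (prodl ss2 y))"
  by (simp add: p_def prodl_append)

lemma p0_eq: "p0 y = prodl ss1 (prodl ss2 y)"
  by (simp add: p0_def prodl_append)

lemma x: "prodl ss2 x = v" "x \<in> A0"
  using permutes_inverses(1)[OF perm12(2)] permutes_in_image[OF permutes_inv[OF perm12(2)]] v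
  by (auto simp: x_def)

lemma p_x: "p x = xs ! 0"
  using xs by (simp add: p_eq x C_v fixed[OF perm12(1)])

lemma p_nth: "i < length xs \<Longrightarrow> p (xs ! i) = (if Suc i < length xs then xs ! Suc i else p0 x)"
  by (simp add: p_eq C_nth fixed[OF perm12(1)] fixed[OF perm12(2)] p0_eq x)

lemma p_other: "y \<in> A0 \<Longrightarrow> y \<noteq> x \<Longrightarrow> p y = p0 y"
proof -
  assume y: "y \<in> A0" "y \<noteq> x"
  then have "prodl ss2 y \<noteq> v" using x permutes_inj[OF perm12(2)] by (metis injD)
  moreover have "prodl ss2 y \<notin> set xs" using permutes_in_image[OF perm12(2)] y(1) xs(3) by blast
  ultimately show "p y = p0 y" by (simp add: p_eq p0_eq C_other)
qed

lemma p0_x: "p0 x \<in> A0"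
  using permutes_in_image[OF perm12(3)] x by simp

lemma invariant_nth:
  assumes "p ` S \<subseteq> S" "xs ! i \<in> S" "i \<le> j" "j < length xs"
  shows "xs ! j \<in> S"
  using assms(3,4)
proof (induction j rule: dec_induct)
  case (step j)
  then show ?case using p_nth[of j] assms(1) by (auto simp: image_subset_iff dest!: bspec[of _ _ "xs ! j"])
qed (use assms in simp)

lemma invariant_p0_x:
  assumes "p ` S \<subseteq> S" "xs ! i \<in> S" "i < length xs" shows "p0 x \<in> S"
proof -
  have "xs ! (length xs - 1) \<in> S" 
    by (rule invariant_nth[OF assms(1,2)]) (use assms(3) in simp_all)
  then have "p (xs ! (length xs - 1)) \<in> S" using assms(1) by blast
  then show ?thesis using p_nth[of "length xs - 1"] xs(1) by simp
qed

lemma invariant_x: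
  assumes "p ` S \<subseteq> S" "x \<in> S" shows "set xs \<subseteq> S" "p0 x \<in> S"
proof -
  have "xs ! 0 \<in> S" using assms p_x by (metis image_subset_iff)
  then have "xs ! j \<in> S" if "j < length xs" for j
    using that by (intro invariant_nth[OF assms(1) \<open>xs ! 0 \<in> S\<close>]) simp_all
  then show "set xs \<subseteq> S" by (auto simp: in_set_conv_nth)
  show "p0 x \<in> S" using xs(1) by (intro invariant_p0_x[OF assms(1) \<open>xs ! 0 \<in> S\<close>]) simp
qed

text \<open>The intersection of a p-invariant set with A0 is invariant under p0: from x the product
  p runs through \<open>xs\<close> and arrives at \<open>p0 x\<close>.\<close>

lemma cycle_labelling_extend:
  assumes c: "cycle_labelling A0 m p0 (restrict c A0)" "c \<in> extensional A"
    and cx: "\<And>a. a \<in> set xs \<Longrightarrow> c a = c x"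
  shows "cycle_labelling A m p c"
proof -
  have c0: "c ` A0 = {..<m}" "\<And>y. y \<in> A0 \<Longrightarrow> c (p0 y) = c y"
    using c(1) permutes_in_image[OF perm12(3)] by (auto simp: cycle_labelling_def)
  have sat: "z \<in> S" if "S \<subseteq> A0" "p0 ` S \<subseteq> S" "y \<in> S" "z \<in> A0" "c z = c y" for S y z
  proof -
    have "restrict c A0 z = restrict c A0 y" using that by auto
    then show ?thesis using c(1) that(1-4) unfolding cycle_labelling_def by blast
  qed
  show ?thesis
    unfolding cycle_labelling_def
  proof (intro conjI ballI allI impI)
    show "c \<in> extensional A" by fact
    show "c ` A = {..<m}" using c0(1) cx x(2) by (auto simp: A_def image_Un)
  next
    fix y assume "y \<in> A"
    then consider "y = x" | "y \<in> A0" "y \<noteq> x" | i where "i < length xs" "y = xs ! i"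
      by (auto simp: A_def in_set_conv_nth)
    then show "c (p y) = c y"
    proof cases
      case 1
      then show ?thesis using p_x cx xs(1) by simp
    next
      case 2
      then show ?thesis using p_other c0(2) by simp
    next
      case (3 i)
      then show ?thesis using p_nth[OF 3(1)] cx c0(2)[OF x(2)] by simp
    qed
  next
    fix S y z assume S: "S \<subseteq> A" "p ` S \<subseteq> S" "y \<in> S" "z \<in> A" "c z = c y"
    define S0 where "S0 = S \<inter> A0"
    have "p0 ` S0 \<subseteq> S0"
    proof (rule image_subsetI)
      fix w assume w: "w \<in> S0"
      have "p0 w \<in> S"
      proof (cases "w = x")
        case True
        then show ?thesis using invariant_x(2)[OF S(2)] w by (simp add: S0_def)
      next
        case False
        have "p w \<in> S" using w S(2) by (auto simp: S0_def)
        then show ?thesis using p_other w False by (simp add: S0_def)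
      qed
      then show "p0 w \<in> S0" using w permutes_in_image[OF perm12(3)] by (simp add: S0_def)
    qed
    moreover have "S0 \<subseteq> A0" by (simp add: S0_def)
    moreover have "\<exists>y0\<in>S0. c y0 = c y"
    proof (cases "y \<in> A0")
      case True
      then show ?thesis using S(3) by (auto simp: S0_def)
    next
      case False
      then have "y \<in> set xs" using S by (auto simp: A_def)
      then obtain i where i: "i < length xs" "y = xs ! i" by (auto simp: in_set_conv_nth)
      then have "p0 x \<in> S" using invariant_p0_x[OF S(2)] S(3) by simp
      then show ?thesis using p0_x c0(2)[OF x(2)] cx[OF \<open>y \<in> set xs\<close>] by (auto simp: S0_def)
    qed
    ultimately have *: "w \<in> S0" if "w \<in> A0" "c w = c y" for w
      using sat that by metis
    show "z \<in> S"
    proof (cases "z \<in> A0")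
      case True
      then show ?thesis using * S(5) by (auto simp: S0_def)
    next
      case False
      then have z: "z \<in> set xs" using S by (auto simp: A_def)
      then have "x \<in> S" using *[OF x(2)] cx S(5) by (simp add: S0_def)
      then show ?thesis using invariant_x(1)[OF S(2)] z by blast
    qed
  qed
qed

text \<open>A set invariant under p0 becomes invariant under p when \<open>xs\<close> is added in
  case it contains x.\<close>

lemma cycle_labelling_restrict:
  assumes c: "cycle_labelling A m p c"
  shows "cycle_labelling A0 m p0 (restrict c A0)" "\<And>a. a \<in> set xs \<Longrightarrow> c a = c x"
proof -
  have cp: "c (p y) = c y" if "y \<in> A" for y using c that by (auto simp: cycle_labelling_def)
  have xA: "x \<in> A" "\<And>i. i < length xs \<Longrightarrow> xs ! i \<in> A" using x by (auto simp: A_def)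
  have cn: "c (xs ! i) = c x" if "i < length xs" for i
    using that
  proof (induction i)
    case 0
    then show ?case using cp[OF xA(1)] p_x by simp
  next
    case (Suc i)
    then show ?case using cp[OF xA(2), of i] p_nth[of i] by simp
  qed
  then show cx: "c a = c x" if "a \<in> set xs" for a using that by (auto simp: in_set_conv_nth)
  have cp0x: "c (p0 x) = c x"
    using cp[OF xA(2), of "length xs - 1"] p_nth[of "length xs - 1"] cn[of "length xs - 1"] xs(1) by simp
  have cp0: "c (p0 y) = c y" if "y \<in> A0" for y
    using cp0x cp[of y] p_other[OF that] that by (cases "y = x") (auto simp: A_def)
  show "cycle_labelling A0 m p0 (restrict c A0)"
    unfolding cycle_labelling_def
  proof (intro conjI ballI allI impI)
    have "c ` A = c ` A0" using cx x(2) by (auto simp: A_def)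
    then show "restrict c A0 ` A0 = {..<m}" using c by (simp add: cycle_labelling_def)
    show "restrict c A0 (p0 y) = restrict c A0 y" if "y \<in> A0" for y
      using that cp0 permutes_in_image[OF perm12(3)] by simp
  next
    fix S y z
    assume S: "S \<subseteq> A0" "p0 ` S \<subseteq> S" "y \<in> S" "z \<in> A0" "restrict c A0 z = restrict c A0 y"
    define S' where "S' = S \<union> (if x \<in> S then set xs else {})"
    have "p ` S' \<subseteq> S'"
    proof (rule image_subsetI)
      fix w assume "w \<in> S'"
      then consider "w = x" "x \<in> S" | "w \<in> S" "w \<noteq> x" | i where "i < length xs" "w = xs ! i" "x \<in> S"
        by (auto simp: S'_def in_set_conv_nth split: if_splits)
      then show "p w \<in> S'"
      proof cases
        case 1
        then show ?thesis using p_x xs(1) by (simp add: S'_def)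
      next
        case 2
        then have "p0 w \<in> S" "w \<in> A0" using S by auto
        then show ?thesis using p_other 2 by (simp add: S'_def)
      next
        case (3 i)
        then have "p0 x \<in> S" using S by auto
        then show ?thesis using p_nth[OF 3(1)] 3 by (simp add: S'_def)
      qed
    qed
    moreover have "S' \<subseteq> A" using S(1) by (auto simp: S'_def A_def)
    moreover have "y \<in> S'" using S(3) by (simp add: S'_def)
    moreover have "z \<in> A" using S(4) by (simp add: A_def)
    moreover have "c z = c y" using S by (auto simp: subset_iff)
    ultimately have "z \<in> S'" using c unfolding cycle_labelling_def by blast
    then show "z \<in> S" using S(4) xs(3) by (auto simp: S'_def split: if_splits)
  qed simp
qed

text \<open>For connectedness the new points are tied to v instead of x, because an invariant set
  contains all points of the leaf or none.\<close>

lemma conn_iff: "conn A (ss1 @ C # ss2) \<longleftrightarrow> conn A0 (ss1 @ ss2)"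
proof
  have CC: "insert v (set xs) \<subseteq> S" if "C ` S \<subseteq> S" "a \<in> S" "a \<in> insert v (set xs)" for S a
  proof -
    have "y \<in> S" if "y \<in> orbit C a" for y
      using that by induction (use \<open>C ` S \<subseteq> S\<close> \<open>a \<in> S\<close> in auto)
    then show ?thesis
      using orbit_cycle_of_list[OF dist, of a] that(3) by (auto simp: C_def)
  qed
  show "conn A0 (ss1 @ ss2)" if "conn A (ss1 @ C # ss2)"
    unfolding conn_def
  proof (intro allI impI; elim conjE)
    fix S assume S: "S \<subseteq> A0" "S \<noteq> {}" "\<forall>s\<in>set (ss1 @ ss2). s ` S \<subseteq> S"
    define S' where "S' = S \<union> (if v \<in> S then set xs else {})"
    obtain y where y: "y \<in> S" using S(2) by blast
    have "S' = A"
    proof (rule connD[OF that])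
      show "S' \<subseteq> A" using S(1) by (auto simp: S'_def A_def)
      show "y \<in> S'" using y by (simp add: S'_def)
      fix s assume s: "s \<in> set (ss1 @ C # ss2)"
      show "s ` S' \<subseteq> S'"
      proof (rule image_subsetI)
        fix w assume w: "w \<in> S'"
        show "s w \<in> S'"
        proof (cases "s = C")
          case True
          show ?thesis
          proof (cases "w \<in> insert v (set xs)")
            case True
            then have "v \<in> S" using w S(1) xs(3) by (auto simp: S'_def split: if_splits)
            moreover have "C w \<in> insert v (set xs)"
              using permutes_in_image[OF cycle_permutes[of "v # xs"]] True by (simp add: C_def)
            ultimately show ?thesis by (auto simp: S'_def \<open>s = C\<close>)
          qed (use w C_other in \<open>auto simp: \<open>s = C\<close>\<close>)
        next
          case False
          then have s': "s \<in> set (ss1 @ ss2)" using s by auto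
          show ?thesis
          proof (cases "w \<in> S")
            case True
            then show ?thesis using S(3) s' by (auto simp: S'_def)
          next
            case False
            then have "w \<in> set xs" using w by (auto simp: S'_def split: if_splits)
            then have "s w = w" using perm[OF s'] xs(3) by (auto simp: permutes_def)
            then show ?thesis using w by simp
          qed
        qed
      qed
    qed
    then show "S = A0" using S(1) xs(3) by (auto simp: S'_def A_def split: if_splits)
  qed
  show "conn A (ss1 @ C # ss2)" if "conn A0 (ss1 @ ss2)"
    unfolding conn_def
  proof (intro allI impI; elim conjE)
    fix S assume S: "S \<subseteq> A" "S \<noteq> {}" "\<forall>s\<in>set (ss1 @ C # ss2). s ` S \<subseteq> S"
    have CS: "C ` S \<subseteq> S" using S(3) by simp
    obtain y where "y \<in> S" using S(2) by blast
    then have "\<exists>z. z \<in> S \<inter> A0" using CC[OF CS, of y] S(1) v by (auto simp: A_def)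
    then obtain z where z: "z \<in> S \<inter> A0" ..
    have "S \<inter> A0 = A0"
    proof (rule connD[OF that _ z])
      show "s ` (S \<inter> A0) \<subseteq> S \<inter> A0" if "s \<in> set (ss1 @ ss2)" for s
      proof -
        have "s ` S \<subseteq> S" using S(3) that by auto
        then show ?thesis using permutes_in_image[OF perm[OF that]] by blast
      qed
    qed simp
    then have "v \<in> S" using v by blast
    then have "set xs \<subseteq> S" using CC[OF CS] by blast
    then show "S = A" using \<open>S \<inter> A0 = A0\<close> S(1) by (auto simp: A_def)
  qed
qed

text \<open>The leaf adds \<open>length xs\<close> to both sides of the minimality equation, so
  neither its position nor its anchor is restricted.\<close>

lemma Fac_insert_iff:
  "(ss1 @ C # ss2, c) \<in> Fac A m \<longleftrightarrow>
     (ss1 @ ss2, restrict c A0) \<in> Fac A0 m \<and> c \<in> extensional A \<and> (\<forall>a\<in>set xs. c a = c x)"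
proof -
  have "card A = card A0 + length xs"
    unfolding A_def using fin xs distinct_card[OF xs(2)] by (subst card_Un_disjoint) auto
  then have 1: "card A + m = (\<Sum>s\<leftarrow>ss1 @ C # ss2. csize s - 1) + 2 \<longleftrightarrow>
      card A0 + m = (\<Sum>s\<leftarrow>ss1 @ ss2. csize s - 1) + 2"
    by (simp add: csize_C)
  have 2: "\<forall>s\<in>set (ss1 @ C # ss2). is_cyc A s"
  proof
    fix s assume "s \<in> set (ss1 @ C # ss2)"
    then have "s = C \<or> s \<in> set (ss1 @ ss2)" by auto
    then show "is_cyc A s" using is_cyc_C is_cyc_mono[OF cyc] by (auto simp: A_def)
  qed
  have 3: "\<forall>s\<in>set (ss1 @ ss2). is_cyc A0 s" using cyc by blast
  have 4: "cycle_labelling A m p c \<longleftrightarrow>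
      cycle_labelling A0 m p0 (restrict c A0) \<and> c \<in> extensional A \<and> (\<forall>a\<in>set xs. c a = c x)"
  proof
    assume h: "cycle_labelling A m p c"
    then have "c \<in> extensional A" by (simp add: cycle_labelling_def)
    then show "cycle_labelling A0 m p0 (restrict c A0) \<and> c \<in> extensional A \<and> (\<forall>a\<in>set xs. c a = c x)"
      using cycle_labelling_restrict[OF h] by simp
  qed (use cycle_labelling_extend[of m c] in simp)
  show ?thesis
    unfolding Fac_def mem_Collect_eq case_prod_conv p_def[symmetric] p0_def[symmetric]
    using 1 2 3 4 conn_iff by blast
qed

end

section \<open>Lists of factors with marked leaves\<close>

datatype 'a item = Core "'a \<Rightarrow> 'a" | Leaf 'a "'a list"

fun item_perm :: "'a item \<Rightarrow> 'a \<Rightarrow> 'a" where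
  "item_perm (Core s) = s"
| "item_perm (Leaf v xs) = cycle_of_list (v # xs)"

fun cores :: "'a item list \<Rightarrow> ('a \<Rightarrow> 'a) list" where
  "cores [] = []"
| "cores (Core s # its) = s # cores its"
| "cores (Leaf v xs # its) = cores its"

fun newpts :: "'a item list \<Rightarrow> 'a list" where
  "newpts [] = []"
| "newpts (Core s # its) = newpts its"
| "newpts (Leaf v xs # its) = xs @ newpts its"

fun is_leaf :: "'a item \<Rightarrow> bool" where
  "is_leaf (Core s) = False"
| "is_leaf (Leaf v xs) = True"

definition num_leaves :: "'a item list \<Rightarrow> nat" where
  "num_leaves its = length (filter is_leaf its)"

text \<open>Anchors lie in A0, so no marked leaf hangs on a new point of another: the marked leaves
  form one layer. Since the cyclic list starts at the anchor, a leaf with a given anchor can be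
  written as \<open>Leaf v xs\<close> in one way only.\<close>

definition wf_items :: "'a set \<Rightarrow> 'a item list \<Rightarrow> bool" where
  "wf_items A0 its \<longleftrightarrow> (\<forall>s\<in>set (cores its). is_cyc A0 s) \<and>
     (\<forall>v xs. Leaf v xs \<in> set its \<longrightarrow> v \<in> A0 \<and> xs \<noteq> []) \<and>
     distinct (newpts its) \<and> set (newpts its) \<inter> A0 = {}"

text \<open>
  \<open>inv' (prodl (cores its)) v\<close> is the point that reaches \<open>v\<close> just before the leaf acts; the new
  points of the leaf lie on its cycle.
\<close>

fun leaf_labels :: "('a \<Rightarrow> nat) \<Rightarrow> 'a item list \<Rightarrow> bool" where
  "leaf_labels c [] = True"
| "leaf_labels c (Core s # its) = leaf_labels c its"
| "leaf_labels c (Leaf v xs # its) =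
     ((\<forall>a\<in>set xs. c a = c (inv' (prodl (cores its)) v)) \<and> leaf_labels c its)"

lemma cores_append [simp]: "cores (its @ js) = cores its @ cores js"
  by (induction "its" rule: cores.induct) auto

lemma newpts_append [simp]: "newpts (its @ js) = newpts its @ newpts js"
  by (induction "its" rule: newpts.induct) auto

lemma Core_in_cores: "Core s \<in> set its \<Longrightarrow> s \<in> set (cores its)"
  by (induction "its" rule: cores.induct) auto

lemma Leaf_newpts: "Leaf v xs \<in> set its \<Longrightarrow> set xs \<subseteq> set (newpts its)"
  by (induction "its" rule: newpts.induct) auto

lemma item_perm_is_cyc:
  assumes "wf_items A0 its" "i \<in> set its"
  shows "is_cyc (A0 \<union> set (newpts its)) (item_perm i)"
proof (cases i)
  case (Core s)
  then have "is_cyc A0 s" using assms Core_in_cores by (auto simp: wf_items_def)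
  then show ?thesis using Core by (auto intro: is_cyc_mono)
next
  case (Leaf v xs)
  obtain is1 is2 where its: "its = is1 @ Leaf v xs # is2" using assms(2) Leaf by (metis split_list)
  then have "distinct xs" "v \<in> A0" "xs \<noteq> []" "set xs \<inter> A0 = {}" "set xs \<subseteq> set (newpts its)"
    using assms by (auto simp: wf_items_def)
  then show ?thesis unfolding is_cyc_def Leaf by (intro exI[of _ "v # xs"]) (auto simp: Suc_le_eq)
qed

lemma items_permute:
  assumes "wf_items A0 its"
  shows "prodl (map item_perm its) permutes (A0 \<union> set (newpts its))"
    "prodl (cores its) permutes A0"
proof -
  show "prodl (map item_perm its) permutes (A0 \<union> set (newpts its))"
    using is_cyc_permutes[OF item_perm_is_cyc[OF assms]] by (intro prodl_permutes) auto
  show "prodl (cores its) permutes A0"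
    using assms is_cyc_permutes by (intro prodl_permutes) (auto simp: wf_items_def)
qed

lemma inv_comp_apply:
  assumes "f permutes A" "g permutes A"
  shows "inv' (f \<circ> g) y = inv' g (inv' f y)"
  using permutes_bij[OF assms(1)] permutes_bij[OF assms(2)] by (simp add: o_inv_distrib)

text \<open>In the presence of leaves the source of v may be a new point, but
  \<open>leaf_labels\<close> gives that point the label of the old source. So labels of sources can
  be computed from the unmarked factors alone.\<close>

lemma leaf_labels_source:
  assumes "wf_items A0 its" "leaf_labels c its" "v \<in> A0"
  shows "c (inv' (prodl (map item_perm its)) v) = c (inv' (prodl (cores its)) v)"
  using assms
proof (induction "its" arbitrary: v rule: cores.induct)
  case (2 s "its")
  have wf: "wf_items A0 its" using 2(2) by (auto simp: wf_items_def)
  have s: "s permutes A0" using 2(2) is_cyc_permutes by (auto simp: wf_items_def)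
  have "inv' s v \<in> A0" using permutes_in_image[OF permutes_inv[OF s]] 2(4) by simp
  then have "c (inv' (prodl (map item_perm its)) (inv' s v)) = c (inv' (prodl (cores its)) (inv' s v))"
    using 2 wf by simp
  moreover have s': "s permutes A0 \<union> set (newpts its)" using s by (rule permutes_subset) simp
  ultimately show ?case
    using inv_comp_apply[OF s' items_permute(1)[OF wf]] inv_comp_apply[OF s items_permute(2)[OF wf]]
    by (simp only: list.map cores.simps item_perm.simps prodl_simps)
next
  case (3 w xs "its")
  have wf: "wf_items A0 its" using 3(2) by (auto simp: wf_items_def)
  have w: "w \<in> A0" "xs \<noteq> []" "distinct xs" "set xs \<inter> A0 = {}" "set xs \<inter> set (newpts its) = {}"
    using 3(2) by (auto simp: wf_items_def)
  have dist: "distinct (w # xs)" using w by auto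
  let ?C = "cycle_of_list (w # xs)"
  let ?P = "prodl (map item_perm its)"
  let ?U = "A0 \<union> set (newpts (Leaf w xs # its))"
  have C: "?C permutes ?U"
    using cycle_permutes[of "w # xs"] by (rule permutes_subset) (use w in auto)
  have P: "?P permutes (A0 \<union> set (newpts its))" by (rule items_permute[OF wf])
  then have P': "?P permutes ?U" by (rule permutes_subset) auto
  have "prodl (map item_perm (Leaf w xs # its)) = ?C \<circ> ?P"
    by (simp only: list.map item_perm.simps prodl_simps)
  then have inv: "inv' (prodl (map item_perm (Leaf w xs # its))) v = inv' ?P (inv' ?C v)"
    by (simp only: inv_comp_apply[OF C P'])
  show ?case
  \<comment> \<open>Among the points of A0 only the anchor w has a new preimage under the leaf: it
    is reached from the last new point, which the items acting earlier fix.\<close>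
  proof (cases "v = w")
    case True
    have "?C (last xs) = w"
      using cycle_of_list_nth[OF dist, of "length xs"] w(2) by (simp add: last_conv_nth)
    then have "inv' ?C w = last xs" using permutes_inv_eq[OF C] by metis
    moreover have "last xs \<in> set xs" using w(2) by simp
    then have "last xs \<notin> A0 \<union> set (newpts its)" using w by blast
    then have "?P (last xs) = last xs" using P by (simp add: permutes_def)
    then have "inv' ?P (last xs) = last xs" using permutes_inv_eq[OF P] by metis
    ultimately have "inv' (prodl (map item_perm (Leaf w xs # its))) v = last xs"
      using inv True by (simp only:)
    moreover have "c (last xs) = c (inv' (prodl (cores its)) w)"
      using 3(3) \<open>last xs \<in> set xs\<close> by simp
    ultimately show ?thesis by (simp only: cores.simps True)
  next
    case False
    then have "?C v = v" using 3(4) w(4) by (intro id_outside_supp) auto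
    then have "inv' ?C v = v" using permutes_inv_eq[OF C] by metis
    moreover have "c (inv' ?P v) = c (inv' (prodl (cores its)) v)" using 3 wf by simp
    ultimately show ?thesis using inv by (simp only: cores.simps)
  qed
qed simp

lemma leaf_labels_cong:
  assumes "wf_items A0 its" "\<And>y. y \<in> A0 \<union> set (newpts its) \<Longrightarrow> c y = d y"
  shows "leaf_labels c its = leaf_labels d its"
  using assms
proof (induction "its" rule: cores.induct)
  case (2 s "its")
  have "wf_items A0 its" using 2(2) by (auto simp: wf_items_def)
  then show ?case using 2 by simp
next
  case (3 v xs "its")
  have wf: "wf_items A0 its" using 3(2) by (auto simp: wf_items_def)
  have "v \<in> A0" using 3(2) by (auto simp: wf_items_def)
  then have "inv' (prodl (cores its)) v \<in> A0"
    using permutes_in_image[OF permutes_inv[OF items_permute(2)[OF wf]]] by simp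
  then have "c (inv' (prodl (cores its)) v) = d (inv' (prodl (cores its)) v)" using 3(3) by simp
  moreover have "\<forall>a\<in>set xs. c a = d a" using 3(3) by simp
  moreover have "leaf_labels c its = leaf_labels d its" by (intro 3(1)[OF wf] 3(3)) auto
  ultimately show ?case by simp
qed simp

lemma leaf_labels_insert:
  "leaf_labels c (is1 @ Leaf v xs # is2) \<longleftrightarrow>
     leaf_labels c (is1 @ is2) \<and> (\<forall>a\<in>set xs. c a = c (inv' (prodl (cores is2)) v))"
  by (induction is1 rule: cores.induct) auto

lemma leaf_labels_appendD: "leaf_labels c (is1 @ is2) \<Longrightarrow> leaf_labels c is2"
  by (induction is1 rule: cores.induct) auto

lemma no_leaf_items:
  assumes "num_leaves its = 0"
  shows "map item_perm its = cores its" "newpts its = []" "leaf_labels c its"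
proof -
  have "map item_perm its = cores its \<and> newpts its = [] \<and> leaf_labels c its"
    using assms unfolding num_leaves_def
    by (induction "its" rule: cores.induct) auto
  then show "map item_perm its = cores its" "newpts its = []" "leaf_labels c its" by auto
qed

text \<open>Leaves are removed one at a time. Each removal is a \<open>leaf_insertion\<close> over
  all remaining points, so the other marked leaves then count as ordinary factors.\<close>

lemma Fac_items_iff:
  assumes "finite A0" "wf_items A0 its"
  shows "(map item_perm its, c) \<in> Fac (A0 \<union> set (newpts its)) m \<longleftrightarrow>
     (cores its, restrict c A0) \<in> Fac A0 m \<and> c \<in> extensional (A0 \<union> set (newpts its)) \<and> leaf_labels c its"
  using assms
proof (induction "num_leaves its" arbitrary: "its" c)
  case 0
  note n = no_leaf_items[OF 0(1)[symmetric]]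
  show ?case
  proof (cases "c \<in> extensional A0")
    case True
    then have "restrict c A0 = c" by (rule extensional_restrict)
    then show ?thesis using True by (simp only: n list.set Un_empty_right simp_thms)
  next
    case False
    then have "(cores its, c) \<notin> Fac A0 m" using Fac_extensional by blast
    then show ?thesis using False by (simp only: n list.set Un_empty_right simp_thms)
  qed
next
  case (Suc k)
  have "\<exists>i\<in>set its. is_leaf i"
    using Suc(2) unfolding num_leaves_def by (metis filter_False list.size(3) nat.distinct(1))
  then obtain v xs where "Leaf v xs \<in> set its" by (metis is_leaf.elims(2))
  then obtain is1 is2 where its: "its = is1 @ Leaf v xs # is2" by (metis split_list)
  let ?js = "is1 @ is2"
  let ?B = "A0 \<union> set (newpts ?js)"
  have wf: "wf_items A0 ?js" "wf_items A0 is2" using Suc(4) unfolding its by (auto simp: wf_items_def)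
  have vA0: "v \<in> A0" using Suc(4) unfolding its by (auto simp: wf_items_def)
  interpret leaf_insertion ?B v xs "map item_perm is1" "map item_perm is2"
  proof
    show "finite ?B" using Suc(3) by simp
    show "v \<in> ?B" "xs \<noteq> []" "distinct xs" "set xs \<inter> ?B = {}"
      using Suc(4) unfolding its by (auto simp: wf_items_def)
    show "is_cyc ?B s" if "s \<in> set (map item_perm is1 @ map item_perm is2)" for s
      using that item_perm_is_cyc[OF wf(1)] by auto
  qed
  have A: "A = A0 \<union> set (newpts its)" unfolding A_def its by auto
  have C: "C = item_perm (Leaf v xs)" unfolding C_def by simp
  have "num_leaves ?js = k" using Suc(2) unfolding its num_leaves_def by simp
  then have IH: "(map item_perm ?js, restrict c ?B) \<in> Fac ?B m \<longleftrightarrow>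
      (cores ?js, restrict c A0) \<in> Fac A0 m \<and> leaf_labels c ?js"
    using Suc(1)[OF _ Suc(3) wf(1), of "restrict c ?B"] leaf_labels_cong[OF wf(1), of "restrict c ?B" c]
    by (simp add: Int_absorb1)
  \<comment> \<open>\<open>Fac_insert_iff\<close> refers to the source under all remaining factors,
    \<open>leaf_labels\<close> to the source under the unmarked ones.\<close>
  have x: "c x = c (inv' (prodl (cores is2)) v)" if "leaf_labels c ?js"
    unfolding x_def by (rule leaf_labels_source[OF wf(2) leaf_labels_appendD[OF that] vA0])
  have "(map item_perm its, c) \<in> Fac (A0 \<union> set (newpts its)) m \<longleftrightarrow>
      (map item_perm ?js, restrict c ?B) \<in> Fac ?B m \<and> c \<in> extensional A \<and> (\<forall>a\<in>set xs. c a = c x)"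
    using Fac_insert_iff[of c m] unfolding A C its by simp
  also have "\<dots> \<longleftrightarrow> (cores ?js, restrict c A0) \<in> Fac A0 m \<and> c \<in> extensional A \<and> leaf_labels c its"
    unfolding IH unfolding its leaf_labels_insert using x by auto
  finally show ?case unfolding A unfolding its by simp
qed

section \<open>Marking leaves of a factorization and inclusion-exclusion\<close>

definition shared :: "('a \<Rightarrow> 'a) list \<Rightarrow> nat \<Rightarrow> 'a set" where
  "shared ss l = {v \<in> supp (ss ! l). \<exists>l'<length ss. l' \<noteq> l \<and> v \<in> supp (ss ! l')}"

definition leaf_positions :: "('a \<Rightarrow> 'a) list \<Rightarrow> nat set" where
  "leaf_positions ss = {l. l < length ss \<and> card (shared ss l) = 1}"

text \<open>For m >= 2 an element amounts to a set of leaf positions of \<open>ss\<close>; see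
  \<open>bij_betw_mark\<close>.\<close>

definition items_of :: "'a set \<Rightarrow> ('a \<Rightarrow> 'a) list \<Rightarrow> 'a item list set" where
  "items_of A ss = {its. map item_perm its = ss \<and> set (newpts its) \<subseteq> A \<and> wf_items (A - set (newpts its)) its}"

lemma newpts_nth_disjoint:
  assumes "distinct (newpts its)" "i < length its" "j < length its" "i \<noteq> j"
    "its ! i = Leaf v xs" "its ! j = Leaf w ys"
  shows "set xs \<inter> set ys = {}"
proof -
  have "set xs \<inter> set ys = {}" if "i < j" "j < length its" "its ! i = Leaf v xs" "its ! j = Leaf w ys" for i j v xs w ys
  proof -
    have eq: "its = take i its @ Leaf v xs # drop (Suc i) its"
      using that by (metis id_take_nth_drop order_less_trans)
    have L: "Leaf w ys \<in> set (drop (Suc i) its)"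
    proof -
      have "drop (Suc i) its ! (j - Suc i) = Leaf w ys" "j - Suc i < length (drop (Suc i) its)"
        using that by simp_all
      then show ?thesis by (metis nth_mem)
    qed
    have "distinct (newpts (take i its @ Leaf v xs # drop (Suc i) its))"
      using assms(1) eq by metis
    then have "distinct (newpts (take i its) @ xs @ newpts (drop (Suc i) its))"
      by (simp only: newpts_append newpts.simps)
    then show ?thesis using Leaf_newpts[OF L] by auto
  qed
  note * = this
  show ?thesis
  proof (cases "i < j")
    case True
    then show ?thesis using *[OF True assms(3,5,6)] by simp
  next
    case False
    then have "j < i" using assms(4) by simp
    then show ?thesis using *[OF _ assms(2,6,5)] by (simp add: Int_commute)
  qed
qed

text \<open>If a factor shared no point, its support would be invariant, hence all of A by
  connectedness. It would be the only factor, and minimality for one cycle on all of A gives m =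
  1.\<close>

lemma Fac_overlap:
  assumes "finite A" "(ss, c) \<in> Fac A m" "2 \<le> m" "l < length ss"
  shows "shared ss l \<noteq> {}"
proof
  assume no: "shared ss l = {}"
  note F = assms(2)[unfolded Fac_def]
  have cyc: "is_cyc A s" if "s \<in> set ss" for s using F that by auto
  have sl: "ss ! l \<in> set ss" using assms(4) by simp
  obtain x where x: "x \<in> supp (ss ! l)"
    using is_cyc_csize[OF cyc[OF sl]] by (fastforce simp: csize_def)
  have disj: "supp (ss ! l') \<inter> supp (ss ! l) = {}" if "l' < length ss" "l' \<noteq> l" for l'
    using no that unfolding shared_def by blast
  have "supp (ss ! l) = A"
  proof (rule connD[of A ss _ x])
    show "conn A ss" using F by simp
    show "supp (ss ! l) \<subseteq> A" by (rule is_cyc_supp[OF cyc[OF sl]])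
    show "s ` supp (ss ! l) \<subseteq> supp (ss ! l)" if s: "s \<in> set ss" for s
    proof -
      obtain l' where l': "l' < length ss" "s = ss ! l'" using s by (metis in_set_conv_nth)
      show ?thesis
      proof (cases "l' = l")
        case True
        then have eq: "ss ! l = s" using l'(2) by simp
        have inj: "inj s" by (rule permutes_inj[OF is_cyc_permutes[OF cyc[OF s]]])
        show ?thesis unfolding eq
        proof (rule image_subsetI)
          fix y assume "y \<in> supp s"
          then have "s y \<noteq> y" by (simp add: supp_def)
          then have "s (s y) \<noteq> s y" by (simp add: inj_eq[OF inj])
          then show "s y \<in> supp s" by (simp add: supp_def)
        qed
      next
        case False
        have "s y = y" if "y \<in> supp (ss ! l)" for y
        proof -
          have "y \<notin> supp s" using disj[OF l'(1) False] l'(2) that by blast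
          then show ?thesis by (simp add: supp_def)
        qed
        then show ?thesis by (simp add: image_subset_iff)
      qed
    qed
  qed (rule x)
  have "l' = l" if "l' < length ss" for l'
  proof (rule ccontr)
    assume "l' \<noteq> l"
    have l': "is_cyc A (ss ! l')" using cyc that by simp
    have "supp (ss ! l') = {}"
      using disj[OF that \<open>l' \<noteq> l\<close>] is_cyc_supp[OF l'] unfolding \<open>supp (ss ! l) = A\<close> by blast
    then show False using is_cyc_csize[OF l'] by (simp add: csize_def)
  qed
  note all = this
  have "length ss \<le> 1"
  proof (rule ccontr)
    assume "\<not> length ss \<le> 1"
    then have "0 < length ss" "1 < length ss" using assms(4) by linarith+
    then have "0 = l" "1 = l" using all by blast+
    then show False by simp
  qed
  then obtain s where s: "ss = [s]" using assms(4) by (cases ss) auto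
  then have "csize s = card A" using \<open>supp (ss ! l) = A\<close> assms(4) by (simp add: csize_def)
  moreover have "csize s \<ge> 2" using is_cyc_csize cyc s by auto
  moreover have "card A + m = csize s - 1 + 2" using F s by simp
  ultimately show False using assms(3) by linarith
qed

text \<open>The new points of a marked leaf are moved by no other factor, so only the anchor can be
  shared, and by \<open>Fac_overlap\<close> some point is.\<close>

lemma items_of_shared:
  assumes A: "finite A" and F: "(ss, c) \<in> Fac A m" "2 \<le> m" and its: "its \<in> items_of A ss"
    and l: "l < length its" "its ! l = Leaf v xs"
  shows "shared ss l = {v}"
proof -
  let ?A0 = "A - set (newpts its)"
  have wf: "wf_items ?A0 its" and ss: "ss = map item_perm its" using its by (auto simp: items_of_def)
  have L: "Leaf v xs \<in> set its" using l by (metis nth_mem)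
  then have v: "v \<in> ?A0" "xs \<noteq> []" using wf by (auto simp: wf_items_def)
  have sub: "set xs \<subseteq> set (newpts its)" by (rule Leaf_newpts[OF L])
  have dist: "distinct (v # xs)"
  proof -
    obtain is1 is2 where "its = is1 @ Leaf v xs # is2" using L by (metis split_list)
    then show ?thesis using wf v(1) sub by (auto simp: wf_items_def)
  qed
  have "supp (ss ! l) = insert v (set xs)"
    using l ss supp_cycle_of_list[OF dist] v(2) by (simp add: Suc_le_eq)
  moreover have "a \<notin> supp (ss ! l')" if "a \<in> set xs" "l' < length ss" "l' \<noteq> l" for a l'
  proof (cases "its ! l'")
    case (Core s)
    have "Core s \<in> set its" using Core that(2) ss by (metis length_map nth_mem)
    then have "is_cyc ?A0 s" using wf Core_in_cores by (auto simp: wf_items_def)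
    then have "supp s \<subseteq> ?A0" by (rule is_cyc_supp)
    then show ?thesis using that sub Core ss by auto
  next
    case (Leaf w ys)
    have "Leaf w ys \<in> set its" using Leaf that(2) ss by (metis length_map nth_mem)
    then have "w \<in> ?A0" using wf by (auto simp: wf_items_def)
    then have "a \<noteq> w" using that(1) sub by auto
    moreover have "a \<notin> set ys"
      using newpts_nth_disjoint[of "its" l l' v xs w ys] wf l Leaf that ss by (auto simp: wf_items_def)
    ultimately have "cycle_of_list (w # ys) a = a" by (intro id_outside_supp) auto
    then show ?thesis using Leaf that ss by (simp add: supp_def)
  qed
  ultimately have "shared ss l \<subseteq> {v}" unfolding shared_def by blast
  moreover have "shared ss l \<noteq> {}" using Fac_overlap[OF A F] l ss by simp
  ultimately show ?thesis by blast
qed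

text \<open>A cycle is written from a prescribed point v on; the tail of the list is then the list
  of new points of a leaf anchored at v.\<close>

lemma canonical_leaf:
  assumes "finite A" "is_cyc A s" "v \<in> supp s"
  shows "cycle_of_list (v # tl (support s v)) = s" "tl (support s v) \<noteq> []"
    "distinct (v # tl (support s v))" "set (v # tl (support s v)) = supp s"
proof -
  have p: "permutation s" using is_cyc_permutes[OF assms(2)] assms(1) permutation_permutes by blast
  have o: "orbit s v = supp s" by (rule is_cyc_orbit[OF assms(2,3)])
  have n: "least_power s v \<ge> 2"
    using length_support_eq_card_orbit[OF p, of v] is_cyc_csize[OF assms(2)] by (simp add: o csize_def)
  then have hd: "v # tl (support s v) = support s v"
    by (cases "support s v") (auto simp: upt_rec)
  show "cycle_of_list (v # tl (support s v)) = s"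
    unfolding hd using cycle_of_list_support[OF p, of v] o by simp
  show "distinct (v # tl (support s v))" unfolding hd by (rule cycle_of_permutation[OF p])
  show "set (v # tl (support s v)) = supp s" unfolding hd set_support_eq_orbit[OF p] by (rule o)
  have "length (tl (support s v)) \<ge> 1" using n by (simp only: length_tl length_map length_upt)
  then show "tl (support s v) \<noteq> []" by (metis list.size(3) not_one_le_zero)
qed

lemma is_cyc_Diff:
  assumes "is_cyc A s" "supp s \<inter> N = {}" shows "is_cyc (A - N) s"
proof -
  obtain cs where cs: "distinct cs" "set cs \<subseteq> A" "length cs \<ge> 2" "s = cycle_of_list cs"
    using assms(1) by (auto simp: is_cyc_def)
  then have "set cs \<subseteq> A - N" using assms(2) supp_cycle_of_list[OF cs(1,3)] by blast
  then show ?thesis using cs unfolding is_cyc_def by blast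
qed

lemma newpts_eq_concat: "newpts its = concat (map (\<lambda>i. case i of Core s \<Rightarrow> [] | Leaf v xs \<Rightarrow> xs) its)"
  by (induction its rule: newpts.induct) auto

lemma distinct_concatI:
  assumes "\<And>i. i < length xss \<Longrightarrow> distinct (xss ! i)"
    "\<And>i j. i < j \<Longrightarrow> j < length xss \<Longrightarrow> set (xss ! i) \<inter> set (xss ! j) = {}"
  shows "distinct (concat xss)"
  using assms
proof (induction xss)
  case (Cons xs xss)
  have "distinct (concat xss)"
  proof (rule Cons.IH)
    show "distinct (xss ! i)" if "i < length xss" for i using Cons.prems(1)[of "Suc i"] that by simp
    show "set (xss ! i) \<inter> set (xss ! j) = {}" if "i < j" "j < length xss" for i j
      using Cons.prems(2)[of "Suc i" "Suc j"] that by simp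
  qed
  moreover have "set xs \<inter> set ys = {}" if "ys \<in> set xss" for ys
  proof -
    obtain i where "i < length xss" "ys = xss ! i" using \<open>ys \<in> set xss\<close> by (metis in_set_conv_nth)
    then show ?thesis using Cons.prems(2)[of 0 "Suc i"] by simp
  qed
  ultimately show ?case using Cons.prems(1)[of 0] by auto
qed simp

lemma cores_nth: "s \<in> set (cores its) \<Longrightarrow> Core s \<in> set its"
  by (induction its rule: cores.induct) auto

context
  fixes A :: "'a set" and ss :: "('a \<Rightarrow> 'a) list" and c :: "'a \<Rightarrow> nat" and m :: nat
  assumes A: "finite A" and F: "(ss, c) \<in> Fac A m" and m: "2 \<le> m"
begin

private definition "anchor l = the_elem (shared ss l)"
private definition "tail l = tl (support (ss ! l) (anchor l))"
private definition "mark L = map (\<lambda>l. if l \<in> L then Leaf (anchor l) (tail l) else Core (ss ! l)) [0..<length ss]"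

private lemma cyc: "l < length ss \<Longrightarrow> is_cyc A (ss ! l)"
  using F by (auto simp: Fac_def)

private lemma anchor:
  assumes "l \<in> leaf_positions ss" shows "shared ss l = {anchor l}"
proof -
  have "card (shared ss l) = 1" using assms by (simp add: leaf_positions_def)
  then obtain v where "shared ss l = {v}" by (rule card_1_singletonE)
  then show ?thesis by (simp add: anchor_def)
qed

private lemma tail:
  assumes "l \<in> leaf_positions ss"
  shows "cycle_of_list (anchor l # tail l) = ss ! l" "tail l \<noteq> []" "distinct (anchor l # tail l)"
    "set (anchor l # tail l) = supp (ss ! l)"
proof -
  have "is_cyc A (ss ! l)" using cyc assms by (auto simp: leaf_positions_def)
  moreover have "anchor l \<in> supp (ss ! l)" using anchor[OF assms] by (auto simp: shared_def)
  ultimately show "cycle_of_list (anchor l # tail l) = ss ! l" "tail l \<noteq> []" "distinct (anchor l # tail l)"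
    "set (anchor l # tail l) = supp (ss ! l)"
    unfolding tail_def using canonical_leaf[OF A] by auto
qed

private lemma tail_private:
  assumes "l \<in> leaf_positions ss" "a \<in> set (tail l)" "l' < length ss" "l' \<noteq> l"
  shows "a \<notin> supp (ss ! l')"
proof
  assume "a \<in> supp (ss ! l')"
  moreover have "a \<in> supp (ss ! l)" using tail(4)[OF assms(1)] assms(2) by auto
  ultimately have "a \<in> shared ss l" using assms(3,4) by (auto simp: shared_def)
  then show False using anchor[OF assms(1)] tail(3)[OF assms(1)] assms(2) by auto
qed

private lemma mark_nth:
  "l < length ss \<Longrightarrow> mark L ! l = (if l \<in> L then Leaf (anchor l) (tail l) else Core (ss ! l))"
  by (simp add: mark_def)

private lemma leaf_less: "l \<in> leaf_positions ss \<Longrightarrow> l < length ss"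
  by (simp add: leaf_positions_def)

private lemma set_newpts_mark:
  assumes "L \<subseteq> leaf_positions ss"
  shows "set (newpts (mark L)) = (\<Union>l\<in>L. set (tail l))"
proof -
  have "newpts (mark L) = concat (map (\<lambda>l. if l \<in> L then tail l else []) [0..<length ss])"
    unfolding newpts_eq_concat mark_def by (simp add: comp_def if_distrib cong: if_cong)
  then have "set (newpts (mark L)) = (\<Union>l\<in>{0..<length ss}. if l \<in> L then set (tail l) else {})"
    by (simp add: if_distrib cong: if_cong)
  also have "\<dots> = (\<Union>l\<in>L. set (tail l))"
  proof -
    have "L \<subseteq> {0..<length ss}"
    proof
      fix l assume "l \<in> L"
      then have "l \<in> leaf_positions ss" using assms by blast
      then show "l \<in> {0..<length ss}" using leaf_less by simp
    qed
    then show ?thesis by (auto split: if_splits)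
  qed
  finally show ?thesis .
qed

private lemma mark_items_of:
  assumes "L \<subseteq> leaf_positions ss" shows "mark L \<in> items_of A ss"
proof -
  note N = set_newpts_mark[OF assms]
  have L: "l \<in> leaf_positions ss \<and> l < length ss" if "l \<in> L" for l
    using that assms leaf_less by blast
  have "set (newpts (mark L)) \<subseteq> A"
  proof
    fix a assume "a \<in> set (newpts (mark L))"
    then obtain l where "l \<in> L" "a \<in> set (tail l)" using N by blast
    then have "a \<in> supp (ss ! l)" "l < length ss" using tail(4)[of l] L[of l] by auto
    then show "a \<in> A" using is_cyc_supp[OF cyc] by blast
  qed
  moreover have "map item_perm (mark L) = ss"
    by (rule nth_equalityI) (use tail(1) L in \<open>auto simp: mark_def\<close>)
  moreover have "wf_items (A - set (newpts (mark L))) (mark L)"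
    unfolding wf_items_def
  proof (intro conjI ballI allI impI)
    fix s assume "s \<in> set (cores (mark L))"
    then have "Core s \<in> set (mark L)" by (rule cores_nth)
    then obtain l where l: "l < length ss" "l \<notin> L" "s = ss ! l"
      by (auto simp: mark_def split: if_splits)
    have "is_cyc A s" using cyc l by simp
    moreover have "supp s \<inter> set (newpts (mark L)) = {}"
      using tail_private L l unfolding N by blast
    ultimately show "is_cyc (A - set (newpts (mark L))) s" by (rule is_cyc_Diff)
  next
    fix v xs assume "Leaf v xs \<in> set (mark L)"
    then obtain l where l: "l < length ss" "l \<in> L" "v = anchor l" "xs = tail l"
      by (auto simp: mark_def split: if_splits)
    show "xs \<noteq> []" using tail(2) L l by simp
    have v: "v \<in> shared ss l" using anchor L l by blast
    then have "v \<in> A" using is_cyc_supp[OF cyc[OF l(1)]] by (auto simp: shared_def)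
    moreover have "v \<notin> set (tail l')" if "l' \<in> L" for l'
    proof (cases "l' = l")
      case True
      then show ?thesis using tail(3)[of l] L l by auto
    next
      case False
      then show ?thesis using tail_private[of l' v l] v L that l(1) by (auto simp: shared_def)
    qed
    ultimately show "v \<in> A - set (newpts (mark L))" using N by blast
  next
    show "distinct (newpts (mark L))"
      unfolding newpts_eq_concat
    proof (rule distinct_concatI)
      fix i assume "i < length (map (case_item (\<lambda>s. []) (\<lambda>v xs. xs)) (mark L))"
      then show "distinct (map (case_item (\<lambda>s. []) (\<lambda>v xs. xs)) (mark L) ! i)"
        using tail(3)[of i] L[of i] by (simp add: mark_def)
    next
      fix i j assume ij: "i < j" "j < length (map (case_item (\<lambda>s. []) (\<lambda>v xs. xs)) (mark L))"
      have "set (tail i) \<inter> set (tail j) = {}" if "i \<in> L" "j \<in> L"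
        using tail_private[of i _ j] tail(4)[of j] L that ij(1) by fastforce
      then show "set (map (case_item (\<lambda>s. []) (\<lambda>v xs. xs)) (mark L) ! i) \<inter>
          set (map (case_item (\<lambda>s. []) (\<lambda>v xs. xs)) (mark L) ! j) = {}"
        using ij by (simp add: mark_def)
    qed
  qed auto
  ultimately show ?thesis by (simp add: items_of_def)
qed

private definition "leaves its = {l. l < length its \<and> is_leaf (its ! l)}"

private lemma leaves_items_of:
  assumes "its \<in> items_of A ss"
  shows "leaves its \<subseteq> leaf_positions ss" "mark (leaves its) = its"
proof -
  have ss: "map item_perm its = ss" using assms by (simp add: items_of_def)
  then have len: "length its = length ss" by auto
  have sh: "shared ss l = {v}" if "l < length its" "its ! l = Leaf v xs" for l v xs
    by (rule items_of_shared[OF A F m assms that])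
  show *: "leaves its \<subseteq> leaf_positions ss"
  proof
    fix l assume l: "l \<in> leaves its"
    then obtain v xs where "its ! l = Leaf v xs" by (auto simp: leaves_def elim: is_leaf.elims)
    then show "l \<in> leaf_positions ss" using sh l len by (auto simp: leaves_def leaf_positions_def)
  qed
  have "mark (leaves its) ! l = its ! l" if l: "l < length ss" for l
  proof (cases "its ! l")
    case (Core s)
    then have "ss ! l = s" using ss l len by (metis item_perm.simps(1) nth_map)
    then show ?thesis using Core l by (simp add: mark_nth leaves_def)
  next
    case (Leaf v xs)
    then have in_l: "l \<in> leaves its" using l len by (simp add: leaves_def)
    then have lp: "l \<in> leaf_positions ss" using * by blast
    have "anchor l = v" using sh[OF _ Leaf] anchor[OF lp] l len by simp
    have c: "cycle_of_list (v # xs) = ss ! l" using Leaf l len ss by (metis item_perm.simps(2) nth_map)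
    have L: "Leaf v xs \<in> set its" using Leaf l len by (metis nth_mem)
    have wf: "wf_items (A - set (newpts its)) its" using assms by (simp add: items_of_def)
    obtain is1 is2 where "its = is1 @ Leaf v xs # is2" using L by (metis split_list)
    then have "distinct xs" using wf by (auto simp: wf_items_def)
    moreover have "v \<notin> set xs" using wf L Leaf_newpts[OF L] by (auto simp: wf_items_def)
    ultimately have d: "distinct (v # xs)" by simp
    have "xs \<noteq> []" using wf L by (auto simp: wf_items_def)
    have len2: "length xs = length (tail l)"
    proof -
      have "Suc (length xs) = csize (ss ! l)"
        using csize_cycle_of_list[OF d] \<open>xs \<noteq> []\<close> c by (simp add: Suc_le_eq)
      moreover have "Suc (length (tail l)) = csize (ss ! l)"
        using csize_cycle_of_list[OF tail(3)[OF lp]] tail(1,2)[OF lp] by (simp add: Suc_le_eq)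
      ultimately show ?thesis by simp
    qed
    \<comment> \<open>Both lists consist of the iterates of the factor at the common anchor.\<close>
    have "xs ! i = tail l ! i" if i: "i < length xs" for i
    proof -
      have "(ss ! l ^^ Suc i) v = xs ! i"
        using funpow_cycle_of_list[OF d, of 0 "Suc i"] i by (simp only: c) simp
      moreover have "(ss ! l ^^ Suc i) v = tail l ! i"
      proof -
        have "(cycle_of_list (anchor l # tail l) ^^ Suc i) ((anchor l # tail l) ! 0)
            = (anchor l # tail l) ! ((0 + Suc i) mod length (anchor l # tail l))"
          by (rule funpow_cycle_of_list[OF tail(3)[OF lp]]) simp_all
        then have "(ss ! l ^^ Suc i) (anchor l) = (anchor l # tail l) ! (Suc i mod Suc (length (tail l)))"
          by (simp only: tail(1)[OF lp] nth_Cons_0 add_0 length_Cons)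
        then show ?thesis using i len2 \<open>anchor l = v\<close> by simp
      qed
      ultimately show ?thesis by simp
    qed
    then have "xs = tail l" using len2 by (intro nth_equalityI) auto
    then show ?thesis using in_l l Leaf \<open>anchor l = v\<close> by (simp add: mark_nth)
  qed
  then show "mark (leaves its) = its" using len by (intro nth_equalityI) (auto simp: mark_def)
qed

text \<open>Anchor and new points of a leaf are forced by the factorization, so marking is only a
  choice of positions and the signed sum runs over subsets.\<close>

private lemma bij_betw_mark: "bij_betw mark (Pow (leaf_positions ss)) (items_of A ss)"
proof (rule bij_betw_byWitness[where f' = leaves])
  show "\<forall>L\<in>Pow (leaf_positions ss). leaves (mark L) = L"
    by (auto simp: leaves_def mark_def leaf_positions_def split: if_splits)
qed (use mark_items_of leaves_items_of in auto)

lemma finite_items_of: "finite (items_of A ss)"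
proof -
  have "finite (leaf_positions ss)" by (auto simp: leaf_positions_def)
  then show ?thesis using bij_betw_finite[OF bij_betw_mark] by simp
qed

text \<open>Expansion of the product of -1 + 1 over the leaf positions.\<close>

lemma sum_items_of_sign:
  "(\<Sum>its\<in>items_of A ss. (-1) ^ num_leaves its) = (if leaf_positions ss = {} then 1 else (0::'b::comm_ring_1))"
proof -
  have fin: "finite (leaf_positions ss)" by (auto simp: leaf_positions_def)
  have "num_leaves (mark L) = card L" if "L \<subseteq> leaf_positions ss" for L
  proof -
    have "{i. i < length (mark L) \<and> is_leaf (mark L ! i)} = L"
      using that by (auto simp: mark_def leaf_positions_def split: if_splits)
    then show ?thesis by (simp add: num_leaves_def length_filter_conv_card)
  qed
  then have "(\<Sum>its\<in>items_of A ss. (-1) ^ num_leaves its) = (\<Sum>L\<in>Pow (leaf_positions ss). (-1::'b) ^ card L)"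
    using sum.reindex_bij_betw[OF bij_betw_mark, of "\<lambda>its. (-1::'b) ^ num_leaves its", symmetric] by simp
  also have "\<dots> = (\<Prod>l\<in>leaf_positions ss. -1 + 1)"
    using prod_add[OF fin, of "\<lambda>_. -1::'b" "\<lambda>_. 1"] by simp
  also have "\<dots> = (if leaf_positions ss = {} then 1 else 0)"
    using fin by (auto simp: zero_power card_gt_0_iff)
  finally show ?thesis .
qed

end

section \<open>Weighted number of ways to attach leaves\<close>

fun leaf_content :: "('a \<Rightarrow> nat) \<Rightarrow> 'a item list \<Rightarrow> nat \<Rightarrow> nat" where
  "leaf_content c [] j = 0"
| "leaf_content c (Core s # its) j = leaf_content c its j"
| "leaf_content c (Leaf v xs # its) j =
     (if c (inv' (prodl (cores its)) v) = j then length xs else 0) + leaf_content c its j"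

fun extend_labels :: "('a \<Rightarrow> nat) \<Rightarrow> 'a item list \<Rightarrow> 'a \<Rightarrow> nat" where
  "extend_labels c [] = c"
| "extend_labels c (Core s # its) = extend_labels c its"
| "extend_labels c (Leaf v xs # its) =
     (\<lambda>x. if x \<in> set xs then c (inv' (prodl (cores its)) v) else extend_labels c its x)"

lemma wf_items_Cons:
  "wf_items A0 (Core s # its) \<longleftrightarrow> is_cyc A0 s \<and> wf_items A0 its"
  "wf_items A0 (Leaf v xs # its) \<longleftrightarrow> v \<in> A0 \<and> xs \<noteq> [] \<and> distinct xs \<and>
     set xs \<inter> (A0 \<union> set (newpts its)) = {} \<and> wf_items A0 its"
  by (auto simp: wf_items_def)

lemma extend_labels_other: "x \<notin> set (newpts its) \<Longrightarrow> extend_labels c its x = c x"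
  by (induction its rule: cores.induct) auto

lemma extend_labels_extensional:
  "c \<in> extensional A0 \<Longrightarrow> extend_labels c its \<in> extensional (A0 \<union> set (newpts its))"
  by (induction its rule: cores.induct) (auto simp: extensional_def)

lemma inv_cores_in:
  assumes "wf_items A0 its" "v \<in> A0" shows "inv' (prodl (cores its)) v \<in> A0"
  using permutes_in_image[OF permutes_inv[OF items_permute(2)[OF assms(1)]]] assms(2) by simp

text \<open>Given the labels on A0, the condition on the new points has exactly one solution. So a
  sum over labellings of all points becomes one over labellings of A0.\<close>

lemma leaf_labels_iff_extend:
  assumes "wf_items A0 its" "c \<in> extensional (A0 \<union> set (newpts its))"
  shows "leaf_labels c its \<longleftrightarrow> c = extend_labels (restrict c A0) its"
proof -
  define d where "d = restrict c A0"
  have "leaf_labels c its \<longleftrightarrow> (\<forall>x\<in>A0 \<union> set (newpts its). c x = extend_labels d its x)"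
    using assms(1)
  proof (induction its rule: cores.induct)
    case 1
    show ?case by (simp add: d_def)
  next
    case (2 s its)
    then show ?case by (simp add: wf_items_Cons)
  next
    case (3 v xs its)
    have wf: "v \<in> A0" "set xs \<inter> (A0 \<union> set (newpts its)) = {}" "wf_items A0 its"
      using 3(2) by (simp_all add: wf_items_Cons)
    have v: "d (inv' (prodl (cores its)) v) = c (inv' (prodl (cores its)) v)"
      using inv_cores_in[OF wf(3,1)] by (simp add: d_def)
    have "x \<notin> set xs" if "x \<in> A0 \<union> set (newpts its)" for x using that wf(2) by blast
    then have "(\<forall>x\<in>A0 \<union> set (newpts (Leaf v xs # its)). c x = extend_labels d (Leaf v xs # its) x)
        \<longleftrightarrow> (\<forall>a\<in>set xs. c a = c (inv' (prodl (cores its)) v)) \<and>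
            (\<forall>x\<in>A0 \<union> set (newpts its). c x = extend_labels d its x)"
      using v by auto
    then show ?case unfolding leaf_labels.simps 3(1)[OF wf(3)] by (rule sym)
  qed
  moreover have "extend_labels d its \<in> extensional (A0 \<union> set (newpts its))"
    unfolding d_def by (rule extend_labels_extensional) simp
  ultimately have "leaf_labels c its \<longleftrightarrow> c = extend_labels d its"
    using extensionalityI[OF assms(2)] by metis
  then show ?thesis by (simp only: d_def)
qed

lemma card_extend_labels:
  assumes "finite A0" "wf_items A0 its"
  shows "card {x\<in>A0 \<union> set (newpts its). extend_labels c its x = j}
       = card {x\<in>A0. c x = j} + leaf_content c its j"
  using assms(2)
proof (induction its rule: cores.induct)
  case (3 v xs its)
  have wf: "v \<in> A0" "set xs \<inter> (A0 \<union> set (newpts its)) = {}" "wf_items A0 its" "distinct xs"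
    using 3(2) by (simp_all add: wf_items_Cons)
  let ?S = "{x\<in>A0 \<union> set (newpts its). extend_labels c its x = j}"
  let ?T = "{x\<in>set xs. c (inv' (prodl (cores its)) v) = j}"
  have "{x\<in>A0 \<union> set (newpts (Leaf v xs # its)). extend_labels c (Leaf v xs # its) x = j} = ?T \<union> ?S"
    using wf(2) by auto
  moreover have "card (?T \<union> ?S) = card ?T + card ?S"
    using assms(1) wf(2) by (intro card_Un_disjoint) auto
  moreover have "card ?T = (if c (inv' (prodl (cores its)) v) = j then length xs else 0)"
    using distinct_card[OF wf(4)] by simp
  ultimately show ?case using 3(1)[OF wf(3)] by simp
qed (auto simp: wf_items_Cons)

definition leaf_weight :: "'a item list \<Rightarrow> qu_poly" where
  "leaf_weight its = (\<Prod>i\<leftarrow>its. case i of Core s \<Rightarrow> 1 | Leaf v xs \<Rightarrow> qvar (length xs + 1))"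

lemma num_leaves_simps [simp]:
  "num_leaves [] = 0" "num_leaves (Core s # its) = num_leaves its"
  "num_leaves (Leaf v xs # its) = Suc (num_leaves its)"
  by (simp_all add: num_leaves_def)

lemma leaf_weight_simps [simp]:
  "leaf_weight [] = 1" "leaf_weight (Core s # its) = leaf_weight its"
  "leaf_weight (Leaf v xs # its) = qvar (length xs + 1) * leaf_weight its"
  by (simp_all add: leaf_weight_def)

definition weight :: "('a \<Rightarrow> 'a) list \<Rightarrow> qu_poly" where
  "weight ss = (\<Prod>s\<leftarrow>ss. qvar (csize s))"

lemma weight_items:
  assumes "wf_items A0 its"
  shows "weight (map item_perm its) = weight (cores its) * leaf_weight its"
  using assms
proof (induction its rule: cores.induct)
  case (3 v xs its)
  have "distinct (v # xs)" "length (v # xs) \<ge> 2"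
    using 3(2) by (auto simp: wf_items_Cons Suc_le_eq)
  then have "csize (cycle_of_list (v # xs)) = length xs + 1" using csize_cycle_of_list by fastforce
  then show ?case using 3 by (simp add: weight_def wf_items_Cons mult_ac)
qed (simp_all add: weight_def wf_items_Cons mult_ac)

definition leaf_patterns ::
  "'a set \<Rightarrow> ('a \<Rightarrow> nat) \<Rightarrow> nat \<Rightarrow> ('a \<Rightarrow> 'a) list \<Rightarrow> 'a set \<Rightarrow> (nat \<Rightarrow> nat) \<Rightarrow> nat \<Rightarrow> 'a item list set" where
  "leaf_patterns A0 c m ss B \<delta> s = {its. cores its = ss \<and> wf_items A0 its \<and> set (newpts its) = B \<and>
     (\<forall>j<m. leaf_content c its j = \<delta> j) \<and> num_leaves its = s}"

lemma leaf_patterns_0: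
  assumes "\<And>s. s \<in> set ss \<Longrightarrow> is_cyc A0 s"
  shows "leaf_patterns A0 c m ss B \<delta> 0 = (if B = {} \<and> (\<forall>j<m. \<delta> j = 0) then {map Core ss} else {})"
proof -
  have 1: "its = map Core (cores its)" if "num_leaves its = 0" for its :: "'a item list"
    using that by (induction its rule: cores.induct) auto
  have 2: "cores (map Core ss) = ss" "newpts (map Core ss) = []" "num_leaves (map Core ss) = 0"
    "leaf_content c (map Core ss) j = 0" for ss and j
    by (induction ss) auto
  have 3: "wf_items A0 (map Core ss)" using assms 2 by (auto simp: wf_items_def)
  have "its \<in> leaf_patterns A0 c m ss B \<delta> 0 \<longleftrightarrow> its = map Core ss \<and> B = {} \<and> (\<forall>j<m. \<delta> j = 0)" for its
  proof
    assume h: "its \<in> leaf_patterns A0 c m ss B \<delta> 0"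
    then have "its = map Core ss" using 1[of its] by (simp add: leaf_patterns_def)
    then show "its = map Core ss \<and> B = {} \<and> (\<forall>j<m. \<delta> j = 0)"
      using h 2 by (auto simp: leaf_patterns_def)
  next
    assume "its = map Core ss \<and> B = {} \<and> (\<forall>j<m. \<delta> j = 0)"
    then show "its \<in> leaf_patterns A0 c m ss B \<delta> 0" using 2 3 by (auto simp: leaf_patterns_def)
  qed
  then show ?thesis by auto
qed

definition leaf_choices :: "(nat \<Rightarrow> nat) \<Rightarrow> 'a set \<Rightarrow> nat \<Rightarrow> 'a list set" where
  "leaf_choices \<delta> B j = {xs. xs \<noteq> [] \<and> distinct xs \<and> set xs \<subseteq> B \<and> length xs \<le> \<delta> j}"

text \<open>Case distinction on the first item. A leaf in first place has all unmarked factors to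
  its right, which is why \<open>lab\<close> uses the whole of \<open>ss\<close>.\<close>

lemma leaf_patterns_Suc:
  fixes A0 :: "'a set"
  assumes ss: "\<And>s. s \<in> set ss \<Longrightarrow> is_cyc A0 s" and B: "B \<inter> A0 = {}" and c: "c ` A0 \<subseteq> {..<m}"
  defines "lab \<equiv> \<lambda>v. c (inv' (prodl ss) v)"
  shows "leaf_patterns A0 c m ss B \<delta> (Suc n) =
    (case ss of [] \<Rightarrow> {} | s # ss' \<Rightarrow> (#) (Core s) ` leaf_patterns A0 c m ss' B \<delta> (Suc n)) \<union>
    (\<Union>v\<in>A0. \<Union>xs\<in>leaf_choices \<delta> B (lab v).
       (#) (Leaf v xs) ` leaf_patterns A0 c m ss (B - set xs) (\<delta>(lab v := \<delta> (lab v) - length xs)) n)"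
    (is "?L = ?R1 \<union> ?R2")
proof (intro Set.set_eqI iffI)
  fix its assume h: "its \<in> ?L"
  show "its \<in> ?R1 \<union> ?R2"
  proof (cases its rule: cores.cases)
    case 1
    then show ?thesis using h by (simp add: leaf_patterns_def)
  next
    case (2 s js)
    then have "ss = s # cores js" "js \<in> leaf_patterns A0 c m (cores js) B \<delta> (Suc n)"
      using h by (auto simp: leaf_patterns_def wf_items_Cons)
    then show ?thesis using 2 by (auto split: list.splits)
  next
    case (3 v xs js)
    have js: "cores js = ss" "v \<in> A0" "xs \<noteq> []" "distinct xs" "set xs \<inter> set (newpts js) = {}"
      "wf_items A0 js" "B = set xs \<union> set (newpts js)" "num_leaves js = n"
      and \<delta>: "\<And>j. j < m \<Longrightarrow> (if lab v = j then length xs else 0) + leaf_content c js j = \<delta> j"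
      using h 3 by (auto simp: leaf_patterns_def wf_items_Cons lab_def)
    have "lab v < m" using inv_cores_in[OF js(6,2)] c by (auto simp: lab_def js(1))
    then have le: "length xs \<le> \<delta> (lab v)" using \<delta>[of "lab v"] by simp
    have "set (newpts js) = B - set xs" using js by blast
    moreover have "leaf_content c js j = (\<delta>(lab v := \<delta> (lab v) - length xs)) j" if "j < m" for j
      using \<delta>[OF that] by auto
    ultimately have "js \<in> leaf_patterns A0 c m ss (B - set xs) (\<delta>(lab v := \<delta> (lab v) - length xs)) n"
      using js by (simp add: leaf_patterns_def)
    moreover have "xs \<in> leaf_choices \<delta> B (lab v)" using js le by (auto simp: leaf_choices_def)
    ultimately show ?thesis using js(2) 3 by blast
  qed
next
  fix its assume "its \<in> ?R1 \<union> ?R2"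
  then consider s ss' js where "ss = s # ss'" "its = Core s # js" "js \<in> leaf_patterns A0 c m ss' B \<delta> (Suc n)"
    | v xs js where "v \<in> A0" "xs \<in> leaf_choices \<delta> B (lab v)" "its = Leaf v xs # js"
      "js \<in> leaf_patterns A0 c m ss (B - set xs) (\<delta>(lab v := \<delta> (lab v) - length xs)) n"
    by (auto split: list.splits)
  then show "its \<in> ?L"
  proof cases
    case 1
    then show ?thesis using ss[of s] by (auto simp: leaf_patterns_def wf_items_Cons)
  next
    case 2
    have js: "cores js = ss" "wf_items A0 js" "set (newpts js) = B - set xs" "num_leaves js = n"
      "\<And>j. j < m \<Longrightarrow> leaf_content c js j = (\<delta>(lab v := \<delta> (lab v) - length xs)) j"
      using 2(4) by (auto simp: leaf_patterns_def)
    have xs: "xs \<noteq> []" "distinct xs" "set xs \<subseteq> B" "length xs \<le> \<delta> (lab v)"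
      using 2(2) by (auto simp: leaf_choices_def)
    have "leaf_content c its j = \<delta> j" if "j < m" for j
      using js(5)[OF that] xs(4) 2(3) js(1) by (auto simp: lab_def)
    moreover have "set (newpts its) = B" using xs js 2(3) by auto
    moreover have "wf_items A0 its" using xs js 2(1,3) B by (auto simp: wf_items_Cons)
    ultimately show ?thesis using js(1,4) 2(3) by (simp add: leaf_patterns_def)
  qed
qed

lemma finite_leaf_choices: "finite B \<Longrightarrow> finite (leaf_choices \<delta> B j)"
  unfolding leaf_choices_def
  by (rule finite_subset[OF _ finite_lists_length_le[of B "\<delta> j"]]) auto

lemma card_lists_fact:
  assumes "finite B" "t \<le> card B"
  shows "card {xs. length xs = t \<and> distinct xs \<and> set xs \<subseteq> B} * fact (card B - t) = (fact (card B) :: nat)"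
proof -
  have "card {xs. length xs = t \<and> distinct xs \<and> set xs \<subseteq> B} = \<Prod>{card B - t + 1..card B}"
    by (rule card_lists_distinct_length_eq[OF assms])
  moreover have "fact (card B) = (\<Prod>{1..card B - t} * \<Prod>{card B - t + 1..card B} :: nat)"
    unfolding fact_prod of_nat_id using assms(2)
    by (subst prod.union_disjoint[symmetric]) (auto intro!: prod.cong)
  ultimately show ?thesis by (simp add: fact_prod)
qed

text \<open>There are (card B)! / (card B - t)! lists of t distinct points of B. The factor (card B
  - t)! of the points left for later leaves therefore becomes (card B)!, independently of t.\<close>

lemma sum_leaf_choices:
  fixes g :: "nat \<Rightarrow> qu_poly"
  assumes B: "finite B" and le: "\<delta> j \<le> card B"
  shows "(\<Sum>xs\<in>leaf_choices \<delta> B j. of_nat (fact (card B - length xs)) * g (length xs))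
       = of_nat (fact (card B)) * (\<Sum>t=1..\<delta> j. g t)"
proof -
  have eq: "{xs\<in>leaf_choices \<delta> B j. length xs = t} = {xs. length xs = t \<and> distinct xs \<and> set xs \<subseteq> B}"
    if "t \<in> {1..\<delta> j}" for t
    using that by (auto simp: leaf_choices_def)
  have "(\<Sum>xs\<in>leaf_choices \<delta> B j. of_nat (fact (card B - length xs)) * g (length xs))
      = (\<Sum>t=1..\<delta> j. \<Sum>xs\<in>{xs\<in>leaf_choices \<delta> B j. length xs = t}. of_nat (fact (card B - length xs)) * g (length xs))"
  proof (rule sum.group[symmetric])
    show "length ` leaf_choices \<delta> B j \<subseteq> {1..\<delta> j}" by (auto simp: leaf_choices_def Suc_le_eq)
  qed (use finite_leaf_choices[OF B] in auto)
  also have "\<dots> = (\<Sum>t=1..\<delta> j. of_nat (fact (card B)) * g t)"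
  proof (rule sum.cong[OF refl])
    fix t assume t: "t \<in> {1..\<delta> j}"
    have "(\<Sum>xs\<in>{xs\<in>leaf_choices \<delta> B j. length xs = t}. of_nat (fact (card B - length xs)) * g (length xs))
        = of_nat (card {xs. length xs = t \<and> distinct xs \<and> set xs \<subseteq> B} * fact (card B - t)) * g t"
      unfolding eq[OF t] by (simp add: mult_ac)
    also have "card {xs. length xs = t \<and> distinct xs \<and> set xs \<subseteq> B} * fact (card B - t) = fact (card B)"
      by (rule card_lists_fact[OF B]) (use t le in auto)
    finally show "(\<Sum>xs\<in>{xs\<in>leaf_choices \<delta> B j. length xs = t}. of_nat (fact (card B - length xs)) * g (length xs))
        = of_nat (fact (card B)) * g t" .
  qed
  finally show ?thesis by (simp add: sum_distrib_left)
qed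

text \<open>The source map is a bijection of A0. So the number of anchors whose source has label j
  is the number of points with label j, wherever the leaf stands in the list.\<close>

lemma card_fibre_permutes:
  assumes "p permutes A0" "finite A0"
  shows "(\<Sum>v\<in>A0. g (c (inv' p v))) = (\<Sum>v\<in>A0. g (c v) :: 'b::comm_monoid_add)"
  by (rule sum.reindex_bij_betw[OF permutes_imp_bij[OF permutes_inv[OF assms(1)]], of "\<lambda>v. g (c v)"])

text \<open>The binomial coefficient places the leaves among the factors, the factorial distributes
  the new points, and \<open>leaf_coeff\<close> accounts for anchors and sizes. Splitting off the
  first item yields Pascal's rule.\<close>

lemma sum_leaf_patterns:
  fixes A0 :: "'a set"
  assumes A0: "finite A0" "c ` A0 \<subseteq> {..<m}"
    and "\<And>s. s \<in> set ss \<Longrightarrow> is_cyc A0 s" "finite B" "B \<inter> A0 = {}" "card B = (\<Sum>j<m. \<delta> j)"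
  shows "finite (leaf_patterns A0 c m ss B \<delta> n) \<and>
    (\<Sum>its\<in>leaf_patterns A0 c m ss B \<delta> n. leaf_weight its)
      = of_nat (fact (card B) * ((length ss + n) choose n)) *
        leaf_coeff m (\<lambda>j. card {x\<in>A0. c x = j}) n \<delta>"
  using assms(3-)
proof (induction "length ss + n" arbitrary: ss n B \<delta> rule: less_induct)
  case less
  let ?e = "\<lambda>j. card {x\<in>A0. c x = j}"
  have B0: "B = {} \<longleftrightarrow> (\<forall>j<m. \<delta> j = 0)" using less.prems(2,4) by (metis card_eq_0_iff lessThan_iff finite_lessThan sum_eq_0_iff)
  have lw: "leaf_weight (map Core ss) = 1" for ss :: "('a \<Rightarrow> 'a) list" by (induction ss) auto
  show ?case
  proof (cases n)
    case 0
    then show ?thesis using leaf_patterns_0[of ss A0 c m B \<delta>] less.prems(1) B0 by (auto simp: lw)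
  next
    case (Suc k)
    define lab where "lab = (\<lambda>v. c (inv' (prodl ss) v))"
    have p: "prodl ss permutes A0" using less.prems(1) is_cyc_permutes by (intro prodl_permutes) blast
    have lab: "lab v < m" if "v \<in> A0" for v
      using permutes_in_image[OF permutes_inv[OF p]] that A0(2) by (auto simp: lab_def)
    define R1 where "R1 = (case ss of [] \<Rightarrow> {} | s # ss' \<Rightarrow> (#) (Core s) ` leaf_patterns A0 c m ss' B \<delta> n)"
    define P where "P v xs = leaf_patterns A0 c m ss (B - set xs) (\<delta>(lab v := \<delta> (lab v) - length xs)) k" for v xs
    define R2 where "R2 = (\<Union>v\<in>A0. \<Union>xs\<in>leaf_choices \<delta> B (lab v). (#) (Leaf v xs) ` P v xs)"
    have L: "leaf_patterns A0 c m ss B \<delta> n = R1 \<union> R2"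
      unfolding R1_def R2_def P_def Suc lab_def
      by (rule leaf_patterns_Suc[OF less.prems(1,3) A0(2)])
    have disj: "R1 \<inter> R2 = {}" by (auto simp: R1_def R2_def split: list.splits)
    have inj: "inj_on ((#) i) X" for i :: "'a item" and X by (rule inj_onI) simp
    have 1: "finite R1 \<and> sum leaf_weight R1 =
        of_nat (fact (card B) * ((length ss + k) choose n)) * leaf_coeff m ?e n \<delta>"
    proof (cases ss)
      \<comment> \<open>Without factors R1 is empty, and k over k + 1 is indeed 0.\<close>
      case Nil
      then show ?thesis by (simp add: R1_def Suc)
    next
      case (Cons s ss')
      have "finite (leaf_patterns A0 c m ss' B \<delta> n) \<and>
          (\<Sum>its\<in>leaf_patterns A0 c m ss' B \<delta> n. leaf_weight its)
          = of_nat (fact (card B) * ((length ss' + n) choose n)) * leaf_coeff m ?e n \<delta>"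
        by (rule less.hyps) (use less.prems Cons in auto)
      moreover have "sum leaf_weight R1 = (\<Sum>its\<in>leaf_patterns A0 c m ss' B \<delta> n. leaf_weight its)"
        unfolding R1_def Cons by (simp add: sum.reindex[OF inj])
      ultimately show ?thesis by (simp add: R1_def Cons Suc)
    qed
    have IH: "finite (P v xs) \<and> (\<Sum>its\<in>P v xs. leaf_weight its)
        = of_nat (fact (card B - length xs) * ((length ss + k) choose k)) *
          leaf_coeff m ?e k (\<delta>(lab v := \<delta> (lab v) - length xs))"
      if "v \<in> A0" "xs \<in> leaf_choices \<delta> B (lab v)" for v xs
    proof -
      have xs: "xs \<noteq> []" "distinct xs" "set xs \<subseteq> B" "length xs \<le> \<delta> (lab v)"
        using that(2) by (auto simp: leaf_choices_def)
      have cardB: "card (B - set xs) = card B - length xs"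
        using xs less.prems(2) by (simp add: card_Diff_subset distinct_card)
      have "card (B - set xs) = (\<Sum>j<m. (\<delta>(lab v := \<delta> (lab v) - length xs)) j)"
        using sum_fun_upd_less[of "lab v" m "length xs" \<delta>] lab[OF that(1)] xs(1,4) less.prems(4) cardB
        by (simp add: Suc_le_eq)
      then show ?thesis unfolding P_def cardB[symmetric]
        using less.prems Suc by (intro less.hyps) auto
    qed
    have fin2: "finite R2"
      unfolding R2_def using A0(1) IH finite_leaf_choices[OF less.prems(2)] by blast
    have "sum leaf_weight R2 = (\<Sum>v\<in>A0. \<Sum>xs\<in>leaf_choices \<delta> B (lab v). \<Sum>its\<in>P v xs. leaf_weight (Leaf v xs # its))"
    proof -
      have "sum leaf_weight R2 = (\<Sum>v\<in>A0. sum leaf_weight (\<Union>xs\<in>leaf_choices \<delta> B (lab v). (#) (Leaf v xs) ` P v xs))"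
        unfolding R2_def using A0(1) IH finite_leaf_choices[OF less.prems(2)]
        by (intro sum.UNION_disjoint) auto
      also have "\<dots> = (\<Sum>v\<in>A0. \<Sum>xs\<in>leaf_choices \<delta> B (lab v). sum leaf_weight ((#) (Leaf v xs) ` P v xs))"
        using IH finite_leaf_choices[OF less.prems(2)]
        by (intro sum.cong refl sum.UNION_disjoint) auto
      finally show ?thesis by (simp add: sum.reindex[OF inj])
    qed
    also have "\<dots> = (\<Sum>v\<in>A0. \<Sum>xs\<in>leaf_choices \<delta> B (lab v). of_nat (fact (card B - length xs)) *
        (of_nat ((length ss + k) choose k) * (qvar (length xs + 1) *
          leaf_coeff m ?e k (\<delta>(lab v := \<delta> (lab v) - length xs)))))"
    proof (intro sum.cong refl)
      fix v xs assume vx: "v \<in> A0" "xs \<in> leaf_choices \<delta> B (lab v)"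
      have "(\<Sum>its\<in>P v xs. leaf_weight (Leaf v xs # its)) = qvar (length xs + 1) * (\<Sum>its\<in>P v xs. leaf_weight its)"
        by (simp add: sum_distrib_left)
      also have "(\<Sum>its\<in>P v xs. leaf_weight its)
          = of_nat (fact (card B - length xs) * ((length ss + k) choose k)) *
            leaf_coeff m ?e k (\<delta>(lab v := \<delta> (lab v) - length xs))"
        using IH[OF vx] by simp
      finally show "(\<Sum>its\<in>P v xs. leaf_weight (Leaf v xs # its)) = of_nat (fact (card B - length xs)) *
          (of_nat ((length ss + k) choose k) * (qvar (length xs + 1) *
            leaf_coeff m ?e k (\<delta>(lab v := \<delta> (lab v) - length xs))))"
        by (simp only: of_nat_mult mult_ac)
    qed
    also have "\<dots> = (\<Sum>v\<in>A0. of_nat (fact (card B)) * (\<Sum>t=1..\<delta> (lab v).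
        (of_nat ((length ss + k) choose k) * (qvar (t + 1) *
          leaf_coeff m ?e k (\<delta>(lab v := \<delta> (lab v) - t))))))"
    proof (intro sum.cong refl sum_leaf_choices less.prems(2))
      fix v assume "v \<in> A0"
      then show "\<delta> (lab v) \<le> card B" unfolding less.prems(4) using lab by (intro member_le_sum) auto
    qed
    also have "\<dots> = (\<Sum>v\<in>A0. of_nat (fact (card B)) * (\<Sum>t=1..\<delta> (c v).
        (of_nat ((length ss + k) choose k) * (qvar (t + 1) *
          leaf_coeff m ?e k (\<delta>(c v := \<delta> (c v) - t))))))"
      unfolding lab_def
      by (rule card_fibre_permutes[OF p A0(1), of "\<lambda>j. of_nat (fact (card B)) * (\<Sum>t=1..\<delta> j.
        (of_nat ((length ss + k) choose k) * (qvar (t + 1) * leaf_coeff m ?e k (\<delta>(j := \<delta> j - t)))))"])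
    also have "\<dots> = (\<Sum>j<m. \<Sum>v\<in>{v\<in>A0. c v = j}. of_nat (fact (card B)) * (\<Sum>t=1..\<delta> (c v).
        (of_nat ((length ss + k) choose k) * (qvar (t + 1) *
          leaf_coeff m ?e k (\<delta>(c v := \<delta> (c v) - t))))))"
      by (rule sum.group[symmetric]) (use A0 in auto)
    also have "\<dots> = of_nat (fact (card B) * ((length ss + k) choose k)) * leaf_coeff m ?e n \<delta>"
      unfolding Suc leaf_coeff.simps by (simp add: sum_distrib_left mult_ac del: leaf_coeff.simps)
    finally have 2: "sum leaf_weight R2 =
        of_nat (fact (card B) * ((length ss + k) choose k)) * leaf_coeff m ?e n \<delta>" .
    have "sum leaf_weight (R1 \<union> R2) = sum leaf_weight R1 + sum leaf_weight R2"
      using 1 fin2 disj by (intro sum.union_disjoint) auto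
    also have "\<dots> = of_nat (fact (card B) * (((length ss + k) choose n) + ((length ss + k) choose k))) * leaf_coeff m ?e n \<delta>"
      using 1 2 by (simp add: algebra_simps del: leaf_coeff.simps)
    also have "((length ss + k) choose n) + ((length ss + k) choose k) = (length ss + n) choose n"
      by (simp add: Suc)
    finally show ?thesis unfolding L using 1 fin2 by simp
  qed
qed

section \<open>The substitution, coefficientwise\<close>

definition weight_term :: "('a \<Rightarrow> 'a) list \<Rightarrow> qu_poly" where
  "weight_term ss = weight ss * uvar ^ length ss * ratc (1 / fact (length ss))"

text \<open>The coefficient of x^a in \<open>Psi m\<close>. There are n! / (a_1 ... a_m)
  permutations with labelled cycles of these lengths, so division by n! turns the number of labelled
  factorizations into H / (a_1 ... a_m).\<close>

definition psi :: "nat \<Rightarrow> (nat \<Rightarrow> nat) \<Rightarrow> qu_poly" where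
  "psi m a = ratc (1 / fact (\<Sum>j<m. a j)) * (\<Sum>(ss, c)\<in>FacS {1..\<Sum>j<m. a j} m a. weight_term ss)"

text \<open>The coefficient of x^a in \<open>Gamma m\<close>; here the division by n! forgets the
  names of the vertices.\<close>

definition gam :: "nat \<Rightarrow> (nat \<Rightarrow> nat) \<Rightarrow> qu_poly" where
  "gam m a = ratc (1 / fact (\<Sum>j<m. a j)) *
     (\<Sum>(ss, c)\<in>{(ss, c) \<in> FacS {1..\<Sum>j<m. a j} m a. leaf_positions ss = {}}. weight_term ss)"

text \<open>Each factor contributes at least 1 to the sum in the minimality equation, which bounds
  the number of factors.\<close>

lemma finite_Fac:
  assumes "finite A" shows "finite (Fac A m)"
proof -
  let ?S = "{ss. set ss \<subseteq> {s. s permutes A} \<and> length ss \<le> card A + m}"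
  have sub: "Fac A m \<subseteq> ?S \<times> (A \<rightarrow>\<^sub>E {..<m})"
  proof clarify
    fix ss c assume h: "(ss, c) \<in> Fac A m"
    have "length ts \<le> (\<Sum>s\<leftarrow>ts. csize s - 1)" if "set ts \<subseteq> set ss" for ts
      using that
    proof (induction ts)
      case (Cons t ts)
      then have "is_cyc A t" using h by (auto simp: Fac_def)
      then have "1 \<le> csize t - 1" using is_cyc_csize[of A t] by simp
      then show ?case using Cons by simp
    qed simp
    from this[of ss] have "length ss \<le> card A + m" using h by (auto simp: Fac_def)
    moreover have "set ss \<subseteq> {s. s permutes A}" using Fac_permutes(1)[OF h] by blast
    moreover have "c \<in> A \<rightarrow>\<^sub>E {..<m}"
      using h by (auto simp: Fac_def cycle_labelling_def PiE_def)
    ultimately show "ss \<in> ?S \<and> c \<in> (A \<rightarrow>\<^sub>E {..<m})" by simp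
  qed
  have "finite ?S" using finite_permutations[OF assms] by (intro finite_lists_length_le)
  moreover have "finite (A \<rightarrow>\<^sub>E {..<m})" using assms by (intro finite_PiE) auto
  ultimately show ?thesis by (intro finite_subset[OF sub] finite_cartesian_product)
qed

lemma finite_FacS: "finite A \<Longrightarrow> finite (FacS A m e)"
  by (rule finite_subset[OF _ finite_Fac]) (auto simp: FacS_def)

definition class_sizes :: "nat \<Rightarrow> 'a set \<Rightarrow> ('a \<Rightarrow> nat) \<Rightarrow> nat \<Rightarrow> nat" where
  "class_sizes m A c = restrict (\<lambda>j. card {x\<in>A. c x = j}) {..<m}"

lemma sum_class_sizes:
  fixes c :: "'a \<Rightarrow> nat"
  assumes "finite A" "c ` A \<subseteq> {..<m}"
  shows "(\<Sum>j<m. card {x\<in>A. c x = j}) = card A"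
proof -
  have "card A = (\<Sum>x\<in>A. 1)" by simp
  also have "\<dots> = (\<Sum>j<m. \<Sum>x\<in>{x\<in>A. c x = j}. 1)" by (rule sum.group[symmetric]) (use assms in auto)
  finally show ?thesis by simp
qed

lemma Fac_image: "(ss, c) \<in> Fac A m \<Longrightarrow> c ` A = {..<m}"
  by (simp add: Fac_def cycle_labelling_def)

lemma FacS_card:
  assumes "finite A" "(ss, c) \<in> FacS A m e" shows "(\<Sum>j<m. e j) = card A"
proof -
  have "(\<Sum>j<m. e j) = (\<Sum>j<m. card {x\<in>A. c x = j})" using assms(2) by (simp add: FacS_def)
  then show ?thesis using sum_class_sizes[OF assms(1), of c m] Fac_image[of ss c A m] assms(2)
    by (auto simp: FacS_def)
qed

lemma FacS_cong: "(\<And>j. j < m \<Longrightarrow> e j = e' j) \<Longrightarrow> FacS A m e = FacS A m e'"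
  by (auto simp: FacS_def)

lemma weight_term_conjugate: "bij g \<Longrightarrow> weight_term (map (conjugate g) ss) = weight_term ss"
  by (simp add: weight_term_def weight_def comp_def csize_conjugate)

lemma ratc_fact_cancel: "of_nat (fact n) * (ratc (1 / fact n) * x) = x"
proof -
  have "ratc (of_nat (fact n)) * ratc (1 / fact n) = 1" by (simp add: ratc_mult)
  then show ?thesis by (simp add: ratc_of_nat[symmetric] mult.assoc[symmetric] del: of_nat_fact)
qed

lemma sum_FacS_psi:
  fixes A :: "nat set"
  assumes "finite A"
  shows "(\<Sum>(ss, c)\<in>FacS A m e. weight_term ss) =
    (if card A = (\<Sum>j<m. e j) then of_nat (fact (card A)) * psi m e else 0)"
proof (cases "card A = (\<Sum>j<m. e j)")
  case True
  have "(\<Sum>(ss, c)\<in>FacS A m e. weight_term ss) = (\<Sum>(ss, c)\<in>FacS {1..card A} m e. weight_term ss)"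
    by (rule sum_FacS_cong) (use assms weight_term_conjugate in auto)
  then show ?thesis using True unfolding psi_def
    by (simp add: ratc_fact_cancel del: of_nat_fact)
next
  case False
  then have "FacS A m e = {}" using FacS_card[OF assms] by fastforce
  then show ?thesis using False by simp
qed

definition leaf_sets :: "'a set \<Rightarrow> nat \<Rightarrow> (nat \<Rightarrow> nat) \<Rightarrow> 'a set \<Rightarrow> ('a \<Rightarrow> 'a) list \<times> ('a \<Rightarrow> nat) \<Rightarrow> 'a item list set" where
  "leaf_sets A m a A0 x = {its. cores its = fst x \<and> wf_items A0 its \<and> set (newpts its) = A - A0 \<and>
     (\<forall>j<m. card {y\<in>A0. snd x y = j} + leaf_content (snd x) its j = a j)}"

text \<open>Exchange of summation: a factorization with marked leaves is given by the set A0 of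
  points that are kept, a labelled factorization on A0, and the leaves attached to it.\<close>

lemma reorganize_leaves:
  fixes A :: "'a set" and h :: "'a item list \<Rightarrow> 'b::comm_monoid_add"
  assumes A: "finite A"
  shows "(\<Sum>(x, its)\<in>Sigma (FacS A m a) (\<lambda>x. items_of A (fst x)). h its) =
    (\<Sum>(A0, x, its)\<in>Sigma (Pow A) (\<lambda>A0. Sigma (Fac A0 m) (leaf_sets A m a A0)). h its)"
proof (rule sum.reindex_bij_witness[where
      i = "\<lambda>(A0, (ss0, c0), its). ((map item_perm its, extend_labels c0 its), its)" and
      j = "\<lambda>((ss, c), its). (A - set (newpts its), (cores its, restrict c (A - set (newpts its))), its)"])
  fix y assume "y \<in> Sigma (FacS A m a) (\<lambda>x. items_of A (fst x))"
  then obtain ss c its where y: "y = ((ss, c), its)" "(ss, c) \<in> FacS A m a" "its \<in> items_of A ss" by auto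
  define A0 where "A0 = A - set (newpts its)"
  have its: "map item_perm its = ss" "set (newpts its) \<subseteq> A" "wf_items A0 its"
    using y(3) by (auto simp: items_of_def A0_def)
  have A0: "A0 \<union> set (newpts its) = A" "A0 \<subseteq> A" "finite A0" using its(2) A by (auto simp: A0_def)
  have F: "(cores its, restrict c A0) \<in> Fac A0 m" "c \<in> extensional A" "leaf_labels c its"
    using Fac_items_iff[OF A0(3) its(3), of c m] y(2) unfolding A0(1) its(1) by (auto simp: FacS_def)
  then have c: "extend_labels (restrict c A0) its = c"
    using leaf_labels_iff_extend[OF its(3), of c] unfolding A0(1) by simp
  show "(\<lambda>(A0, (ss0, c0), its). ((map item_perm its, extend_labels c0 its), its))
      ((\<lambda>((ss, c), its). (A - set (newpts its), (cores its, restrict c (A - set (newpts its))), its)) y) = y"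
    using c its(1) by (simp add: y(1) A0_def)
  have "card {x\<in>A0. restrict c A0 x = j} + leaf_content (restrict c A0) its j = a j" if "j < m" for j
    using card_extend_labels[OF A0(3) its(3), of "restrict c A0" j] y(2) that
    unfolding A0(1) c by (auto simp: FacS_def)
  then have "its \<in> leaf_sets A m a A0 (cores its, restrict c A0)"
    using its A0 by (auto simp: leaf_sets_def A0_def)
  then show "(\<lambda>((ss, c), its). (A - set (newpts its), (cores its, restrict c (A - set (newpts its))), its)) y
      \<in> Sigma (Pow A) (\<lambda>A0. Sigma (Fac A0 m) (leaf_sets A m a A0))"
    using F(1) A0 by (simp add: y(1) A0_def)
  show "(case (\<lambda>((ss, c), its). (A - set (newpts its), (cores its, restrict c (A - set (newpts its))), its)) y of
      (A0, x, its) \<Rightarrow> h its) = (case y of (x, its) \<Rightarrow> h its)"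
    by (simp add: y(1))
next
  fix y assume "y \<in> Sigma (Pow A) (\<lambda>A0. Sigma (Fac A0 m) (leaf_sets A m a A0))"
  then obtain A0 ss0 c0 its where y: "y = (A0, (ss0, c0), its)" "A0 \<subseteq> A" "(ss0, c0) \<in> Fac A0 m"
    "its \<in> leaf_sets A m a A0 (ss0, c0)" by auto
  have its: "cores its = ss0" "wf_items A0 its" "set (newpts its) = A - A0"
    "\<And>j. j < m \<Longrightarrow> card {x\<in>A0. c0 x = j} + leaf_content c0 its j = a j"
    using y(4) by (auto simp: leaf_sets_def)
  have A0: "A0 \<union> set (newpts its) = A" "A - set (newpts its) = A0" "finite A0"
    using its(3) y(2) A finite_subset by auto
  have c0: "c0 \<in> extensional A0" by (rule Fac_extensional[OF y(3)])
  have exten: "extend_labels c0 its \<in> extensional (A0 \<union> set (newpts its))"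
    by (rule extend_labels_extensional[OF c0])
  have "restrict (extend_labels c0 its) A0 x = c0 x" for x
  proof (cases "x \<in> A0")
    case True
    then show ?thesis using extend_labels_other[of x its c0] its(3) by simp
  qed (use c0 in \<open>simp add: extensional_arb[of c0 A0]\<close>)
  then have r: "restrict (extend_labels c0 its) A0 = c0" by (rule ext)
  then have ll: "leaf_labels (extend_labels c0 its) its"
    using leaf_labels_iff_extend[OF its(2) exten] by simp
  have "(map item_perm its, extend_labels c0 its) \<in> Fac A m"
    using Fac_items_iff[OF A0(3) its(2), of "extend_labels c0 its" m] r ll exten y(3) its(1)
    unfolding A0(1) by simp
  moreover have "card {x\<in>A. extend_labels c0 its x = j} = a j" if "j < m" for j
    using card_extend_labels[OF A0(3) its(2), of c0 j] its(4)[OF that] unfolding A0(1) by simp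
  ultimately have "(map item_perm its, extend_labels c0 its) \<in> FacS A m a" by (simp add: FacS_def)
  moreover have "its \<in> items_of A (map item_perm its)"
    using its A0 by (auto simp: items_of_def)
  ultimately show "(\<lambda>(A0, (ss0, c0), its). ((map item_perm its, extend_labels c0 its), its)) y
      \<in> Sigma (FacS A m a) (\<lambda>x. items_of A (fst x))"
    by (simp add: y(1))
  show "(\<lambda>((ss, c), its). (A - set (newpts its), (cores its, restrict c (A - set (newpts its))), its))
      ((\<lambda>(A0, (ss0, c0), its). ((map item_perm its, extend_labels c0 its), its)) y) = y"
    using A0(2) r its(1) by (simp add: y(1))
qed

text \<open>The number of ways to place n leaves among r factors splits the weight 1/(r + n)! into
  one for the core and one for the leaves.\<close>

lemma ratc_binomial:
  "ratc (1 / fact (r + n)) * of_nat ((r + n) choose n) = ratc (1 / fact r) * ratc (1 / fact n)"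
proof -
  have "of_nat ((r + n) choose n) = (fact (r + n) / (fact n * fact r) :: rat)"
    using binomial_fact[of n "r + n", where 'a = rat] by simp
  then have "1 / fact (r + n) * of_nat ((r + n) choose n) = (1 / fact r * (1 / fact n) :: rat)"
    by (simp add: field_simps)
  then show ?thesis by (simp only: ratc_of_nat[symmetric] ratc_mult)
qed

lemma length_items: "length its = length (cores its) + num_leaves its"
  by (induction its rule: cores.induct) auto

lemma num_leaves_le: "wf_items A0 its \<Longrightarrow> num_leaves its \<le> length (newpts its)"
proof (induction its rule: cores.induct)
  case (3 v xs its)
  then have "xs \<noteq> []" "wf_items A0 its" by (simp_all add: wf_items_Cons)
  then show ?case using 3 by (cases xs) auto
qed (auto simp: wf_items_Cons)

lemma finite_leaf_sets:
  fixes A :: "'a set"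
  assumes "finite A" "A0 \<subseteq> A" "(ss0, c0) \<in> Fac A0 m"
  shows "finite (leaf_sets A m a A0 (ss0, c0))"
proof (rule finite_subset)
  let ?I = "Core ` set ss0 \<union> (\<Union>v\<in>A. Leaf v ` {xs. set xs \<subseteq> A \<and> length xs \<le> card A})"
  show "leaf_sets A m a A0 (ss0, c0) \<subseteq> {its. set its \<subseteq> ?I \<and> length its \<le> length ss0 + card A}"
  proof clarify
    fix its assume "its \<in> leaf_sets A m a A0 (ss0, c0)"
    then have its: "cores its = ss0" "wf_items A0 its" "set (newpts its) \<subseteq> A" by (auto simp: leaf_sets_def)
    have d: "distinct (newpts its)" using its(2) by (simp add: wf_items_def)
    then have le: "length (newpts its) \<le> card A"
      using card_mono[OF assms(1) its(3)] by (simp add: distinct_card)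
    have "i \<in> ?I" if i: "i \<in> set its" for i
    proof (cases i)
      case (Core s)
      then show ?thesis using i Core_in_cores its(1) by auto
    next
      case (Leaf v xs)
      then have "Leaf v xs \<in> set its" using i by simp
      then have "set xs \<subseteq> A" "v \<in> A0" "distinct xs"
        using Leaf_newpts[of v xs its] its by (auto simp: wf_items_def dest!: split_list)
      then have "length xs \<le> card A" using card_mono[OF assms(1), of "set xs"] by (simp add: distinct_card)
      then show ?thesis using \<open>set xs \<subseteq> A\<close> \<open>v \<in> A0\<close> assms(2) Leaf by auto
    qed
    then have "set its \<subseteq> ?I" by (rule subsetI)
    moreover have "length its \<le> length ss0 + card A"
      using length_items[of its] num_leaves_le[OF its(2)] le its(1) by simp
    ultimately show "set its \<subseteq> ?I \<and> length its \<le> length ss0 + card A" ..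
  qed
  have "finite ?I" using assms(1) finite_lists_length_le[OF assms(1)] by auto
  then show "finite {its. set its \<subseteq> ?I \<and> length its \<le> length ss0 + card A}"
    by (rule finite_lists_length_le)
qed

text \<open>The cycles of the core contribute independently. A cycle with e points and final length
  a gives the coefficient of x^a in (x exp(-uQ))^e, where x^e stands for the points already present.
  If some cycle would have to shrink, both sides vanish.\<close>

lemma sum_leaf_sets:
  fixes A :: "'a set"
  assumes A: "finite A" "A0 \<subseteq> A" and x: "(ss0, c0) \<in> Fac A0 m" and a: "(\<Sum>j<m. a j) = card A"
  shows "(\<Sum>its\<in>leaf_sets A m a A0 (ss0, c0). (-1) ^ num_leaves its * weight_term (map item_perm its))
    = weight_term ss0 * of_nat (fact (card A - card A0)) *
      (\<Prod>j<m. fps_nth ((fps_X * Vser) ^ card {y\<in>A0. c0 y = j}) (a j))"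
proof -
  define e where "e j = card {y\<in>A0. c0 y = j}" for j
  have A0: "finite A0" using A finite_subset by blast
  have c0: "c0 ` A0 \<subseteq> {..<m}" using Fac_image[OF x] by simp
  have sume: "(\<Sum>j<m. e j) = card A0" unfolding e_def by (rule sum_class_sizes[OF A0 c0])
  have cyc: "is_cyc A0 s" if "s \<in> set ss0" for s using x that by (auto simp: Fac_def)
  have XV: "fps_nth ((fps_X * Vser) ^ k) n = (if k \<le> n then fps_nth (Vser ^ k) (n - k) else 0)" for k n
    by (auto simp: power_mult_distrib fps_X_power_mult_nth not_le)
  show ?thesis
  proof (cases "\<forall>j<m. e j \<le> a j")
    case False
    then obtain j where j: "j < m" "a j < e j" by (auto simp: not_le)
    then have "leaf_sets A m a A0 (ss0, c0) = {}" by (auto simp: leaf_sets_def e_def)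
    moreover have "(\<Prod>j<m. fps_nth ((fps_X * Vser) ^ e j) (a j)) = 0"
    proof (rule prod_zero)
      show "\<exists>j\<in>{..<m}. fps_nth ((fps_X * Vser) ^ e j) (a j) = 0"
        using j by (intro bexI[of _ j]) (auto simp: XV)
    qed simp
    ultimately show ?thesis by (simp add: e_def)
  next
    case True
    define \<delta> where "\<delta> j = a j - e j" for j
    define B where "B = A - A0"
    have B: "finite B" "B \<inter> A0 = {}" "card B = card A - card A0"
      using A A0 by (auto simp: B_def card_Diff_subset)
    have "(\<Sum>j<m. \<delta> j) + (\<Sum>j<m. e j) = (\<Sum>j<m. a j)"
      using True by (simp add: \<delta>_def sum.distrib[symmetric])
    then have cardB: "card B = (\<Sum>j<m. \<delta> j)" using sume a B(3) by simp
    define P where "P n = leaf_patterns A0 c0 m ss0 B \<delta> n" for n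
    have P: "finite (P n)" "(\<Sum>its\<in>P n. leaf_weight its)
        = of_nat (fact (card B) * ((length ss0 + n) choose n)) * leaf_coeff m e n \<delta>" for n
      using sum_leaf_patterns[OF A0 c0, of ss0 B \<delta> n] cyc B(1,2) cardB unfolding P_def e_def by auto
    \<comment> \<open>Every leaf uses a new point, so there are at most \<open>card B\<close>
      leaves.\<close>
    have W: "leaf_sets A m a A0 (ss0, c0) = (\<Union>n\<in>{..card B}. P n)"
    proof -
      have "(e j + leaf_content c0 its j = a j) = (leaf_content c0 its j = \<delta> j)" if "j < m" for j its
        using True that by (auto simp: \<delta>_def)
      moreover have "num_leaves its \<le> card B" if "wf_items A0 its" "set (newpts its) = B" for its
        using num_leaves_le[OF that(1)] that distinct_card[of "newpts its"] by (simp add: wf_items_def)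
      ultimately show ?thesis by (auto simp: leaf_sets_def P_def leaf_patterns_def B_def e_def)
    qed
    have "(\<Sum>its\<in>leaf_sets A m a A0 (ss0, c0). (-1) ^ num_leaves its * weight_term (map item_perm its))
        = (\<Sum>n\<le>card B. \<Sum>its\<in>P n. (-1) ^ num_leaves its * weight_term (map item_perm its))"
      unfolding W by (rule sum.UNION_disjoint) (use P(1) in \<open>auto simp: P_def leaf_patterns_def\<close>)
    also have "\<dots> = (\<Sum>n\<le>card B. weight_term ss0 * of_nat (fact (card B)) *
        ((- uvar) ^ n * ratc (1 / fact n) * leaf_coeff m e n \<delta>))"
    proof (rule sum.cong[OF refl])
      fix n
      have "(\<Sum>its\<in>P n. (-1) ^ num_leaves its * weight_term (map item_perm its))
          = (\<Sum>its\<in>P n. ((-1) ^ n * weight ss0 * uvar ^ (length ss0 + n) * ratc (1 / fact (length ss0 + n))) * leaf_weight its)"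
      proof (rule sum.cong[OF refl])
        fix its assume "its \<in> P n"
        then have its: "cores its = ss0" "wf_items A0 its" "num_leaves its = n"
          by (auto simp: P_def leaf_patterns_def)
        then show "(-1) ^ num_leaves its * weight_term (map item_perm its) =
          ((-1) ^ n * weight ss0 * uvar ^ (length ss0 + n) * ratc (1 / fact (length ss0 + n))) * leaf_weight its"
          using weight_items[OF its(2)] length_items[of its]
          by (simp add: weight_term_def mult_ac)
      qed
      also have "\<dots> = ((-1) ^ n * weight ss0 * uvar ^ (length ss0 + n) * ratc (1 / fact (length ss0 + n))) *
          (of_nat (fact (card B) * ((length ss0 + n) choose n)) * leaf_coeff m e n \<delta>)"
        by (simp only: sum_distrib_left[symmetric] P(2))
      also have "\<dots> = ((-1) ^ n * uvar ^ n) * weight ss0 * uvar ^ length ss0 * of_nat (fact (card B)) *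
          (ratc (1 / fact (length ss0 + n)) * of_nat ((length ss0 + n) choose n)) * leaf_coeff m e n \<delta>"
        by (simp only: of_nat_mult power_add mult_ac)
      also have "\<dots> = weight_term ss0 * of_nat (fact (card B)) * ((- uvar) ^ n * ratc (1 / fact n) * leaf_coeff m e n \<delta>)"
        unfolding ratc_binomial weight_term_def power_minus[of uvar] by (simp only: mult_ac)
      finally show "(\<Sum>its\<in>P n. (-1) ^ num_leaves its * weight_term (map item_perm its)) = \<dots>" .
    qed
    also have "\<dots> = weight_term ss0 * of_nat (fact (card B)) * (\<Prod>j<m. fps_nth (Vser ^ e j) (\<delta> j))"
      using leaf_coeff_exp[of \<delta> m "card B" e] cardB by (simp only: sum_distrib_left[symmetric])
    also have "(\<Prod>j<m. fps_nth (Vser ^ e j) (\<delta> j)) = (\<Prod>j<m. fps_nth ((fps_X * Vser) ^ e j) (a j))"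
      using True by (intro prod.cong) (auto simp: XV \<delta>_def)
    finally show ?thesis by (simp add: B(3) e_def)
  qed
qed

text \<open>Extensional functions list every exponent vector below a exactly once.\<close>

definition exponents :: "nat \<Rightarrow> (nat \<Rightarrow> nat) \<Rightarrow> (nat \<Rightarrow> nat) set" where
  "exponents m a = Pi\<^sub>E {..<m} (\<lambda>j. {..a j})"

lemma finite_exponents: "finite (exponents m a)"
  unfolding exponents_def by (intro finite_PiE) auto

lemma XV_nth_eq_0: "a < e \<Longrightarrow> fps_nth ((fps_X * Vser) ^ e) a = 0"
  by (simp add: power_mult_distrib fps_X_power_mult_nth)

lemma prod_XV_eq_0:
  assumes "e \<in> extensional {..<m}" "e \<notin> exponents m a"
  shows "(\<Prod>j<m. fps_nth ((fps_X * Vser) ^ e j) (a j)) = 0"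
proof -
  obtain j where j: "j < m" "a j < e j"
    using assms by (auto simp: exponents_def PiE_def Pi_def not_le)
  show ?thesis
  proof (rule prod_zero)
    show "\<exists>j\<in>{..<m}. fps_nth ((fps_X * Vser) ^ e j) (a j) = 0"
      using j XV_nth_eq_0 by (intro bexI[of _ j]) auto
  qed simp
qed

text \<open>The choice of the k core points among the n points turns k! (n - k)! into n!, which
  matches the divisions by factorials in \<open>psi\<close> and \<open>gam\<close>.\<close>

lemma sum_subsets_fact:
  assumes "finite A" "k \<le> card A"
  shows "(\<Sum>A0\<in>{A0\<in>Pow A. card A0 = k}. of_nat (fact (card A - card A0)) * of_nat (fact (card A0)))
       = (of_nat (fact (card A)) :: qu_poly)"
proof -
  have "(\<Sum>A0\<in>{A0\<in>Pow A. card A0 = k}. of_nat (fact (card A - card A0)) * of_nat (fact (card A0)))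
      = (\<Sum>A0\<in>{A0\<in>Pow A. card A0 = k}. of_nat (fact (card A - k) * fact k) :: qu_poly)"
    by (rule sum.cong) auto
  also have "\<dots> = of_nat ((card A choose k) * (fact (card A - k) * fact k))"
    using n_subsets[OF assms(1), of k] by (simp add: Pow_def conj_commute mult_ac)
  also have "(card A choose k) * (fact (card A - k) * fact k) = fact (card A)"
    using binomial_fact_lemma[OF assms(2)] by (simp add: mult_ac)
  finally show ?thesis .
qed

text \<open>In terms of series, the smooth series arises from the full one by substituting x_j
  exp(-uQ(x_j)) for each x_j; this is its coefficient at x^a, to which only exponents e <= a
  contribute.\<close>

theorem gam_eq_psi:
  assumes m: "2 \<le> m"
  shows "gam m a = (\<Sum>e\<in>exponents m a. psi m e * (\<Prod>j<m. fps_nth ((fps_X * Vser) ^ e j) (a j)))"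
proof -
  define n where "n = (\<Sum>j<m. a j)"
  define A where "A = {1..n}"
  have A: "finite A" "card A = n" by (auto simp: A_def)
  let ?D = "\<lambda>e. \<Prod>j<m. fps_nth ((fps_X * Vser) ^ e j) (a j)"
  have "(\<Sum>(ss, c)\<in>{(ss, c) \<in> FacS A m a. leaf_positions ss = {}}. weight_term ss)
      = (\<Sum>(ss, c)\<in>FacS A m a. (if leaf_positions ss = {} then 1 else 0) * weight_term ss)"
    using finite_FacS[OF A(1)] by (intro sum.mono_neutral_cong_left) (auto split: if_splits)
  also have "\<dots> = (\<Sum>x\<in>FacS A m a. \<Sum>its\<in>items_of A (fst x). (-1) ^ num_leaves its * weight_term (map item_perm its))"
  proof (rule sum.cong[OF refl])
    fix x assume "x \<in> FacS A m a"
    then obtain ss c where x: "x = (ss, c)" "(ss, c) \<in> Fac A m" by (auto simp: FacS_def)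
    have "(\<Sum>its\<in>items_of A ss. (-1) ^ num_leaves its * weight_term (map item_perm its))
        = (\<Sum>its\<in>items_of A ss. (-1) ^ num_leaves its) * weight_term ss"
      unfolding sum_distrib_right by (rule sum.cong) (auto simp: items_of_def)
    also have "\<dots> = (if leaf_positions ss = {} then 1 else 0) * weight_term ss"
      by (simp only: sum_items_of_sign[OF A(1) x(2) m])
    finally show "(case x of (ss, c) \<Rightarrow> (if leaf_positions ss = {} then 1 else 0) * weight_term ss)
        = (\<Sum>its\<in>items_of A (fst x). (-1) ^ num_leaves its * weight_term (map item_perm its))"
      by (simp add: x(1))
  qed
  also have "\<dots> = (\<Sum>(x, its)\<in>Sigma (FacS A m a) (\<lambda>x. items_of A (fst x)). (-1) ^ num_leaves its * weight_term (map item_perm its))"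
  proof (rule sum.Sigma)
    show "\<forall>x\<in>FacS A m a. finite (items_of A (fst x))"
      using finite_items_of[OF A(1) _ m] by (auto simp: FacS_def)
  qed (rule finite_FacS[OF A(1)])
  also have "\<dots> = (\<Sum>(A0, x, its)\<in>Sigma (Pow A) (\<lambda>A0. Sigma (Fac A0 m) (leaf_sets A m a A0)).
      (-1) ^ num_leaves its * weight_term (map item_perm its))"
    by (rule reorganize_leaves[OF A(1)])
  also have "\<dots> = (\<Sum>A0\<in>Pow A. \<Sum>x\<in>Fac A0 m. \<Sum>its\<in>leaf_sets A m a A0 x. (-1) ^ num_leaves its * weight_term (map item_perm its))"
  proof -
    have fin: "finite (Fac A0 m)" if "A0 \<in> Pow A" for A0
      using that finite_subset[OF _ A(1)] finite_Fac by blast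
    have finl: "finite (leaf_sets A m a A0 x)" if "A0 \<in> Pow A" "x \<in> Fac A0 m" for A0 x
      using finite_leaf_sets[of A A0 "fst x" "snd x" m] that A(1) by auto
    show ?thesis
      by (subst sum.Sigma[symmetric]) (use A(1) fin finl in \<open>auto simp: sum.Sigma intro!: sum.cong\<close>)
  qed
  also have "\<dots> = (\<Sum>A0\<in>Pow A. \<Sum>(ss0, c0)\<in>Fac A0 m. weight_term ss0 * of_nat (fact (n - card A0)) * ?D (class_sizes m A0 c0))"
  proof (intro sum.cong refl)
    fix A0 x assume A0: "A0 \<in> Pow A" and x: "x \<in> Fac A0 m"
    obtain ss0 c0 where x': "x = (ss0, c0)" by fastforce
    have "(\<Prod>j<m. fps_nth ((fps_X * Vser) ^ card {y\<in>A0. c0 y = j}) (a j)) = ?D (class_sizes m A0 c0)"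
      by (rule prod.cong) (auto simp: class_sizes_def)
    then show "(\<Sum>its\<in>leaf_sets A m a A0 x. (-1) ^ num_leaves its * weight_term (map item_perm its))
        = (case x of (ss0, c0) \<Rightarrow> weight_term ss0 * of_nat (fact (n - card A0)) * ?D (class_sizes m A0 c0))"
      using sum_leaf_sets[OF A(1) _ x[unfolded x'], of a] A0 A(2) by (simp add: x' n_def)
  qed
  also have "\<dots> = (\<Sum>A0\<in>Pow A. \<Sum>e\<in>exponents m a. of_nat (fact (n - card A0)) * ?D e *
      (if card A0 = (\<Sum>j<m. e j) then of_nat (fact (card A0)) * psi m e else 0))"
  proof (intro sum.cong refl)
    fix A0 assume "A0 \<in> Pow A"
    then have A0: "finite A0" using finite_subset[OF _ A(1)] by blast
    let ?h = "\<lambda>(ss0, c0). weight_term ss0 * of_nat (fact (n - card A0)) * ?D (class_sizes m A0 c0)"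
    let ?F = "{(ss0, c0)\<in>Fac A0 m. class_sizes m A0 c0 \<in> exponents m a}"
    \<comment> \<open>Cores with a cycle longer than its final length have weight 0, so the sizes
      may be confined to the finite box.\<close>
    have "sum ?h (Fac A0 m) = sum ?h ?F"
    proof (rule sum.mono_neutral_right)
      show "\<forall>x\<in>Fac A0 m - ?F. ?h x = 0"
      proof
        fix x assume "x \<in> Fac A0 m - ?F"
        then obtain ss0 c0 where x: "x = (ss0, c0)" "class_sizes m A0 c0 \<notin> exponents m a" by auto
        have "class_sizes m A0 c0 \<in> extensional {..<m}" by (simp add: class_sizes_def)
        then have "?D (class_sizes m A0 c0) = 0" using x(2) by (rule prod_XV_eq_0)
        then show "?h x = 0" by (simp add: x(1))
      qed
    qed (use finite_Fac[OF A0] in auto)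
    also have "\<dots> = (\<Sum>e\<in>exponents m a. sum ?h {x\<in>?F. class_sizes m A0 (snd x) = e})"
      by (rule sum.group[symmetric]) (use finite_Fac[OF A0] finite_exponents in \<open>auto simp: case_prod_unfold\<close>)
    also have "\<dots> = (\<Sum>e\<in>exponents m a. of_nat (fact (n - card A0)) * ?D e *
      (if card A0 = (\<Sum>j<m. e j) then of_nat (fact (card A0)) * psi m e else 0))"
    proof (rule sum.cong[OF refl])
      fix e assume e: "e \<in> exponents m a"
      then have ext: "e \<in> extensional {..<m}" by (auto simp: exponents_def PiE_def)
      have iff: "class_sizes m A0 c0 = e \<longleftrightarrow> (\<forall>j<m. card {x\<in>A0. c0 x = j} = e j)" for c0
        using extensionalityI[OF _ ext, of "class_sizes m A0 c0"] by (auto simp: class_sizes_def)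
      have "{x\<in>?F. class_sizes m A0 (snd x) = e} = FacS A0 m e"
      proof -
        have "{x\<in>?F. class_sizes m A0 (snd x) = e} = {x\<in>Fac A0 m. class_sizes m A0 (snd x) = e}"
          using e by auto
        then show ?thesis by (auto simp: FacS_def iff)
      qed
      then have "sum ?h {x\<in>?F. class_sizes m A0 (snd x) = e}
          = (\<Sum>(ss0, c0)\<in>FacS A0 m e. of_nat (fact (n - card A0)) * ?D e * weight_term ss0)"
      proof (rule sum.cong)
        fix x assume "x \<in> FacS A0 m e"
        then obtain ss0 c0 where "x = (ss0, c0)" "class_sizes m A0 c0 = e"
          using iff by (auto simp: FacS_def)
        then show "?h x = (case x of (ss0, c0) \<Rightarrow> of_nat (fact (n - card A0)) * ?D e * weight_term ss0)"
          by (simp add: mult_ac)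
      qed
      also have "\<dots> = of_nat (fact (n - card A0)) * ?D e * (\<Sum>(ss0, c0)\<in>FacS A0 m e. weight_term ss0)"
        unfolding sum_distrib_left by (rule sum.cong) auto
      finally show "sum ?h {x\<in>?F. class_sizes m A0 (snd x) = e} = of_nat (fact (n - card A0)) * ?D e *
          (if card A0 = (\<Sum>j<m. e j) then of_nat (fact (card A0)) * psi m e else 0)"
        unfolding sum_FacS_psi[OF A0] .
    qed
    finally show "sum ?h (Fac A0 m) = (\<Sum>e\<in>exponents m a. of_nat (fact (n - card A0)) * ?D e *
      (if card A0 = (\<Sum>j<m. e j) then of_nat (fact (card A0)) * psi m e else 0))" .
  qed
  also have "\<dots> = (\<Sum>e\<in>exponents m a. of_nat (fact n) * (psi m e * ?D e))"
  proof (subst sum.swap, rule sum.cong[OF refl])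
    fix e assume e: "e \<in> exponents m a"
    let ?k = "\<Sum>j<m. e j"
    have "?k \<le> card A" unfolding A(2) n_def using e by (intro sum_mono) (auto simp: exponents_def PiE_def Pi_def)
    have "(\<Sum>A0\<in>Pow A. of_nat (fact (n - card A0)) * ?D e * (if card A0 = ?k then of_nat (fact (card A0)) * psi m e else 0))
        = (\<Sum>A0\<in>{A0\<in>Pow A. card A0 = ?k}. (of_nat (fact (card A - card A0)) * of_nat (fact (card A0))) * (psi m e * ?D e))"
      using A by (intro sum.mono_neutral_cong_right) (auto simp: mult_ac)
    also have "\<dots> = of_nat (fact n) * (psi m e * ?D e)"
      using sum_subsets_fact[OF A(1) \<open>?k \<le> card A\<close>] by (simp only: sum_distrib_right[symmetric] A(2))
    finally show "(\<Sum>A0\<in>Pow A. of_nat (fact (n - card A0)) * ?D e * (if card A0 = ?k then of_nat (fact (card A0)) * psi m e else 0))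
        = of_nat (fact n) * (psi m e * ?D e)" .
  qed
  also have "\<dots> = of_nat (fact n) * (\<Sum>e\<in>exponents m a. psi m e * ?D e)" by (rule sum_distrib_left[symmetric])
  finally have "(\<Sum>(ss, c)\<in>{(ss, c) \<in> FacS A m a. leaf_positions ss = {}}. weight_term ss) = \<dots>" .
  then have "gam m a = ratc (1 / fact n) * (of_nat (fact n) * (\<Sum>e\<in>exponents m a. psi m e * ?D e))"
    unfolding gam_def n_def[symmetric] A_def[symmetric] by simp
  also have "\<dots> = (\<Sum>e\<in>exponents m a. psi m e * ?D e)"
    using ratc_fact_cancel[of n] by (simp only: mult.left_commute)
  finally show ?thesis .
qed

text \<open>Substituting w undoes the previous substitution: once the sums are exchanged, the inner
  one is a product over j of entries of mutually inverse matrices, a Kronecker delta.\<close>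

theorem psi_eq_gam:
  assumes m: "2 \<le> m"
  shows "(\<Sum>a\<in>exponents m b. gam m a * (\<Prod>j<m. fps_nth (wser ^ a j) (b j))) = psi m b"
proof -
  let ?D = "\<lambda>e a. \<Prod>j<m. fps_nth ((fps_X * Vser) ^ e j) (a j)"
  let ?W = "\<lambda>a. \<Prod>j<m. fps_nth (wser ^ a j) (b j)"
  have "gam m a = (\<Sum>e\<in>exponents m b. psi m e * ?D e a)" if a: "a \<in> exponents m b" for a
  proof -
    have "a j \<le> b j" if "j < m" for j using a that by (auto simp: exponents_def PiE_def Pi_def)
    then have "exponents m a \<subseteq> exponents m b"
      unfolding exponents_def by (intro PiE_mono) auto
    then show ?thesis unfolding gam_eq_psi[OF m]
      by (intro sum.mono_neutral_left finite_exponents)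
        (auto intro!: prod_XV_eq_0[simplified] simp: exponents_def PiE_def)
  qed
  then have "(\<Sum>a\<in>exponents m b. gam m a * ?W a)
      = (\<Sum>a\<in>exponents m b. \<Sum>e\<in>exponents m b. psi m e * (?D e a * ?W a))"
    by (intro sum.cong) (simp_all add: sum_distrib_right mult.assoc)
  also have "\<dots> = (\<Sum>e\<in>exponents m b. psi m e * (\<Sum>a\<in>exponents m b. ?D e a * ?W a))"
    by (subst sum.swap) (simp add: sum_distrib_left)
  also have "\<dots> = (\<Sum>e\<in>exponents m b. psi m e * (\<Prod>j<m. if b j = e j then 1 else 0))"
  proof (intro sum.cong refl arg_cong2[of _ _ _ _ "(*)"])
    fix e
    have "(\<Sum>a\<in>exponents m b. ?D e a * ?W a)
        = (\<Prod>j<m. \<Sum>k\<le>b j. fps_nth ((fps_X * Vser) ^ e j) k * fps_nth (wser ^ k) (b j))"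
      unfolding exponents_def by (subst prod_sum_PiE) (simp_all add: prod.distrib)
    then show "(\<Sum>a\<in>exponents m b. ?D e a * ?W a) = (\<Prod>j<m. if b j = e j then 1 else 0)"
      by (simp only: wser_power_inverts)
  qed
  \<comment> \<open>b may take any values from m on, whereas members of the box are extensional; the
    surviving index is the restriction of b.\<close>
  also have "\<dots> = (\<Sum>e\<in>exponents m b. if e = restrict b {..<m} then psi m e else 0)"
  proof (intro sum.cong refl)
    fix e assume "e \<in> exponents m b"
    then have ext: "e \<in> extensional {..<m}" by (auto simp: exponents_def PiE_def)
    show "psi m e * (\<Prod>j<m. if b j = e j then 1 else 0) = (if e = restrict b {..<m} then psi m e else 0)"
    proof (cases "\<forall>j<m. b j = e j")
      case True
      then have "e = restrict b {..<m}" by (intro extensionalityI[OF ext]) auto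
      then show ?thesis using True by simp
    next
      case False
      then have "e \<noteq> restrict b {..<m}" by auto
      moreover have "(\<Prod>j<m. if b j = e j then 1 else (0 :: qu_poly)) = 0"
        using False by (intro prod_zero) auto
      ultimately show ?thesis by simp
    qed
  qed
  also have "\<dots> = psi m (restrict b {..<m})"
    by (subst sum.delta[OF finite_exponents]) (auto simp: exponents_def)
  also have "\<dots> = psi m b"
  proof -
    have "(\<Sum>j<m. restrict b {..<m} j) = (\<Sum>j<m. b j)" by (rule sum.cong) auto
    moreover have "FacS A m (restrict b {..<m}) = FacS A m b" for A :: "nat set"
      by (rule FacS_cong) simp
    ultimately show ?thesis by (simp only: psi_def)
  qed
  finally show ?thesis .
qed

section \<open>Coefficients of products and substitutions in several variables\<close>

lemma mcoeff_mult: "mcoeff (f * g) e = (\<Sum>(a, b)\<in>antidiag e. mcoeff f a * mcoeff g b)"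
  by (simp add: times_mpser_def)

lemma mcoeff_0 [simp]: "mcoeff 0 e = 0"
  by (simp add: zero_mpser_def)

lemma mcoeff_1: "mcoeff 1 e = (if e = 0 then 1 else 0)"
  by (simp add: one_mpser_def)

lemma mcoeff_mconst_mult: "mcoeff (mconst c * f) e = c * mcoeff f e"
proof -
  have "mcoeff (mconst c * f) e = (\<Sum>p\<in>antidiag e. if p = (0, e) then c * mcoeff f e else 0)"
    unfolding mcoeff_mult by (rule sum.cong) (auto simp: mconst_def antidiag_def split: if_splits)
  also have "\<dots> = c * mcoeff f e"
    by (subst sum.delta[OF finite_antidiag]) (auto simp: antidiag_def)
  finally show ?thesis .
qed

text \<open>The univariate series f in the variable x_j. Variables, their powers and the series
  substituted for them all have this form, which reduces products to coefficients in one
  variable.\<close>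

definition uni :: "nat \<Rightarrow> 'a::comm_ring_1 fps \<Rightarrow> 'a mpser" where
  "uni j f = Abs_mpser (\<lambda>e. if Poly_Mapping.keys e \<subseteq> {j} then fps_nth f (Poly_Mapping.lookup e j) else 0)"

lemma mcoeff_uni:
  "mcoeff (uni j f) e = (if Poly_Mapping.keys e \<subseteq> {j} then fps_nth f (Poly_Mapping.lookup e j) else 0)"
  by (simp add: uni_def)

lemma keys_subset_single_iff:
  fixes e :: "nat \<Rightarrow>\<^sub>0 nat"
  shows "Poly_Mapping.keys e \<subseteq> {j} \<longleftrightarrow> e = Poly_Mapping.single j (Poly_Mapping.lookup e j)"
proof
  assume h: "Poly_Mapping.keys e \<subseteq> {j}"
  show "e = Poly_Mapping.single j (Poly_Mapping.lookup e j)"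
  proof (rule poly_mapping_eqI)
    fix i show "Poly_Mapping.lookup e i = Poly_Mapping.lookup (Poly_Mapping.single j (Poly_Mapping.lookup e j)) i"
      using h by (cases "i = j") (auto simp: lookup_single in_keys_iff subset_iff)
  qed
next
  assume "e = Poly_Mapping.single j (Poly_Mapping.lookup e j)"
  then show "Poly_Mapping.keys e \<subseteq> {j}" by (metis keys_single empty_subsetI order_refl)
qed

lemma keys_add_nat: "Poly_Mapping.keys (a + b) = Poly_Mapping.keys a \<union> Poly_Mapping.keys (b :: nat \<Rightarrow>\<^sub>0 nat)"
  by (auto simp: in_keys_iff lookup_add)

lemma uni_mult: "uni j f * uni j g = uni j (f * g)"
proof (rule mpser_eqI)
  fix e :: "nat \<Rightarrow>\<^sub>0 nat"
  show "mcoeff (uni j f * uni j g) e = mcoeff (uni j (f * g)) e"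
  proof (cases "Poly_Mapping.keys e \<subseteq> {j}")
    case True
    define n where "n = Poly_Mapping.lookup e j"
    have e: "e = Poly_Mapping.single j n" using True by (simp add: keys_subset_single_iff n_def)
    have "mcoeff (uni j f * uni j g) e = (\<Sum>(a, b)\<in>antidiag e. fps_nth f (Poly_Mapping.lookup a j) * fps_nth g (Poly_Mapping.lookup b j))"
      unfolding mcoeff_mult
    proof (rule sum.cong[OF refl])
      fix p assume "p \<in> antidiag e"
      then obtain a b where p: "p = (a, b)" "a + b = e" by (auto simp: antidiag_def)
      then have "Poly_Mapping.keys a \<subseteq> {j}" "Poly_Mapping.keys b \<subseteq> {j}"
        using True keys_add_nat[of a b] by auto
      then show "(case p of (a, b) \<Rightarrow> mcoeff (uni j f) a * mcoeff (uni j g) b)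
          = (case p of (a, b) \<Rightarrow> fps_nth f (Poly_Mapping.lookup a j) * fps_nth g (Poly_Mapping.lookup b j))"
        by (simp add: p mcoeff_uni)
    qed
    also have "\<dots> = (\<Sum>i=0..n. fps_nth f i * fps_nth g (n - i))"
    proof (rule sum.reindex_bij_witness[where
          i = "\<lambda>i. (Poly_Mapping.single j i, Poly_Mapping.single j (n - i))" and
          j = "\<lambda>(a, b). Poly_Mapping.lookup a j"])
      fix p assume "p \<in> antidiag e"
      then obtain a b where p: "p = (a, b)" "a + b = e" by (auto simp: antidiag_def)
      then have "Poly_Mapping.keys a \<subseteq> {j}" "Poly_Mapping.keys b \<subseteq> {j}"
        using True keys_add_nat[of a b] by auto
      then have ab: "a = Poly_Mapping.single j (Poly_Mapping.lookup a j)" "b = Poly_Mapping.single j (Poly_Mapping.lookup b j)"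
        by (simp_all only: keys_subset_single_iff[symmetric])
      have n: "n = Poly_Mapping.lookup a j + Poly_Mapping.lookup b j"
        by (simp add: n_def p(2)[symmetric] lookup_add)
      show "(\<lambda>i. (Poly_Mapping.single j i, Poly_Mapping.single j (n - i))) ((\<lambda>(a, b). Poly_Mapping.lookup a j) p) = p"
        using ab n by (simp add: p(1))
      show "(\<lambda>(a, b). Poly_Mapping.lookup a j) p \<in> {0..n}" using n by (simp add: p(1))
      show "fps_nth f ((\<lambda>(a, b). Poly_Mapping.lookup a j) p) * fps_nth g (n - (\<lambda>(a, b). Poly_Mapping.lookup a j) p)
          = (case p of (a, b) \<Rightarrow> fps_nth f (Poly_Mapping.lookup a j) * fps_nth g (Poly_Mapping.lookup b j))"
        using n by (simp add: p(1))
    next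
      fix i assume "i \<in> {0..n}"
      then show "(Poly_Mapping.single j i, Poly_Mapping.single j (n - i)) \<in> antidiag e"
        by (simp add: antidiag_def e single_add[symmetric])
    qed simp
    finally show ?thesis using True by (simp add: mcoeff_uni fps_mult_nth n_def)
  next
    case False
    have "mcoeff (uni j f) a * mcoeff (uni j g) b = 0" if "a + b = e" for a b
      using False that keys_add_nat[of a b] by (auto simp: mcoeff_uni)
    then have "mcoeff (uni j f * uni j g) e = 0"
      unfolding mcoeff_mult by (intro sum.neutral) (auto simp: antidiag_def)
    then show ?thesis using False by (simp add: mcoeff_uni)
  qed
qed

lemma uni_1: "uni j 1 = 1"
proof (rule mpser_eqI)
  fix e :: "nat \<Rightarrow>\<^sub>0 nat"
  show "mcoeff (uni j 1) e = mcoeff 1 e"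
  proof (cases "Poly_Mapping.keys e \<subseteq> {j}")
    case True
    then have e: "e = Poly_Mapping.single j (Poly_Mapping.lookup e j)" by (simp add: keys_subset_single_iff)
    have "e = 0 \<longleftrightarrow> Poly_Mapping.lookup e j = 0" by (metis e lookup_zero single_zero)
    then show ?thesis using True by (simp add: mcoeff_uni mcoeff_1 fps_one_def)
  next
    case False
    then have "e \<noteq> 0" by auto
    then show ?thesis using False by (simp add: mcoeff_uni mcoeff_1)
  qed
qed

lemma uni_power: "uni j f ^ k = uni j (f ^ k)"
  by (induction k) (simp_all add: uni_1 uni_mult)

lemma mvar_eq_uni: "mvar j = uni j fps_X"
proof (rule mpser_eqI)
  fix e :: "nat \<Rightarrow>\<^sub>0 nat"
  have "Poly_Mapping.keys e \<subseteq> {j} \<and> Poly_Mapping.lookup e j = 1 \<longleftrightarrow> e = Poly_Mapping.single j 1"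
    unfolding keys_subset_single_iff by (metis lookup_single_eq)
  then show "mcoeff (mvar j) e = mcoeff (uni j fps_X) e"
    by (auto simp: mvar_def mcoeff_uni fps_X_def)
qed

lemma fps_subst_mvar: "fps_subst f (mvar j) = uni j f"
proof (rule mpser_eqI)
  fix e :: "nat \<Rightarrow>\<^sub>0 nat"
  let ?g = "\<lambda>k. mcoeff (mconst (fps_nth f k) * mvar j ^ k) e"
  have g: "?g k = (if Poly_Mapping.keys e \<subseteq> {j} \<and> Poly_Mapping.lookup e j = k then fps_nth f k else 0)" for k
    by (simp add: mcoeff_mconst_mult mvar_eq_uni uni_power mcoeff_uni fps_X_power_nth)
  have "mcoeff (fps_subst f (mvar j)) e = (\<Sum>k\<in>{k. ?g k \<noteq> 0}. ?g k)"
    by (simp add: fps_subst_def msum_def)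
  also have "\<dots> = (\<Sum>k\<in>{Poly_Mapping.lookup e j}. ?g k)"
    by (rule sum.mono_neutral_left) (auto simp: g split: if_splits)
  also have "\<dots> = mcoeff (uni j f) e" by (simp add: g mcoeff_uni)
  finally show "mcoeff (fps_subst f (mvar j)) e = mcoeff (uni j f) e" .
qed

text \<open>An exponent vector splits in only one way over distinct variables, so the convolution
  has a single nonzero term.\<close>

lemma mcoeff_prod_uni:
  assumes "finite J"
  shows "mcoeff (\<Prod>j\<in>J. uni j (f j)) e =
    (if Poly_Mapping.keys e \<subseteq> J then \<Prod>j\<in>J. fps_nth (f j) (Poly_Mapping.lookup e j) else 0)"
  using assms
proof (induction J arbitrary: e rule: finite_induct)
  case empty
  have "Poly_Mapping.keys e = {} \<longleftrightarrow> e = 0" by (metis keys_eq_empty)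
  then show ?case by (simp add: mcoeff_1)
next
  case (insert i J)
  let ?P = "\<Prod>j\<in>J. uni j (f j)"
  have split: "mcoeff (uni i (f i)) a * mcoeff ?P b =
      (if Poly_Mapping.keys a \<subseteq> {i} \<and> Poly_Mapping.keys b \<subseteq> J
       then fps_nth (f i) (Poly_Mapping.lookup a i) * (\<Prod>j\<in>J. fps_nth (f j) (Poly_Mapping.lookup b j)) else 0)" for a b
    by (simp add: mcoeff_uni insert.IH)
  show ?case
  proof (cases "Poly_Mapping.keys e \<subseteq> insert i J")
    case False
    have "mcoeff (uni i (f i)) a * mcoeff ?P b = 0" if "a + b = e" for a b
      unfolding split using False that keys_add_nat[of a b] by auto
    then have "mcoeff (uni i (f i) * ?P) e = 0"
      unfolding mcoeff_mult by (intro sum.neutral) (auto simp: antidiag_def)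
    then show ?thesis using False insert.hyps by simp
  next
    case True
    define a0 where "a0 = Poly_Mapping.single i (Poly_Mapping.lookup e i)"
    define b0 where "b0 = e - a0"
    have lb: "Poly_Mapping.lookup b0 j = (if j = i then 0 else Poly_Mapping.lookup e j)" for j
      by (simp add: b0_def a0_def lookup_minus lookup_single)
    have ab: "a0 + b0 = e"
      by (rule poly_mapping_eqI) (simp add: lookup_add lb a0_def lookup_single)
    have ka: "Poly_Mapping.keys a0 \<subseteq> {i}" by (simp add: a0_def)
    have kb: "Poly_Mapping.keys b0 \<subseteq> J"
      using True by (auto simp: in_keys_iff lb subset_iff split: if_splits)
    have uniq: "p = (a0, b0)" if p: "p \<in> antidiag e" "Poly_Mapping.keys (fst p) \<subseteq> {i}" "Poly_Mapping.keys (snd p) \<subseteq> J" for p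
    proof -
      obtain a b where p': "p = (a, b)" "a + b = e" using p(1) by (auto simp: antidiag_def)
      have "Poly_Mapping.lookup b i = 0" using p(3) insert.hyps(2) p'(1) by (auto simp: in_keys_iff)
      then have "Poly_Mapping.lookup a i = Poly_Mapping.lookup e i" by (simp add: p'(2)[symmetric] lookup_add)
      then have "a = a0" using p(2) p'(1) unfolding keys_subset_single_iff a0_def by simp
      then show ?thesis using p' ab by auto
    qed
    have "mcoeff (uni i (f i) * ?P) e = (\<Sum>p\<in>antidiag e. if p = (a0, b0) then mcoeff (uni i (f i)) a0 * mcoeff ?P b0 else 0)"
      unfolding mcoeff_mult
    proof (rule sum.cong[OF refl])
      fix p assume p: "p \<in> antidiag e"
      show "(case p of (a, b) \<Rightarrow> mcoeff (uni i (f i)) a * mcoeff ?P b)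
          = (if p = (a0, b0) then mcoeff (uni i (f i)) a0 * mcoeff ?P b0 else 0)"
      proof (cases "p = (a0, b0)")
        case False
        obtain a b where ab': "p = (a, b)" by fastforce
        then have "\<not> (Poly_Mapping.keys a \<subseteq> {i} \<and> Poly_Mapping.keys b \<subseteq> J)"
          using uniq[OF p] False by auto
        then show ?thesis using False unfolding ab' case_prod_conv split by (simp only: if_False)
      qed simp
    qed
    also have "\<dots> = mcoeff (uni i (f i)) a0 * mcoeff ?P b0"
      by (subst sum.delta[OF finite_antidiag]) (use ab in \<open>auto simp: antidiag_def\<close>)
    also have "\<dots> = fps_nth (f i) (Poly_Mapping.lookup e i) * (\<Prod>j\<in>J. fps_nth (f j) (Poly_Mapping.lookup e j))"
    proof -
      have "(\<Prod>j\<in>J. fps_nth (f j) (Poly_Mapping.lookup b0 j)) = (\<Prod>j\<in>J. fps_nth (f j) (Poly_Mapping.lookup e j))"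
        using insert.hyps(2) by (intro prod.cong) (auto simp: lb)
      then show ?thesis using ka kb by (simp add: split a0_def)
    qed
    finally show ?thesis using True insert.hyps by simp
  qed
qed

lemma fps_power_nth_less:
  assumes "fps_nth w 0 = (0 :: 'a::comm_ring_1)" "n < k" shows "fps_nth (w ^ k) n = 0"
  using assms by (rule startsby_zero_power_prefix[rule_format])

definition of_exponent :: "nat \<Rightarrow> (nat \<Rightarrow> nat) \<Rightarrow> nat \<Rightarrow>\<^sub>0 nat" where
  "of_exponent m a = Poly_Mapping.Abs_poly_mapping (\<lambda>j. if j < m then a j else 0)"

lemma lookup_of_exponent: "Poly_Mapping.lookup (of_exponent m a) j = (if j < m then a j else 0)"
proof -
  have "finite {j. (if j < m then a j else 0) \<noteq> 0}" by (rule finite_subset[of _ "{..<m}"]) (auto split: if_splits)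
  then show ?thesis unfolding of_exponent_def by (simp add: Abs_poly_mapping_inverse)
qed

text \<open>As w has no constant term, w^k has no coefficient below degree k. So only the finitely
  many exponents bounded by b contribute, and the formal sum in \<open>msubst\<close> is an honest
  one.\<close>

lemma mcoeff_msubst_uni:
  fixes F :: "'a::comm_ring_1 mpser"
  assumes F: "\<And>e. \<not> Poly_Mapping.keys e \<subseteq> {..<m} \<Longrightarrow> mcoeff F e = 0"
    and w: "fps_nth w 0 = 0"
  shows "mcoeff (msubst F (\<lambda>j. uni j w)) b = (if Poly_Mapping.keys b \<subseteq> {..<m}
    then \<Sum>a\<in>exponents m (Poly_Mapping.lookup b). mcoeff F (of_exponent m a) *
           (\<Prod>j<m. fps_nth (w ^ a j) (Poly_Mapping.lookup b j)) else 0)"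
proof -
  let ?g = "\<lambda>e. mcoeff (mconst (mcoeff F e) * (\<Prod>j\<in>Poly_Mapping.keys e. uni j w ^ Poly_Mapping.lookup e j)) b"
  have g: "?g e = mcoeff F e * (if Poly_Mapping.keys b \<subseteq> {..<m}
      then \<Prod>j<m. fps_nth (w ^ Poly_Mapping.lookup e j) (Poly_Mapping.lookup b j) else 0)" for e
  proof (cases "Poly_Mapping.keys e \<subseteq> {..<m}")
    case True
    have "(\<Prod>j\<in>Poly_Mapping.keys e. uni j w ^ Poly_Mapping.lookup e j) = (\<Prod>j<m. uni j (w ^ Poly_Mapping.lookup e j))"
      unfolding uni_power using True
      by (intro prod.mono_neutral_left) (auto simp: in_keys_iff uni_1)
    then show ?thesis by (simp only: mcoeff_mconst_mult mcoeff_prod_uni[OF finite_lessThan])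
  qed (simp add: F mcoeff_mconst_mult)
  have coeff: "mcoeff (msubst F (\<lambda>j. uni j w)) b = (\<Sum>e\<in>{e. ?g e \<noteq> 0}. ?g e)"
    by (simp add: msubst_def msum_def)
  show ?thesis
  proof (cases "Poly_Mapping.keys b \<subseteq> {..<m}")
    case False
    then have "?g e = 0" for e by (simp only: g if_False mult_zero_right)
    then show ?thesis using False unfolding coeff by simp
  next
    case True
    let ?E = "of_exponent m ` exponents m (Poly_Mapping.lookup b)"
    have inj: "inj_on (of_exponent m) (exponents m (Poly_Mapping.lookup b))"
    proof (rule inj_onI)
      fix x y assume h: "x \<in> exponents m (Poly_Mapping.lookup b)" "y \<in> exponents m (Poly_Mapping.lookup b)"
        "of_exponent m x = of_exponent m y"
      have "x j = y j" if "j < m" for j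
        using arg_cong[OF h(3), of "\<lambda>e. Poly_Mapping.lookup e j"] that by (simp add: lookup_of_exponent)
      then show "x = y" using h(1,2) unfolding exponents_def by (intro PiE_ext) auto
    qed
    have fin: "finite (exponents m (Poly_Mapping.lookup b))" unfolding exponents_def by (intro finite_PiE) auto
    have "e \<in> ?E" if "?g e \<noteq> 0" for e
    proof -
      have ne: "mcoeff F e \<noteq> 0" "(\<Prod>j<m. fps_nth (w ^ Poly_Mapping.lookup e j) (Poly_Mapping.lookup b j)) \<noteq> 0"
        using that True by (auto simp only: g if_True mult_zero_left mult_zero_right)
      have k: "Poly_Mapping.keys e \<subseteq> {..<m}" using F ne(1) by blast
      have "Poly_Mapping.lookup e j \<le> Poly_Mapping.lookup b j" if "j < m" for j
      proof (rule ccontr)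
        assume "\<not> Poly_Mapping.lookup e j \<le> Poly_Mapping.lookup b j"
        then have "fps_nth (w ^ Poly_Mapping.lookup e j) (Poly_Mapping.lookup b j) = 0"
          by (intro fps_power_nth_less[OF w]) simp
        then show False using ne(2) that prod_zero[OF finite_lessThan, of m "\<lambda>j. fps_nth (w ^ Poly_Mapping.lookup e j) (Poly_Mapping.lookup b j)"] by blast
      qed
      then have "restrict (Poly_Mapping.lookup e) {..<m} \<in> exponents m (Poly_Mapping.lookup b)"
        by (auto simp: exponents_def)
      moreover have "of_exponent m (restrict (Poly_Mapping.lookup e) {..<m}) = e"
        using k by (intro poly_mapping_eqI) (auto simp: lookup_of_exponent in_keys_iff subset_iff not_less)
      ultimately show ?thesis by (metis imageI)
    qed
    then have "(\<Sum>e\<in>{e. ?g e \<noteq> 0}. ?g e) = (\<Sum>e\<in>?E. ?g e)"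
      using fin by (intro sum.mono_neutral_left) auto
    also have "\<dots> = (\<Sum>a\<in>exponents m (Poly_Mapping.lookup b). ?g (of_exponent m a))"
      by (simp only: sum.reindex[OF inj] comp_def)
    also have "\<dots> = (\<Sum>a\<in>exponents m (Poly_Mapping.lookup b). mcoeff F (of_exponent m a) *
           (\<Prod>j<m. fps_nth (w ^ a j) (Poly_Mapping.lookup b j)))"
      using True by (intro sum.cong refl) (simp only: g if_True, simp add: lookup_of_exponent)
    finally show ?thesis using True coeff by (simp only: if_True)
  qed
qed

lemma mcoeff_mvar_monomial:
  "mcoeff (mconst c * (\<Prod>j<m. mvar j ^ (\<alpha> ! j))) b =
     (if Poly_Mapping.keys b \<subseteq> {..<m} \<and> (\<forall>j<m. Poly_Mapping.lookup b j = \<alpha> ! j) then c else 0)"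
proof -
  have "mcoeff (mconst c * (\<Prod>j<m. mvar j ^ (\<alpha> ! j))) b =
      c * (if Poly_Mapping.keys b \<subseteq> {..<m} then \<Prod>j<m. fps_nth (fps_X ^ (\<alpha> ! j)) (Poly_Mapping.lookup b j) else 0)"
    by (simp only: mvar_eq_uni uni_power mcoeff_mconst_mult mcoeff_prod_uni[OF finite_lessThan])
  moreover have "(\<Prod>j<m. fps_nth (fps_X ^ (\<alpha> ! j)) (Poly_Mapping.lookup b j) :: 'a)
      = (if \<forall>j<m. Poly_Mapping.lookup b j = \<alpha> ! j then 1 else 0)"
  proof (cases "\<forall>j<m. Poly_Mapping.lookup b j = \<alpha> ! j")
    case False
    then obtain j where j: "j < m" "Poly_Mapping.lookup b j \<noteq> \<alpha> ! j" by blast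
    have "(\<Prod>j<m. fps_nth (fps_X ^ (\<alpha> ! j)) (Poly_Mapping.lookup b j) :: 'a) = 0"
      by (rule prod_zero) (use j in \<open>auto simp: fps_X_power_nth\<close>)
    then show ?thesis using False by simp
  qed (simp add: fps_X_power_nth)
  ultimately show ?thesis by auto
qed

section \<open>Factorizations of a fixed permutation\<close>

lemma is_k_cycle_iff: "k \<ge> 2 \<Longrightarrow> is_k_cycle n k s \<longleftrightarrow> is_cyc {1..n} s \<and> csize s = k"
  unfolding is_k_cycle_def is_cyc_def using csize_cycle_of_list by fastforce

lemma ex_is_k_cycle_iff: "(\<exists>k\<ge>2. is_k_cycle n k s) \<longleftrightarrow> is_cyc {1..n} s"
  using is_k_cycle_iff is_cyc_csize by blast

lemma num_cycles_eq: "num_cycles n p = num_orbits {1..n} p"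
  by (simp add: num_cycles_def num_orbits_def)

lemma num_orbits_is_cyc:
  assumes "finite A" "is_cyc A s" shows "num_orbits A s + csize s = card A + 1"
proof -
  have sA: "supp s \<subseteq> A" by (rule is_cyc_supp[OF assms(2)])
  have ne: "supp s \<noteq> {}" using is_cyc_csize[OF assms(2)] by (auto simp: csize_def)
  have 1: "orbit s x = {x}" if "x \<notin> supp s" for x
    using that orbit_eq_singleton_iff[of s x] by (simp add: supp_def)
  have "orbit s ` A = insert (supp s) ((\<lambda>x. {x}) ` (A - supp s))"
  proof -
    have "orbit s ` A = orbit s ` supp s \<union> orbit s ` (A - supp s)" using sA by blast
    moreover have "orbit s ` supp s = {supp s}" using is_cyc_orbit[OF assms(2)] ne by auto
    moreover have "orbit s ` (A - supp s) = (\<lambda>x. {x}) ` (A - supp s)" using 1 by (intro image_cong) auto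
    ultimately show ?thesis by simp
  qed
  moreover have "supp s \<notin> (\<lambda>x. {x}) ` (A - supp s)" by auto
  moreover have "card ((\<lambda>x. {x}) ` (A - supp s)) = card A - csize s"
    using sA assms(1) finite_subset[OF sA] by (simp add: card_image inj_on_def csize_def card_Diff_subset)
  moreover have "csize s \<le> card A" unfolding csize_def by (rule card_mono[OF assms(1) sA])
  ultimately show ?thesis using assms(1) by (simp add: num_orbits_def)
qed

text \<open>Serves to count cycles by their labels, and white faces by cycles.\<close>

lemma card_image_eq_iff:
  assumes "\<And>x y. x \<in> A \<Longrightarrow> y \<in> A \<Longrightarrow> f x = f y \<longleftrightarrow> g x = g y"
  shows "card (f ` A) = card (g ` A)"
proof (rule bij_betw_same_card)
  let ?h = "\<lambda>z. g (inv_into A f z)"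
  have h: "?h (f x) = g x" if "x \<in> A" for x
    using assms[of "inv_into A f (f x)" x] that by (simp add: inv_into_into f_inv_into_f)
  show "bij_betw ?h (f ` A) (g ` A)"
    unfolding bij_betw_def inj_on_def
  proof (intro conjI ballI impI)
    fix u v assume "u \<in> f ` A" "v \<in> f ` A" "?h u = ?h v"
    then show "u = v" using h assms by auto
  next
    have "?h ` f ` A = (\<lambda>x. ?h (f x)) ` A" by (rule image_image)
    also have "\<dots> = g ` A" by (rule image_cong) (simp_all add: h)
    finally show "?h ` f ` A = g ` A" .
  qed
qed

lemma num_orbits_labelling:
  assumes "cycle_labelling A m p c" "p permutes A" "finite A" shows "num_orbits A p = m"
proof -
  have "orbit p x = orbit p y \<longleftrightarrow> c x = c y" if "x \<in> A" "y \<in> A" for x y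
  proof -
    have "c x = c y \<longleftrightarrow> x \<in> orbit p y" by (rule cycle_labelling_orbit_iff[OF assms that(2,1)])
    also have "\<dots> \<longleftrightarrow> orbit p x = orbit p y"
      using orbit_eq_if_mem[OF assms(2,3)] self_in_orbit[OF assms(2,3)] by metis
    finally show ?thesis by simp
  qed
  then have "num_orbits A p = card (c ` A)" unfolding num_orbits_def by (rule card_image_eq_iff)
  then show ?thesis using assms(1) by (simp add: cycle_labelling_def)
qed

text \<open>An orbit of the generated group is invariant under the factors. Conversely a factor maps
  a finite invariant set onto itself, so that set is stable under inverses and thus under the
  group.\<close>

lemma transitive_iff_conn:
  assumes perm: "\<And>s. s \<in> set ss \<Longrightarrow> s permutes {1..n}"
  shows "(\<forall>a\<in>{1..n}. \<forall>b\<in>{1..n}. \<exists>g\<in>generate (sym_group n) (set ss). g a = b) \<longleftrightarrow> conn {1..n} ss"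
proof
  assume tr: "\<forall>a\<in>{1..n}. \<forall>b\<in>{1..n}. \<exists>g\<in>generate (sym_group n) (set ss). g a = b"
  show "conn {1..n} ss"
    unfolding conn_def
  proof (intro allI impI; elim conjE)
    fix S assume S: "S \<subseteq> {1..n}" "S \<noteq> {}" "\<forall>s\<in>set ss. s ` S \<subseteq> S"
    have fin: "finite S" using S(1) finite_subset by blast
    have im: "s ` S = S" if "s \<in> set ss" for s
    proof (rule card_subset_eq[OF fin])
      show "s ` S \<subseteq> S" using S(3) that by blast
      show "card (s ` S) = card S"
        using permutes_inj[OF perm[OF that]] by (intro card_image) (auto simp: inj_on_def dest: injD)
    qed
    have "g x \<in> S" if "g \<in> generate (sym_group n) (set ss)" "x \<in> S" for g x
      using that
    proof (induction arbitrary: x)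
      case one
      then show ?case by (simp add: sym_group_one)
    next
      case (incl h)
      then show ?case using im by blast
    next
      case (inv h)
      obtain y where y: "y \<in> S" "x = h y" using im[OF inv.hyps] inv.prems by blast
      have "m_inv (sym_group n) h = inv' h"
        using perm[OF inv.hyps] by (intro sym_group_inv_equality) (simp add: sym_group_carrier)
      then show ?case using y permutes_inverses(2)[OF perm[OF inv.hyps]] by simp
    next
      case (eng h1 h2)
      then show ?case by (simp add: sym_group_mult)
    qed
    note inS = this
    obtain x where x: "x \<in> S" using S(2) by blast
    have "{1..n} \<subseteq> S"
    proof
      fix b assume "b \<in> {1..n}"
      moreover have "x \<in> {1..n}" using x S(1) by (rule set_mp[rotated])
      ultimately obtain g where "g \<in> generate (sym_group n) (set ss)" "g x = b" using tr by metis
      then show "b \<in> S" using inS x by metis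
    qed
    then show "S = {1..n}" using S(1) by (intro equalityI)
  qed
next
  assume c: "conn {1..n} ss"
  show "\<forall>a\<in>{1..n}. \<forall>b\<in>{1..n}. \<exists>g\<in>generate (sym_group n) (set ss). g a = b"
  proof (intro ballI)
    fix a b assume ab: "a \<in> {1..n}" "b \<in> {1..n}"
    let ?G = "generate (sym_group n) (set ss)"
    define S where "S = {g a |g. g \<in> ?G}"
    have carr: "set ss \<subseteq> carrier (sym_group n)" using perm by (auto simp: sym_group_carrier)
    have G: "g permutes {1..n}" if "g \<in> ?G" for g
      using group.generate_in_carrier[OF sym_group_is_group carr that] by (simp add: sym_group_carrier)
    have "S = {1..n}"
    proof (rule connD[OF c])
      show "S \<subseteq> {1..n}" using permutes_in_image[OF G] ab(1) by (auto simp: S_def)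
      have "id \<in> ?G" using generate.one[of "sym_group n" "set ss"] by (simp add: sym_group_one)
      then have "id a \<in> S" unfolding S_def by blast
      then show "a \<in> S" by simp
      show "s ` S \<subseteq> S" if "s \<in> set ss" for s
      proof (rule image_subsetI)
        fix y assume "y \<in> S"
        then obtain g where g: "g \<in> ?G" "y = g a" by (auto simp: S_def)
        have "s \<otimes>\<^bsub>sym_group n\<^esub> g \<in> ?G" 
          by (rule generate.eng[OF generate.incl[OF that] g(1)])
        then have "s \<circ> g \<in> ?G" by (simp add: sym_group_mult)
        then have "(s \<circ> g) a \<in> S" unfolding S_def by blast
        then show "s y \<in> S" by (simp add: g(2))
      qed
    qed
    then have "b \<in> S" using ab(2) by simp
    then show "\<exists>g\<in>?G. g a = b" unfolding S_def by blast
  qed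
qed

text \<open>A factor contributes n minus its number of cycles to the minimality condition, which for
  a k-cycle is k - 1.\<close>

lemma Fac_iff_cycle_factorization:
  assumes c: "cycle_labelling {1..n} m p c"
  shows "(ss, c) \<in> Fac {1..n} m \<and> prodl ss = p \<longleftrightarrow> cycle_factorization n p ss"
proof (cases "(\<forall>s\<in>set ss. is_cyc {1..n} s) \<and> prodl ss = p")
  case False
  then show ?thesis
    unfolding cycle_factorization_def minimal_transitive_factorization_def transitive_factorization_def
      ex_is_k_cycle_iff prodl_def[symmetric] Fac_def mem_Collect_eq case_prod_conv by blast
next
  case True
  then have cyc: "is_cyc {1..n} s" if "s \<in> set ss" for s using that by blast
  have perm: "s permutes {1..n}" if "s \<in> set ss" for s by (rule is_cyc_permutes[OF cyc[OF that]])
  have p: "p permutes {1..n}" using True perm prodl_permutes by blast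
  have "int n * int (length ts) - (\<Sum>s\<leftarrow>ts. int (num_cycles n s)) = int (\<Sum>s\<leftarrow>ts. csize s - 1)"
    if "set ts \<subseteq> set ss" for ts
    using that
  proof (induction ts)
    case (Cons t ts)
    have "num_cycles n t + csize t = n + 1"
      using num_orbits_is_cyc[OF _ cyc[of t]] Cons.prems by (simp add: num_cycles_eq)
    moreover have "csize t \<ge> 2" using is_cyc_csize[OF cyc[of t]] Cons.prems by simp
    ultimately have "int (num_cycles n t) = int n - int (csize t - 1)" by simp
    then show ?case using Cons by (simp add: algebra_simps)
  qed simp
  from this[of ss] have len: "int n * int (length ss) - (\<Sum>s\<leftarrow>ss. int (num_cycles n s)) = int (\<Sum>s\<leftarrow>ss. csize s - 1)"
    by simp
  have "num_cycles n p = m" using num_orbits_labelling[OF c p] by (simp add: num_cycles_eq)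
  then have "minimal_transitive_factorization n p ss \<longleftrightarrow> conn {1..n} ss \<and> n + m = (\<Sum>s\<leftarrow>ss. csize s - 1) + 2"
  proof -
    have tr: "(\<forall>a\<in>{1..n}. \<forall>b\<in>{1..n}. \<exists>g\<in>generate (sym_group n) (set ss). g a = b) \<longleftrightarrow> conn {1..n} ss"
      by (rule transitive_iff_conn) (rule perm)
    have "int N = int n + int m - 2 \<longleftrightarrow> n + m = N + 2" for N by linarith
    then show ?thesis
      unfolding minimal_transitive_factorization_def transitive_factorization_def prodl_def[symmetric]
        tr len \<open>num_cycles n p = m\<close> using perm True by blast
  qed
  then show ?thesis using True c
    unfolding cycle_factorization_def ex_is_k_cycle_iff Fac_def mem_Collect_eq case_prod_conv by simp
qed

definition has_type :: "(nat \<Rightarrow>\<^sub>0 nat) \<Rightarrow> ('a \<Rightarrow> 'a) list \<Rightarrow> bool" where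
  "has_type i ss \<longleftrightarrow> (\<forall>k\<ge>2. length (filter (\<lambda>s. csize s = k) ss) = Poly_Mapping.lookup i k)"

lemma cycle_factorizations_eq:
  assumes c: "cycle_labelling {1..n} m p c"
  shows "cycle_factorizations n p i = {ss. (ss, c) \<in> Fac {1..n} m \<and> prodl ss = p \<and> has_type i ss}"
proof -
  have "(\<forall>k\<ge>2. length (filter (is_k_cycle n k) ss) = Poly_Mapping.lookup i k) \<longleftrightarrow> has_type i ss"
    if "cycle_factorization n p ss" for ss
  proof -
    have "filter (is_k_cycle n k) ss = filter (\<lambda>s. csize s = k) ss" if "k \<ge> 2" for k
      using \<open>cycle_factorization n p ss\<close> is_k_cycle_iff[OF that]
      by (intro filter_cong) (auto simp: cycle_factorization_def ex_is_k_cycle_iff)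
    then show ?thesis by (simp add: has_type_def)
  qed
  then show ?thesis
    unfolding cycle_factorizations_def using Fac_iff_cycle_factorization[OF c] by blast
qed

lemma has_type_conjugate: "bij g \<Longrightarrow> has_type i (map (conjugate g) ss) \<longleftrightarrow> has_type i ss"
  by (simp add: has_type_def filter_map comp_def csize_conjugate)

lemma labelling_step: "cycle_labelling A m p c \<Longrightarrow> x \<in> A \<Longrightarrow> c (p x) = c x"
  by (simp add: cycle_labelling_def)

text \<open>Base points on the labelled cycles remove all automorphisms: the symmetric group acts
  simply transitively on these triples, so that there are n! of them if there is any.\<close>

definition based_perms :: "'a set \<Rightarrow> nat \<Rightarrow> (nat \<Rightarrow> nat) \<Rightarrow> (('a \<Rightarrow> 'a) \<times> ('a \<Rightarrow> nat) \<times> (nat \<Rightarrow> 'a)) set" where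
  "based_perms A m a = {(p, c, x). p permutes A \<and> cycle_labelling A m p c \<and>
     (\<forall>j<m. card {y\<in>A. c y = j} = a j) \<and> x \<in> Pi\<^sub>E {..<m} (\<lambda>j. {y\<in>A. c y = j})}"

lemma funpow_eq_iff_mod:
  assumes p: "permutation p"
  shows "(p ^^ s) y = (p ^^ t) y \<longleftrightarrow> s mod card (orbit p y) = t mod card (orbit p y)"
proof -
  have l: "(p ^^ n) y = y \<longleftrightarrow> card (orbit p y) dvd n" for n
    using least_power_dvd[OF p] by (simp add: length_support_eq_card_orbit[OF p])
  have inj: "inj p" using permutation_bijective[OF p] bij_is_inj by blast
  have *: "(p ^^ s) y = (p ^^ t) y \<longleftrightarrow> s mod card (orbit p y) = t mod card (orbit p y)" if "s \<le> t" for s t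
  proof -
    have "(p ^^ t) y = (p ^^ s) ((p ^^ (t - s)) y)" using that by (simp add: funpow_add[symmetric, THEN fun_cong, simplified])
    then have "(p ^^ s) y = (p ^^ t) y \<longleftrightarrow> (p ^^ (t - s)) y = y"
      using inj_fn[OF inj, of s] by (metis injD)
    then show ?thesis using that l mod_eq_dvd_iff_nat[of s t] by metis
  qed
  show ?thesis using *[of s t] *[of t s] by (cases "s \<le> t") auto
qed

context
  fixes A :: "'a set" and m :: nat and a :: "nat \<Rightarrow> nat" and p0 c0 x0
  assumes A: "finite A" and b0: "(p0, c0, x0) \<in> based_perms A m a"
begin

private lemma based:
  assumes "(p, c, x) \<in> based_perms A m a"
  shows "p permutes A" "permutation p" "cycle_labelling A m p c" "j < m \<Longrightarrow> x j \<in> A \<and> c (x j) = j"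
    "j < m \<Longrightarrow> card (orbit p (x j)) = a j" "x \<in> extensional {..<m}" "c \<in> extensional A"
    "y \<in> A \<Longrightarrow> c y < m \<and> (\<exists>t. y = (p ^^ t) (x (c y)))"
proof -
  show p: "p permutes A" "cycle_labelling A m p c" using assms by (auto simp: based_perms_def)
  then show perm: "permutation p" using A permutation_permutes by blast
  show "c \<in> extensional A" using p(2) by (simp add: cycle_labelling_def)
  show x: "x j \<in> A \<and> c (x j) = j" if "j < m" for j using assms that by (auto simp: based_perms_def PiE_def Pi_def)
  show "x \<in> extensional {..<m}" using assms by (auto simp: based_perms_def PiE_def)
  have orb: "orbit p (x j) = {y\<in>A. c y = j}" if "j < m" for j
    using cycle_labelling_orbit_iff[OF p(2,1) A, of "x j"] x[OF that] permutes_orbit_subset[OF p(1), of "x j"] by auto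
  then show "card (orbit p (x j)) = a j" if "j < m" for j using assms that by (auto simp: based_perms_def)
  show "c y < m \<and> (\<exists>t. y = (p ^^ t) (x (c y)))" if y: "y \<in> A" for y
  proof -
    have "c y < m" using p(2) y by (auto simp: cycle_labelling_def)
    moreover have "y \<in> orbit p (x (c y))" using orb[OF calculation] y by simp
    ultimately show ?thesis using orbit_altdef_permutation[OF perm] by auto
  qed
qed

text \<open>Cycles with the same label have the same length, so iterates at the two base points
  coincide for the same pairs of exponents.\<close>

private lemma transfer_funpow:
  assumes "(p, c, x) \<in> based_perms A m a" "j < m"
  shows "(p ^^ s) (x j) = (p ^^ t) (x j) \<longleftrightarrow> (p0 ^^ s) (x0 j) = (p0 ^^ t) (x0 j)"
  using funpow_eq_iff_mod[OF based(2)[OF assms(1)], of s "x j" t] funpow_eq_iff_mod[OF based(2)[OF b0], of s "x0 j" t]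
    based(5)[OF assms] based(5)[OF b0 assms(2)] by simp

private definition "move g = (conjugate g p0, relabel g A c0, restrict (g \<circ> x0) {..<m})"

private lemma move_based:
  assumes g: "g permutes A" shows "move g \<in> based_perms A m a"
proof -
  have bij: "bij g" using g by (rule permutes_bij)
  have gA: "g ` A = A" using g by (rule permutes_image)
  have "conjugate g p0 permutes A"
    unfolding conjugate_def using g based(1)[OF b0] by (intro permutes_compose permutes_inv)
  moreover have "cycle_labelling A m (conjugate g p0) (relabel g A c0)"
    using cycle_labelling_conjugate[OF bij based(1,3)[OF b0]] by (simp add: gA)
  moreover have "card {y\<in>A. relabel g A c0 y = j} = a j" if "j < m" for j
    using relabel_class[OF bij, of A c0 j] b0 that by (simp add: gA based_perms_def)
  moreover have "relabel g A c0 (g (x0 j)) = j \<and> g (x0 j) \<in> A" if "j < m" for j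
    using relabel_apply[OF bij] based(4)[OF b0 that] permutes_in_image[OF g] by simp
  ultimately show ?thesis by (auto simp: move_def based_perms_def)
qed

private lemma move_funpow:
  assumes "bij g" shows "g ((p0 ^^ t) y) = (conjugate g p0 ^^ t) (g y)"
proof (induction t)
  case (Suc t)
  have "(conjugate g p0 ^^ Suc t) (g y) = conjugate g p0 (g ((p0 ^^ t) y))" using Suc by simp
  also have "\<dots> = g (p0 ((p0 ^^ t) y))" by (rule conjugate_apply[OF assms])
  finally show ?case by simp
qed simp

private lemma inj_move: "inj_on move {g. g permutes A}"
proof (rule inj_onI; clarify)
  fix g h assume g: "g permutes A" and h: "h permutes A" and eq: "move g = move h"
  have "g y = h y" for y
  proof (cases "y \<in> A")
    case True
    then obtain t where t: "y = (p0 ^^ t) (x0 (c0 y))" "c0 y < m" using based(8)[OF b0] by blast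
    have "restrict (g \<circ> x0) {..<m} (c0 y) = restrict (h \<circ> x0) {..<m} (c0 y)" using eq by (simp add: move_def)
    then have "g (x0 (c0 y)) = h (x0 (c0 y))" using t(2) by simp
    moreover have "conjugate g p0 = conjugate h p0" using eq by (simp add: move_def)
    ultimately show ?thesis
      using move_funpow[OF permutes_bij[OF g], of t "x0 (c0 y)"] move_funpow[OF permutes_bij[OF h], of t "x0 (c0 y)"] t(1)
      by metis
  qed (use g h in \<open>simp add: permutes_def\<close>)
  then show "g = h" by (rule ext)
qed

text \<open>The relabelling has to carry the t-th iterate at a base point of p0 to the t-th iterate
  at the base point of p with the same label. By \<open>transfer_funpow\<close> the chosen exponent
  t does not matter.\<close>

private lemma move_onto:
  assumes b: "(p, c, x) \<in> based_perms A m a" shows "\<exists>g. g permutes A \<and> move g = (p, c, x)"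
proof -
  define t where "t y = (SOME t. y = (p0 ^^ t) (x0 (c0 y)))" for y
  have t: "y = (p0 ^^ t y) (x0 (c0 y))" if "y \<in> A" for y
  proof -
    have "\<exists>t. y = (p0 ^^ t) (x0 (c0 y))" using based(8)[OF b0 that] by (rule conjunct2)
    then show ?thesis unfolding t_def by (rule someI_ex)
  qed
  have c0m: "c0 y < m" if "y \<in> A" for y using based(8)[OF b0 that] by blast
  define g where "g y = (if y \<in> A then (p ^^ t y) (x (c0 y)) else y)" for y
  have pow_A: "(p ^^ n) (x j) \<in> A \<and> c ((p ^^ n) (x j)) = j" if "j < m" for n j
  proof (induction n)
    case (Suc n)
    then show ?case using labelling_step[OF based(3)[OF b]] permutes_in_image[OF based(1)[OF b]] by simp
  qed (use based(4)[OF b that] in simp)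
  have pow0_A: "(p0 ^^ n) (x0 j) \<in> A \<and> c0 ((p0 ^^ n) (x0 j)) = j" if "j < m" for n j
  proof (induction n)
    case (Suc n)
    then show ?case using labelling_step[OF based(3)[OF b0]] permutes_in_image[OF based(1)[OF b0]] by simp
  qed (use based(4)[OF b0 that] in simp)
  have g: "g ((p0 ^^ n) (x0 j)) = (p ^^ n) (x j)" if "j < m" for n j
  proof -
    let ?y = "(p0 ^^ n) (x0 j)"
    have y: "?y \<in> A" "c0 ?y = j" using pow0_A[OF that] by auto
    have "(p0 ^^ n) (x0 j) = (p0 ^^ t ?y) (x0 j)" using t[OF y(1)] y(2) by simp
    then have "(p ^^ n) (x j) = (p ^^ t ?y) (x j)" using transfer_funpow[OF b that] by blast
    then show ?thesis using y by (simp add: g_def)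
  qed
  have cg: "c (g y) = c0 y" "g y \<in> A" if "y \<in> A" for y
    using pow_A[OF c0m[OF that]] that by (simp_all add: g_def)
  have "inj_on g A"
  proof (rule inj_onI)
    fix y z assume yz: "y \<in> A" "z \<in> A" "g y = g z"
    then have c: "c0 y = c0 z" using cg by metis
    then have "(p ^^ t y) (x (c0 y)) = (p ^^ t z) (x (c0 y))" using yz by (simp add: g_def)
    then have "(p0 ^^ t y) (x0 (c0 y)) = (p0 ^^ t z) (x0 (c0 y))" using transfer_funpow[OF b c0m[OF yz(1)]] by blast
    then show "y = z" using t[OF yz(1)] t[OF yz(2)] c by simp
  qed
  then have "bij_betw g A A" using cg(2) A by (simp add: bij_betw_def endo_inj_surj image_subset_iff)
  then have gp: "g permutes A" by (rule bij_imp_permutes) (simp add: g_def)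
  have bij: "bij g" by (rule permutes_bij[OF gp])
  have comm: "g (p0 y) = p (g y)" for y
  proof (cases "y \<in> A")
    case True
    have "g (p0 y) = g ((p0 ^^ Suc (t y)) (x0 (c0 y)))" using t[OF True] by simp
    also have "\<dots> = (p ^^ Suc (t y)) (x (c0 y))" by (rule g[OF c0m[OF True]])
    also have "\<dots> = p (g y)" using True by (simp add: g_def)
    finally show ?thesis .
  next
    case False
    then have "p0 y = y" "p y = y" using based(1)[OF b0] based(1)[OF b] by (simp_all add: permutes_def)
    then show ?thesis using False by (simp add: g_def)
  qed
  have "conjugate g p0 = p"
    using comm permutes_inverses(1)[OF gp] by (simp add: conjugate_def fun_eq_iff)
  moreover have "relabel g A c0 = c"
  proof (rule extensionalityI[of _ A])
    show "relabel g A c0 \<in> extensional A" by (simp add: relabel_def permutes_image[OF gp])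
    fix z assume "z \<in> A"
    then obtain y where "y \<in> A" "z = g y" using permutes_image[OF gp] by blast
    then show "relabel g A c0 z = c z" using relabel_apply[OF bij] cg(1) by simp
  qed (rule based(7)[OF b])
  moreover have "restrict (g \<circ> x0) {..<m} = x"
  proof (rule extensionalityI[of _ "{..<m}"])
    show "restrict (g \<circ> x0) {..<m} j = x j" if "j \<in> {..<m}" for j using g[of j 0] that by simp
  qed (use based(6)[OF b] in auto)
  ultimately show ?thesis using gp by (auto simp: move_def)
qed

lemma bij_betw_based_perms:
  "bij_betw (\<lambda>g. (conjugate g p0, relabel g A c0, restrict (g \<circ> x0) {..<m})) {g. g permutes A} (based_perms A m a)"
  unfolding bij_betw_def
proof
  show "inj_on (\<lambda>g. (conjugate g p0, relabel g A c0, restrict (g \<circ> x0) {..<m})) {g. g permutes A}"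
    using inj_move by (simp add: move_def[abs_def])
  show "(\<lambda>g. (conjugate g p0, relabel g A c0, restrict (g \<circ> x0) {..<m})) ` {g. g permutes A} = based_perms A m a"
    using move_based move_onto unfolding move_def by force
qed

end

text \<open>Equality of multisets allows the orbits to be listed in an order \<open>qs\<close> in
  which their sizes read \<alpha>; a point is labelled by the index of its orbit.\<close>

lemma ex_labelling_of_cycle_lengths:
  assumes "has_cycle_lengths n p \<alpha>"
  shows "\<exists>c. cycle_labelling {1..n} (length \<alpha>) p c \<and> (\<forall>j<length \<alpha>. card {x\<in>{1..n}. c x = j} = \<alpha> ! j)"
proof -
  let ?A = "{1..n}"
  have p: "p permutes ?A" and ms: "image_mset card (mset_set (orbit p ` ?A)) = mset \<alpha>"
    using assms by (auto simp: has_cycle_lengths_def)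
  obtain os where os: "distinct os" "set os = orbit p ` ?A"
    using finite_distinct_list[of "orbit p ` ?A"] by auto
  have "mset os = mset_set (orbit p ` ?A)" using os by (metis mset_set_set)
  then have "mset \<alpha> = mset (map card os)" using ms by simp
  then obtain f where f: "f permutes {..<length (map card os)}" "permute_list f (map card os) = \<alpha>"
    by (rule mset_eq_permutation)
  have f': "f permutes {..<length os}" using f(1) by simp
  define qs where "qs = permute_list f os"
  have qs: "distinct qs" "set qs = orbit p ` ?A" "map card qs = \<alpha>"
    using os f f' by (simp_all add: qs_def permute_list_map)
  have len: "length \<alpha> = length qs" using qs(3) by auto
  have ex: "\<exists>j. j < length qs \<and> qs ! j = orbit p x" if "x \<in> ?A" for x
    using that qs(2) by (metis imageI in_set_conv_nth)
  define c where "c = restrict (\<lambda>x. THE j. j < length qs \<and> qs ! j = orbit p x) ?A"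
  have c: "c x = j \<longleftrightarrow> qs ! j = orbit p x" if "x \<in> ?A" "j < length qs" for x j
  proof -
    from ex[OF that(1)] obtain k where k: "k < length qs" "qs ! k = orbit p x" by blast
    have u: "l = k" if "l < length qs" "qs ! l = orbit p x" for l
      using nth_eq_iff_index_eq[OF qs(1) that(1) k(1)] that(2) k(2) by simp
    have "(THE j. j < length qs \<and> qs ! j = orbit p x) = k"
      using k u by (intro the_equality) blast+
    then have "c x = k" using that(1) by (simp add: c_def)
    then show ?thesis using u[OF that(2)] k(2) by auto
  qed
  have c_less: "c x < length qs" if x: "x \<in> ?A" for x
  proof -
    from ex[OF x] obtain k where k: "k < length qs" "qs ! k = orbit p x" by blast
    then show ?thesis using c[OF x k(1)] by simp
  qed
  have "cycle_labelling ?A (length \<alpha>) p c"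
  proof (rule cycle_labellingI[OF p])
    show "c \<in> extensional ?A" by (simp add: c_def)
    show "c ` ?A = {..<length \<alpha>}"
    proof (intro equalityI subsetI)
      fix j assume "j \<in> {..<length \<alpha>}"
      then have j: "j < length qs" using len by simp
      then obtain x where "x \<in> ?A" "qs ! j = orbit p x" using qs(2) by (metis imageE nth_mem)
      then show "j \<in> c ` ?A" using c j by (metis imageI)
    qed (use c_less len in auto)
    show "c y = c x \<longleftrightarrow> y \<in> orbit p x" if x: "x \<in> ?A" and y: "y \<in> ?A" for x y
    proof -
      have "c y = c x \<longleftrightarrow> qs ! c x = orbit p y" using c[OF y c_less[OF x]] .
      also have "qs ! c x = orbit p x" using c[OF x c_less[OF x]] by simp
      finally show ?thesis
        using orbit_eq_if_mem[OF p, of y x] self_in_orbit[OF p, of y] by auto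
    qed
  qed simp
  moreover have "card {x\<in>?A. c x = j} = \<alpha> ! j" if j: "j < length \<alpha>" for j
  proof -
    have j': "j < length qs" using j len by simp
    then obtain x where x: "x \<in> ?A" "qs ! j = orbit p x" using qs(2) by (metis imageE nth_mem)
    have "{y\<in>?A. c y = j} = orbit p x"
    proof (intro equalityI subsetI)
      fix y assume "y \<in> {y\<in>?A. c y = j}"
      then have "qs ! j = orbit p y" using c[of y j] j' by auto
      then show "y \<in> orbit p x" using x(2) self_in_orbit[OF p, of y] by simp
    next
      fix y assume y: "y \<in> orbit p x"
      then have "y \<in> ?A" using permutes_orbit_subset[OF p x(1)] by blast
      moreover have "orbit p y = orbit p x" using orbit_eq_if_mem[OF p _ y] by simp
      ultimately show "y \<in> {y\<in>?A. c y = j}" using c[of y j] j' x(2) by simp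
    qed
    then show ?thesis using x(2) qs(3) j' by (metis nth_map)
  qed
  ultimately show ?thesis by blast
qed

text \<open>\<open>H_num\<close> takes its permutation by choice, so existence is required. The
  points are arranged as pairs (j, t) with t below \<open>\<alpha> ! j\<close>, and t is advanced
  cyclically.\<close>

lemma ex_cycle_lengths:
  assumes "composition \<alpha> n" shows "\<exists>p. has_cycle_lengths n p \<alpha>"
proof -
  let ?A = "{1..n}" and ?m = "length \<alpha>"
  define P where "P = (SIGMA j:{..<?m}. {..<\<alpha> ! j})"
  have "sum_list \<alpha> = (\<Sum>j<?m. \<alpha> ! j)" by (simp add: sum_list_sum_nth atLeast0LessThan)
  then have "card P = n" using assms by (simp add: P_def composition_def)
  moreover have "finite P" by (simp add: P_def)
  ultimately obtain h where h: "bij_betw h P ?A" using finite_same_card_bij[of P ?A] by auto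
  have pos: "\<alpha> ! j > 0" if "j < ?m" for j using assms that by (auto simp: composition_def)
  define k where "k = inv_into P h"
  have kh: "k (h x) = x" if "x \<in> P" for x using h that by (simp add: k_def bij_betw_inv_into_left)
  have hk: "h (k y) = y" "k y \<in> P" if "y \<in> ?A" for y
    using h that by (auto simp: k_def bij_betw_inv_into_right bij_betw_def inv_into_into)
  define p where "p y = (if y \<in> ?A then h (fst (k y), Suc (snd (k y)) mod \<alpha> ! fst (k y)) else y)" for y
  have hA: "h x \<in> ?A" if "x \<in> P" for x using h that by (auto simp: bij_betw_def)
  have ph: "p (h (j, t)) = h (j, Suc t mod \<alpha> ! j)" if "j < ?m" "t < \<alpha> ! j" for j t
    using that hA[of "(j, t)"] kh[of "(j, t)"] by (simp add: p_def P_def)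
  have pnh: "(p ^^ i) (h (j, t)) = h (j, (t + i) mod \<alpha> ! j)" if "j < ?m" "t < \<alpha> ! j" for j t i
  proof (induction i)
    case (Suc i)
    have "(t + i) mod \<alpha> ! j < \<alpha> ! j" using pos[OF that(1)] by simp
    then show ?case using Suc ph[OF that(1)] by (simp add: mod_Suc_eq)
  qed (use that in simp)
  have orb: "orbit p (h (j, t)) = (\<lambda>i. h (j, i)) ` {..<\<alpha> ! j}" if "j < ?m" "t < \<alpha> ! j" for j t
  proof -
    have "(p ^^ (\<alpha> ! j)) (h (j, t)) = h (j, t)" using pnh[OF that] that by simp
    then have "orbit p (h (j, t)) = {(p ^^ i) (h (j, t)) |i. i < \<alpha> ! j}"
      using pos[OF that(1)] by (rule orbit_altdef_bounded)
    also have "\<dots> = (\<lambda>i. h (j, (t + i) mod \<alpha> ! j)) ` {..<\<alpha> ! j}" using pnh[OF that] by auto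
    also have "\<dots> = (\<lambda>i. h (j, i)) ` (\<lambda>i. (t + i) mod \<alpha> ! j) ` {..<\<alpha> ! j}" by (simp add: image_image)
    \<comment> \<open>Adding t permutes the residues modulo \<open>\<alpha> ! j\<close>.\<close>
    also have "(\<lambda>i. (t + i) mod \<alpha> ! j) ` {..<\<alpha> ! j} = {..<\<alpha> ! j}"
    proof (intro equalityI subsetI)
      fix i assume "i \<in> {..<\<alpha> ! j}"
      then have i: "i < \<alpha> ! j" by simp
      have "(t + (\<alpha> ! j - t + i) mod \<alpha> ! j) mod \<alpha> ! j = (t + (\<alpha> ! j - t + i)) mod \<alpha> ! j"
        by (rule mod_add_right_eq)
      also have "t + (\<alpha> ! j - t + i) = \<alpha> ! j + i" using that(2) by simp
      finally have "i = (t + (\<alpha> ! j - t + i) mod \<alpha> ! j) mod \<alpha> ! j" using i by simp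
      moreover have "(\<alpha> ! j - t + i) mod \<alpha> ! j \<in> {..<\<alpha> ! j}" using pos[OF that(1)] by simp
      ultimately show "i \<in> (\<lambda>i. (t + i) mod \<alpha> ! j) ` {..<\<alpha> ! j}" by (rule image_eqI)
    qed (use pos[OF that(1)] in auto)
    finally show ?thesis .
  qed
  have cover: "\<exists>j t. j < ?m \<and> t < \<alpha> ! j \<and> y = h (j, t)" if "y \<in> ?A" for y
  proof -
    obtain j t where jt: "k y = (j, t)" by fastforce
    then have "j < ?m" "t < \<alpha> ! j" using hk(2)[OF that] by (simp_all add: P_def)
    moreover have "y = h (j, t)" using hk(1)[OF that] jt by simp
    ultimately show ?thesis by blast
  qed
  have "p permutes ?A"
  proof (rule bij_imp_permutes)
    have "?A \<subseteq> p ` ?A"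
    proof
      fix y assume "y \<in> ?A"
      then obtain j t where y: "j < ?m" "t < \<alpha> ! j" "y = h (j, t)" using cover by blast
      have "y \<in> orbit p y" using orb[OF y(1,2)] y(2,3) by auto
      then obtain i where i: "0 < i" "y = (p ^^ i) y" by (auto simp: orbit_altdef)
      then obtain i' where i': "i = Suc i'" using gr0_implies_Suc by blast
      have "(p ^^ i') y = h (j, (t + i') mod \<alpha> ! j)" using pnh[OF y(1,2)] y(3) by simp
      moreover have "(j, (t + i') mod \<alpha> ! j) \<in> P" using y(1) pos[OF y(1)] by (simp add: P_def)
      ultimately have "(p ^^ i') y \<in> ?A" using hA by simp
      moreover have "(p ^^ i) y = p ((p ^^ i') y)" by (simp add: i')
      then have "y = p ((p ^^ i') y)" by (rule trans[OF i(2)])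
      ultimately show "y \<in> p ` ?A" by (rule image_eqI[rotated])
    qed
    moreover have "card (p ` ?A) \<le> card ?A" by (rule card_image_le) simp
    ultimately have "p ` ?A = ?A" by (metis card_seteq finite_atLeastAtMost finite_imageI)
    then show "bij_betw p ?A ?A" by (simp add: bij_betw_def finite_surj_inj)
  qed (simp add: p_def del: atLeastAtMost_iff)
  moreover have "image_mset card (mset_set (orbit p ` ?A)) = mset \<alpha>"
  proof -
    define C where "C j = (\<lambda>i. h (j, i)) ` {..<\<alpha> ! j}" for j
    have orbs1: "orbit p ` ?A = C ` {..<?m}"
    proof (intro equalityI subsetI)
      fix X assume "X \<in> orbit p ` ?A"
      then obtain y where "y \<in> ?A" "X = orbit p y" by blast
      moreover obtain j t where "j < ?m" "t < \<alpha> ! j" "y = h (j, t)" using cover[OF calculation(1)] by blast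
      ultimately have "X = C j" "j \<in> {..<?m}" using orb[of j t] by (simp_all add: C_def)
      then show "X \<in> C ` {..<?m}" by (rule image_eqI)
    next
      fix X assume "X \<in> C ` {..<?m}"
      then obtain j where j: "j < ?m" "X = C j" by auto
      then have "X = orbit p (h (j, 0))" using orb[OF j(1) pos[OF j(1)]] by (simp add: C_def)
      moreover have "h (j, 0) \<in> ?A" using j(1) pos[OF j(1)] by (intro hA) (simp add: P_def)
      ultimately show "X \<in> orbit p ` ?A" by blast
    qed
    have orbs2: "inj_on C {..<?m}"
    proof (rule inj_onI)
      fix j l assume jl: "j \<in> {..<?m}" "l \<in> {..<?m}" "C j = C l"
      have "h (j, 0) \<in> C j" using pos jl(1) by (auto simp: C_def)
      then obtain i where i: "i < \<alpha> ! l" "h (j, 0) = h (l, i)" using jl(3) by (auto simp: C_def)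
      have "(j, 0) \<in> P" "(l, i) \<in> P" using jl pos i(1) by (auto simp: P_def)
      then have "(j, 0) = (l, i)" using kh i(2) by metis
      then show "j = l" by simp
    qed
    have orbs3: "card (C j) = \<alpha> ! j" if j: "j < ?m" for j
    proof -
      have "inj_on (\<lambda>i. h (j, i)) {..<\<alpha> ! j}"
      proof (rule inj_onI)
        fix x y assume xy: "x \<in> {..<\<alpha> ! j}" "y \<in> {..<\<alpha> ! j}" "h (j, x) = h (j, y)"
        have "(j, x) \<in> P" "(j, y) \<in> P" using xy(1,2) j by (simp_all add: P_def)
        note kxy = kh[OF this(1)] kh[OF this(2)]
        have "k (h (j, x)) = k (h (j, y))" by (rule arg_cong[OF xy(3)])
        then show "x = y" unfolding kxy by simp
      qed
      then show ?thesis by (simp add: C_def card_image)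
    qed
    have "image_mset card (mset_set (orbit p ` ?A)) = image_mset card (image_mset C (mset_set {..<?m}))"
      unfolding orbs1 image_mset_mset_set[OF orbs2] ..
    also have "\<dots> = image_mset (\<lambda>j. card (C j)) (mset_set {..<?m})"
      by (simp add: multiset.map_comp comp_def)
    also have "\<dots> = image_mset ((!) \<alpha>) (mset_set {..<?m})"
      by (rule image_mset_cong) (simp add: orbs3)
    also have "mset_set {..<?m} = mset [0..<?m]" by (simp add: atLeast0LessThan)
    also have "image_mset ((!) \<alpha>) (mset [0..<?m]) = mset (map ((!) \<alpha>) [0..<?m])" by (rule mset_map[symmetric])
    also have "map ((!) \<alpha>) [0..<?m] = \<alpha>" by (rule map_nth)
    finally show ?thesis .
  qed
  ultimately show ?thesis by (auto simp: has_cycle_lengths_def)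
qed

definition FacT :: "nat \<Rightarrow> (nat \<Rightarrow> nat) \<Rightarrow> (nat \<Rightarrow>\<^sub>0 nat) \<Rightarrow> ((nat \<Rightarrow> nat) list \<times> (nat \<Rightarrow> nat)) set" where
  "FacT m a i = {(ss, c) \<in> FacS {1..\<Sum>j<m. a j} m a. has_type i ss}"

text \<open>Factorizations with labelled cycles and base points are counted twice. There are n!
  based permutations, each with \<open>H_num \<alpha> i\<close> factorizations by conjugation. On
  the other hand a factorization with labelled cycles leaves \<open>\<alpha> ! j\<close> choices for
  the base point of cycle j.\<close>

lemma H_num_eq:
  assumes \<alpha>: "composition \<alpha> n" "length \<alpha> = m"
  shows "fact n * H_num \<alpha> i = (\<Prod>j<m. \<alpha> ! j) * card (FacT m ((!) \<alpha>) i)"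
proof -
  let ?A = "{1..n}"
  define p0 where "p0 = (SOME p. has_cycle_lengths n p \<alpha>)"
  have sum: "sum_list \<alpha> = n" using \<alpha>(1) by (simp add: composition_def)
  have sum': "(\<Sum>j<m. \<alpha> ! j) = n" using sum \<alpha>(2) by (simp add: sum_list_sum_nth atLeast0LessThan)
  have pos: "\<alpha> ! j > 0" if "j < m" for j using \<alpha> that by (auto simp: composition_def)
  have "has_cycle_lengths n p0 \<alpha>" unfolding p0_def by (rule someI_ex[OF ex_cycle_lengths[OF \<alpha>(1)]])
  then obtain c0 where c0: "cycle_labelling ?A m p0 c0" "\<And>j. j < m \<Longrightarrow> card {x\<in>?A. c0 x = j} = \<alpha> ! j"
    and p0: "p0 permutes ?A"
    using ex_labelling_of_cycle_lengths[of n p0 \<alpha>] \<alpha>(2) by (auto simp: has_cycle_lengths_def)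
  define X where "X p c = {ss. (ss, c) \<in> Fac ?A m \<and> prodl ss = p \<and> has_type i ss}"
    for p :: "nat \<Rightarrow> nat" and c :: "nat \<Rightarrow> nat"
  have H: "H_num \<alpha> i = card (X p0 c0)"
    unfolding H_num_def sum p0_def[symmetric] X_def using cycle_factorizations_eq[OF c0(1)] by simp
  define x0 where "x0 = restrict (\<lambda>j. SOME x. x \<in> ?A \<and> c0 x = j) {..<m}"
  have "x0 j \<in> ?A \<and> c0 (x0 j) = j" if "j < m" for j
  proof -
    have "{x\<in>?A. c0 x = j} \<noteq> {}" using c0(2)[OF that] pos[OF that] by (metis card.empty less_irrefl)
    then have "\<exists>x. x \<in> ?A \<and> c0 x = j" by blast
    then show ?thesis using someI_ex[of "\<lambda>x. x \<in> ?A \<and> c0 x = j"] that by (simp add: x0_def)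
  qed
  then have b0: "(p0, c0, x0) \<in> based_perms ?A m ((!) \<alpha>)"
    using p0 c0 by (auto simp: based_perms_def x0_def)
  have X_inj: "card (X (conjugate g p) (relabel g ?A c)) = card (X p c)"
    if g: "g permutes ?A" and c: "c \<in> extensional ?A" for g p c
  proof -
    have bij: "bij g" by (rule permutes_bij[OF g])
    have bij': "bij (inv' g)" by (rule permutes_bij[OF permutes_inv[OF g]])
    have gA: "g ` ?A = ?A" "inv' g ` ?A = ?A"
      by (rule permutes_image[OF g], rule permutes_image[OF permutes_inv[OF g]])
    have map: "map (conjugate g) ss \<in> X (conjugate g p) (relabel g ?A c)"
      if "ss \<in> X p c" "bij g" "g ` ?A = ?A" for ss g p c
      using that(1) Fac_conjugate[OF that(2), of ss c ?A m] unfolding that(3)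
      by (simp add: X_def prodl_conjugate[OF that(2)] has_type_conjugate[OF that(2)] that(3) del: atLeastAtMost_iff)
    have undo_conj: "conjugate (inv' g) (conjugate g p) = p" "relabel (inv' g) ?A (relabel g ?A c) = c"
      using conjugate_inv[OF bij] relabel_inv[OF bij c] gA by simp_all
    have "bij_betw (map (conjugate g)) (X p c) (X (conjugate g p) (relabel g ?A c))"
    proof (rule bij_betw_byWitness[where f' = "map (conjugate (inv' g))"])
      show "\<forall>ss\<in>X p c. map (conjugate (inv' g)) (map (conjugate g) ss) = ss"
        by (simp add: conjugate_inv[OF bij] comp_def)
      show "\<forall>ss\<in>X (conjugate g p) (relabel g ?A c). map (conjugate g) (map (conjugate (inv' g)) ss) = ss"
        using conjugate_inv[OF bij'] by (simp add: inv_inv_eq[OF bij] comp_def)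
      show "map (conjugate g) ` X p c \<subseteq> X (conjugate g p) (relabel g ?A c)"
        using map[OF _ bij gA(1)] by blast
      show "map (conjugate (inv' g)) ` X (conjugate g p) (relabel g ?A c) \<subseteq> X p c"
        using map[OF _ bij' gA(2), of _ "conjugate g p" "relabel g ?A c"] unfolding undo_conj by blast
    qed
    then show ?thesis by (rule bij_betw_same_card[symmetric])
  qed
  have finX: "finite (X p c)" for p c
    by (rule finite_subset[OF _ finite_imageI[OF finite_Fac[of ?A m], of fst]]) (force simp: X_def)+
  have finb: "finite (based_perms ?A m ((!) \<alpha>))"
    using bij_betw_finite[OF bij_betw_based_perms[OF _ b0]] finite_permutations[of ?A] by simp
  have "fact n * H_num \<alpha> i = (\<Sum>g\<in>{g. g permutes ?A}. H_num \<alpha> i)"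
    by (simp add: card_permutations)
  also have "\<dots> = (\<Sum>g\<in>{g. g permutes ?A}. card (X (conjugate g p0) (relabel g ?A c0)))"
    using X_inj b0 c0(1) by (intro sum.cong) (auto simp: H cycle_labelling_def)
  also have "\<dots> = (\<Sum>(p, c, x)\<in>based_perms ?A m ((!) \<alpha>). card (X p c))"
    using sum.reindex_bij_betw[OF bij_betw_based_perms[OF _ b0], of "\<lambda>(p, c, x). card (X p c)"]
    by simp
  also have "\<dots> = card (SIGMA y:based_perms ?A m ((!) \<alpha>). X (fst y) (fst (snd y)))"
    using finb finX by (subst card_SigmaI) (auto intro!: sum.cong)
  also have "\<dots> = card (SIGMA y:FacT m ((!) \<alpha>) i. Pi\<^sub>E {..<m} (\<lambda>j. {z\<in>?A. snd y z = j}))"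
  proof (rule bij_betw_same_card, rule bij_betw_byWitness[where
        f = "\<lambda>((p, c, x), ss). ((ss, c), x)" and f' = "\<lambda>((ss, c), x). ((prodl ss, c, x), ss)"])
    show "(\<lambda>((p, c, x), ss). ((ss, c), x)) ` (SIGMA y:based_perms ?A m ((!) \<alpha>). X (fst y) (fst (snd y)))
        \<subseteq> (SIGMA y:FacT m ((!) \<alpha>) i. Pi\<^sub>E {..<m} (\<lambda>j. {z\<in>?A. snd y z = j}))"
    proof
      fix y assume "y \<in> (\<lambda>((p, c, x), ss). ((ss, c), x)) ` (SIGMA y:based_perms ?A m ((!) \<alpha>). X (fst y) (fst (snd y)))"
      then obtain p c x ss where y: "y = ((ss, c), x)" "(p, c, x) \<in> based_perms ?A m ((!) \<alpha>)" "ss \<in> X p c"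
        by fastforce
      have "(ss, c) \<in> FacT m ((!) \<alpha>) i"
        using y(2,3) unfolding based_perms_def X_def FacT_def FacS_def sum' mem_Collect_eq case_prod_conv by blast
      moreover have "x \<in> Pi\<^sub>E {..<m} (\<lambda>j. {z\<in>?A. c z = j})"
        using y(2) unfolding based_perms_def mem_Collect_eq case_prod_conv by blast
      ultimately show "y \<in> (SIGMA y:FacT m ((!) \<alpha>) i. Pi\<^sub>E {..<m} (\<lambda>j. {z\<in>?A. snd y z = j}))"
        by (simp add: y(1) del: atLeastAtMost_iff)
    qed
    show "(\<lambda>((ss, c), x). ((prodl ss, c, x), ss)) ` (SIGMA y:FacT m ((!) \<alpha>) i. Pi\<^sub>E {..<m} (\<lambda>j. {z\<in>?A. snd y z = j}))
        \<subseteq> (SIGMA y:based_perms ?A m ((!) \<alpha>). X (fst y) (fst (snd y)))"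
    proof
      fix y assume "y \<in> (\<lambda>((ss, c), x). ((prodl ss, c, x), ss)) ` (SIGMA y:FacT m ((!) \<alpha>) i. Pi\<^sub>E {..<m} (\<lambda>j. {z\<in>?A. snd y z = j}))"
      then obtain ss c x where y: "y = ((prodl ss, c, x), ss)" "(ss, c) \<in> FacT m ((!) \<alpha>) i"
        "x \<in> Pi\<^sub>E {..<m} (\<lambda>j. {z\<in>?A. c z = j})" by auto
      have F: "(ss, c) \<in> Fac ?A m" "\<And>j. j < m \<Longrightarrow> card {x\<in>?A. c x = j} = \<alpha> ! j" "has_type i ss"
        using y(2) unfolding FacT_def FacS_def sum' by auto
      have "cycle_labelling ?A m (prodl ss) c" using F(1) by (simp add: Fac_def)
      then show "y \<in> (SIGMA y:based_perms ?A m ((!) \<alpha>). X (fst y) (fst (snd y)))"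
        using F y(3) Fac_permutes(2)[OF F(1)] by (simp add: y(1) based_perms_def X_def)
    qed
  qed (auto simp: X_def)
  also have "\<dots> = (\<Sum>y\<in>FacT m ((!) \<alpha>) i. \<Prod>j<m. \<alpha> ! j)"
  proof -
    have "finite (FacT m ((!) \<alpha>) i)"
      by (rule finite_subset[OF _ finite_FacS]) (auto simp: FacT_def)
    moreover have "card (Pi\<^sub>E {..<m} (\<lambda>j. {z\<in>?A. snd y z = j})) = (\<Prod>j<m. \<alpha> ! j)" if "y \<in> FacT m ((!) \<alpha>) i" for y
      using that by (subst card_PiE) (auto simp: FacT_def FacS_def sum' intro!: prod.cong)
    ultimately show ?thesis by (subst card_SigmaI) (auto intro!: finite_PiE)
  qed
  finally show ?thesis by (simp add: mult.commute)
qed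

section \<open>The polymap of a factorization\<close>

text \<open>The cyclic successor of l, as met on a clockwise tour about a vertex with an increasing
  rotator.\<close>

definition next_in :: "nat set \<Rightarrow> nat \<Rightarrow> nat" where
  "next_in L l = (if \<exists>k\<in>L. l < k then Min {k\<in>L. l < k} else Min L)"

lemma next_in_greater:
  assumes "finite L" "k \<in> L" "l < k"
  shows "next_in L l \<in> L" "l < next_in L l" "next_in L l \<le> k"
proof -
  let ?S = "{k\<in>L. l < k}"
  have S: "finite ?S" "k \<in> ?S" using assms by auto
  have "next_in L l = Min ?S" using assms by (auto simp: next_in_def)
  moreover have "Min ?S \<in> ?S" using S by (intro Min_in) auto
  moreover have "Min ?S \<le> k" using S by (intro Min_le)
  ultimately show "next_in L l \<in> L" "l < next_in L l" "next_in L l \<le> k" by auto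
qed

lemma next_in_wrap: "\<not> (\<exists>k\<in>L. l < k) \<Longrightarrow> next_in L l = Min L"
  by (simp add: next_in_def)

lemma next_in_mem: "finite L \<Longrightarrow> L \<noteq> {} \<Longrightarrow> next_in L l \<in> L"
  using next_in_greater(1)[of L _ l] next_in_wrap[of L l] Min_in[of L] by metis

lemma next_in_eqI:
  assumes "finite L" "k \<in> L" "l < k" "\<And>k'. k' \<in> L \<Longrightarrow> l < k' \<Longrightarrow> k \<le> k'"
  shows "next_in L l = k"
  using next_in_greater[OF assms(1-3)] assms(4) by (meson le_antisym)

text \<open>Existence of predecessors makes the rotation onto. Away from the minimum the predecessor
  is smaller, which permits induction along the tour.\<close>

lemma ex_next_in:
  assumes "finite L" "k \<in> L" shows "\<exists>l\<in>L. next_in L l = k \<and> (k \<noteq> Min L \<longrightarrow> l < k)"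
proof (cases "k = Min L")
  case True
  have "L \<noteq> {}" using assms(2) by blast
  have "\<not> (\<exists>k\<in>L. Max L < k)" using assms(1) by (meson Max_ge leD)
  then have "next_in L (Max L) = k" using next_in_wrap True by metis
  then show ?thesis using Max_in[OF assms(1) \<open>L \<noteq> {}\<close>] True by blast
next
  case False
  have "Min L < k" using False Min_le[OF assms] by simp
  moreover have "Min L \<in> L" using assms by (intro Min_in) auto
  ultimately have ne: "{l\<in>L. l < k} \<noteq> {}" by blast
  define p where "p = Max {l\<in>L. l < k}"
  have p: "p \<in> L" "p < k" using Max_in[of "{l\<in>L. l < k}"] ne assms(1) by (auto simp: p_def)
  have "next_in L p = k"
  proof (rule next_in_eqI[OF assms p(2)])
    fix k' assume k': "k' \<in> L" "p < k'"
    show "k \<le> k'"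
    proof (rule ccontr)
      assume "\<not> k \<le> k'"
      then have "k' \<le> p" unfolding p_def using k' assms(1) by (intro Max_ge) auto
      then show False using k'(2) by simp
    qed
  qed
  then show ?thesis using p by blast
qed

text \<open>Allows an increasing rotator to be expressed by positions on the full tour of darts,
  without indexing the filtered list.\<close>

lemma sorted_wrt_map_filter_iff:
  fixes g :: "'a \<Rightarrow> 'b::linorder"
  shows "sorted_wrt (<) (map g (filter P xs)) \<longleftrightarrow>
    (\<forall>i j. i < j \<longrightarrow> j < length xs \<longrightarrow> P (xs ! i) \<longrightarrow> P (xs ! j) \<longrightarrow> g (xs ! i) < g (xs ! j))"
proof (induction xs)
  case (Cons x xs)
  have "(\<forall>i j. i < j \<longrightarrow> j < length (x # xs) \<longrightarrow> P ((x # xs) ! i) \<longrightarrow> P ((x # xs) ! j) \<longrightarrow> g ((x # xs) ! i) < g ((x # xs) ! j))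
      \<longleftrightarrow> (\<forall>y\<in>set xs. P x \<longrightarrow> P y \<longrightarrow> g x < g y) \<and>
          (\<forall>i j. i < j \<longrightarrow> j < length xs \<longrightarrow> P (xs ! i) \<longrightarrow> P (xs ! j) \<longrightarrow> g (xs ! i) < g (xs ! j))"
    (is "?L \<longleftrightarrow> ?R1 \<and> ?R2")
  proof (intro iffI conjI)
    assume L: ?L
    show ?R1
    proof (intro ballI impI)
      fix y assume y: "y \<in> set xs" "P x" "P y"
      then obtain j where "j < length xs" "xs ! j = y" by (metis in_set_conv_nth)
      then show "g x < g y" using L[rule_format, of 0 "Suc j"] y by simp
    qed
    show ?R2
    proof (intro allI impI)
      fix i j assume "i < j" "j < length xs" "P (xs ! i)" "P (xs ! j)"
      then show "g (xs ! i) < g (xs ! j)" using L[rule_format, of "Suc i" "Suc j"] by simp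
    qed
  next
    assume R: "?R1 \<and> ?R2"
    show ?L
    proof (intro allI impI)
      fix i j assume ij: "i < j" "j < length (x # xs)" "P ((x # xs) ! i)" "P ((x # xs) ! j)"
      then obtain j' where j': "j = Suc j'" by (cases j) auto
      show "g ((x # xs) ! i) < g ((x # xs) ! j)"
      proof (cases i)
        case 0
        then show ?thesis using R ij j' by simp
      next
        case (Suc i')
        then show ?thesis using R ij j' by simp
      qed
    qed
  qed
  then show ?case unfolding Cons.IH[symmetric] by auto
qed simp

text \<open>\<open>S_num\<close> counts maps with natural numbers as darts, so a dart is coded from
  its origin, a polygon and a side.\<close>

definition enc :: "nat \<Rightarrow> nat \<Rightarrow> bool \<Rightarrow> nat" where
  "enc v l b = to_nat (v, l, b)"

lemma enc_inject [simp]: "enc v l b = enc v' l' b' \<longleftrightarrow> v = v' \<and> l = l' \<and> b = b'"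
  by (simp add: enc_def)

lemma from_nat_enc [simp]: "from_nat (enc v l b) = (v, l, b)"
  by (simp add: enc_def)

definition labels_at :: "(nat \<Rightarrow> nat) list \<Rightarrow> nat \<Rightarrow> nat set" where
  "labels_at ss v = {l. l < length ss \<and> v \<in> supp (ss ! l)}"

definition canon_darts :: "(nat \<Rightarrow> nat) list \<Rightarrow> nat set" where
  "canon_darts ss = {enc v l b |v l b. l \<in> labels_at ss v}"

definition canon_polygon :: "(nat \<Rightarrow> nat) list \<Rightarrow> nat \<Rightarrow> nat set" where
  "canon_polygon ss l = (\<lambda>v. enc v l True) ` supp (ss ! l)"

text \<open>The preceding dart on the white face carries the largest label at u. So each vertex
  accounts for one descent, completed by this dart.\<close>

definition start :: "(nat \<Rightarrow> nat) list \<Rightarrow> nat \<Rightarrow> nat" where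
  "start ss u = enc u (Min (labels_at ss u)) False"

text \<open>
  The dart \<open>enc v l True\<close> has origin \<open>v\<close> and the polygon with label \<open>l + 1\<close> on its left, and
  \<open>enc v l False\<close> is the dart before it in clockwise order. Every polygon is traversed as
  its factor prescribes.
\<close>

definition canon :: "nat set \<Rightarrow> (nat \<Rightarrow> nat) list \<Rightarrow> (nat \<Rightarrow> nat) \<Rightarrow> nat labelled_polymap" where
  "canon A ss c = \<lparr>
     darts = canon_darts ss,
     rot = (\<lambda>d. if d \<in> canon_darts ss
        then (case from_nat d of (v, l, b) \<Rightarrow> if b then enc v (next_in (labels_at ss v) l) False else enc v l True)
        else d),
     flip = (\<lambda>d. if d \<in> canon_darts ss
        then (case from_nat d of (v, l, b) \<Rightarrow> if b then enc ((ss ! l) v) l False else enc (inv' (ss ! l) v) l True)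
        else d),
     polygons = canon_polygon ss ` {..<length ss},
     polygon_label = (\<lambda>p. Suc (THE l. l < length ss \<and> p = canon_polygon ss l)),
     face_label = (\<lambda>f. Suc (c (SOME u. u \<in> A \<and> start ss u \<in> f)))\<rparr>"

text \<open>Transitivity and genus stay outside the locale, since they become connectedness and
  Euler's formula for the constructed map. Because of \<open>cover\<close> each point has a dart and
  so is a vertex.\<close>

locale factors =
  fixes A :: "nat set" and ss :: "(nat \<Rightarrow> nat) list"
  assumes A: "finite A" "A \<noteq> {}"
    and cyc: "l < length ss \<Longrightarrow> is_cyc A (ss ! l)"
    and cover: "v \<in> A \<Longrightarrow> labels_at ss v \<noteq> {}"
begin

abbreviation "L \<equiv> labels_at ss"
abbreviation "D \<equiv> canon_darts ss"
abbreviation "st \<equiv> start ss"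
text \<open>The labelling enters \<open>canon\<close> through the face labels only, so any value may
  stand in its place here.\<close>

definition "R = rot (canon A ss undefined)"
definition "F = flip (canon A ss undefined)"
definition "W d = R (F d)"

lemma canon_simps [simp]:
  "darts (canon A ss c) = D" "rot (canon A ss c) = R" "flip (canon A ss c) = F"
  "polygons (canon A ss c) = canon_polygon ss ` {..<length ss}"
  by (simp_all add: canon_def R_def F_def)

lemma face_perm_canon [simp]: "face_perm (canon A ss c) = W"
  by (simp add: face_perm_def W_def fun_eq_iff)

lemma L: "l \<in> L v \<longleftrightarrow> l < length ss \<and> v \<in> supp (ss ! l)"
  by (simp add: labels_at_def)

lemma finL: "finite (L v)"
  by (simp add: labels_at_def)

lemma L_A: "l \<in> L v \<Longrightarrow> v \<in> A"
  using is_cyc_supp[OF cyc] by (auto simp: L)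

lemma perm: "l < length ss \<Longrightarrow> ss ! l permutes A"
  using is_cyc_permutes[OF cyc] .

lemma D_enc [simp]: "enc v l b \<in> D \<longleftrightarrow> l \<in> L v"
  by (auto simp: canon_darts_def)

lemma D_cases: assumes "d \<in> D" obtains v l b where "d = enc v l b" "l \<in> L v"
  using assms by (auto simp: canon_darts_def)

lemma R_True: "l \<in> L v \<Longrightarrow> R (enc v l True) = enc v (next_in (L v) l) False"
  and R_False: "l \<in> L v \<Longrightarrow> R (enc v l False) = enc v l True"
  and F_True: "l \<in> L v \<Longrightarrow> F (enc v l True) = enc ((ss ! l) v) l False"
  and F_False: "l \<in> L v \<Longrightarrow> F (enc v l False) = enc (inv' (ss ! l) v) l True"
  and RF_other: "d \<notin> D \<Longrightarrow> R d = d" "d \<notin> D \<Longrightarrow> F d = d"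
  by (simp_all add: R_def F_def canon_def)

lemma next_L: "l \<in> L v \<Longrightarrow> next_in (L v) l \<in> L v"
  using next_in_mem[OF finL] by blast

lemma inj_s: "l < length ss \<Longrightarrow> inj (ss ! l)"
  using permutes_inj[OF perm] .

lemma L_step: "l \<in> L v \<Longrightarrow> l \<in> L ((ss ! l) v)" and L_step_inv: "l \<in> L v \<Longrightarrow> l \<in> L (inv' (ss ! l) v)"
proof -
  assume l: "l \<in> L v"
  then have p: "ss ! l permutes A" and v: "(ss ! l) v \<noteq> v" using perm by (auto simp: L supp_def)
  then show "l \<in> L ((ss ! l) v)" using l inj_s[of l] by (auto simp: L supp_def dest: injD)
  have "(ss ! l) (inv' (ss ! l) v) = v" by (rule permutes_inverses(1)[OF p])
  then have "(ss ! l) (inv' (ss ! l) v) \<noteq> inv' (ss ! l) v" using v by metis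
  then show "l \<in> L (inv' (ss ! l) v)" using l by (simp add: L supp_def)
qed

lemma s_inv: "l \<in> L v \<Longrightarrow> (ss ! l) (inv' (ss ! l) v) = v" "l \<in> L v \<Longrightarrow> inv' (ss ! l) ((ss ! l) v) = v"
  using permutes_inverses[OF perm] by (simp_all add: L)

lemma finD: "finite D"
proof (rule finite_subset)
  show "D \<subseteq> (\<lambda>(v, l, b). enc v l b) ` (A \<times> {..<length ss} \<times> UNIV)"
  proof
    fix d assume "d \<in> D"
    then obtain v l b where "d = enc v l b" "l \<in> L v" by (rule D_cases)
    then show "d \<in> (\<lambda>(v, l, b). enc v l b) ` (A \<times> {..<length ss} \<times> UNIV)"
      using L_A[of l v] L[of l v] by (intro image_eqI[of _ _ "(v, l, b)"]) auto
  qed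
qed (use A in simp)

lemma RD: "d \<in> D \<Longrightarrow> R d \<in> D" and FD: "d \<in> D \<Longrightarrow> F d \<in> D"
proof -
  assume "d \<in> D"
  then obtain v l b where d: "d = enc v l b" "l \<in> L v" by (rule D_cases)
  show "R d \<in> D" using d next_L by (cases b) (simp_all add: R_True R_False)
  show "F d \<in> D" using d L_step L_step_inv by (cases b) (simp_all add: F_True F_False)
qed

lemma FF: "d \<in> D \<Longrightarrow> F (F d) = d" and F_ne: "d \<in> D \<Longrightarrow> F d \<noteq> d"
proof -
  assume "d \<in> D"
  then obtain v l b where d: "d = enc v l b" "l \<in> L v" by (rule D_cases)
  show "F (F d) = d" using d by (cases b) (simp_all add: F_True F_False L_step L_step_inv s_inv)
  show "F d \<noteq> d" using d by (cases b) (simp_all add: F_True F_False)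
qed

lemma F_perm: "F permutes D"
proof (rule bij_imp_permutes)
  show "bij_betw F D D" by (rule bij_betw_byWitness[where f' = F]) (use FF FD in auto)
qed (use RF_other in auto)

lemma R_perm: "R permutes D"
proof (rule bij_imp_permutes)
  have "D \<subseteq> R ` D"
  proof
    fix d assume "d \<in> D"
    then obtain v l b where d: "d = enc v l b" "l \<in> L v" by (rule D_cases)
    show "d \<in> R ` D"
    proof (cases b)
      case True
      then show ?thesis using d by (intro image_eqI[of _ _ "enc v l False"]) (simp_all add: R_False)
    next
      case False
      obtain k where "k \<in> L v" "next_in (L v) k = l" using ex_next_in[OF finL d(2)] by blast
      then show ?thesis using d False by (intro image_eqI[of _ _ "enc v k True"]) (simp_all add: R_True)
    qed
  qed
  then have "R ` D = D" using RD by blast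
  then show "bij_betw R D D" using finD by (simp add: bij_betw_def finite_surj_inj)
qed (use RF_other in auto)

lemma W_perm: "W permutes D"
  using permutes_compose[OF F_perm R_perm] by (simp add: W_def[abs_def] comp_def)

lemma W_True: "l \<in> L v \<Longrightarrow> W (enc v l True) = enc ((ss ! l) v) l True"
  by (simp add: W_def F_True R_False L_step)

lemma W_False: "l \<in> L v \<Longrightarrow> W (enc v l False) = enc (inv' (ss ! l) v) (next_in (L (inv' (ss ! l) v)) l) False"
  by (simp add: W_def F_False R_True L_step_inv)

definition "vset v = {enc v l b |l b. l \<in> L v}"

lemma start_D: "v \<in> A \<Longrightarrow> Min (L v) \<in> L v"
  using Min_in[OF finL cover] .

text \<open>Two rotations take the white dart of a label to that of the next label, so by induction
  from the smallest label the orbit contains all darts at v.\<close>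

lemma orbit_R: assumes "l \<in> L v" shows "orbit R (enc v l b) = vset v"
proof -
  note eq = orbit_eq_if_mem[OF R_perm finD]
  have v: "v \<in> A" using L_A assms .
  have F0: "enc v k False \<in> orbit R (st v)" if "k \<in> L v" for k
    using that
  proof (induction k rule: less_induct)
    case (less k)
    show ?case
    proof (cases "k = Min (L v)")
      case True
      then show ?thesis using self_in_orbit[OF R_perm finD, of "st v"] by (simp add: start_def)
    next
      case False
      obtain p where p: "p \<in> L v" "next_in (L v) p = k" "p < k"
        using ex_next_in[OF finL less.prems] False by blast
      have "enc v p False \<in> orbit R (st v)" by (rule less.IH[OF p(3,1)])
      then have "R (R (enc v p False)) \<in> orbit R (st v)" by (intro orbit.step)
      then show ?thesis using p by (simp add: R_False R_True)
    qed
  qed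
  have F1: "enc v k b \<in> orbit R (st v)" if "k \<in> L v" for k b
  proof (cases b)
    case True
    have "R (enc v k False) \<in> orbit R (st v)" using F0[OF that] by (rule orbit.step)
    then show ?thesis using that True by (simp add: R_False)
  qed (use F0[OF that] in simp)
  have "orbit R (enc v l b) = orbit R (st v)" by (rule eq[OF F1[OF assms]])
  moreover have "orbit R (st v) \<subseteq> vset v"
  proof
    fix d assume "d \<in> orbit R (st v)"
    then show "d \<in> vset v"
    proof induction
      case base
      then show ?case using start_D[OF v] by (auto simp: vset_def start_def R_False)
    next
      case (step d)
      then obtain k b where "d = enc v k b" "k \<in> L v" by (auto simp: vset_def)
      then show ?case using next_L[of k v] by (cases b) (auto simp: vset_def R_True R_False)
    qed
  qed
  moreover have "vset v \<subseteq> orbit R (st v)" using F1 by (auto simp: vset_def)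
  ultimately show ?thesis by blast
qed

lemma vertex_canon: "l \<in> L v \<Longrightarrow> vertex (canon A ss c) (enc v l b) = vset v"
  by (simp add: vertex_def orbit_R)

lemma vset_inj: "v \<in> A \<Longrightarrow> vset v = vset w \<Longrightarrow> v = w"
proof -
  assume v: "v \<in> A" and eq: "vset v = vset w"
  have "st v \<in> vset v" using start_D[OF v] by (auto simp: vset_def start_def)
  then have "st v \<in> vset w" using eq by simp
  then show "v = w" by (auto simp: vset_def start_def)
qed

lemma vertices_canon: "vertices (canon A ss c) = vset ` A"
proof (intro equalityI subsetI)
  fix X assume "X \<in> vertices (canon A ss c)"
  then obtain d where "d \<in> D" "X = vertex (canon A ss c) d" by (auto simp: vertices_def)
  then show "X \<in> vset ` A" by (metis D_cases L_A vertex_canon imageI)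
next
  fix X assume "X \<in> vset ` A"
  then obtain v where v: "v \<in> A" "X = vset v" by blast
  then have "X = vertex (canon A ss c) (st v)" using start_D by (simp add: start_def vertex_canon)
  then show "X \<in> vertices (canon A ss c)" using start_D[OF v(1)] by (simp add: vertices_def start_def)
qed

lemma card_vertices_canon: "card (vertices (canon A ss c)) = card A"
  unfolding vertices_canon by (rule card_image) (use vset_inj in \<open>auto simp: inj_on_def\<close>)

lemma face_True: assumes "l \<in> L v" shows "face (canon A ss c) (enc v l True) = canon_polygon ss l"
proof -
  have l: "l < length ss" "v \<in> supp (ss ! l)" using assms by (auto simp: L)
  have o: "orbit (ss ! l) v = supp (ss ! l)" by (rule is_cyc_orbit[OF cyc[OF l(1)] l(2)])
  have "(\<lambda>x. enc x l True) ` orbit (ss ! l) v = orbit W (enc v l True)"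
  proof (rule orbit_inverse)
    show "v \<in> orbit (ss ! l) v" using o l(2) by simp
    show "W (enc x l True) = enc ((ss ! l) x) l True" if "x \<in> orbit (ss ! l) v" for x
      using that o l(1) by (intro W_True) (simp add: L)
  qed
  then show ?thesis by (simp add: face_def canon_polygon_def o)
qed

lemma orbit_F: "d \<in> D \<Longrightarrow> orbit F d = {d, F d}"
proof (intro equalityI subsetI)
  fix x assume d: "d \<in> D"
  show "x \<in> {d, F d}" if "x \<in> orbit F d" using that by induction (use FF[OF d] in auto)
  show "x \<in> orbit F d" if "x \<in> {d, F d}"
    using that self_in_orbit[OF F_perm finD, of d] orbit.base[of F d] by blast
qed

definition "black = {enc v l True |v l. l \<in> L v}"

lemma black_D: "black \<subseteq> D"
  by (auto simp: black_def)

text \<open>Exactly one dart of every edge has a polygon on its left, so edges can be counted by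
  these darts.\<close>

lemma edges_canon: "edges (canon A ss c) = (\<lambda>d. {d, F d}) ` black"
proof (intro equalityI subsetI)
  fix X assume "X \<in> edges (canon A ss c)"
  then obtain d where d: "d \<in> D" "X = {d, F d}" by (auto simp: edges_def edge_def orbit_F)
  then obtain v l b where v: "d = enc v l b" "l \<in> L v" by (metis D_cases)
  show "X \<in> (\<lambda>d. {d, F d}) ` black"
  proof (cases b)
    case True
    then have "d \<in> black" using v by (auto simp: black_def)
    then show ?thesis using d(2) by blast
  next
    case False
    then have "F d \<in> black" using v L_step_inv by (auto simp: black_def F_False)
    moreover have "X = {F d, F (F d)}" using d FF by auto
    ultimately show ?thesis by blast
  qed
next
  fix X assume "X \<in> (\<lambda>d. {d, F d}) ` black"
  then obtain d where d: "d \<in> D" "X = {d, F d}" using black_D by blast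
  then have "X = edge (canon A ss c) d" by (simp add: edge_def orbit_F)
  then show "X \<in> edges (canon A ss c)" using d(1) by (simp add: edges_def)
qed

lemma card_black: "card black = (\<Sum>s\<leftarrow>ss. csize s)"
proof -
  have "black = (\<lambda>(l, v). enc v l True) ` (SIGMA l:{..<length ss}. supp (ss ! l))"
    by (auto simp: black_def L image_iff)
  moreover have "inj_on (\<lambda>(l, v). enc v l True) (SIGMA l:{..<length ss}. supp (ss ! l))"
    by (auto simp: inj_on_def)
  moreover have "finite (supp (ss ! l))" if "l < length ss" for l
    using is_cyc_supp[OF cyc[OF that]] A finite_subset by blast
  ultimately have "card black = (\<Sum>l<length ss. csize (ss ! l))"
    by (simp add: card_image card_SigmaI csize_def)
  then show ?thesis by (simp add: sum_list_sum_nth atLeast0LessThan)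
qed

lemma card_edges_canon: "card (edges (canon A ss c)) = (\<Sum>s\<leftarrow>ss. csize s)"
proof -
  have "inj_on (\<lambda>d. {d, F d}) black"
  proof (rule inj_onI)
    fix d e assume de: "d \<in> black" "e \<in> black" "{d, F d} = {e, F e}"
    obtain v l where d: "d = enc v l True" "l \<in> L v" using de(1) by (auto simp: black_def)
    obtain w k where e: "e = enc w k True" "k \<in> L w" using de(2) by (auto simp: black_def)
    have "d \<noteq> F e" using d e by (simp add: F_True)
    then show "d = e" using de(3) by blast
  qed
  then show ?thesis by (simp add: edges_canon card_image card_black)
qed

text \<open>
  \<open>src v l\<close> follows a white face from the dart \<open>enc v l False\<close> back to its most recent
  passage from a largest to a smallest label.
\<close>

definition "tot = prodl ss"
definition "src v l = prodl (take l ss) v"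

lemma tot_perm: "tot permutes A"
  unfolding tot_def using perm by (intro prodl_permutes) (auto simp: in_set_conv_nth)

lemma src_A: "l \<le> length ss \<Longrightarrow> src v l \<in> A \<longleftrightarrow> v \<in> A"
proof -
  have "prodl (take l ss) permutes A"
    using perm by (intro prodl_permutes) (auto simp: in_set_conv_nth)
  then show ?thesis unfolding src_def by (rule permutes_in_image)
qed

lemma src_Suc: "l < length ss \<Longrightarrow> src v (Suc l) = src ((ss ! l) v) l"
  by (simp add: src_def take_Suc_conv_app_nth prodl_append)

lemma src_skip:
  assumes "i \<le> j" "j \<le> length ss" "\<And>k. i \<le> k \<Longrightarrow> k < j \<Longrightarrow> k \<notin> L u"
  shows "src u j = src u i"
  using assms
proof (induction j rule: dec_induct)
  case (step j)
  have "j \<notin> L u" using step by auto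
  then have "(ss ! j) u = u" using step.prems by (auto simp: L supp_def)
  then show ?case using step src_Suc[of j u] by simp
qed simp

lemma src_start: "u \<in> A \<Longrightarrow> src u (Min (L u)) = u"
proof -
  assume u: "u \<in> A"
  have "src u (Min (L u)) = src u 0"
  proof (rule src_skip)
    show "Min (L u) \<le> length ss" using start_D[OF u] by (simp add: L)
    show "k \<notin> L u" if "k < Min (L u)" for k using that Min_le[OF finL, of k u] by auto
  qed simp
  then show "src u (Min (L u)) = u" by (simp add: src_def)
qed

text \<open>A white face leads from v to its preimage u under factor l and goes on with the
  cyclically next label at u. While labels increase, \<open>src\<close> is unchanged. At a wrap all
  factors above l fix u, so the full product takes u to the old \<open>src\<close>.\<close>

lemma src_step:
  assumes l: "l \<in> L v" and u: "u = inv' (ss ! l) v"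
  shows "\<exists>k\<in>L u. l < k \<Longrightarrow> src u (next_in (L u) l) = src v l"
    and "\<not> (\<exists>k\<in>L u. l < k) \<Longrightarrow> tot u = src v l"
proof -
  have l': "l < length ss" using l by (simp add: L)
  have 1: "src u (Suc l) = src v l" using src_Suc[OF l'] s_inv(1)[OF l] u by simp
  show "src u (next_in (L u) l) = src v l" if "\<exists>k\<in>L u. l < k"
  proof -
    obtain k where k: "k \<in> L u" "l < k" using \<open>\<exists>k\<in>L u. l < k\<close> by blast
    note n = next_in_greater[OF finL k]
    have "src u (next_in (L u) l) = src u (Suc l)"
    proof (rule src_skip)
      show "j \<notin> L u" if "Suc l \<le> j" "j < next_in (L u) l" for j
        using next_in_greater(3)[OF finL, of j u l] that by auto
      show "next_in (L u) l \<le> length ss" using n(1) by (simp add: L)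
    qed (use n(2) in simp)
    then show ?thesis using 1 by simp
  qed
  show "tot u = src v l" if "\<not> (\<exists>k\<in>L u. l < k)"
  proof -
    have "src u (length ss) = src u (Suc l)"
      by (rule src_skip) (use l' that in auto)
    then show ?thesis using 1 by (simp add: src_def tot_def)
  qed
qed

end

section \<open>White faces as cycles of the product\<close>

context factors
begin

lemma tot_inv: "y \<in> A \<Longrightarrow> inv' tot y \<in> A" "tot (inv' tot y) = y" "inv' tot (tot y) = y"
  using permutes_in_image[OF permutes_inv[OF tot_perm]] permutes_inverses[OF tot_perm] by auto

text \<open>Labels increase along the face until the first wrap, and the wrap ends in a start dart;
  the induction is on the room left above l.\<close>

lemma reach_start:
  "l \<in> L v \<Longrightarrow> start ss (inv' tot (src v l)) \<in> orbit W (enc v l False)"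
proof (induction "length ss - l" arbitrary: v l rule: less_induct)
  case less
  define u where "u = inv' (ss ! l) v"
  note step = src_step[OF less.prems u_def]
  have W: "W (enc v l False) = enc u (next_in (L u) l) False"
    using W_False[OF less.prems] by (simp add: u_def)
  show ?case
  proof (cases "\<exists>k\<in>L u. l < k")
    case True
    then obtain k where k: "k \<in> L u" "l < k" by blast
    note n = next_in_greater[OF finL k]
    have "length ss - next_in (L u) l < length ss - l" using n(1,2) unfolding L by linarith
    then have "start ss (inv' tot (src u (next_in (L u) l))) \<in> orbit W (enc u (next_in (L u) l) False)"
      using n(1) by (rule less.hyps)
    then have "start ss (inv' tot (src v l)) \<in> orbit W (W (enc v l False))"
      by (simp only: W step(1)[OF True])
    then show ?thesis by (rule orbit_subset)
  next
    case False
    have "inv' tot (src v l) = u" using step(2)[OF False] tot_inv(3)[of u] by simp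
    moreover have "W (enc v l False) = start ss u" using W next_in_wrap[OF False] by (simp add: start_def)
    ultimately show ?thesis using orbit.base[of W "enc v l False"] by simp
  qed
qed

text \<open>The cycle of the product that contains \<open>src\<close> is an invariant of the white
  face.\<close>

lemma orbit_white:
  assumes "l \<in> L v" "d \<in> orbit W (enc v l False)"
  shows "\<exists>v' l'. d = enc v' l' False \<and> l' \<in> L v' \<and> src v' l' \<in> orbit tot (src v l)"
proof -
  have step: "\<exists>v' l'. W (enc w k False) = enc v' l' False \<and> l' \<in> L v' \<and> src v' l' \<in> orbit tot (src w k)"
    if k: "k \<in> L w" for w k
  proof -
    define u where "u = inv' (ss ! k) w"
    have u: "k \<in> L u" using L_step_inv[OF k] by (simp add: u_def)
    have W: "W (enc w k False) = enc u (next_in (L u) k) False" using W_False[OF k] by (simp add: u_def)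
    have n: "next_in (L u) k \<in> L u" by (rule next_L[OF u])
    have "src u (next_in (L u) k) \<in> orbit tot (src w k)"
    proof (cases "\<exists>k'\<in>L u. k < k'")
      case True
      then show ?thesis using src_step(1)[OF k u_def True] self_in_orbit[OF tot_perm A(1)] by simp
    next
      case False
      have "src u (next_in (L u) k) = u" using next_in_wrap[OF False] src_start[OF L_A[OF u]] by simp
      moreover have "tot u = src w k" by (rule src_step(2)[OF k u_def False])
      then have "u \<in> orbit tot (src w k)"
        using permutation_orbit_step[of tot u] self_in_orbit[OF tot_perm A(1), of u] tot_perm A(1) permutation_permutes
        by metis
      ultimately show ?thesis by simp
    qed
    then show ?thesis using W n by blast
  qed
  show ?thesis
    using assms(2)
  proof induction
    case base
    show ?case by (rule step[OF assms(1)])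
  next
    case (step d)
    then obtain w k where d: "d = enc w k False" "k \<in> L w" "src w k \<in> orbit tot (src v l)" by blast
    obtain v' l' where "W d = enc v' l' False" "l' \<in> L v'" "src v' l' \<in> orbit tot (src w k)"
      using \<open>\<And>w k. k \<in> L w \<Longrightarrow> \<exists>v' l'. W (enc w k False) = enc v' l' False \<and> l' \<in> L v' \<and> src v' l' \<in> orbit tot (src w k)\<close>[OF d(2)]
        d(1) by blast
    then show ?case using orbit_trans[OF _ d(3)] by blast
  qed
qed

definition "wface y = orbit W (start ss y)"

lemma face_start: "face (canon A ss c) (start ss y) = wface y"
  by (simp add: face_def wface_def)

lemma face_canon: "face (canon A ss c) d = orbit W d"
  by (simp add: face_def)

lemma wface_False: "l \<in> L v \<Longrightarrow> orbit W (enc v l False) = wface (inv' tot (src v l))"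
  unfolding wface_def by (rule orbit_eq_if_mem[OF W_perm finD reach_start, symmetric])

lemma wface_self: "start ss y \<in> wface y"
  unfolding wface_def by (rule self_in_orbit[OF W_perm finD])

text \<open>From one start dart to the next a white face applies the inverse of the product, so its
  start darts belong to exactly one cycle.\<close>

lemma start_wface_iff: assumes "y \<in> A" "z \<in> A" shows "start ss z \<in> wface y \<longleftrightarrow> z \<in> orbit tot y"
proof
  assume "start ss z \<in> wface y"
  then have "enc z (Min (L z)) False \<in> orbit W (enc y (Min (L y)) False)" by (simp add: wface_def start_def)
  from orbit_white[OF start_D[OF assms(1)] this]
  have "src z (Min (L z)) \<in> orbit tot (src y (Min (L y)))" by auto
  then show "z \<in> orbit tot y" by (simp add: src_start assms)
next
  assume "z \<in> orbit tot y"
  have p: "permutation tot" using tot_perm A(1) permutation_permutes by blast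
  have step: "start ss (inv' tot x) \<in> orbit W (start ss x)" if "x \<in> A" for x
    using reach_start[OF start_D[OF that]] by (simp add: src_start that start_def)
  have "z \<in> orbit (inv' tot) y" using \<open>z \<in> orbit tot y\<close> orbit_inv_eq[OF p, of y] by simp
  then have "start ss z \<in> wface y \<and> z \<in> A"
  proof induction
    case base
    show ?case using step[OF assms(1)] tot_inv(1)[OF assms(1)] by (simp add: wface_def)
  next
    case (step x)
    then have x: "start ss x \<in> orbit W (start ss y)" "x \<in> A" by (simp_all add: wface_def)
    have "start ss (inv' tot x) \<in> orbit W (start ss y)"
      by (rule orbit_trans[OF _ x(1)]) (use reach_start[OF start_D[OF x(2)]] in \<open>simp add: src_start x(2) start_def\<close>)
    then show ?case using tot_inv(1)[OF x(2)] by (simp add: wface_def)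
  qed
  then show "start ss z \<in> wface y" ..
qed

lemma wface_eq_iff: "y \<in> A \<Longrightarrow> z \<in> A \<Longrightarrow> wface y = wface z \<longleftrightarrow> orbit tot y = orbit tot z"
proof -
  assume yz: "y \<in> A" "z \<in> A"
  have "wface y = wface z \<longleftrightarrow> start ss y \<in> wface z"
    using wface_self[of y] orbit_eq_if_mem[OF W_perm finD, of "start ss y" "start ss z"]
    by (auto simp: wface_def)
  also have "\<dots> \<longleftrightarrow> y \<in> orbit tot z" using start_wface_iff yz by simp
  also have "\<dots> \<longleftrightarrow> orbit tot y = orbit tot z"
    using orbit_eq_if_mem[OF tot_perm A(1), of y z] self_in_orbit[OF tot_perm A(1), of y] by auto
  finally show ?thesis .
qed

lemma wface_white: "y \<in> A \<Longrightarrow> d \<in> wface y \<Longrightarrow> \<exists>v l. d = enc v l False \<and> l \<in> L v"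
  using orbit_white[OF start_D, of y d] by (auto simp: wface_def start_def)

lemma polygon_ne: "l < length ss \<Longrightarrow> canon_polygon ss l \<noteq> {}"
  using is_cyc_csize[OF cyc, of l] by (auto simp: canon_polygon_def csize_def)

lemma wface_not_polygon: assumes "y \<in> A" shows "wface y \<noteq> canon_polygon ss l"
proof
  assume "wface y = canon_polygon ss l"
  then have "start ss y \<in> canon_polygon ss l" using wface_self by blast
  then show False by (auto simp: canon_polygon_def start_def)
qed

lemma polygon_inj: "l < length ss \<Longrightarrow> canon_polygon ss l = canon_polygon ss k \<Longrightarrow> l = k"
proof -
  assume l: "l < length ss" "canon_polygon ss l = canon_polygon ss k"
  obtain d where d: "d \<in> canon_polygon ss l" using polygon_ne[OF l(1)] by blast
  then have "d \<in> canon_polygon ss k" using l(2) by simp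
  then show "l = k" using d by (auto simp: canon_polygon_def)
qed

lemma label_polygon: "l < length ss \<Longrightarrow> polygon_label (canon A ss c) (canon_polygon ss l) = Suc l"
  unfolding canon_def by (auto intro!: the_equality dest: polygon_inj)

lemma faces_canon: "faces (canon A ss c) = canon_polygon ss ` {..<length ss} \<union> wface ` A"
proof (intro equalityI subsetI)
  fix X assume "X \<in> faces (canon A ss c)"
  then obtain d where d: "d \<in> D" "X = face (canon A ss c) d" by (auto simp: faces_def)
  then obtain v l b where v: "d = enc v l b" "l \<in> L v" by (metis D_cases)
  show "X \<in> canon_polygon ss ` {..<length ss} \<union> wface ` A"
  proof (cases b)
    case True
    then have "X = canon_polygon ss l" "l < length ss" using d v face_True by (auto simp: L)
    then show ?thesis by blast
  next
    case False
    then have "X = wface (inv' tot (src v l))" using d v wface_False by (simp add: face_canon)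
    moreover have "inv' tot (src v l) \<in> A" using v L_A[OF v(2)] by (intro tot_inv(1)) (simp add: src_A L)
    ultimately show ?thesis by blast
  qed
next
  fix X assume "X \<in> canon_polygon ss ` {..<length ss} \<union> wface ` A"
  then show "X \<in> faces (canon A ss c)"
  proof
    assume "X \<in> canon_polygon ss ` {..<length ss}"
    then obtain l where l: "l < length ss" "X = canon_polygon ss l" by blast
    then obtain v where "v \<in> supp (ss ! l)" using polygon_ne[OF l(1)] by (auto simp: canon_polygon_def)
    then have v: "l \<in> L v" using l(1) by (simp add: L)
    then have "X = face (canon A ss c) (enc v l True)" using l(2) face_True by simp
    then show ?thesis using v by (simp add: faces_def)
  next
    assume "X \<in> wface ` A"
    then obtain y where y: "y \<in> A" "X = wface y" by blast
    then have "X = face (canon A ss c) (start ss y)" by (simp add: face_start)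
    then show ?thesis using start_D[OF y(1)] by (simp add: faces_def start_def)
  qed
qed

lemma white_faces_canon: "white_faces (canon A ss c) = wface ` A"
  using wface_not_polygon by (auto simp: white_faces_def faces_canon)

lemma card_wface: "card (wface ` A) = num_orbits A tot"
  unfolding num_orbits_def by (rule card_image_eq_iff[OF wface_eq_iff])

lemma card_polygons: "card (canon_polygon ss ` {..<length ss}) = length ss"
  using polygon_inj by (subst card_image) (auto simp: inj_on_def)

lemma edge_label_canon: assumes "l \<in> L v" shows "edge_label (canon A ss c) (enc v l b) = Suc l"
proof (cases b)
  case True
  then show ?thesis using face_True[OF assms] assms label_polygon by (simp add: edge_label_def L)
next
  case False
  have "face (canon A ss c) (enc v l False) \<notin> polygons (canon A ss c)"
    using wface_False[OF assms] wface_not_polygon[of "inv' tot (src v l)"] tot_inv(1)[of "src v l"] L_A[OF assms] assms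
    by (auto simp: face_canon src_A L)
  moreover have "face (canon A ss c) (flip (canon A ss c) (enc v l False)) = canon_polygon ss l"
    using face_True[OF L_step_inv[OF assms]] F_False[OF assms] by simp
  ultimately show ?thesis using False assms label_polygon by (simp add: edge_label_def L)
qed

text \<open>The face permutation maps the descents of a white face bijectively onto its start
  darts.\<close>

lemma descents_canon: assumes y: "y \<in> A" shows "descents (canon A ss c) (wface y) = card (orbit tot y)"
proof -
  let ?S = "{d \<in> wface y. edge_label (canon A ss c) d \<ge> edge_label (canon A ss c) (W d)}"
  have Wf: "W d \<in> wface y" if "d \<in> wface y" for d using that unfolding wface_def by (rule orbit.step)
  have oA: "orbit tot y \<subseteq> A" by (rule permutes_orbit_subset[OF tot_perm y])
  have "W ` ?S = start ss ` orbit tot y"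
  proof (intro equalityI subsetI)
    fix e assume "e \<in> W ` ?S"
    then obtain d where d: "d \<in> wface y" "edge_label (canon A ss c) d \<ge> edge_label (canon A ss c) (W d)" "e = W d" by blast
    obtain v l where v: "d = enc v l False" "l \<in> L v" using wface_white[OF y d(1)] by blast
    define u where "u = inv' (ss ! l) v"
    have u: "l \<in> L u" using L_step_inv[OF v(2)] by (simp add: u_def)
    have W: "W d = enc u (next_in (L u) l) False" using W_False[OF v(2)] v(1) by (simp add: u_def)
    have "\<not> (\<exists>k\<in>L u. l < k)"
    proof
      assume "\<exists>k\<in>L u. l < k"
      then obtain k where "k \<in> L u" "l < k" by blast
      then have "l < next_in (L u) l" by (rule next_in_greater(2)[OF finL])
      moreover have "edge_label (canon A ss c) d = Suc l" using edge_label_canon[OF v(2)] by (simp add: v(1))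
      moreover have "edge_label (canon A ss c) (W d) = Suc (next_in (L u) l)"
        using edge_label_canon[OF next_L[OF u]] by (simp add: W)
      ultimately show False using d(2) by simp
    qed
    then have "W d = start ss u" using W next_in_wrap by (simp add: start_def)
    moreover have "u \<in> orbit tot y"
      using Wf[OF d(1)] start_wface_iff[OF y L_A[OF u]] \<open>W d = start ss u\<close> by simp
    ultimately show "e \<in> start ss ` orbit tot y" using d(3) by blast
  next
    fix e assume "e \<in> start ss ` orbit tot y"
    then obtain u where u: "u \<in> orbit tot y" "e = start ss u" by blast
    have uA: "u \<in> A" using u(1) oA by blast
    have "start ss u \<in> wface y" using start_wface_iff[OF y uA] u(1) by simp
    \<comment> \<open>This is the dart before the start dart. Its label occurs at u, hence is at
      least the smallest label there, and a descent results.\<close>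
    then have "inv' W (start ss u) \<in> wface y"
    proof -
      have "permutation W" using W_perm finD permutation_permutes by blast
      then have "wface y = orbit (inv' W) (start ss y)" unfolding wface_def by (rule orbit_inv_eq[symmetric])
      then show ?thesis using \<open>start ss u \<in> wface y\<close> by (simp add: orbit.step)
    qed
    then obtain v l where v: "inv' W (start ss u) = enc v l False" "l \<in> L v" "enc v l False \<in> wface y"
      using wface_white[OF y] by metis
    have W: "W (enc v l False) = start ss u" using v(1) permutes_inverses(1)[OF W_perm] by metis
    define w where "w = inv' (ss ! l) v"
    have "enc w (next_in (L w) l) False = start ss u" using W W_False[OF v(2)] by (simp add: w_def)
    then have w: "w = u" "next_in (L u) l = Min (L u)" by (auto simp: start_def)
    have lu: "l \<in> L u" using L_step_inv[OF v(2)] w(1) by (simp add: w_def)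
    have "edge_label (canon A ss c) (W (enc v l False)) = Suc (Min (L u))"
      using W edge_label_canon[OF start_D[OF uA]] by (simp add: start_def)
    also have "\<dots> \<le> edge_label (canon A ss c) (enc v l False)"
      using Min_le[OF finL lu] edge_label_canon[OF v(2)] by simp
    finally have "enc v l False \<in> ?S" using v(3) by simp
    then show "e \<in> W ` ?S" using W u(2) by (metis imageI)
  qed
  moreover have "card (W ` ?S) = card ?S"
    by (rule card_image[OF inj_on_subset[OF permutes_inj[OF W_perm] subset_UNIV]])
  moreover have "card (start ss ` orbit tot y) = card (orbit tot y)"
    by (rule card_image) (auto simp: inj_on_def start_def)
  ultimately have "card ?S = card (orbit tot y)" by simp
  then show ?thesis by (simp add: descents_def)
qed

text \<open>Rotation joins all darts at a vertex, and flipping an edge of polygon l leads from a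
  vertex to its image under factor l. So sets closed under the factors correspond to sets of darts
  closed under both maps.\<close>

lemma connected_iff:
  "(\<forall>a\<in>D. \<forall>b\<in>D. (a, b) \<in> {(c, d). d = R c \<or> d = F c}\<^sup>*) \<longleftrightarrow> conn A ss"
proof
  let ?E = "{(c, d). d = R c \<or> d = F c}\<^sup>*"
  assume con: "\<forall>a\<in>D. \<forall>b\<in>D. (a, b) \<in> ?E"
  show "conn A ss"
    unfolding conn_def
  proof (intro allI impI; elim conjE)
    fix S assume S: "S \<subseteq> A" "S \<noteq> {}" "\<forall>s\<in>set ss. s ` S \<subseteq> S"
    obtain x where x: "x \<in> S" using S(2) by blast
    have fin: "finite S" using S(1) A(1) finite_subset by blast
    have im: "(ss ! l) ` S = S" if "l < length ss" for l
    proof (rule card_subset_eq[OF fin])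
      show "(ss ! l) ` S \<subseteq> S" using S(3) that by simp
      show "card ((ss ! l) ` S) = card S" 
        by (rule card_image[OF inj_on_subset[OF inj_s[OF that] subset_UNIV]])
    qed
    define T where "T = {enc v l b |v l b. v \<in> S \<and> l \<in> L v}"
    have closed: "R d \<in> T \<and> F d \<in> T" if "d \<in> T" for d
    proof -
      obtain v l b where d: "d = enc v l b" "v \<in> S" "l \<in> L v" using \<open>d \<in> T\<close> by (auto simp: T_def)
      have l: "l < length ss" using d(3) by (simp add: L)
      have "(ss ! l) v \<in> S" using im[OF l] d(2) by blast
      moreover have "inv' (ss ! l) v \<in> S"
      proof -
        obtain w where "w \<in> S" "v = (ss ! l) w" using im[OF l] d(2) by blast
        then show ?thesis using inj_s[OF l] by simp
      qed
      ultimately show ?thesis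
        using d next_L[OF d(3)] L_step[OF d(3)] L_step_inv[OF d(3)]
        by (cases b) (auto simp: T_def R_True R_False F_True F_False)
    qed
    have "A \<subseteq> S"
    proof
      fix y assume y: "y \<in> A"
      have "x \<in> A" using x S(1) by blast
      have "start ss x \<in> D" "start ss y \<in> D"
        using start_D[OF \<open>x \<in> A\<close>] start_D[OF y] by (simp_all add: start_def)
      then have "(start ss x, start ss y) \<in> ?E" using con by blast
      moreover have "start ss x \<in> T" using x start_D[OF \<open>x \<in> A\<close>] by (auto simp: T_def start_def)
      ultimately have "start ss y \<in> T"
        by (induction rule: rtrancl_induct) (use closed in auto)
      then show "y \<in> S" by (auto simp: T_def start_def)
    qed
    then show "S = A" using S(1) by blast
  qed
next
  let ?E = "{(c, d). d = R c \<or> d = F c}\<^sup>*"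
  assume c: "conn A ss"
  have R_E: "(a, R d) \<in> ?E" if "(a, d) \<in> ?E" for a d using that by (rule rtrancl_into_rtrancl) simp
  have F_E: "(a, F d) \<in> ?E" if "(a, d) \<in> ?E" for a d using that by (rule rtrancl_into_rtrancl) simp
  have orb: "(a, e) \<in> ?E" if "(a, d) \<in> ?E" "e \<in> orbit R d" for a d e
    using that(2) by induction (use that(1) R_E in auto)
  have vs: "(a, e) \<in> ?E" if "(a, enc v l b) \<in> ?E" "l \<in> L v" "e \<in> vset v" for a v l b e
    using orb[OF that(1)] that(3) orbit_R[OF that(2)] by simp
  show "\<forall>a\<in>D. \<forall>b\<in>D. (a, b) \<in> ?E"
  proof (intro ballI)
    fix a b assume a: "a \<in> D" and b: "b \<in> D"
    obtain v0 l0 b0 where v0: "a = enc v0 l0 b0" "l0 \<in> L v0" using a by (rule D_cases)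
    obtain v1 l1 b1 where v1: "b = enc v1 l1 b1" "l1 \<in> L v1" using b by (rule D_cases)
    define S where "S = {v\<in>A. \<forall>e\<in>vset v. (a, e) \<in> ?E}"
    have "S = A"
    proof (rule connD[OF c])
      show "v0 \<in> S" using vs[of a v0 l0 b0] v0 L_A[OF v0(2)] by (auto simp: S_def)
      show "S \<subseteq> A" by (auto simp: S_def)
      fix s assume "s \<in> set ss"
      then obtain l where l: "l < length ss" "s = ss ! l" by (metis in_set_conv_nth)
      show "s ` S \<subseteq> S"
      proof (rule image_subsetI)
        fix v assume v: "v \<in> S"
        show "s v \<in> S"
        proof (cases "l \<in> L v")
          case True
          have "enc v l True \<in> vset v" using True by (auto simp: vset_def)
          then have "(a, enc v l True) \<in> ?E" using v by (simp add: S_def)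
          then have "(a, F (enc v l True)) \<in> ?E" by (rule F_E)
          then have "(a, enc (s v) l False) \<in> ?E" using F_True[OF True] l(2) by simp
          then have "\<forall>e\<in>vset (s v). (a, e) \<in> ?E" using vs L_step[OF True] l(2) by blast
          then show ?thesis using L_A[OF L_step[OF True]] l(2) by (simp add: S_def)
        next
          case False
          then have "s v = v" using l by (auto simp: L supp_def)
          then show ?thesis using v by simp
        qed
      qed
    qed
    then have "v1 \<in> S" using L_A[OF v1(2)] by simp
    moreover have "b \<in> vset v1" using v1 by (auto simp: vset_def)
    ultimately show "(a, b) \<in> ?E" by (simp add: S_def)
  qed
qed

lemma D_ne: "D \<noteq> {}"
proof -
  obtain v where "v \<in> A" using A(2) by blast
  then show ?thesis using D_enc[of v "Min (L v)" True] start_D by blast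
qed

text \<open>Vertices are the points, edges number the sum of the cycle lengths, and there is one
  face for each factor and for each cycle of the product. With these numbers Euler's formula is the
  minimality equation.\<close>

lemma planar_canon_iff:
  "planar_map (canon A ss c) \<longleftrightarrow> conn A ss \<and> card A + num_orbits A tot = (\<Sum>s\<leftarrow>ss. csize s - 1) + 2"
proof -
  have "(\<Sum>s\<leftarrow>ss. csize s) = (\<Sum>s\<leftarrow>ss. csize s - 1) + length ss"
  proof -
    have "(\<Sum>s\<leftarrow>ts. csize s) = (\<Sum>s\<leftarrow>ts. csize s - 1) + length ts" if "set ts \<subseteq> set ss" for ts
      using that
    proof (induction ts)
      case (Cons t ts)
      then obtain l where "l < length ss" "t = ss ! l" by (metis in_set_conv_nth insert_subset list.simps(15))
      then have "csize t \<ge> 2" using is_cyc_csize[OF cyc] by simp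
      then show ?case using Cons by simp
    qed simp
    then show ?thesis by blast
  qed
  moreover have "card (faces (canon A ss c)) = length ss + num_orbits A tot"
  proof -
    have "card (canon_polygon ss ` {..<length ss} \<union> wface ` A) = card (canon_polygon ss ` {..<length ss}) + card (wface ` A)"
      using A(1) wface_not_polygon by (intro card_Un_disjoint) auto
    then show ?thesis by (simp add: faces_canon card_polygons card_wface)
  qed
  ultimately have euler: "int (card (vertices (canon A ss c))) - int (card (edges (canon A ss c))) + int (card (faces (canon A ss c))) = 2
      \<longleftrightarrow> card A + num_orbits A tot = (\<Sum>s\<leftarrow>ss. csize s - 1) + 2"
    unfolding card_vertices_canon card_edges_canon by linarith
  show ?thesis
    unfolding planar_map_def euler canon_simps connected_iff
    using finD D_ne R_perm F_perm FF F_ne by blast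
qed

end

section \<open>Properness, smoothness and poly-index of the constructed map\<close>

context factors
begin

lemma white_not_polygon: assumes "l \<in> L v" shows "face (canon A ss c) (enc v l False) \<notin> canon_polygon ss ` {..<length ss}"
proof -
  have "inv' tot (src v l) \<in> A" using assms L_A[OF assms] by (intro tot_inv(1)) (simp add: src_A L)
  then show ?thesis using wface_False[OF assms] wface_not_polygon by (auto simp: face_canon)
qed

lemma black_polygon: "l \<in> L v \<Longrightarrow> face (canon A ss c) (enc v l True) \<in> canon_polygon ss ` {..<length ss}"
  using face_True[of l v c] by (auto simp: L)

lemma polymap_canon: assumes "planar_map (canon A ss c)" shows "polymap (canon A ss c)"
  unfolding polymap_def canon_simps
proof (intro conjI ballI)
  show "planar_map (canon A ss c)" by fact
  show "canon_polygon ss ` {..<length ss} \<subseteq> faces (canon A ss c)" by (auto simp: faces_canon)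
next
  fix d assume "d \<in> D"
  then obtain v l b where d: "d = enc v l b" "l \<in> L v" by (rule D_cases)
  show "face (canon A ss c) d \<in> canon_polygon ss ` {..<length ss} \<longleftrightarrow>
      face (canon A ss c) (F d) \<notin> canon_polygon ss ` {..<length ss}"
  proof (cases b)
    case True
    then show ?thesis
      using black_polygon[OF d(2)] white_not_polygon[OF L_step[OF d(2)]] by (simp add: d(1) F_True[OF d(2)])
  next
    case False
    then show ?thesis
      using white_not_polygon[OF d(2)] black_polygon[OF L_step_inv[OF d(2)]] by (simp add: d(1) F_False[OF d(2)])
  qed
next
  fix f assume "f \<in> canon_polygon ss ` {..<length ss}"
  then obtain l where l: "l < length ss" "f = canon_polygon ss l" by blast
  have mem: "\<exists>v. d = enc v l True \<and> l \<in> L v" if "d \<in> f" for d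
    using that l by (auto simp: canon_polygon_def L)
  show "inj_on (vertex (canon A ss c)) f"
  proof (rule inj_onI)
    fix d e assume de: "d \<in> f" "e \<in> f" "vertex (canon A ss c) d = vertex (canon A ss c) e"
    obtain v where v: "d = enc v l True" "l \<in> L v" using mem[OF de(1)] by blast
    obtain w where w: "e = enc w l True" "l \<in> L w" using mem[OF de(2)] by blast
    have "vset v = vset w" using de(3) vertex_canon[OF v(2)] vertex_canon[OF w(2)] by (simp add: v(1) w(1))
    then show "d = e" using vset_inj[OF L_A[OF v(2)]] v w by simp
  qed
  show "inj_on (edge (canon A ss c)) f"
  proof (rule inj_onI)
    fix d e assume de: "d \<in> f" "e \<in> f" "edge (canon A ss c) d = edge (canon A ss c) e"
    obtain v where v: "d = enc v l True" "l \<in> L v" using mem[OF de(1)] by blast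
    obtain w where w: "e = enc w l True" "l \<in> L w" using mem[OF de(2)] by blast
    have "d \<in> D" "e \<in> D" using v w by simp_all
    then have "{d, F d} = {e, F e}" using de(3) by (simp add: edge_def orbit_F)
    moreover have "d \<noteq> F e" using v w by (simp add: F_True)
    ultimately show "d = e" by blast
  qed
qed

lemma loopless_canon: "loopless (canon A ss c)"
  unfolding loopless_def canon_simps
proof
  fix d assume "d \<in> D"
  then obtain v l b where d: "d = enc v l b" "l \<in> L v" by (rule D_cases)
  have ne: "(ss ! l) v \<noteq> v" using d(2) by (simp add: L supp_def)
  have ne': "inv' (ss ! l) v \<noteq> v" using ne s_inv(1)[OF d(2)] by metis
  note v = vset_inj[OF L_A[OF d(2)]]
  show "vertex (canon A ss c) d \<noteq> vertex (canon A ss c) (F d)"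
  proof (cases b)
    case True
    have "vset v \<noteq> vset ((ss ! l) v)" using ne v by metis
    then show ?thesis using True d(1) vertex_canon[OF d(2)] vertex_canon[OF L_step[OF d(2)]] F_True[OF d(2)] by simp
  next
    case False
    have "vset v \<noteq> vset (inv' (ss ! l) v)" using ne' v by metis
    then show ?thesis using False d(1) vertex_canon[OF d(2)] vertex_canon[OF L_step_inv[OF d(2)]] F_False[OF d(2)] by simp
  qed
qed

text \<open>The tour begins at the start dart: positions 2i and 2i + 1 hold the white and the black
  dart of the i-th smallest label, counted from 0.\<close>

lemma increasing_canon: assumes v: "v \<in> A" shows "increasing_rotator (canon A ss c) (vset v)"
proof -
  let ?M = "canon A ss c"
  define ls where "ls = sorted_list_of_set (L v)"
  define k where "k = length ls"
  have ls: "sorted_wrt (<) ls" "set ls = L v" "k = card (L v)"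
    using finL by (simp_all add: ls_def k_def strict_sorted_list_of_set)
  have kpos: "0 < k" using finL cover[OF v] by (simp add: ls(3) card_gt_0_iff)
  have nth: "ls ! i \<in> L v" if "i < k" for i using nth_mem[of i ls] that ls(2) unfolding k_def by blast
  have mono: "ls ! i < ls ! j" if "i < j" "j < k" for i j
    using sorted_wrt_nth_less[OF ls(1)] that by (simp add: k_def)
  have hd: "Min (L v) = ls ! 0"
  proof (rule Min_eqI[OF finL])
    fix x assume "x \<in> L v"
    then obtain i where "i < k" "x = ls ! i" using ls(2) by (metis in_set_conv_nth k_def)
    then show "ls ! 0 \<le> x" using mono[of 0 i] by (cases "i = 0") auto
  qed (use nth kpos in simp)
  have next_ls: "next_in (L v) (ls ! i) = ls ! Suc i" if "Suc i < k" for i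
  proof (rule next_in_eqI[OF finL nth[OF that] mono[OF lessI that]])
    fix x assume x: "x \<in> L v" "ls ! i < x"
    then obtain j where j: "j < k" "x = ls ! j" using ls(2) by (metis in_set_conv_nth k_def)
    have "i < j"
    proof (rule ccontr)
      assume "\<not> i < j"
      then have "j = i \<or> j < i" by auto
      then show False using x(2) j mono[of j i] that by auto
    qed
    then show "ls ! Suc i \<le> x" using mono[of "Suc i" j] j by (cases "j = Suc i") auto
  qed
  have pow: "(R ^^ (2 * i)) (start ss v) = enc v (ls ! i) False" if "i < k" for i
    using that
  proof (induction i)
    case 0
    then show ?case by (simp add: start_def hd)
  next
    case (Suc i)
    then have i: "i < k" by simp
    have "(R ^^ (2 * Suc i)) (start ss v) = R (R (enc v (ls ! i) False))" using Suc i by simp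
    also have "\<dots> = enc v (ls ! Suc i) False"
      using R_False[OF nth[OF i]] R_True[OF nth[OF i]] next_ls[OF Suc.prems] by simp
    finally show ?case .
  qed
  have pow1: "(R ^^ Suc (2 * i)) (start ss v) = enc v (ls ! i) True" if "i < k" for i
    using pow[OF that] R_False[OF nth[OF that]] by simp
  have Rp: "permutation R" using R_perm finD permutation_permutes by blast
  have lp: "least_power R (start ss v) = 2 * k"
  proof -
    have "least_power R (start ss v) = card (vset v)"
      using length_support_eq_card_orbit[OF Rp, of "start ss v"] orbit_R[OF start_D[OF v]] by (simp add: start_def)
    also have "vset v = (\<lambda>(l, b). enc v l b) ` (L v \<times> UNIV)" by (auto simp: vset_def image_iff)
    also have "card \<dots> = 2 * k"
      by (subst card_image) (auto simp: inj_on_def card_cartesian_product ls(3))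
    finally show ?thesis .
  qed
  let ?xs = "map (face ?M) (support R (start ss v))"
  have face_even: "?xs ! j \<notin> polygons ?M" if "j < 2 * k" "even j" for j
  proof -
    from that(2) obtain i where "j = 2 * i" by blast
    then have i: "j = 2 * i" "i < k" using that(1) by auto
    have "?xs ! j = face ?M (enc v (ls ! i) False)" using that(1) pow[OF i(2)] by (simp add: lp i(1))
    then show ?thesis using white_not_polygon[OF nth[OF i(2)]] by simp
  qed
  have face_odd: "polygon_label ?M (?xs ! j) = Suc (ls ! (j div 2))" if "j < 2 * k" "odd j" for j
  proof -
    from that(2) obtain i where "j = 2 * i + 1" by (rule oddE)
    then have i: "j = Suc (2 * i)" "i < k" using that(1) by auto
    have "?xs ! j = face ?M (enc v (ls ! i) True)" using that(1) pow1[OF i(2)] by (simp add: lp i(1))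
    then have "?xs ! j = canon_polygon ss (ls ! i)" using face_True[OF nth[OF i(2)]] by simp
    then show ?thesis using label_polygon nth[OF i(2)] i(1) by (simp add: L)
  qed
  have "sorted_wrt (<) (map (polygon_label ?M) (filter (\<lambda>f. f \<in> polygons ?M) ?xs))"
    unfolding sorted_wrt_map_filter_iff
  proof (intro allI impI)
    fix i j assume ij: "i < j" "j < length ?xs" "?xs ! i \<in> polygons ?M" "?xs ! j \<in> polygons ?M"
    have j: "j < 2 * k" using ij(2) by (simp add: lp)
    have "odd i" "odd j" using face_even[of i] face_even[of j] ij j by auto
    then have "i div 2 < j div 2" "j div 2 < k" using ij(1) j by (auto elim!: oddE)
    then have "ls ! (i div 2) < ls ! (j div 2)" using mono by blast
    then show "polygon_label ?M (?xs ! i) < polygon_label ?M (?xs ! j)"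
      using face_odd[of i] face_odd[of j] \<open>odd i\<close> \<open>odd j\<close> ij(1) j by simp
  qed
  moreover have "start ss v \<in> vset v" using start_D[OF v] by (auto simp: vset_def start_def)
  ultimately show ?thesis
    unfolding increasing_rotator_def rotator_from_def canon_simps by blast
qed

lemma proper_canon: assumes "planar_map (canon A ss c)" shows "proper (canon A ss c)"
  unfolding proper_def
proof (intro conjI ballI polymap_canon[OF assms] loopless_canon)
  have "bij_betw Suc {..<length ss} {1..length ss}"
    by (simp add: bij_betw_def image_Suc_lessThan)
  moreover have "bij_betw (canon_polygon ss) {..<length ss} (polygons (canon A ss c))"
    using polygon_inj by (auto simp: bij_betw_def inj_on_def)
  moreover have "(polygon_label (canon A ss c) \<circ> canon_polygon ss) l = Suc l" if "l \<in> {..<length ss}" for l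
    using label_polygon that by simp
  ultimately show "bij_betw (polygon_label (canon A ss c)) (polygons (canon A ss c)) {1..card (polygons (canon A ss c))}"
    using bij_betw_comp_iff[of "canon_polygon ss" "{..<length ss}" "polygons (canon A ss c)" "polygon_label (canon A ss c)" "{1..length ss}"]
      bij_betw_cong[of "{..<length ss}" "polygon_label (canon A ss c) \<circ> canon_polygon ss" Suc "{1..length ss}"]
    by (simp add: card_polygons)
next
  fix v assume "v \<in> vertices (canon A ss c)"
  then show "increasing_rotator (canon A ss c) v" using increasing_canon by (auto simp: vertices_canon)
qed

text \<open>\<open>canon\<close> reads the label at some start dart of the face. All of these belong
  to one cycle of the product, on which c is constant.\<close>

lemma face_label_canon:
  assumes c: "\<And>x. x \<in> A \<Longrightarrow> c (tot x) = c x" and u: "u \<in> A" "start ss u \<in> f" and f: "f \<in> wface ` A"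
  shows "face_label (canon A ss c) f = Suc (c u)"
proof -
  let ?w = "SOME u. u \<in> A \<and> start ss u \<in> f"
  have w: "?w \<in> A \<and> start ss ?w \<in> f" using someI[of "\<lambda>u. u \<in> A \<and> start ss u \<in> f" u] u by blast
  obtain y where y: "y \<in> A" "f = wface y" using f by blast
  have "c z = c y" if z: "z \<in> orbit tot y" for z
  proof -
    have "c z = c y \<and> z \<in> A"
      using z by induction (use c y(1) permutes_in_image[OF tot_perm] in auto)
    then show ?thesis ..
  qed
  then have "c ?w = c u" using start_wface_iff[OF y(1)] w u y(2) by metis
  then show ?thesis by (simp add: canon_def)
qed

text \<open>Faces are numbered from 1 and cycles from 0, hence the shift by \<open>Suc\<close>.
  Injectivity of the face labels says that c separates cycles, and the descents give the class
  sizes.\<close>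

lemma theta_proper_canon_iff:
  assumes c: "\<And>x. x \<in> A \<Longrightarrow> c (tot x) = c x" "c \<in> extensional A"
  shows "theta_proper \<theta> (canon A ss c) \<longleftrightarrow> (ss, c) \<in> FacS A (length \<theta>) ((!) \<theta>)"
proof -
  let ?M = "canon A ss c" and ?m = "length \<theta>"
  have fl: "face_label ?M (wface y) = Suc (c y)" if "y \<in> A" for y
    using face_label_canon[of c y "wface y"] c(1) that wface_self[of y] by blast
  have cyc': "\<forall>s\<in>set ss. is_cyc A s" using cyc by (auto simp: in_set_conv_nth)
  have class_orbit: "{x\<in>A. c x = c y} = orbit tot y" if "cycle_labelling A ?m tot c" "y \<in> A" for y
    using cycle_labelling_orbit_iff[OF that(1) tot_perm A(1) that(2)] permutes_orbit_subset[OF tot_perm that(2)] by blast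
  show ?thesis
  proof
    assume th: "theta_proper \<theta> ?M"
    then have pr: "planar_map ?M" and bij: "bij_betw (face_label ?M) (wface ` A) {1..?m}"
      and desc: "\<And>y. y \<in> A \<Longrightarrow> card (orbit tot y) = \<theta> ! c y"
      using fl descents_canon[of _ c]
      by (auto simp: theta_proper_def proper_def polymap_def white_faces_canon)
    have "cycle_labelling A ?m tot c"
    proof (rule cycle_labellingI[OF tot_perm A(1) c(2)])
      have "face_label ?M ` wface ` A = Suc ` c ` A" using fl by (simp add: image_image)
      then have "Suc ` c ` A = Suc ` {..<?m}" using bij by (simp add: bij_betw_def image_Suc_lessThan)
      then show "c ` A = {..<?m}" using inj_image_eq_iff[OF inj_Suc] by blast
      show "c y = c x \<longleftrightarrow> y \<in> orbit tot x" if x: "x \<in> A" and y: "y \<in> A" for x y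
      proof -
        have "c y = c x \<longleftrightarrow> face_label ?M (wface y) = face_label ?M (wface x)" using fl x y by simp
        also have "\<dots> \<longleftrightarrow> wface y = wface x"
          using bij x y by (auto simp: bij_betw_def dest: inj_onD)
        also have "\<dots> \<longleftrightarrow> y \<in> orbit tot x"
          using wface_eq_iff[OF y x] orbit_eq_if_mem[OF tot_perm A(1), of y x] self_in_orbit[OF tot_perm A(1), of y] by auto
        finally show ?thesis .
      qed
    qed
    moreover have "num_orbits A tot = ?m" by (rule num_orbits_labelling[OF calculation tot_perm A(1)])
    moreover have "card {x\<in>A. c x = j} = \<theta> ! j" if "j < ?m" for j
    proof -
      have "j \<in> c ` A" using calculation(1) that by (simp add: cycle_labelling_def)
      then obtain y where y: "y \<in> A" "j = c y" by blast
      then show ?thesis using class_orbit[OF calculation(1) y(1)] desc[OF y(1)] by simp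
    qed
    ultimately show "(ss, c) \<in> FacS A ?m ((!) \<theta>)"
      using pr[unfolded planar_canon_iff] cyc' by (simp add: FacS_def Fac_def tot_def)
  next
    assume fs: "(ss, c) \<in> FacS A ?m ((!) \<theta>)"
    then have lab: "cycle_labelling A ?m tot c" by (simp add: FacS_def Fac_def tot_def)
    have "planar_map ?M"
      using fs num_orbits_labelling[OF lab tot_perm A(1)] by (simp add: planar_canon_iff FacS_def Fac_def)
    moreover have "bij_betw (face_label ?M) (wface ` A) {1..?m}"
      unfolding bij_betw_def
    proof
      show "inj_on (face_label ?M) (wface ` A)"
      proof (rule inj_onI)
        fix f g assume fg: "f \<in> wface ` A" "g \<in> wface ` A" "face_label ?M f = face_label ?M g"
        obtain y z where y: "y \<in> A" "f = wface y" and z: "z \<in> A" "g = wface z" using fg(1,2) by blast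
        have "c y = c z" using fg(3) fl y z by simp
        then have "y \<in> orbit tot z" using cycle_labelling_orbit_iff[OF lab tot_perm A(1) z(1) y(1)] by simp
        then show "f = g" using wface_eq_iff[OF y(1) z(1)] orbit_eq_if_mem[OF tot_perm A(1)] y z by simp
      qed
      have "face_label ?M ` wface ` A = Suc ` c ` A" using fl by (simp add: image_image)
      then show "face_label ?M ` wface ` A = {1..?m}"
        using lab by (simp add: cycle_labelling_def image_Suc_lessThan)
    qed
    moreover have "descents ?M f = \<theta> ! (face_label ?M f - 1)" if "f \<in> wface ` A" for f
    proof -
      obtain y where y: "y \<in> A" "f = wface y" using \<open>f \<in> wface ` A\<close> by blast
      have "c y < ?m" using lab y(1) by (auto simp: cycle_labelling_def)
      then have "card (orbit tot y) = \<theta> ! c y" using class_orbit[OF lab y(1)] fs by (auto simp: FacS_def)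
      then show ?thesis using descents_canon[OF y(1), of c] fl[OF y(1)] by (simp add: y(2))
    qed
    ultimately show "theta_proper \<theta> ?M"
      unfolding theta_proper_def white_faces_canon using proper_canon by blast
  qed
qed

text \<open>A vertex lies on polygon l exactly if factor l moves the point, so shared vertices are
  shared points.\<close>

lemma leaf_canon_iff: assumes l: "l < length ss" shows "leaf (canon A ss c) (canon_polygon ss l) \<longleftrightarrow> card (shared ss l) = 1"
proof -
  have meet: "vset v \<inter> canon_polygon ss k \<noteq> {} \<longleftrightarrow> v \<in> supp (ss ! k)" if "k < length ss" for v k
    using that by (auto simp: vset_def canon_polygon_def L)
  have "{v \<in> vset ` A. v \<inter> canon_polygon ss l \<noteq> {} \<and>
      (\<exists>p'\<in>canon_polygon ss ` {..<length ss}. p' \<noteq> canon_polygon ss l \<and> v \<inter> p' \<noteq> {})} = vset ` shared ss l"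
  proof (intro equalityI subsetI)
    fix X assume "X \<in> {v \<in> vset ` A. v \<inter> canon_polygon ss l \<noteq> {} \<and>
      (\<exists>p'\<in>canon_polygon ss ` {..<length ss}. p' \<noteq> canon_polygon ss l \<and> v \<inter> p' \<noteq> {})}"
    then obtain v k where "X = vset v" "vset v \<inter> canon_polygon ss l \<noteq> {}" "k < length ss"
      "canon_polygon ss k \<noteq> canon_polygon ss l" "vset v \<inter> canon_polygon ss k \<noteq> {}" by blast
    moreover from this have "k \<noteq> l" by blast
    ultimately have "X = vset v" "v \<in> shared ss l" using meet l by (auto simp: shared_def)
    then show "X \<in> vset ` shared ss l" by blast
  next
    fix X assume "X \<in> vset ` shared ss l"
    then obtain v k where v: "X = vset v" "v \<in> supp (ss ! l)" "k < length ss" "k \<noteq> l" "v \<in> supp (ss ! k)"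
      by (auto simp: shared_def)
    then have "canon_polygon ss k \<noteq> canon_polygon ss l" using polygon_inj by blast
    moreover have "v \<in> A" using v(2) is_cyc_supp[OF cyc[OF l]] by blast
    moreover have "vset v \<inter> canon_polygon ss l \<noteq> {}" using meet[OF l] v(2) by simp
    moreover have "vset v \<inter> canon_polygon ss k \<noteq> {}" using meet[OF v(3)] v(5) by simp
    ultimately show "X \<in> {v \<in> vset ` A. v \<inter> canon_polygon ss l \<noteq> {} \<and>
      (\<exists>p'\<in>canon_polygon ss ` {..<length ss}. p' \<noteq> canon_polygon ss l \<and> v \<inter> p' \<noteq> {})}"
      unfolding v(1) by (intro CollectI conjI imageI bexI[of _ "canon_polygon ss k"]) (use v(3) in simp_all)
  qed
  moreover have "inj_on vset (shared ss l)"
  proof (rule inj_onI)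
    fix v w assume "v \<in> shared ss l" "w \<in> shared ss l" "vset v = vset w"
    then show "v = w" using vset_inj is_cyc_supp[OF cyc[OF l]] by (auto simp: shared_def)
  qed
  ultimately show ?thesis using l by (simp add: leaf_def vertices_canon card_image)
qed

lemma smooth_canon_iff: "smooth (canon A ss c) \<longleftrightarrow> leaf_positions ss = {}"
proof
  assume "smooth (canon A ss c)"
  then show "leaf_positions ss = {}" using leaf_canon_iff by (auto simp: smooth_def leaf_positions_def)
next
  assume e: "leaf_positions ss = {}"
  show "smooth (canon A ss c)"
    unfolding smooth_def
  proof
    assume "\<exists>p. leaf (canon A ss c) p"
    then obtain p where p: "leaf (canon A ss c) p" by blast
    then obtain l where "l < length ss" "p = canon_polygon ss l" by (auto simp: leaf_def)
    then have "l \<in> leaf_positions ss" using p leaf_canon_iff by (simp add: leaf_positions_def)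
    then show False using e by blast
  qed
qed

lemma has_poly_index_canon_iff: "has_poly_index (canon A ss c) i \<longleftrightarrow> has_type i ss"
proof -
  have "card {p \<in> canon_polygon ss ` {..<length ss}. card p = k} = length (filter (\<lambda>s. csize s = k) ss)" for k
  proof -
    have cp: "card (canon_polygon ss l) = csize (ss ! l)" for l
      unfolding canon_polygon_def csize_def by (rule card_image) (simp add: inj_on_def)
    have "{p \<in> canon_polygon ss ` {..<length ss}. card p = k} = canon_polygon ss ` {l. l < length ss \<and> csize (ss ! l) = k}"
      using cp by auto
    moreover have "inj_on (canon_polygon ss) {l. l < length ss \<and> csize (ss ! l) = k}"
      using polygon_inj by (auto simp: inj_on_def)
    ultimately show ?thesis by (simp add: card_image length_filter_conv_card)
  qed
  then show ?thesis by (auto simp: has_poly_index_def has_type_def)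
qed

end

text \<open>A point moved by no factor is an invariant set, hence all of A; but one point carries
  only one label, against m >= 2.\<close>

lemma factors_of_Fac:
  assumes "finite A" "(ss, c) \<in> Fac A m" "2 \<le> m" shows "factors A ss"
proof
  have cyc: "is_cyc A (ss ! l)" if "l < length ss" for l using assms(2) that by (auto simp: Fac_def)
  then show "is_cyc A (ss ! l)" if "l < length ss" for l using that .
  have im: "c ` A = {..<m}" by (rule Fac_image[OF assms(2)])
  then show "A \<noteq> {}" using assms(3) by (metis image_empty lessThan_empty_iff not_numeral_le_zero)
  show "finite A" by fact
  fix v assume v: "v \<in> A"
  show "labels_at ss v \<noteq> {}"
  proof
    assume e: "labels_at ss v = {}"
    have "{v} = A"
    proof (rule connD[of A ss _ v])
      show "conn A ss" using assms(2) by (simp add: Fac_def)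
      show "s ` {v} \<subseteq> {v}" if s: "s \<in> set ss" for s
      proof -
        obtain l where "l < length ss" "s = ss ! l" using s by (metis in_set_conv_nth)
        then show ?thesis using e by (auto simp: labels_at_def supp_def)
      qed
    qed (use v in auto)
    then have "card (c ` A) \<le> 1" using card_image_le[of "{v}" c] by auto
    then show False using im assms(3) by simp
  qed
qed

section \<open>Isomorphisms of polymaps\<close>

text \<open>\<open>polymap_iso\<close> with its witness as a parameter, so that the witness can be
  composed, inverted and used for transport.\<close>

definition map_iso :: "('d \<Rightarrow> 'd) \<Rightarrow> 'd labelled_polymap \<Rightarrow> 'd labelled_polymap \<Rightarrow> bool" where
  "map_iso h M N \<longleftrightarrow> bij_betw h (darts M) (darts N) \<and>
     (\<forall>d\<in>darts M. h (rot M d) = rot N (h d) \<and> h (flip M d) = flip N (h d)) \<and>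
     (\<forall>f\<in>faces M. f \<in> polygons M \<longleftrightarrow> h ` f \<in> polygons N) \<and>
     (\<forall>f\<in>polygons M. polygon_label N (h ` f) = polygon_label M f) \<and>
     (\<forall>f\<in>white_faces M. face_label N (h ` f) = face_label M f)"

lemma polymap_iso_iff: "polymap_iso M N \<longleftrightarrow> (\<exists>h. map_iso h M N)"
  by (simp add: polymap_iso_def map_iso_def)

text \<open>The part of the definition of a polymap that an isomorphism does not transport: the
  permutations are the identity outside the set of darts, and no junk sets are coloured black.\<close>

definition clean :: "'d labelled_polymap \<Rightarrow> bool" where
  "clean M \<longleftrightarrow> finite (darts M) \<and> rot M permutes darts M \<and> flip M permutes darts M \<and> polygons M \<subseteq> faces M"

lemma clean_theta_proper: "theta_proper \<theta> M \<Longrightarrow> clean M"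
  by (simp add: clean_def theta_proper_def proper_def polymap_def planar_map_def)

lemma clean_faces:
  assumes "clean M"
  shows "f \<in> faces M \<Longrightarrow> f \<subseteq> darts M" "v \<in> vertices M \<Longrightarrow> v \<subseteq> darts M" "e \<in> edges M \<Longrightarrow> e \<subseteq> darts M"
    "face_perm M permutes darts M" "d \<in> darts M \<Longrightarrow> d \<in> face M d" "d \<in> darts M \<Longrightarrow> d \<in> vertex M d"
proof -
  have c: "finite (darts M)" "rot M permutes darts M" "flip M permutes darts M" using assms by (auto simp: clean_def)
  show f: "face_perm M permutes darts M" unfolding face_perm_def by (rule permutes_compose[OF c(3,2)])
  show "f \<in> faces M \<Longrightarrow> f \<subseteq> darts M" using permutes_orbit_subset[OF f] by (auto simp: faces_def face_def)
  show "v \<in> vertices M \<Longrightarrow> v \<subseteq> darts M" using permutes_orbit_subset[OF c(2)] by (auto simp: vertices_def vertex_def)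
  show "e \<in> edges M \<Longrightarrow> e \<subseteq> darts M" using permutes_orbit_subset[OF c(3)] by (auto simp: edges_def edge_def)
  show "d \<in> darts M \<Longrightarrow> d \<in> face M d" unfolding face_def by (rule self_in_orbit[OF f c(1)])
  show "d \<in> darts M \<Longrightarrow> d \<in> vertex M d" unfolding vertex_def by (rule self_in_orbit[OF c(2,1)])
qed

locale iso =
  fixes h :: "'d \<Rightarrow> 'd" and M N :: "'d labelled_polymap"
  assumes h: "map_iso h M N" and M: "clean M" and N: "clean N"
begin

lemma bij: "bij_betw h (darts M) (darts N)"
  and rot: "d \<in> darts M \<Longrightarrow> rot N (h d) = h (rot M d)"
  and flip: "d \<in> darts M \<Longrightarrow> flip N (h d) = h (flip M d)"
  and poly: "f \<in> faces M \<Longrightarrow> h ` f \<in> polygons N \<longleftrightarrow> f \<in> polygons M"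
  and plabel: "f \<in> polygons M \<Longrightarrow> polygon_label N (h ` f) = polygon_label M f"
  and flabel: "f \<in> white_faces M \<Longrightarrow> face_label N (h ` f) = face_label M f"
  using h by (auto simp: map_iso_def)

lemma finM: "finite (darts M)" and permM: "rot M permutes darts M" "flip M permutes darts M"
  and finN: "finite (darts N)" and permN: "rot N permutes darts N" "flip N permutes darts N"
  using M N by (auto simp: clean_def)

lemma inj: "inj_on h (darts M)"
  using bij by (rule bij_betw_imp_inj_on)

lemma img: "h ` darts M = darts N"
  using bij by (rule bij_betw_imp_surj_on)

lemma rotM: "d \<in> darts M \<Longrightarrow> rot M d \<in> darts M" and flipM: "d \<in> darts M \<Longrightarrow> flip M d \<in> darts M"
  using permutes_in_image[OF permM(1)] permutes_in_image[OF permM(2)] by auto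

lemma face_perm: "d \<in> darts M \<Longrightarrow> face_perm N (h d) = h (face_perm M d)"
  by (simp add: face_perm_def flip rot flipM)

text \<open>Cells are orbits, so a bijection that commutes with rotation and flip carries cells to
  cells; the rest of the locale is transport of structure.\<close>

lemma orbit_img:
  assumes "p permutes darts M" "\<And>d. d \<in> darts M \<Longrightarrow> q (h d) = h (p d)" "d \<in> darts M"
  shows "orbit q (h d) = h ` orbit p d"
proof (rule orbit_inverse[symmetric])
  show "d \<in> orbit p d" by (rule self_in_orbit[OF assms(1) finM])
  show "q (h x) = h (p x)" if "x \<in> orbit p d" for x
    using that permutes_orbit_subset[OF assms(1,3)] assms(2) by blast
qed

lemma vertex: "d \<in> darts M \<Longrightarrow> vertex N (h d) = h ` vertex M d"
  unfolding vertex_def by (rule orbit_img[OF permM(1) rot])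

lemma edge: "d \<in> darts M \<Longrightarrow> edge N (h d) = h ` edge M d"
  unfolding edge_def by (rule orbit_img[OF permM(2) flip])

lemma face: "d \<in> darts M \<Longrightarrow> face N (h d) = h ` face M d"
  unfolding face_def by (rule orbit_img[OF clean_faces(4)[OF M] face_perm])

lemma vertices: "vertices N = image h ` vertices M"
  unfolding vertices_def img[symmetric] image_image by (rule image_cong) (simp_all add: vertex)

lemma edges: "edges N = image h ` edges M"
  unfolding edges_def img[symmetric] image_image by (rule image_cong) (simp_all add: edge)

lemma faces: "faces N = image h ` faces M"
  unfolding faces_def img[symmetric] image_image by (rule image_cong) (simp_all add: face)

lemma inj_image: "inj_on (image h) (Pow (darts M))"
  using inj by (rule inj_on_image_Pow)

lemma inj_vertices: "inj_on (image h) (vertices M)" and inj_edges: "inj_on (image h) (edges M)"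
  and inj_faces: "inj_on (image h) (faces M)"
proof -
  have "vertices M \<subseteq> Pow (darts M)" "edges M \<subseteq> Pow (darts M)" "faces M \<subseteq> Pow (darts M)"
    using clean_faces(1-3)[OF M] by blast+
  then show "inj_on (image h) (vertices M)" "inj_on (image h) (edges M)" "inj_on (image h) (faces M)"
    using inj_on_subset[OF inj_image] by auto
qed

lemma polygons_faces: "polygons M \<subseteq> faces M"
  using M by (simp add: clean_def)

lemma polygons: "polygons N = image h ` polygons M"
proof (intro equalityI subsetI)
  fix p assume p: "p \<in> polygons N"
  then have "p \<in> faces N" using N by (auto simp: clean_def)
  then obtain f where f: "f \<in> faces M" "p = h ` f" by (auto simp: faces)
  then show "p \<in> image h ` polygons M" using p poly by blast
next
  fix p assume "p \<in> image h ` polygons M"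
  then show "p \<in> polygons N" using poly polygons_faces by blast
qed

lemma inj_polygons: "inj_on (image h) (polygons M)"
  using inj_on_subset[OF inj_faces polygons_faces] .

lemma white_faces: "white_faces N = image h ` white_faces M"
proof -
  have "image h ` (faces M - polygons M) = image h ` faces M - image h ` polygons M"
    by (rule inj_on_image_set_diff[OF inj_faces Diff_subset polygons_faces])
  then show ?thesis by (simp add: white_faces_def faces polygons)
qed

lemma card_img: "X \<subseteq> darts M \<Longrightarrow> card (h ` X) = card X"
  using card_image[OF inj_on_subset[OF inj]] .

lemma face_in: "d \<in> darts M \<Longrightarrow> face M d \<in> faces M"
  by (simp add: faces_def)

lemma planar: assumes p: "planar_map M" shows "planar_map N"
  unfolding planar_map_def
proof (intro conjI ballI)
  show "finite (darts N)" "rot N permutes darts N" "flip N permutes darts N" by (fact finN permN)+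
  show "darts N \<noteq> {}" using p img by (auto simp: planar_map_def)
  show "flip N d \<noteq> d" "flip N (flip N d) = d" if "d \<in> darts N" for d
  proof -
    obtain e where e: "e \<in> darts M" "d = h e" using \<open>d \<in> darts N\<close> img by blast
    have "flip M e \<noteq> e" "flip M (flip M e) = e" using p e(1) by (auto simp: planar_map_def)
    then show "flip N d \<noteq> d" "flip N (flip N d) = d"
      using e flip[OF e(1)] flip[OF flipM[OF e(1)]] flipM[OF e(1)] inj by (auto dest: inj_onD)
  qed
  show "(a, b) \<in> {(c, d). d = rot N c \<or> d = flip N c}\<^sup>*" if "a \<in> darts N" "b \<in> darts N" for a b
  proof -
    obtain x y where xy: "x \<in> darts M" "a = h x" "y \<in> darts M" "b = h y" using \<open>a \<in> darts N\<close> \<open>b \<in> darts N\<close> img by blast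
    have "(x, y) \<in> {(c, d). d = rot M c \<or> d = flip M c}\<^sup>*" using p xy by (simp add: planar_map_def)
    then have "y \<in> darts M \<and> (h x, h y) \<in> {(c, d). d = rot N c \<or> d = flip N c}\<^sup>*"
    proof (induction rule: rtrancl_induct)
      case base
      then show ?case using xy(1) by simp
    next
      case (step y z)
      then have "y \<in> darts M" "z = rot M y \<or> z = flip M y" by auto
      then have "z \<in> darts M" "h z = rot N (h y) \<or> h z = flip N (h y)"
        using rotM flipM rot flip by auto
      then show ?case using step.IH by (auto intro: rtrancl_into_rtrancl)
    qed
    then show ?thesis using xy by simp
  qed
  show "int (card (vertices N)) - int (card (edges N)) + int (card (faces N)) = 2"
    using p by (simp add: vertices edges faces card_image inj_vertices inj_edges inj_faces planar_map_def)
qed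

lemma pm: assumes p: "polymap M" shows "polymap N"
  unfolding polymap_def
proof (intro conjI ballI)
  show "planar_map N" using p planar by (simp add: polymap_def)
  show "polygons N \<subseteq> faces N" using N by (simp add: clean_def)
next
  fix d assume "d \<in> darts N"
  then obtain e where e: "e \<in> darts M" "d = h e" using img by blast
  have "face M e \<in> polygons M \<longleftrightarrow> face M (flip M e) \<notin> polygons M" using p e(1) by (simp add: polymap_def)
  then show "face N d \<in> polygons N \<longleftrightarrow> face N (flip N d) \<notin> polygons N"
    using e flipM[OF e(1)] by (simp add: flip face poly face_in)
next
  fix f assume "f \<in> polygons N"
  then obtain g where g: "g \<in> polygons M" "f = h ` g" by (auto simp: polygons)
  have gD: "g \<subseteq> darts M" using g(1) polygons_faces clean_faces(1)[OF M] by blast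
  have i: "inj_on (vertex M) g" "inj_on (edge M) g" using p g(1) by (auto simp: polymap_def)
  show "inj_on (vertex N) f"
  proof (rule inj_onI)
    fix a b assume ab: "a \<in> f" "b \<in> f" "vertex N a = vertex N b"
    obtain x y where xy: "x \<in> g" "a = h x" "y \<in> g" "b = h y" using ab g(2) by blast
    have D: "x \<in> darts M" "y \<in> darts M" using xy gD by auto
    then have "h ` vertex M x = h ` vertex M y" using ab(3) xy by (simp add: vertex)
    then have "vertex M x = vertex M y" using inj_vertices D by (auto simp: vertices_def dest: inj_onD)
    then show "a = b" using i(1) xy by (auto dest: inj_onD)
  qed
  show "inj_on (edge N) f"
  proof (rule inj_onI)
    fix a b assume ab: "a \<in> f" "b \<in> f" "edge N a = edge N b"
    obtain x y where xy: "x \<in> g" "a = h x" "y \<in> g" "b = h y" using ab g(2) by blast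
    have D: "x \<in> darts M" "y \<in> darts M" using xy gD by auto
    then have "h ` edge M x = h ` edge M y" using ab(3) xy by (simp add: edge)
    then have "edge M x = edge M y" using inj_edges D by (auto simp: edges_def dest: inj_onD)
    then show "a = b" using i(2) xy by (auto dest: inj_onD)
  qed
qed

lemma ll: assumes p: "loopless M" shows "loopless N"
  unfolding loopless_def
proof
  fix d assume "d \<in> darts N"
  then obtain e where e: "e \<in> darts M" "d = h e" using img by blast
  have "vertex M e \<noteq> vertex M (flip M e)" using p e(1) by (simp add: loopless_def)
  then have "h ` vertex M e \<noteq> h ` vertex M (flip M e)"
    using inj_vertices e(1) flipM[OF e(1)] by (auto simp: vertices_def dest: inj_onD)
  then show "vertex N d \<noteq> vertex N (flip N d)" using e flipM[OF e(1)] by (simp add: flip vertex)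
qed

lemma rot_pow: "d \<in> darts M \<Longrightarrow> (rot N ^^ i) (h d) = h ((rot M ^^ i) d) \<and> (rot M ^^ i) d \<in> darts M"
  by (induction i) (simp_all add: rot rotM)

lemma rotator_label:
  assumes d: "d \<in> darts M"
  shows "map (polygon_label N) (rotator_from N (h d)) = map (polygon_label M) (rotator_from M d)"
proof -
  have "least_power (rot N) (h d) = least_power (rot M) d"
  proof -
    have p: "permutation (rot M)" "permutation (rot N)"
      using permM permN finM finN permutation_permutes by blast+
    have "vertex M d \<in> vertices M" using d by (simp add: vertices_def)
    then have "vertex M d \<subseteq> darts M" by (rule clean_faces(2)[OF M])
    then have "card (vertex N (h d)) = card (vertex M d)" using card_img vertex[OF d] by simp
    then show ?thesis
      using length_support_eq_card_orbit[OF p(1)] length_support_eq_card_orbit[OF p(2)] by (simp add: vertex_def)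
  qed
  then have s: "support (rot N) (h d) = map h (support (rot M) d)" using rot_pow[OF d] by simp
  have sub: "set (support (rot M) d) \<subseteq> darts M" using rot_pow[OF d] by auto
  have "map (polygon_label N) (filter (\<lambda>f. f \<in> polygons N) (map (face N) (map h xs))) =
      map (polygon_label M) (filter (\<lambda>f. f \<in> polygons M) (map (face M) xs))" if "set xs \<subseteq> darts M" for xs
    using that
  proof (induction xs)
    case (Cons x xs)
    then have x: "x \<in> darts M" by simp
    then show ?case using Cons by (simp add: face poly face_in plabel)
  qed simp
  then show ?thesis unfolding rotator_from_def s using sub by blast
qed

lemma pp: assumes p: "proper M" shows "proper N"
  unfolding proper_def
proof (intro conjI ballI)
  show "polymap N" "loopless N" using p pm ll by (auto simp: proper_def)
  have b: "bij_betw (image h) (polygons M) (polygons N)" using inj_polygons by (simp add: bij_betw_def polygons)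
  have card: "card (polygons N) = card (polygons M)" using bij_betw_same_card[OF b] by simp
  have "bij_betw (polygon_label N \<circ> image h) (polygons M) {1..card (polygons M)}"
    using p plabel bij_betw_cong[of "polygons M" "polygon_label N \<circ> image h" "polygon_label M"] by (simp add: proper_def)
  then show "bij_betw (polygon_label N) (polygons N) {1..card (polygons N)}"
    unfolding card using bij_betw_comp_iff[OF b] by blast
next
  fix v assume "v \<in> vertices N"
  then obtain w where w: "w \<in> vertices M" "v = h ` w" by (auto simp: vertices)
  then obtain d where d: "d \<in> w" "sorted_wrt (<) (map (polygon_label M) (rotator_from M d))"
    using p by (auto simp: proper_def increasing_rotator_def)
  then have "d \<in> darts M" using clean_faces(2)[OF M w(1)] by blast
  then show "increasing_rotator N v" unfolding increasing_rotator_def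
    using rotator_label d w(2) by (intro bexI[of _ "h d"]) auto
qed

lemma edge_label: assumes "d \<in> darts M" "polymap M" shows "edge_label N (h d) = edge_label M d"
proof -
  have "face M d \<in> polygons M \<longleftrightarrow> face M (flip M d) \<notin> polygons M" using assms by (simp add: polymap_def)
  then show ?thesis
    using assms flipM[OF assms(1)] by (simp add: edge_label_def flip face poly face_in plabel)
qed

lemma face_permM: "d \<in> darts M \<Longrightarrow> face_perm M d \<in> darts M"
  using permutes_in_image[OF clean_faces(4)[OF M]] by simp

lemma descents: assumes "f \<in> faces M" "polymap M" shows "descents N (h ` f) = descents M f"
proof -
  have fD: "f \<subseteq> darts M" by (rule clean_faces(1)[OF M assms(1)])
  have "{d \<in> h ` f. edge_label N (face_perm N d) \<le> edge_label N d} = h ` {d \<in> f. edge_label M (face_perm M d) \<le> edge_label M d}"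
  proof -
    have "edge_label N (face_perm N (h d)) = edge_label M (face_perm M d)" "edge_label N (h d) = edge_label M d" if "d \<in> f" for d
      using that fD edge_label[OF _ assms(2)] face_permM by (auto simp: face_perm)
    then show ?thesis by auto
  qed
  moreover have "{d \<in> f. edge_label M (face_perm M d) \<le> edge_label M d} \<subseteq> darts M" using fD by blast
  ultimately show ?thesis unfolding descents_def by (simp only: card_img)
qed

lemma theta: assumes p: "theta_proper \<theta> M" shows "theta_proper \<theta> N"
  unfolding theta_proper_def
proof (intro conjI ballI)
  show "proper N" using p pp by (simp add: theta_proper_def)
  have b: "bij_betw (image h) (white_faces M) (white_faces N)"
    using inj_on_subset[OF inj_faces, of "white_faces M"] Diff_subset[of "faces M" "polygons M"]
    unfolding bij_betw_def white_faces by (simp only: white_faces_def[of M])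
  have "bij_betw (face_label N \<circ> image h) (white_faces M) {1..length \<theta>}"
    using p flabel bij_betw_cong[of "white_faces M" "face_label N \<circ> image h" "face_label M"] by (simp add: theta_proper_def)
  then show "bij_betw (face_label N) (white_faces N) {1..length \<theta>}" using bij_betw_comp_iff[OF b] by blast
next
  fix f assume "f \<in> white_faces N"
  then obtain g where g: "g \<in> white_faces M" "f = h ` g" by (auto simp: white_faces)
  have "polymap M" using p by (simp add: theta_proper_def proper_def)
  then have "descents N f = descents M g" using g by (simp add: descents white_faces_def)
  then show "descents N f = \<theta> ! (face_label N f - 1)" using p g flabel by (simp add: theta_proper_def)
qed

text \<open>Leaves are pulled back along h, so smoothness is pushed forward.\<close>

lemma leaf: assumes "leaf N q" shows "\<exists>p. leaf M p"
proof -
  obtain p where p: "p \<in> polygons M" "q = h ` p" using assms by (auto simp: leaf_def polygons)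
  have sub: "X \<subseteq> darts M" if "X \<in> vertices M \<or> X \<in> polygons M" for X
    using that clean_faces(1,2)[OF M] polygons_faces by blast
  have meet: "h ` v \<inter> h ` p' \<noteq> {} \<longleftrightarrow> v \<inter> p' \<noteq> {}" if "v \<in> vertices M" "p' \<in> polygons M" for v p'
    using inj_on_image_Int[OF inj sub sub, of v p'] that by auto
  have neq: "h ` p' \<noteq> h ` p \<longleftrightarrow> p' \<noteq> p" if "p' \<in> polygons M" for p'
    using inj_polygons that p(1) by (auto dest: inj_onD)
  have "{v \<in> vertices N. v \<inter> q \<noteq> {} \<and> (\<exists>p'\<in>polygons N. p' \<noteq> q \<and> v \<inter> p' \<noteq> {})} =
      image h ` {v \<in> vertices M. v \<inter> p \<noteq> {} \<and> (\<exists>p'\<in>polygons M. p' \<noteq> p \<and> v \<inter> p' \<noteq> {})}"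
  proof (intro equalityI subsetI)
    fix X assume "X \<in> {v \<in> vertices N. v \<inter> q \<noteq> {} \<and> (\<exists>p'\<in>polygons N. p' \<noteq> q \<and> v \<inter> p' \<noteq> {})}"
    then obtain v p' where "v \<in> vertices M" "X = h ` v" "h ` v \<inter> h ` p \<noteq> {}" "p' \<in> polygons M" "h ` p' \<noteq> h ` p" "h ` v \<inter> h ` p' \<noteq> {}"
      unfolding vertices polygons p(2) by blast
    moreover from this have "v \<inter> p \<noteq> {}" "p' \<noteq> p" "v \<inter> p' \<noteq> {}" using meet[of v p] meet[of v p'] neq[of p'] p(1) by simp_all
    ultimately show "X \<in> image h ` {v \<in> vertices M. v \<inter> p \<noteq> {} \<and> (\<exists>p'\<in>polygons M. p' \<noteq> p \<and> v \<inter> p' \<noteq> {})}"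
      by (intro image_eqI[of _ _ v]) auto
  next
    fix X assume "X \<in> image h ` {v \<in> vertices M. v \<inter> p \<noteq> {} \<and> (\<exists>p'\<in>polygons M. p' \<noteq> p \<and> v \<inter> p' \<noteq> {})}"
    then obtain v p' where v: "v \<in> vertices M" "X = h ` v" "v \<inter> p \<noteq> {}" "p' \<in> polygons M" "p' \<noteq> p" "v \<inter> p' \<noteq> {}" by blast
    have "h ` v \<inter> h ` p \<noteq> {}" "h ` p' \<noteq> h ` p" "h ` v \<inter> h ` p' \<noteq> {}"
      using meet[OF v(1) p(1)] meet[OF v(1) v(4)] neq[OF v(4)] v(3,5,6) by blast+
    moreover have "X \<in> vertices N" "h ` p' \<in> polygons N" unfolding vertices polygons using v by blast+
    ultimately show "X \<in> {v \<in> vertices N. v \<inter> q \<noteq> {} \<and> (\<exists>p'\<in>polygons N. p' \<noteq> q \<and> v \<inter> p' \<noteq> {})}"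
      unfolding p(2) v(2) by blast
  qed
  moreover have "inj_on (image h) {v \<in> vertices M. v \<inter> p \<noteq> {} \<and> (\<exists>p'\<in>polygons M. p' \<noteq> p \<and> v \<inter> p' \<noteq> {})}"
    by (rule inj_on_subset[OF inj_vertices]) blast
  ultimately have "leaf M p" using assms p(1) by (simp add: leaf_def card_image)
  then show ?thesis by blast
qed

lemma sm: "smooth M \<Longrightarrow> smooth N"
  using leaf by (auto simp: smooth_def)

lemma poly_index: assumes "has_poly_index M i" shows "has_poly_index N i"
proof -
  have "card {p \<in> polygons N. card p = k} = card {p \<in> polygons M. card p = k}" for k
  proof -
    have "card (h ` p) = card p" if "p \<in> polygons M" for p
      using that card_img clean_faces(1)[OF M] polygons_faces by blast
    then have "{p \<in> polygons N. card p = k} = image h ` {p \<in> polygons M. card p = k}" unfolding polygons by auto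
    moreover have "inj_on (image h) {p \<in> polygons M. card p = k}" by (rule inj_on_subset[OF inj_polygons]) blast
    ultimately show ?thesis by (simp add: card_image)
  qed
  then show ?thesis using assms by (simp add: has_poly_index_def)
qed

end

text \<open>Through this a factorization read off from a map inherits transitivity and minimality
  from the planarity of the map.\<close>

lemma map_iso_transfer:
  assumes "map_iso h M N" "clean N" "M \<in> {M. theta_proper \<theta> M \<and> smooth M \<and> has_poly_index M i}"
  shows "theta_proper \<theta> N \<and> smooth N \<and> has_poly_index N i"
proof -
  interpret iso h M N using assms clean_theta_proper by unfold_locales auto
  show ?thesis using assms(3) theta sm poly_index by blast
qed

lemma map_iso_refl: "map_iso id M M"
  by (simp add: map_iso_def)

lemma map_iso_trans:
  assumes "map_iso h M N" "map_iso k N P" "clean M" "clean N"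
  shows "map_iso (k \<circ> h) M P"
proof -
  interpret iso h M N using assms by unfold_locales
  have D: "h d \<in> darts N" if "d \<in> darts M" for d using img that by blast
  have k: "bij_betw k (darts N) (darts P)" "\<And>d. d \<in> darts N \<Longrightarrow> k (rot N d) = rot P (k d) \<and> k (flip N d) = flip P (k d)"
    "\<And>f. f \<in> faces N \<Longrightarrow> f \<in> polygons N \<longleftrightarrow> k ` f \<in> polygons P"
    "\<And>f. f \<in> polygons N \<Longrightarrow> polygon_label P (k ` f) = polygon_label N f"
    "\<And>f. f \<in> white_faces N \<Longrightarrow> face_label P (k ` f) = face_label N f"
    using assms(2) by (auto simp: map_iso_def)
  have F: "h ` f \<in> faces N" if "f \<in> faces M" for f using that faces by blast
  have Po: "h ` f \<in> polygons N" if "f \<in> polygons M" for f using that polygons by blast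
  have Wh: "h ` f \<in> white_faces N" if "f \<in> white_faces M" for f using that white_faces by blast
  show ?thesis
    unfolding map_iso_def
  proof (intro conjI ballI)
    show "bij_betw (k \<circ> h) (darts M) (darts P)" by (rule bij_betw_trans[OF bij k(1)])
    show "(k \<circ> h) (rot M d) = rot P ((k \<circ> h) d)" "(k \<circ> h) (flip M d) = flip P ((k \<circ> h) d)" if "d \<in> darts M" for d
      using k(2)[OF D[OF that]] rot[OF that] flip[OF that] by simp_all
    show "f \<in> polygons M \<longleftrightarrow> (k \<circ> h) ` f \<in> polygons P" if "f \<in> faces M" for f
      using k(3)[OF F[OF that]] poly[OF that] by (simp add: image_comp)
    show "polygon_label P ((k \<circ> h) ` f) = polygon_label M f" if "f \<in> polygons M" for f
      using k(4)[OF Po[OF that]] plabel[OF that] by (simp add: image_comp)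
    show "face_label P ((k \<circ> h) ` f) = face_label M f" if "f \<in> white_faces M" for f
      using k(5)[OF Wh[OF that]] flabel[OF that] by (simp add: image_comp)
  qed
qed

lemma map_iso_sym:
  assumes "map_iso h M N" "clean M" "clean N"
  shows "map_iso (inv_into (darts M) h) N M"
proof -
  interpret iso h M N using assms by unfold_locales
  let ?k = "inv_into (darts M) h"
  have kh: "?k (h d) = d" if "d \<in> darts M" for d using inj that by (rule inv_into_f_f)
  have kim: "?k ` h ` X = X" if "X \<subseteq> darts M" for X using inj that by (rule inv_into_image_cancel)
  show ?thesis
    unfolding map_iso_def
  proof (intro conjI ballI)
    show "bij_betw ?k (darts N) (darts M)" using bij by (rule bij_betw_inv_into)
    show "?k (rot N d) = rot M (?k d)" "?k (flip N d) = flip M (?k d)" if "d \<in> darts N" for d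
    proof -
      obtain e where e: "e \<in> darts M" "d = h e" using \<open>d \<in> darts N\<close> img by blast
      show "?k (rot N d) = rot M (?k d)" "?k (flip N d) = flip M (?k d)"
        using e kh rot[OF e(1)] flip[OF e(1)] rotM[OF e(1)] flipM[OF e(1)] by simp_all
    qed
    show "f \<in> polygons N \<longleftrightarrow> ?k ` f \<in> polygons M" if "f \<in> faces N" for f
    proof -
      obtain g where g: "g \<in> faces M" "f = h ` g" using \<open>f \<in> faces N\<close> faces by blast
      then show ?thesis using poly kim[OF clean_faces(1)[OF M g(1)]] by simp
    qed
    show "polygon_label M (?k ` f) = polygon_label N f" if "f \<in> polygons N" for f
    proof -
      obtain g where g: "g \<in> polygons M" "f = h ` g" using \<open>f \<in> polygons N\<close> polygons by blast
      then have "g \<in> faces M" using polygons_faces by blast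
      then show ?thesis using g plabel kim[OF clean_faces(1)[OF M]] by simp
    qed
    show "face_label M (?k ` f) = face_label N f" if "f \<in> white_faces N" for f
    proof -
      obtain g where g: "g \<in> white_faces M" "f = h ` g" using \<open>f \<in> white_faces N\<close> white_faces by blast
      then have "g \<in> faces M" by (simp add: white_faces_def)
      then show ?thesis using g flabel kim[OF clean_faces(1)[OF M]] by simp
    qed
  qed
qed

section \<open>The factorization of a polymap\<close>

lemma (in factors) clean_canon: "clean (canon A ss c)"
  unfolding clean_def canon_simps using finD R_perm F_perm by (auto simp: faces_canon)

lemma orbit_image:
  assumes "p permutes S" "finite S" "d \<in> S" "\<And>x. x \<in> orbit p d \<Longrightarrow> q (h x) = h (p x)"
  shows "orbit q (h d) = h ` orbit p d"
  by (rule orbit_inverse[symmetric]) (use self_in_orbit[OF assms(1,2)] assms(4) in auto)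

locale proper_map =
  fixes M :: "nat labelled_polymap" and \<theta> :: "nat list"
  assumes th: "theta_proper \<theta> M"
begin

lemma pr: "proper M" and pmap: "polymap M" and pl: "planar_map M" and lless: "loopless M" and cl: "clean M"
  using th clean_theta_proper[OF th] by (auto simp: theta_proper_def proper_def polymap_def)

lemma fin: "finite (darts M)" and rotp: "rot M permutes darts M" and flipp: "flip M permutes darts M"
  and ne: "darts M \<noteq> {}"
  using pl by (auto simp: planar_map_def)

lemma fpp: "face_perm M permutes darts M"
  by (rule clean_faces(4)[OF cl])

lemma rotD: "rot M d \<in> darts M \<longleftrightarrow> d \<in> darts M" and flipD: "flip M d \<in> darts M \<longleftrightarrow> d \<in> darts M"
  and fpD: "face_perm M d \<in> darts M \<longleftrightarrow> d \<in> darts M"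
  using permutes_in_image[OF rotp] permutes_in_image[OF flipp] permutes_in_image[OF fpp] by auto

lemma flip2: "d \<in> darts M \<Longrightarrow> flip M (flip M d) = d"
  using pl by (simp add: planar_map_def)

definition "blk d \<longleftrightarrow> d \<in> darts M \<and> face M d \<in> polygons M"

lemma face_step: "face M (face_perm M d) = face M d"
  unfolding face_def by (rule orbit_eq_if_mem[OF fpp fin orbit.base])

lemma face_rot: "d \<in> darts M \<Longrightarrow> face M (rot M d) = face M (flip M d)"
  using face_step[of "flip M d"] by (simp add: face_perm_def flip2)

lemma vertex_rot: "vertex M (rot M d) = vertex M d"
  unfolding vertex_def by (rule orbit_eq_if_mem[OF rotp fin orbit.base])

lemma blk_flip: "d \<in> darts M \<Longrightarrow> blk (flip M d) \<longleftrightarrow> \<not> blk d"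
  using pmap flipD[of d] unfolding blk_def polymap_def by blast

text \<open>On the left of the next clockwise dart lies the face on the right of d, so darts with
  black and with white left faces alternate about a vertex.\<close>

lemma blk_rot: "d \<in> darts M \<Longrightarrow> blk (rot M d) \<longleftrightarrow> \<not> blk d"
  using blk_flip[of d] by (simp add: blk_def rotD flipD face_rot)

lemma blk_step: "blk (face_perm M d) \<longleftrightarrow> blk d"
  by (simp add: blk_def fpD face_step)

lemma blkD: "blk d \<Longrightarrow> d \<in> darts M"
  by (simp add: blk_def)

definition "r = card (polygons M)"
definition "n = card (vertices M)"
definition "Ar = {1..n}"

text \<open>An arbitrary numbering of the vertices; a different one would conjugate the
  factorization.\<close>

definition lam :: "nat set \<Rightarrow> nat" where
  "lam = (SOME f. bij_betw f (vertices M) Ar)"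

lemma lam: "bij_betw lam (vertices M) Ar"
proof -
  have "finite (vertices M)" using fin by (simp add: vertices_def)
  then have "\<exists>f. bij_betw f (vertices M) Ar"
    by (intro finite_same_card_bij) (simp_all add: n_def Ar_def)
  then show ?thesis unfolding lam_def by (rule someI_ex)
qed

definition "V d = lam (vertex M d)"
definition "lab d = polygon_label M (face M d) - 1"
definition "P l = {d. blk d \<and> lab d = l}"

lemma V_eq: "d \<in> darts M \<Longrightarrow> e \<in> darts M \<Longrightarrow> V d = V e \<longleftrightarrow> vertex M d = vertex M e"
  using lam by (auto simp: V_def vertices_def bij_betw_def dest: inj_onD)

lemma V_in: "d \<in> darts M \<Longrightarrow> V d \<in> Ar"
  using lam unfolding V_def vertices_def bij_betw_def by blast

lemma V_surj: assumes "v \<in> Ar" obtains d where "d \<in> darts M" "V d = v"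
proof -
  have "lam ` vertices M = Ar" using lam by (rule bij_betw_imp_surj_on)
  then have "v \<in> lam ` vertices M" using assms by simp
  then obtain X where X: "X \<in> vertices M" "v = lam X" by (rule imageE)
  then obtain d where "d \<in> darts M" "X = vertex M d" by (auto simp: vertices_def)
  then show thesis using that[of d] X(2) by (simp add: V_def)
qed

lemma V_rot: "V (rot M d) = V d"
  by (simp add: V_def vertex_rot)

lemma plab: "bij_betw (polygon_label M) (polygons M) {1..r}"
  using pr by (simp add: proper_def r_def)

lemma plab_in: "f \<in> polygons M \<Longrightarrow> polygon_label M f \<in> {1..r}"
  using plab unfolding bij_betw_def by blast

lemma Suc_lab: "blk d \<Longrightarrow> polygon_label M (face M d) = Suc (lab d) \<and> lab d < r"
  using plab_in[of "face M d"] by (auto simp: blk_def lab_def)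

lemma lab_eq: "blk d \<Longrightarrow> blk e \<Longrightarrow> lab d = lab e \<Longrightarrow> face M d = face M e"
  using Suc_lab[of d] Suc_lab[of e] inj_onD[OF bij_betw_imp_inj_on[OF plab], of "face M d" "face M e"]
  by (simp add: blk_def)

lemma lab_step: "lab (face_perm M d) = lab d"
  by (simp add: lab_def face_step)

lemma P_face: assumes "blk d" shows "P (lab d) = face M d"
proof (intro equalityI subsetI)
  fix e assume "e \<in> P (lab d)"
  then have e: "blk e" "lab e = lab d" by (auto simp: P_def)
  then have "face M e = face M d" using lab_eq[OF e(1) assms] by simp
  then show "e \<in> face M d" using clean_faces(5)[OF cl blkD[OF e(1)]] by simp
next
  fix e assume e: "e \<in> face M d"
  then have f: "face M e = face M d" unfolding face_def by (rule orbit_eq_if_mem[OF fpp fin])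
  have "e \<in> darts M" using e clean_faces(1)[OF cl, of "face M d"] blkD[OF assms] by (auto simp: faces_def)
  then show "e \<in> P (lab d)" using assms f by (simp add: P_def blk_def lab_def)
qed

lemma P_ex: assumes "l < r" obtains d where "blk d" "lab d = l"
proof -
  have "Suc l \<in> polygon_label M ` polygons M" using plab assms by (simp add: bij_betw_def)
  then obtain p where p: "p \<in> polygons M" "Suc l = polygon_label M p" by blast
  then have "p \<in> faces M" using pmap by (auto simp: polymap_def)
  then obtain d where "d \<in> darts M" "p = face M d" by (auto simp: faces_def)
  then show thesis using that[of d] p by (simp add: blk_def lab_def flip: p(2))
qed

text \<open>The boundary of a polygon repeats no vertex. This is what makes the walk around it a
  permutation of the vertices.\<close>

lemma inj_P: "inj_on V (P l)"
proof (rule inj_onI)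
  fix d e assume de: "d \<in> P l" "e \<in> P l" "V d = V e"
  then have b: "blk d" "blk e" "lab d = l" "lab e = l" by (auto simp: P_def)
  have "vertex M d = vertex M e" using de(3) V_eq[OF blkD blkD] b by blast
  moreover have "d \<in> face M d" "e \<in> face M d" using de P_face[OF b(1)] b(3) by auto
  moreover have "inj_on (vertex M) (face M d)" using pmap b(1) by (auto simp: polymap_def blk_def)
  ultimately show "d = e" by (auto dest: inj_onD)
qed

lemma bij_P: "bij_betw (face_perm M) (P l) (P l)"
proof (rule bij_betw_imageI)
  show "inj_on (face_perm M) (P l)" using permutes_inj_on[OF fpp] .
  then have "card (face_perm M ` P l) = card (P l)" by (rule card_image)
  moreover have "face_perm M ` P l \<subseteq> P l" by (auto simp: P_def blk_step lab_step)
  moreover have "finite (P l)" using fin by (rule rev_finite_subset) (auto simp: P_def blk_def)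
  ultimately show "face_perm M ` P l = P l" by (intro card_subset_eq)
qed

definition "\<sigma> l x = (if x \<in> V ` P l then V (face_perm M (inv_into (P l) V x)) else x)"

lemma sg: "d \<in> P l \<Longrightarrow> \<sigma> l (V d) = V (face_perm M d)"
  using inv_into_f_f[OF inj_P] by (simp add: \<sigma>_def)

text \<open>There are no loops, so consecutive vertices of a polygon differ and its factor moves all
  of them.\<close>

lemma V_step: assumes "d \<in> P l" shows "V (face_perm M d) \<noteq> V d"
proof -
  have d: "d \<in> darts M" using assms by (auto simp: P_def blk_def)
  have "vertex M d \<noteq> vertex M (flip M d)" using lless d by (simp add: loopless_def)
  then have "V d \<noteq> V (flip M d)" using V_eq d flipD by blast
  then show ?thesis by (simp add: face_perm_def V_rot)
qed

lemma supp_sg: "supp (\<sigma> l) = V ` P l"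
proof (intro equalityI subsetI)
  fix x assume "x \<in> supp (\<sigma> l)"
  then show "x \<in> V ` P l" by (auto simp: supp_def \<sigma>_def split: if_splits)
next
  fix x assume "x \<in> V ` P l"
  then obtain d where "d \<in> P l" "x = V d" by blast
  then show "x \<in> supp (\<sigma> l)" using sg V_step by (simp add: supp_def)
qed

lemma P_D: "P l \<subseteq> darts M"
  by (auto simp: P_def blk_def)

lemma sg_perm: "\<sigma> l permutes Ar"
proof -
  have "bij_betw (V \<circ> (face_perm M \<circ> inv_into (P l) V)) (V ` P l) (V ` P l)"
    using bij_betw_trans[OF bij_betw_trans[OF bij_betw_inv_into[OF inj_on_imp_bij_betw[OF inj_P]] bij_P] inj_on_imp_bij_betw[OF inj_P]] .
  then have "bij_betw (\<sigma> l) (V ` P l) (V ` P l)"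
    by (rule bij_betw_cong[THEN iffD1, rotated]) (simp add: \<sigma>_def)
  then have "\<sigma> l permutes V ` P l" by (rule bij_imp_permutes) (simp add: \<sigma>_def)
  moreover have "V ` P l \<subseteq> Ar" using P_D V_in by blast
  ultimately show ?thesis by (rule permutes_subset)
qed

lemma sg_cyc: assumes "l < r" shows "is_cyc Ar (\<sigma> l)"
proof -
  obtain d where d: "blk d" "lab d = l" using P_ex[OF assms] .
  then have dP: "d \<in> P l" by (simp add: P_def)
  have Pl: "P l = orbit (face_perm M) d" using P_face[OF d(1)] d(2) by (simp add: face_def)
  have "orbit (\<sigma> l) (V d) = V ` orbit (face_perm M) d"
    by (rule orbit_image[OF fpp fin blkD[OF d(1)]]) (use sg Pl in blast)
  then have "supp (\<sigma> l) \<subseteq> orbit (\<sigma> l) (V d)" by (simp add: supp_sg Pl)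
  moreover have "\<sigma> l (V d) \<noteq> V d" using sg[OF dP] V_step[OF dP] by simp
  ultimately show ?thesis by (intro is_cycI[OF _ sg_perm]) (auto simp: Ar_def)
qed

definition "ss = map \<sigma> [0..<r]"

lemma ss_nth: "length ss = r" "l < r \<Longrightarrow> ss ! l = \<sigma> l"
  by (simp_all add: ss_def)

lemma labels: "l \<in> labels_at ss v \<longleftrightarrow> (\<exists>d. blk d \<and> lab d = l \<and> V d = v)"
proof
  assume "l \<in> labels_at ss v"
  then have "l < r" "v \<in> supp (ss ! l)" by (simp_all add: labels_at_def ss_nth(1))
  then have "v \<in> V ` P l" by (simp add: ss_nth(2) supp_sg)
  then show "\<exists>d. blk d \<and> lab d = l \<and> V d = v" by (auto simp: P_def)
next
  assume "\<exists>d. blk d \<and> lab d = l \<and> V d = v"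
  then obtain d where d: "blk d" "lab d = l" "V d = v" by blast
  then have "v \<in> V ` P l" by (auto simp: P_def)
  then show "l \<in> labels_at ss v" using Suc_lab[OF d(1)] d(2) by (simp add: labels_at_def ss_nth supp_sg)
qed

text \<open>Of two consecutive darts at a vertex one has a polygon on its left, so every vertex is
  moved by some factor.\<close>

lemma fac: "factors Ar ss"
proof
  show "finite Ar" by (simp add: Ar_def)
  show "Ar \<noteq> {}" using ne V_in by (metis all_not_in_conv)
  show "is_cyc Ar (ss ! l)" if "l < length ss" for l using that sg_cyc by (simp add: ss_nth)
  show "labels_at ss v \<noteq> {}" if "v \<in> Ar" for v
  proof -
    obtain d where d: "d \<in> darts M" "V d = v" using V_surj[OF \<open>v \<in> Ar\<close>] .
    have "blk d \<or> blk (rot M d)" using blk_rot[OF d(1)] by blast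
    then show ?thesis using labels[of _ v] d(2) V_rot[of d] by blast
  qed
qed

sublocale factors Ar ss by (rule fac)

text \<open>A dart with a white face on its left is named after the polygon of the next dart, in
  agreement with the coding in \<open>canon\<close>.\<close>

definition "hh d = (if blk d then enc (V d) (lab d) True else enc (V d) (lab (rot M d)) False)"

text \<open>Consecutive black darts at a vertex are two rotations apart, and from a suitable dart d0
  on their labels increase. So the next black dart has the cyclic successor as its label.\<close>

lemma next_lab: assumes "blk d" shows "lab (rot M (rot M d)) = next_in (labels_at ss (V d)) (lab d)"
proof -
  have dD: "d \<in> darts M" using assms by (rule blkD)
  let ?v = "vertex M d" and ?L = "labels_at ss (V d)"
  have vM: "?v \<in> vertices M" using dD by (simp add: vertices_def)
  then obtain d0 where d0: "d0 \<in> ?v" "sorted_wrt (<) (map (polygon_label M) (rotator_from M d0))"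
    using pr by (auto simp: proper_def increasing_rotator_def)
  have d0D: "d0 \<in> darts M" using d0(1) clean_faces(2)[OF cl vM] by blast
  define N where "N = least_power (rot M) d0"
  define x where "x i = (rot M ^^ i) d0" for i
  have xD: "x i \<in> darts M" for i by (induction i) (simp_all add: x_def d0D rotD)
  have xS: "rot M (x i) = x (Suc i)" for i by (simp add: x_def)
  have Rp: "permutation (rot M)" using rotp fin permutation_permutes by blast
  have v0: "vertex M d0 = ?v" using orbit_eq_if_mem[OF rotp fin] d0(1) by (simp add: vertex_def)
  have Vx: "V (x i) = V d" for i
    by (induction i) (simp_all add: V_def v0 vertex_rot x_def)
  have ex: "\<exists>i<N. e = x i" if e: "e \<in> darts M" "V e = V d" for e
  proof -
    have "vertex M e = vertex M d0" using V_eq[OF e(1) dD] e(2) v0 by simp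
    then have "e \<in> orbit (rot M) d0" using clean_faces(6)[OF cl e(1)] by (simp add: vertex_def)
    then show ?thesis by (auto simp: set_support_eq_orbit[OF Rp, symmetric] N_def x_def)
  qed
  have xN: "x N = d0" using least_power_of_permutation(1)[OF Rp] by (simp add: x_def N_def)
  have sorted: "lab (x i) < lab (x j)" if ij: "i < j" "j < N" "blk (x i)" "blk (x j)" for i j
  proof -
    have "polygon_label M (map (face M) (support (rot M) d0) ! i) < polygon_label M (map (face M) (support (rot M) d0) ! j)"
      using d0(2)[unfolded rotator_from_def sorted_wrt_map_filter_iff] ij
      by (simp add: N_def x_def blk_def)
    then have "polygon_label M (face M (x i)) < polygon_label M (face M (x j))"
      using ij(1,2) by (simp add: N_def x_def)
    then show ?thesis using Suc_lab ij by simp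
  qed
  obtain i where i: "i < N" "d = x i" using ex[OF dD refl] by blast
  have bi: "blk (x i)" "\<not> blk (x (Suc i))" "blk (x (Suc (Suc i)))"
    using assms blk_rot[OF xD, of i] blk_rot[OF xD, of "Suc i"] by (simp_all add: i(2) xS)
  have rr: "rot M (rot M d) = x (Suc (Suc i))" by (simp add: i(2) xS)
  have Lx: "\<exists>j<N. blk (x j) \<and> k = lab (x j)" if k: "k \<in> ?L" for k
  proof -
    obtain e where e: "blk e" "lab e = k" "V e = V d" using k labels by blast
    obtain j where "j < N" "e = x j" using ex[OF blkD[OF e(1)] e(3)] by blast
    then show ?thesis using e by blast
  qed
  have xL: "lab (x j) \<in> ?L" if "blk (x j)" for j using labels Vx that by blast
  \<comment> \<open>Labels increase along the tour and the dart right after d is white, so a larger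
    label comes at least two positions later.\<close>
  have later: "Suc (Suc i) \<le> j" if j: "j < N" "blk (x j)" "lab (x i) < lab (x j)" for j
  proof -
    have "\<not> j < i" using sorted[of j i] j i(1) bi(1) by auto
    moreover have "j \<noteq> i" "j \<noteq> Suc i" using j bi by auto
    ultimately show ?thesis by simp
  qed
  show ?thesis
  \<comment> \<open>Either the next black dart comes before the tour is back at d0 and has the least
    larger label, or the tour has closed up and the next black dart is the first one, with the
    smallest label.\<close>
  proof (cases "Suc (Suc i) < N")
    case True
    have "next_in ?L (lab (x i)) = lab (x (Suc (Suc i)))"
    proof (rule next_in_eqI[OF finL xL[OF bi(3)] sorted[OF _ True bi(1,3)]])
      show "i < Suc (Suc i)" by simp
      fix k assume k: "k \<in> ?L" "lab (x i) < k"
      obtain j where j: "j < N" "blk (x j)" "k = lab (x j)" using Lx[OF k(1)] by blast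
      have "Suc (Suc i) \<le> j" using later[OF j(1,2)] k(2) j(3) by simp
      then show "lab (x (Suc (Suc i))) \<le> k"
        using sorted[OF _ j(1) bi(3) j(2)] j(3) by (cases "j = Suc (Suc i)") (simp_all add: less_imp_le)
    qed
    then show ?thesis using rr i(2) by simp
  next
    case False
    define q where "q = Suc (Suc i) - N"
    have xq: "x (Suc (Suc i)) = x q"
    proof -
      have "x (Suc (Suc i)) = (rot M ^^ (q + N)) d0" using False by (simp add: q_def x_def del: funpow.simps)
      also have "\<dots> = (rot M ^^ q) (x N)" by (simp only: funpow_add comp_apply x_def)
      also have "\<dots> = x q" unfolding xN by (simp only: x_def)
      finally show ?thesis .
    qed
    \<comment> \<open>The tour may begin with a white dart; then its first black dart is at position
      1.\<close>
    have q: "q = 0 \<or> q = Suc 0" using False i(1) by (auto simp: q_def)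
    have bq: "blk (x q)" using bi(3) xq by simp
    have "Min ?L = lab (x q)"
    proof (rule Min_eqI[OF finL _ xL[OF bq]])
      fix k assume "k \<in> ?L"
      then obtain j where j: "j < N" "blk (x j)" "k = lab (x j)" using Lx by blast
      have "q \<noteq> Suc 0 \<or> j \<noteq> 0"
      proof (rule ccontr)
        assume "\<not> (q \<noteq> Suc 0 \<or> j \<noteq> 0)"
        then show False using bq j(2) blk_rot[OF xD, of 0] by (simp add: xS)
      qed
      then have "q = j \<or> q < j" using q by auto
      then show "lab (x q) \<le> k" using sorted[OF _ j(1) bq j(2)] j(3) by (auto simp: less_imp_le)
    qed
    moreover have "\<not> (\<exists>k\<in>?L. lab (x i) < k)"
    proof
      assume "\<exists>k\<in>?L. lab (x i) < k"
      then obtain k where k: "k \<in> ?L" "lab (x i) < k" by blast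
      obtain j where j: "j < N" "blk (x j)" "k = lab (x j)" using Lx[OF k(1)] by blast
      have "Suc (Suc i) \<le> j" using later[OF j(1,2)] k(2) j(3) by simp
      then show False using False j(1) by simp
    qed
    ultimately show ?thesis using next_in_wrap[of ?L "lab (x i)"] rr xq i(2) by simp
  qed
qed

lemma hh_D: assumes d: "d \<in> darts M" shows "hh d \<in> canon_darts ss"
proof (cases "blk d")
  case True
  then show ?thesis using labels by (auto simp: hh_def)
next
  case False
  then have "blk (rot M d)" using blk_rot[OF d] by simp
  then have "lab (rot M d) \<in> labels_at ss (V d)" using labels V_rot by blast
  then show ?thesis using False by (simp add: hh_def)
qed

lemma bij_hh: "bij_betw hh (darts M) (canon_darts ss)"
proof (rule bij_betw_imageI)
  have eq: "d = e" if "blk d" "blk e" "V d = V e" "lab d = lab e" for d e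
    using inj_onD[OF inj_P[of "lab e"], of d e] that by (simp add: P_def)
  show "inj_on hh (darts M)"
  proof (rule inj_onI)
    fix d e assume de: "d \<in> darts M" "e \<in> darts M" "hh d = hh e"
    have b: "blk d \<longleftrightarrow> blk e" using de(3) by (auto simp: hh_def split: if_splits)
    show "d = e"
    proof (cases "blk d")
      case True
      then show ?thesis using eq[of d e] b de(3) by (simp add: hh_def)
    next
      case False
      have "rot M d = rot M e" using eq[of "rot M d" "rot M e"] False b de by (simp add: hh_def blk_rot V_rot)
      then show ?thesis using permutes_inj[OF rotp] by (auto dest: injD)
    qed
  qed
  show "hh ` darts M = canon_darts ss"
  proof (intro equalityI subsetI)
    fix y assume "y \<in> hh ` darts M"
    then show "y \<in> canon_darts ss" using hh_D by blast
  next
    fix y assume "y \<in> canon_darts ss"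
    then obtain v l b where y: "y = enc v l b" "l \<in> labels_at ss v" by (rule D_cases)
    obtain d where d: "blk d" "lab d = l" "V d = v" using y(2) labels by blast
    show "y \<in> hh ` darts M"
    proof (cases b)
      case True
      then have "y = hh d" using d y(1) by (simp add: hh_def)
      then show ?thesis using blkD[OF d(1)] by blast
    next
      case False
      obtain e where e: "d = rot M e" using permutes_surj[OF rotp] by (metis surjD)
      have eD: "e \<in> darts M" using blkD[OF d(1)] rotD e by simp
      have "\<not> blk e" using d(1) blk_rot[OF eD] e by simp
      then have "y = hh e" using d y(1) False V_rot[of e] e by (simp add: hh_def)
      then show ?thesis using eD by blast
    qed
  qed
qed

lemma hh_rot: assumes d: "d \<in> darts M" shows "hh (rot M d) = R (hh d)"
proof (cases "blk d")
  case True
  have "lab d \<in> labels_at ss (V d)" using labels True by blast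
  moreover have "\<not> blk (rot M d)" using blk_rot[OF d] True by simp
  ultimately show ?thesis using True next_lab[OF True] by (simp add: hh_def V_rot R_True)
next
  case False
  then have b: "blk (rot M d)" using blk_rot[OF d] by simp
  then have "lab (rot M d) \<in> labels_at ss (V d)" using labels V_rot by blast
  then show ?thesis using False b by (simp add: hh_def V_rot R_False)
qed

lemma hh_flip_blk: assumes b: "blk d" shows "hh (flip M d) = F (hh d)"
proof -
  have nb: "\<not> blk (flip M d)" using blk_flip[OF blkD[OF b]] b by simp
  have l: "lab d \<in> labels_at ss (V d)" using labels b by blast
  have dP: "d \<in> P (lab d)" using b by (simp add: P_def)
  have "V (flip M d) = V (face_perm M d)" by (simp add: face_perm_def V_rot)
  also have "\<dots> = (ss ! lab d) (V d)" using sg[OF dP] Suc_lab[OF b] by (simp add: ss_nth)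
  finally have "hh (flip M d) = enc ((ss ! lab d) (V d)) (lab d) False"
    using nb lab_step[of d] by (simp add: hh_def face_perm_def)
  then show ?thesis using F_True[OF l] b by (simp add: hh_def)
qed

lemma hh_flip: assumes d: "d \<in> darts M" shows "hh (flip M d) = F (hh d)"
proof (cases "blk d")
  case False
  then have b: "blk (flip M d)" using blk_flip[OF d] by simp
  have "hh d = F (hh (flip M d))" using hh_flip_blk[OF b] flip2[OF d] by simp
  then show ?thesis using FF hh_D[of "flip M d"] d flipD by simp
qed (rule hh_flip_blk)

lemma hh_orbit: assumes d: "d \<in> darts M" shows "orbit W (hh d) = hh ` face M d"
  unfolding face_def
proof (rule orbit_image[OF fpp fin d])
  fix x assume "x \<in> orbit (face_perm M) d"
  then have x: "x \<in> darts M" using permutes_orbit_subset[OF fpp d] by blast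
  then show "W (hh x) = hh (face_perm M x)" using hh_rot[of "flip M x"] flipD by (simp add: W_def face_perm_def hh_flip)
qed

lemma hh_polygon: assumes b: "blk d" shows "hh ` face M d = canon_polygon ss (lab d)"
proof -
  have "hh ` P (lab d) = (\<lambda>v. enc v (lab d) True) ` V ` P (lab d)"
    unfolding image_image by (rule image_cong) (auto simp: P_def hh_def)
  then show ?thesis using P_face[OF b] Suc_lab[OF b] by (simp add: canon_polygon_def ss_nth supp_sg)
qed

definition "hinv = inv_into (darts M) hh"
text \<open>The label of a vertex is that of the white face through its start dart, shifted because
  cycle labels begin with 0.\<close>

definition "cc = (\<lambda>y\<in>Ar. face_label M (hinv ` wface y) - 1)"

lemma cc_tot: assumes x: "x \<in> Ar" shows "cc (tot x) = cc x"
proof -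
  have tx: "tot x \<in> Ar" using x permutes_in_image[OF tot_perm] by simp
  have "orbit tot (tot x) = orbit tot x" using orbit_eq_if_mem[OF tot_perm A(1) orbit.base] .
  then have "wface (tot x) = wface x" using wface_eq_iff[OF tx x] by simp
  then show ?thesis using tx x by (simp add: cc_def)
qed

lemma hh_iso: "map_iso hh M (canon Ar ss cc)"
  unfolding map_iso_def canon_simps
proof (intro conjI ballI bij_hh hh_rot hh_flip)
  fix f assume f: "f \<in> faces M"
  then obtain d where d: "d \<in> darts M" "f = face M d" by (auto simp: faces_def)
  show "f \<in> polygons M \<longleftrightarrow> hh ` f \<in> canon_polygon ss ` {..<length ss}"
  proof
    assume "f \<in> polygons M"
    then have "blk d" using d by (simp add: blk_def)
    then show "hh ` f \<in> canon_polygon ss ` {..<length ss}" using hh_polygon Suc_lab d(2) by (simp add: ss_nth)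
  next
    assume "hh ` f \<in> canon_polygon ss ` {..<length ss}"
    moreover have "d \<in> f" using clean_faces(5)[OF cl d(1)] d(2) by simp
    ultimately have "hh d \<in> \<Union> (canon_polygon ss ` {..<length ss})" by blast
    then obtain v l where "hh d = enc v l True" by (auto simp: canon_polygon_def)
    then have "blk d" by (auto simp: hh_def split: if_splits)
    then show "f \<in> polygons M" using d(2) by (simp add: blk_def)
  qed
next
  fix f assume f: "f \<in> polygons M"
  then have "f \<in> faces M" using pmap by (auto simp: polymap_def)
  then obtain d where d: "d \<in> darts M" "f = face M d" by (auto simp: faces_def)
  then have b: "blk d" using f by (simp add: blk_def)
  have "lab d < length ss" using Suc_lab[OF b] by (simp add: ss_nth)
  then show "polygon_label (canon Ar ss cc) (hh ` f) = polygon_label M f"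
    using hh_polygon[OF b] Suc_lab[OF b] d(2) label_polygon by simp
next
  fix f assume f: "f \<in> white_faces M"
  then have fF: "f \<in> faces M" "f \<notin> polygons M" by (auto simp: white_faces_def)
  then obtain d where d: "d \<in> darts M" "f = face M d" by (auto simp: faces_def)
  then have nb: "\<not> blk d" using fF(2) by (simp add: blk_def)
  then have b: "blk (rot M d)" using blk_rot[OF d(1)] by simp
  have l: "lab (rot M d) \<in> labels_at ss (V d)" using labels b V_rot by blast
  define y where "y = inv' tot (src (V d) (lab (rot M d)))"
  have "src (V d) (lab (rot M d)) \<in> Ar" using src_A L_A[OF l] l by (simp add: L)
  then have y: "y \<in> Ar" unfolding y_def by (rule tot_inv(1))
  have hf: "hh ` f = wface y"
    using hh_orbit[OF d(1)] wface_False[OF l] nb d(2) by (simp add: hh_def y_def)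
  have "hinv ` hh ` f = f"
    unfolding hinv_def using bij_betw_imp_inj_on[OF bij_hh] clean_faces(1)[OF cl fF(1)] by (rule inv_into_image_cancel)
  then have "cc y = face_label M f - 1" using y hf by (simp add: cc_def)
  moreover have "face_label M f \<in> {1..length \<theta>}" using th f by (auto simp: theta_proper_def bij_betw_def)
  moreover have "face_label (canon Ar ss cc) (wface y) = Suc (cc y)"
    using face_label_canon[of cc y "wface y"] cc_tot y wface_self[of y] by blast
  ultimately show "face_label (canon Ar ss cc) (hh ` f) = face_label M f" using hf by simp
qed

end

text \<open>Every isomorphism class contains a map of the form \<open>canon\<close>. Its number of
  vertices is the total number of descents, which fixes the set of points.\<close>

lemma ex_canon:
  assumes "M \<in> smooth_theta_proper_polymaps \<theta> i"
  shows "\<exists>h ss c. (ss, c) \<in> FacT (length \<theta>) ((!) \<theta>) i \<and> leaf_positions ss = {} \<and>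
    map_iso h M (canon {1..\<Sum>j<length \<theta>. \<theta> ! j} ss c)"
proof -
  have M: "theta_proper \<theta> M" "M \<in> {M. theta_proper \<theta> M \<and> smooth M \<and> has_poly_index M i}"
    using assms by (simp_all add: smooth_theta_proper_polymaps_def)
  interpret proper_map M \<theta> by unfold_locales (rule M(1))
  let ?N = "canon Ar ss cc"
  have N: "theta_proper \<theta> ?N \<and> smooth ?N \<and> has_poly_index ?N i"
    by (rule map_iso_transfer[OF hh_iso clean_canon M(2)])
  have "cc \<in> extensional Ar" by (simp add: cc_def)
  then have F: "(ss, cc) \<in> FacS Ar (length \<theta>) ((!) \<theta>)"
    using N theta_proper_canon_iff[of cc \<theta>] cc_tot by blast
  then have "(\<Sum>j<length \<theta>. \<theta> ! j) = card Ar" by (rule FacS_card[OF A(1)])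
  then have Ar: "Ar = {1..\<Sum>j<length \<theta>. \<theta> ! j}" by (simp add: Ar_def)
  have "(ss, cc) \<in> FacT (length \<theta>) ((!) \<theta>) i"
    using F N has_poly_index_canon_iff[of cc i] unfolding FacT_def Ar by simp
  moreover have "leaf_positions ss = {}" using N smooth_canon_iff by simp
  ultimately show ?thesis using hh_iso unfolding Ar by blast
qed

section \<open>Counting isomorphism classes\<close>

lemma Fac_tot: "(ss, c) \<in> Fac A m \<Longrightarrow> x \<in> A \<Longrightarrow> c (prodl ss x) = c x"
  by (simp add: Fac_def cycle_labelling_def)

text \<open>A relabelling of the points changes the origin of each coded dart and keeps polygon and
  side.\<close>

lemma canon_iso_conjugate:
  assumes g: "g permutes A" and X: "factors A ss" and Y: "factors A (map (conjugate g) ss)"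
    and c: "\<And>x. x \<in> A \<Longrightarrow> c (prodl ss x) = c x"
    and d: "\<And>x. x \<in> A \<Longrightarrow> relabel g A c (prodl (map (conjugate g) ss) x) = relabel g A c x"
  shows "\<exists>h. map_iso h (canon A ss c) (canon A (map (conjugate g) ss) (relabel g A c))"
proof -
  let ?ts = "map (conjugate g) ss" and ?d = "relabel g A c"
  interpret X: factors A ss by (rule X)
  interpret Y: factors A ?ts by (rule Y)
  have bij: "bij g" by (rule permutes_bij[OF g])
  have inj: "g x = g y \<longleftrightarrow> x = y" for x y using bij_is_inj[OF bij] by (simp add: inj_eq)
  have gA: "g x \<in> A \<longleftrightarrow> x \<in> A" for x by (rule permutes_in_image[OF g])
  define h where "h x = (case from_nat x :: nat \<times> nat \<times> bool of (v, l, b) \<Rightarrow> enc (g v) l b)" for x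
  have h: "h (enc v l b) = enc (g v) l b" for v l b by (simp add: h_def)
  have L: "labels_at ?ts (g v) = labels_at ss v" for v
    by (auto simp: labels_at_def supp_conjugate[OF bij] inj)
  have hD: "h x \<in> canon_darts ?ts" if "x \<in> canon_darts ss" for x
    using that by (elim X.D_cases) (simp add: h L)
  have bh: "bij_betw h (canon_darts ss) (canon_darts ?ts)"
  proof (rule bij_betw_imageI)
    show "inj_on h (canon_darts ss)"
      by (rule inj_onI) (elim X.D_cases, simp add: h inj)
    show "h ` canon_darts ss = canon_darts ?ts"
    proof (intro equalityI subsetI)
      fix y assume "y \<in> canon_darts ?ts"
      then obtain v l b where y: "y = enc v l b" "l \<in> labels_at ?ts v" by (rule Y.D_cases)
      obtain w where w: "v = g w" using bij_is_surj[OF bij] by (metis surjD)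
      have "enc w l b \<in> canon_darts ss" using y(2) L[of w] w by simp
      then show "y \<in> h ` canon_darts ss" using h[of w l b] y(1) w by (intro image_eqI[of _ _ "enc w l b"]) simp_all
    qed (use hD in blast)
  qed
  have hR: "h (X.R x) = Y.R (h x)" if "x \<in> canon_darts ss" for x
  proof -
    obtain v l b where x: "x = enc v l b" "l \<in> labels_at ss v" using X.D_cases[OF \<open>x \<in> canon_darts ss\<close>] .
    have l: "l \<in> labels_at ?ts (g v)" using x(2) L by simp
    show ?thesis
      by (cases b) (simp_all add: x(1) X.R_True[OF x(2)] X.R_False[OF x(2)] Y.R_True[OF l] Y.R_False[OF l] h L)
  qed
  have hF1: "h (X.F (enc v l True)) = Y.F (h (enc v l True))" if l: "l \<in> labels_at ss v" for v l
  proof -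
    have l': "l \<in> labels_at ?ts (g v)" using l L by simp
    have "(?ts ! l) (g v) = g ((ss ! l) v)" using l conjugate_apply[OF bij] by (simp add: X.L)
    then show ?thesis using X.F_True[OF l] Y.F_True[OF l'] by (simp add: h)
  qed
  have hF: "h (X.F x) = Y.F (h x)" if "x \<in> canon_darts ss" for x
  proof -
    obtain v l b where x: "x = enc v l b" "l \<in> labels_at ss v" using X.D_cases[OF \<open>x \<in> canon_darts ss\<close>] .
    show ?thesis
    proof (cases b)
      case True
      then show ?thesis using hF1[OF x(2)] x(1) by simp
    next
      case False
      let ?e = "X.F x"
      have e: "?e = enc (inv' (ss ! l) v) l True" using X.F_False[OF x(2)] x(1) False by simp
      have "h (X.F ?e) = Y.F (h ?e)" unfolding e by (rule hF1[OF X.L_step_inv[OF x(2)]])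
      then have "h x = Y.F (h ?e)" using X.FF[OF \<open>x \<in> canon_darts ss\<close>] by simp
      then show ?thesis using Y.FF[OF hD[OF X.FD[OF \<open>x \<in> canon_darts ss\<close>]]] by simp
    qed
  qed
  have hp: "h ` canon_polygon ss l = canon_polygon ?ts l" if "l < length ss" for l
    using that by (simp add: canon_polygon_def image_image h supp_conjugate[OF bij])
  have sub: "canon_polygon ss l \<subseteq> canon_darts ss" if "l < length ss" for l
    using that by (auto simp: canon_polygon_def X.L)
  have start: "h (start ss y) = start ?ts (g y)" for y by (simp add: start_def h L)
  have hw: "h ` X.wface y = Y.wface (g y)" if y: "y \<in> A" for y
  proof -
    have s: "start ss y \<in> canon_darts ss" using X.start_D[OF y] by (simp add: start_def)
    have "orbit Y.W (h (start ss y)) = h ` orbit X.W (start ss y)"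
    proof (rule orbit_image[OF X.W_perm X.finD s])
      fix x assume "x \<in> orbit X.W (start ss y)"
      then have "x \<in> canon_darts ss" using permutes_orbit_subset[OF X.W_perm s] by blast
      then show "Y.W (h x) = h (X.W x)" by (simp add: X.W_def Y.W_def hF hR X.FD)
    qed
    then show ?thesis by (simp add: X.wface_def Y.wface_def start)
  qed
  have "map_iso h (canon A ss c) (canon A ?ts ?d)"
    unfolding map_iso_def X.canon_simps Y.canon_simps X.white_faces_canon
  proof (intro conjI ballI bh hR hF)
    fix f assume f: "f \<in> faces (canon A ss c)"
    show "f \<in> canon_polygon ss ` {..<length ss} \<longleftrightarrow> h ` f \<in> canon_polygon ?ts ` {..<length ?ts}"
    proof
      assume "h ` f \<in> canon_polygon ?ts ` {..<length ?ts}"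
      then obtain l where l: "l < length ss" "h ` f = h ` canon_polygon ss l" using hp by auto
      have "f \<subseteq> canon_darts ss" using clean_faces(1)[OF X.clean_canon f] by simp
      then have "f = canon_polygon ss l"
        using inj_on_image_eq_iff[OF bij_betw_imp_inj_on[OF bh] _ sub[OF l(1)]] l(2) by blast
      then show "f \<in> canon_polygon ss ` {..<length ss}" using l(1) by blast
    qed (use hp in auto)
  next
    fix f assume "f \<in> canon_polygon ss ` {..<length ss}"
    then obtain l where l: "l < length ss" "f = canon_polygon ss l" by blast
    then show "polygon_label (canon A ?ts ?d) (h ` f) = polygon_label (canon A ss c) f"
      using X.label_polygon Y.label_polygon hp by simp
  next
    fix f assume "f \<in> X.wface ` A"
    then obtain y where y: "y \<in> A" "f = X.wface y" by blast
    have gy: "g y \<in> A" using y(1) gA by simp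
    have "face_label (canon A ss c) (X.wface y) = Suc (c y)"
      using X.face_label_canon[of c "y" "X.wface y"] y(1) c[folded X.tot_def] X.wface_self[of "y"] by blast
    moreover have "face_label (canon A ?ts ?d) (Y.wface (g y)) = Suc (?d (g y))"
      using Y.face_label_canon[of ?d "g y" "Y.wface (g y)"] gy d[folded Y.tot_def] Y.wface_self[of "g y"] by blast
    ultimately show "face_label (canon A ?ts ?d) (h ` f) = face_label (canon A ss c) f"
      using hw[OF y(1)] relabel_apply[OF bij y(1)] y(2) by simp
  qed
  then show ?thesis by blast
qed

text \<open>An isomorphism keeps polygon labels and sends vertices to vertices, so it acts on
  \<open>enc v l b\<close> through a map g of points. Since it respects the walk around each
  polygon, g conjugates the factors into each other.\<close>

lemma canon_iso_imp_conjugate: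
  assumes h: "map_iso h (canon A ss c) (canon A ts d)" and X: "factors A ss" and Y: "factors A ts"
    and c: "\<And>x. x \<in> A \<Longrightarrow> c (prodl ss x) = c x" and d: "\<And>x. x \<in> A \<Longrightarrow> d (prodl ts x) = d x"
    and ext: "d \<in> extensional A"
  shows "\<exists>g. g permutes A \<and> ts = map (conjugate g) ss \<and> d = relabel g A c"
proof -
  interpret X: factors A ss by (rule X)
  interpret Y: factors A ts by (rule Y)
  interpret I: iso h "canon A ss c" "canon A ts d"
    by (rule iso.intro[OF h X.clean_canon Y.clean_canon])
  have bh: "bij_betw h (canon_darts ss) (canon_darts ts)" using I.bij by simp
  have hR: "h (X.R x) = Y.R (h x)" if "x \<in> canon_darts ss" for x using I.rot[of x] that by simp
  have hF: "h (X.F x) = Y.F (h x)" if "x \<in> canon_darts ss" for x using I.flip[of x] that by simp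
  have hW: "h (X.W x) = Y.W (h x)" if "x \<in> canon_darts ss" for x
    using that by (simp add: X.W_def Y.W_def hF hR X.FD)
  have hD: "h x \<in> canon_darts ts" if "x \<in> canon_darts ss" for x using bh that by (auto simp: bij_betw_def)
  have len: "length ts = length ss"
  proof -
    have "card (canon_polygon ts ` {..<length ts}) = card (canon_polygon ss ` {..<length ss})"
      using I.polygons I.inj_polygons by (simp add: card_image)
    then show ?thesis using X.card_polygons Y.card_polygons by simp
  qed
  have hp: "h ` canon_polygon ss l = canon_polygon ts l" if l: "l < length ss" for l
  proof -
    have m: "canon_polygon ss l \<in> polygons (canon A ss c)" using l by simp
    then have "h ` canon_polygon ss l \<in> polygons (canon A ts d)" using I.polygons by blast
    then obtain k where k: "k < length ts" "h ` canon_polygon ss l = canon_polygon ts k" by auto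
    have "Suc k = Suc l" using I.plabel[OF m] X.label_polygon[OF l] Y.label_polygon[OF k(1)] k(2) by simp
    then show ?thesis using k(2) by simp
  qed
  \<comment> \<open>Read off from the start dart of v; \<open>hv\<close> shows that all darts at v
    go to the same vertex.\<close>
  define g where "g v = (if v \<in> A then fst (from_nat (h (start ss v)) :: nat \<times> nat \<times> bool) else v)" for v
  have sD: "start ss v \<in> canon_darts ss" if "v \<in> A" for v using X.start_D[OF that] by (simp add: start_def)
  have hv: "g v \<in> A \<and> h ` X.vset v = Y.vset (g v)" if v: "v \<in> A" for v
  proof -
    obtain w l b where w: "h (start ss v) = enc w l b" "l \<in> labels_at ts w" using Y.D_cases[OF hD[OF sD[OF v]]] .
    have gw: "g v = w" using w(1) v by (simp add: g_def)
    have "orbit Y.R (h (start ss v)) = h ` orbit X.R (start ss v)"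
    proof (rule orbit_image[OF X.R_perm X.finD sD[OF v]])
      fix x assume "x \<in> orbit X.R (start ss v)"
      then have "x \<in> canon_darts ss" using permutes_orbit_subset[OF X.R_perm sD[OF v]] by blast
      then show "Y.R (h x) = h (X.R x)" using hR by simp
    qed
    then have "h ` X.vset v = Y.vset w" using X.orbit_R[OF X.start_D[OF v]] Y.orbit_R[OF w(2)] w(1) by (simp add: start_def)
    then show ?thesis using gw Y.L_A[OF w(2)] by simp
  qed
  have hT: "h (enc v l True) = enc (g v) l True \<and> l \<in> labels_at ts (g v)" if l: "l \<in> labels_at ss v" for v l
  proof -
    have l': "l < length ss" "v \<in> supp (ss ! l)" using l by (simp_all add: X.L)
    have "enc v l True \<in> canon_polygon ss l" using l'(2) by (simp add: canon_polygon_def)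
    then have "h (enc v l True) \<in> canon_polygon ts l" using hp[OF l'(1)] by blast
    moreover have "h (enc v l True) \<in> Y.vset (g v)"
      using hv[OF X.L_A[OF l]] l by (auto simp: X.vset_def)
    ultimately show ?thesis by (auto simp: canon_polygon_def Y.vset_def)
  qed
  \<comment> \<open>The white dart is the predecessor of the black one in the rotation, which is
    injective.\<close>
  have hFa: "h (enc v l False) = enc (g v) l False" if l: "l \<in> labels_at ss v" for v l
  proof -
    have "Y.R (h (enc v l False)) = h (enc v l True)" using hR[of "enc v l False"] X.R_False[OF l] l by simp
    also have "\<dots> = Y.R (enc (g v) l False)" using hT[OF l] Y.R_False by simp
    finally show ?thesis using permutes_inj[OF Y.R_perm] by (auto dest: injD)
  qed
  have g: "g permutes A"
  proof (rule bij_imp_permutes)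
    have inj: "inj_on g A"
    proof (rule inj_onI)
      fix v w assume vw: "v \<in> A" "w \<in> A" "g v = g w"
      then have "h ` X.vset v = h ` X.vset w" using hv by simp
      moreover have "X.vset u \<subseteq> canon_darts ss" for u by (auto simp: X.vset_def)
      ultimately have "X.vset v = X.vset w"
        using inj_on_image_eq_iff[OF bij_betw_imp_inj_on[OF bh], of "X.vset v" "X.vset w"] by blast
      then show "v = w" by (rule X.vset_inj[OF vw(1)])
    qed
    moreover have "g ` A \<subseteq> A" using hv by blast
    ultimately show "bij_betw g A A" using endo_inj_surj[OF X.A(1)] by (simp add: bij_betw_def)
  qed (simp add: g_def)
  have bij: "bij g" by (rule permutes_bij[OF g])
  have gs: "supp (ts ! l) = g ` supp (ss ! l)" if l: "l < length ss" for l
  proof -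
    have "h ` canon_polygon ss l = (\<lambda>v. enc v l True) ` g ` supp (ss ! l)"
      unfolding canon_polygon_def image_image
      by (rule image_cong) (use hT l in \<open>auto simp: X.L\<close>)
    then have "(\<lambda>v. enc v l True) ` supp (ts ! l) = (\<lambda>v. enc v l True) ` g ` supp (ss ! l)"
      using hp[OF l] by (simp add: canon_polygon_def)
    moreover have i: "inj (\<lambda>v. enc v l True)" by (simp add: inj_def)
    ultimately show ?thesis unfolding inj_image_eq_iff[OF i] by simp
  qed
  have gL: "labels_at ts (g v) = labels_at ss v" for v
    using gs len bij_is_inj[OF bij] by (auto simp: labels_at_def inj_eq)
  have comm: "(ts ! l) (g v) = g ((ss ! l) v)" if l: "l < length ss" for l v
  proof (cases "v \<in> supp (ss ! l)")
    case True
    then have lv: "l \<in> labels_at ss v" using l by (simp add: X.L)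
    note t = hT[OF lv]
    have "h (X.W (enc v l True)) = Y.W (h (enc v l True))" using hW lv by simp
    then have "enc (g ((ss ! l) v)) l True = enc ((ts ! l) (g v)) l True"
      using t X.W_True[OF lv] hT[OF X.L_step[OF lv]] Y.W_True[of l "g v"] by simp
    then show ?thesis by simp
  next
    case False
    then have "g v \<notin> supp (ts ! l)" using gs[OF l] bij_is_inj[OF bij] by (auto simp: inj_eq)
    then show ?thesis using False by (simp add: supp_def)
  qed
  have "ts = map (conjugate g) ss"
  proof (rule nth_equalityI)
    fix l assume "l < length ts"
    then have l: "l < length ss" using len by simp
    have "(ts ! l) x = conjugate g (ss ! l) x" for x
    proof -
      obtain v where v: "x = g v" using bij_is_surj[OF bij] by (metis surjD)
      show ?thesis unfolding v using comm[OF l] conjugate_apply[OF bij] by simp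
    qed
    then show "ts ! l = map (conjugate g) ss ! l" using l by (simp add: fun_eq_iff)
  qed (simp add: len)
  moreover have "d = relabel g A c"
  proof (rule extensionalityI[OF ext])
    show "relabel g A c \<in> extensional A" by (simp add: relabel_def permutes_image[OF g])
    fix x assume "x \<in> A"
    then obtain v where v: "v \<in> A" "x = g v" using permutes_image[OF g] by blast
    have gv: "g v \<in> A" using hv[OF v(1)] by simp
    have st: "h (start ss v) = start ts (g v)" using hFa[OF X.start_D[OF v(1)]] by (simp add: start_def gL)
    have "orbit Y.W (h (start ss v)) = h ` orbit X.W (start ss v)"
    proof (rule orbit_image[OF X.W_perm X.finD sD[OF v(1)]])
      fix x assume "x \<in> orbit X.W (start ss v)"
      then have "x \<in> canon_darts ss" using permutes_orbit_subset[OF X.W_perm sD[OF v(1)]] by blast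
      then show "Y.W (h x) = h (X.W x)" using hW by simp
    qed
    then have hw: "h ` X.wface v = Y.wface (g v)" by (simp add: X.wface_def Y.wface_def st)
    have "face_label (canon A ss c) (X.wface v) = Suc (c v)"
      using X.face_label_canon[of c "v" "X.wface v"] v(1) c[folded X.tot_def] X.wface_self[of "v"] by blast
    moreover have "face_label (canon A ts d) (Y.wface (g v)) = Suc (d (g v))"
      using Y.face_label_canon[of d "g v" "Y.wface (g v)"] gv d[folded Y.tot_def] Y.wface_self[of "g v"] by blast
    moreover have "X.wface v \<in> white_faces (canon A ss c)" using v(1) by (simp add: X.white_faces_canon)
    ultimately have "d (g v) = c v" using I.flabel[of "X.wface v"] hw by simp
    then show "d x = relabel g A c x" using relabel_apply[OF bij v(1)] v(2) by simp
  qed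
  ultimately show ?thesis using g by blast
qed

lemma leaf_positions_map_conjugate:
  assumes "bij g" shows "leaf_positions (map (conjugate g) ss) = leaf_positions ss"
proof -
  have "shared (map (conjugate g) ss) l = g ` shared ss l" if "l < length ss" for l
    using that bij_is_inj[OF assms] by (auto simp: shared_def supp_conjugate[OF assms] inj_eq intro!: imageI) blast+
  moreover have "card (g ` S) = card S" for S by (rule card_image[OF bij_inj_on[OF assms]])
  ultimately show ?thesis by (auto simp: leaf_positions_def)
qed

text \<open>If g and k have the same effect, then \<open>inv' k \<circ> g\<close> commutes with all
  factors and keeps the labels, so \<open>Fac_centralizer_trivial\<close> applies.\<close>

lemma Fac_stabilizer_trivial:
  assumes A: "finite A" and x: "(ss, c) \<in> Fac A m" "2 \<le> m" and g: "g permutes A" "k permutes A"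
    and eq: "map (conjugate g) ss = map (conjugate k) ss" "relabel g A c = relabel k A c"
  shows "g = k"
proof -
  have b: "bij g" "bij k" using g by (auto intro: permutes_bij)
  have "inv' k \<circ> g = id"
  proof (rule Fac_centralizer_trivial[OF A x])
    show "inv' k \<circ> g permutes A" by (rule permutes_compose[OF g(1) permutes_inv[OF g(2)]])
    show "(inv' k \<circ> g) \<circ> s = s \<circ> (inv' k \<circ> g)" if s: "s \<in> set ss" for s
    proof
      fix x
      have "conjugate g s = conjugate k s" using eq(1) s by simp
      then have "g (s x) = conjugate k s (g x)" using conjugate_apply[OF b(1), of s x] by simp
      also have "\<dots> = k (s (inv' k (g x)))" by (simp add: conjugate_def)
      finally show "((inv' k \<circ> g) \<circ> s) x = (s \<circ> (inv' k \<circ> g)) x" using b(2) by (simp add: bij_is_inj)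
    qed
    show "c ((inv' k \<circ> g) x) = c x" if x: "x \<in> A" for x
    proof -
      have "c x = relabel k A c (g x)" using relabel_apply[OF b(1) x, of c] eq(2) by simp
      moreover have "g x \<in> k ` A" using permutes_image[OF g(2)] permutes_in_image[OF g(1)] x by simp
      ultimately show ?thesis by (simp add: relabel_def)
    qed
  qed
  then have "k (inv' k (g x)) = k x" for x by (simp add: fun_eq_iff)
  then show ?thesis using permutes_inverses(1)[OF g(2)] by (simp add: fun_eq_iff)
qed

definition SmT :: "nat \<Rightarrow> (nat \<Rightarrow> nat) \<Rightarrow> (nat \<Rightarrow>\<^sub>0 nat) \<Rightarrow> ((nat \<Rightarrow> nat) list \<times> (nat \<Rightarrow> nat)) set" where
  "SmT m a i = {(ss, c) \<in> FacT m a i. leaf_positions ss = {}}"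

text \<open>Isomorphism classes correspond to orbits of the symmetric group on labelled
  factorizations without leaves. The action is free, so every class has n! representatives.\<close>

lemma S_num_eq:
  assumes m: "2 \<le> m" "length \<theta> = m"
  shows "fact (\<Sum>j<m. \<theta> ! j) * S_num \<theta> i = card (SmT m ((!) \<theta>) i)"
proof -
  define n where "n = (\<Sum>j<m. \<theta> ! j)"
  define A where "A = {1..n}"
  have finA: "finite A" "card A = n" by (simp_all add: A_def)
  let ?T = "SmT m ((!) \<theta>) i" and ?S = "smooth_theta_proper_polymaps \<theta> i"
  define E where "E = {(M, N). M \<in> ?S \<and> N \<in> ?S \<and> polymap_iso M N}"
  define act where "act g = (\<lambda>(ss, c). (map (conjugate g) ss, relabel g A c))" for g
  define cn where "cn = (\<lambda>(ss, c). canon A ss c)"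
  have T: "(ss, c) \<in> ?T \<longleftrightarrow> (ss, c) \<in> FacS A m ((!) \<theta>) \<and> has_type i ss \<and> leaf_positions ss = {}" for ss c
    by (auto simp: SmT_def FacT_def A_def n_def)
  have TF: "(ss, c) \<in> Fac A m" if "(ss, c) \<in> ?T" for ss c using that by (simp add: T FacS_def)
  have fac: "factors A ss" if "(ss, c) \<in> ?T" for ss c using factors_of_Fac[OF finA(1) TF[OF that] m(1)] .
  have finT: "finite ?T"
    by (rule finite_subset[OF _ finite_FacS[OF finA(1), of m "(!) \<theta>"]]) (auto simp: T)
  have clS: "clean M" if "M \<in> ?S" for M
    using that clean_theta_proper by (auto simp: smooth_theta_proper_polymaps_def)
  have equiv: "equiv ?S E"
  proof (rule equivI)
    show "E \<subseteq> ?S \<times> ?S" by (auto simp: E_def)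
    show "refl_on ?S E" unfolding refl_on_def E_def using map_iso_refl polymap_iso_iff by blast
    show "sym E"
    proof (rule symI)
      fix M N assume "(M, N) \<in> E"
      then show "(N, M) \<in> E" using map_iso_sym[of _ M N] clS by (auto simp: E_def polymap_iso_iff)
    qed
    show "trans E"
    proof (rule transI)
      fix M N P assume "(M, N) \<in> E" "(N, P) \<in> E"
      then show "(M, P) \<in> E" using map_iso_trans[of _ M N _ P] clS by (auto simp: E_def polymap_iso_iff)
    qed
  qed
  have cnS: "cn x \<in> ?S" if x: "x \<in> ?T" for x
  proof -
    obtain ss c where y: "x = (ss, c)" by fastforce
    interpret factors A ss by (rule fac) (use x y in simp)
    have F: "(ss, c) \<in> Fac A m" using TF x y by simp
    have "c (tot v) = c v" if "v \<in> A" for v using Fac_tot[OF F that] by (simp add: tot_def)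
    then have "theta_proper \<theta> (canon A ss c)"
      using theta_proper_canon_iff[OF _ Fac_extensional[OF F], of \<theta>] x y m(2) by (simp add: T)
    then show ?thesis
      using x y smooth_canon_iff[of c] has_poly_index_canon_iff[of c i] by (simp add: cn_def smooth_theta_proper_polymaps_def T)
  qed
  have actT: "act g x \<in> ?T" if x: "x \<in> ?T" and g: "g permutes A" for g x
  proof -
    obtain ss c where y: "x = (ss, c)" by fastforce
    have b: "bij g" "g ` A = A" by (rule permutes_bij[OF g], rule permutes_image[OF g])
    have "(map (conjugate g) ss, relabel g A c) \<in> FacS (g ` A) m ((!) \<theta>)"
      using FacS_conjugate[OF b(1)] x y by (simp add: T)
    then show ?thesis
      using x y has_type_conjugate[OF b(1)] leaf_positions_map_conjugate[OF b(1)] b(2) by (simp add: T act_def)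
  qed
  have iso_iff: "polymap_iso (cn x) (cn y) \<longleftrightarrow> (\<exists>g. g permutes A \<and> y = act g x)" if xy: "x \<in> ?T" "y \<in> ?T" for x y
  proof -
    obtain ss c where x: "x = (ss, c)" by fastforce
    obtain ts d where y: "y = (ts, d)" by fastforce
    note F = TF[OF xy(1)[unfolded x]] TF[OF xy(2)[unfolded y]]
    note f = fac[OF xy(1)[unfolded x]] fac[OF xy(2)[unfolded y]]
    show ?thesis
    proof
      assume "polymap_iso (cn x) (cn y)"
      then obtain h where "map_iso h (canon A ss c) (canon A ts d)" by (auto simp: polymap_iso_iff cn_def x y)
      from canon_iso_imp_conjugate[OF this f Fac_tot[OF F(1)] Fac_tot[OF F(2)] Fac_extensional[OF F(2)]]
      show "\<exists>g. g permutes A \<and> y = act g x" by (simp add: act_def x y)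
    next
      assume "\<exists>g. g permutes A \<and> y = act g x"
      then obtain g where g: "g permutes A" "ts = map (conjugate g) ss" "d = relabel g A c" by (auto simp: act_def x y)
      from canon_iso_conjugate[OF g(1) f[unfolded g(2)] Fac_tot[OF F(1)] Fac_tot[OF F(2)[unfolded g(2,3)]]]
      show "polymap_iso (cn x) (cn y)" by (simp add: polymap_iso_iff cn_def x y g(2,3))
    qed
  qed
  define \<phi> where "\<phi> x = E `` {cn x}" for x
  have img: "\<phi> ` ?T = ?S // E"
  proof (intro equalityI subsetI)
    fix K assume "K \<in> \<phi> ` ?T"
    then show "K \<in> ?S // E" using cnS by (auto simp: \<phi>_def intro: quotientI)
  next
    fix K assume "K \<in> ?S // E"
    then obtain M where M: "M \<in> ?S" "K = E `` {M}" by (rule quotientE)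
    obtain h ss c where h: "(ss, c) \<in> FacT m ((!) \<theta>) i" "leaf_positions ss = {}" "map_iso h M (canon A ss c)"
      using ex_canon[OF M(1)] by (auto simp: m(2) A_def n_def)
    then have x: "(ss, c) \<in> ?T" by (simp add: SmT_def)
    then have "(M, cn (ss, c)) \<in> E" using M(1) cnS[OF x] h(3) by (auto simp: E_def polymap_iso_iff cn_def)
    then have "K = \<phi> (ss, c)" unfolding M(2) \<phi>_def by (rule equiv_class_eq[OF equiv])
    then show "K \<in> \<phi> ` ?T" using x by blast
  qed
  have fiber: "card {y\<in>?T. \<phi> y = K} = fact n" if K: "K \<in> \<phi> ` ?T" for K
  proof -
    obtain x where x: "x \<in> ?T" "K = \<phi> x" using K by blast
    have "{y\<in>?T. \<phi> y = K} = (\<lambda>g. act g x) ` {g. g permutes A}"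
    proof (intro equalityI subsetI)
      fix y assume y: "y \<in> {y\<in>?T. \<phi> y = K}"
      then have "(cn x, cn y) \<in> E"
        using eq_equiv_class_iff[OF equiv cnS[OF x(1)] cnS[of y]] by (simp add: \<phi>_def x(2))
      then have "polymap_iso (cn x) (cn y)" by (simp add: E_def)
      then show "y \<in> (\<lambda>g. act g x) ` {g. g permutes A}" using iso_iff[OF x(1)] y by blast
    next
      fix y assume "y \<in> (\<lambda>g. act g x) ` {g. g permutes A}"
      then obtain g where g: "g permutes A" "y = act g x" by blast
      have y: "y \<in> ?T" using actT[OF x(1) g(1)] g(2) by simp
      have "polymap_iso (cn x) (cn y)" using iso_iff[OF x(1) y] g by blast
      then have "(cn x, cn y) \<in> E" using cnS x(1) y by (simp add: E_def)
      then show "y \<in> {y\<in>?T. \<phi> y = K}" using y equiv_class_eq[OF equiv] by (simp add: \<phi>_def x(2))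
    qed
    moreover have "inj_on (\<lambda>g. act g x) {g. g permutes A}"
    proof (rule inj_onI)
      fix g k assume gk: "g \<in> {g. g permutes A}" "k \<in> {g. g permutes A}" "act g x = act k x"
      obtain ss c where s: "x = (ss, c)" by fastforce
      show "g = k"
        using Fac_stabilizer_trivial[OF finA(1) TF[of ss c] m(1), of g k] gk x(1) s by (simp add: act_def)
    qed
    ultimately show ?thesis using card_permutations[OF finA(2,1)] by (simp add: card_image)
  qed
  have "card ?T = (\<Sum>K\<in>\<phi> ` ?T. card {y\<in>?T. \<phi> y = K})"
    using sum.group[OF finT finite_imageI[OF finT] subset_refl, where g = \<phi> and h = "\<lambda>_. 1::nat"] by simp
  also have "\<dots> = (\<Sum>K\<in>\<phi> ` ?T. fact n)" by (rule sum.cong) (simp_all add: fiber)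
  also have "\<dots> = fact n * S_num \<theta> i" by (simp add: img S_num_def E_def)
  finally show ?thesis by (simp add: n_def)
qed

section \<open>Comparison of coefficients\<close>

definition type_of :: "('a \<Rightarrow> 'a) list \<Rightarrow> nat \<Rightarrow>\<^sub>0 nat" where
  "type_of ss = Poly_Mapping.Abs_poly_mapping (\<lambda>k. length (filter (\<lambda>s. csize s = k) ss))"

lemma lookup_type_of: "Poly_Mapping.lookup (type_of ss) k = length (filter (\<lambda>s. csize s = k) ss)"
proof -
  have "{k. length (filter (\<lambda>s. csize s = k) ss) \<noteq> 0} \<subseteq> csize ` set ss"
    by (auto simp: filter_empty_conv)
  then have "finite {k. length (filter (\<lambda>s. csize s = k) ss) \<noteq> 0}" by (rule finite_subset) simp
  then show ?thesis unfolding type_of_def by (simp add: Abs_poly_mapping_inverse)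
qed

lemma keys_type_of: "Poly_Mapping.keys (type_of ss) = csize ` set ss"
  by (auto simp: in_keys_iff lookup_type_of filter_empty_conv)

text \<open>\<open>has_type\<close> looks at lengths k >= 2 only. At 0 and 1 both sides vanish, by
  \<open>index_seqs\<close> and since no factor is shorter than 2.\<close>

lemma has_type_iff:
  assumes "\<And>s. s \<in> set ss \<Longrightarrow> 2 \<le> csize s" "i \<in> index_seqs"
  shows "has_type i ss \<longleftrightarrow> i = type_of ss"
proof
  assume h: "has_type i ss"
  show "i = type_of ss"
  proof (rule poly_mapping_eqI)
    fix k
    show "Poly_Mapping.lookup i k = Poly_Mapping.lookup (type_of ss) k"
    proof (cases "2 \<le> k")
      case True
      then show ?thesis using h by (simp add: has_type_def lookup_type_of)
    next
      case False
      then have "k \<notin> Poly_Mapping.keys i" using assms(2) by (auto simp: index_seqs_def)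
      moreover have "k \<notin> Poly_Mapping.keys (type_of ss)" using False assms(1) by (auto simp: keys_type_of)
      ultimately show ?thesis by (simp add: in_keys_iff)
    qed
  qed
qed (simp add: has_type_def lookup_type_of)

lemma prod_list_count: "(\<Prod>x\<leftarrow>xs. f x) = (\<Prod>k\<in>set xs. (f k :: 'b::comm_monoid_mult) ^ count_list xs k)"
proof (induction xs)
  case (Cons x xs)
  show ?case
  proof (cases "x \<in> set xs")
    case True
    have "(\<Prod>k\<in>set xs. f k ^ count_list (x # xs) k) = (\<Prod>k\<in>set xs. (if k = x then f x else 1) * f k ^ count_list xs k)"
      by (rule prod.cong) auto
    also have "\<dots> = f x * (\<Prod>k\<in>set xs. f k ^ count_list xs k)"
      using True by (simp add: prod.distrib prod.delta)
    finally show ?thesis using Cons True by (simp add: insert_absorb)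
  next
    case False
    have "(\<Prod>k\<in>set xs. f k ^ count_list (x # xs) k) = (\<Prod>k\<in>set xs. f k ^ count_list xs k)"
      by (rule prod.cong) (use False in auto)
    then show ?thesis using Cons False by (simp add: count_notin)
  qed
qed simp

lemma count_csize: "count_list (map csize ss) k = length (filter (\<lambda>s. csize s = k) ss)"
  by (induction ss) auto

lemma qmon_type_of: "qmon (type_of ss) = weight ss"
proof -
  have "weight ss = (\<Prod>k\<leftarrow>map csize ss. qvar k)" by (simp add: weight_def comp_def)
  also have "\<dots> = (\<Prod>k\<in>csize ` set ss. qvar k ^ count_list (map csize ss) k)"
    unfolding prod_list_count by simp
  finally show ?thesis by (simp add: qmon_def keys_type_of lookup_type_of count_csize)
qed

lemma rsize_type_of: "rsize (type_of ss) = length ss"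
proof -
  have "rsize (type_of ss) = (\<Sum>k\<in>set (map csize ss). count_list (map csize ss) k)"
    by (simp add: rsize_def keys_type_of lookup_type_of count_csize)
  then show ?thesis by (simp add: sum_count_set)
qed

text \<open>The common shape of \<open>Psi\<close> and \<open>Gamma\<close>. At exponent b only the
  composition with parts b_j occurs, and the sum over i becomes a sum over the finite set T of
  objects grouped by type. If some b_j with j < m is 0 there is no composition, so T has to be
  empty.\<close>

lemma msum_monomials:
  fixes C :: "(nat \<Rightarrow>\<^sub>0 nat) \<Rightarrow> nat list \<Rightarrow> 'a::comm_ring_1" and T :: "'c set"
  assumes m: "0 < m" and T: "finite T" and ty: "\<And>t. t \<in> T \<Longrightarrow> ty t \<in> I"
    and C: "\<And>i. i \<in> I \<Longrightarrow> (\<forall>j<m. 0 < Poly_Mapping.lookup b j) \<Longrightarrow>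
      C i (map (Poly_Mapping.lookup b) [0..<m]) = (\<Sum>t\<in>{t\<in>T. ty t = i}. g t)"
    and empty: "\<And>j. j < m \<Longrightarrow> Poly_Mapping.lookup b j = 0 \<Longrightarrow> T = {}"
  shows "mcoeff (msum {(n, i, \<alpha>). n \<ge> 1 \<and> i \<in> I \<and> composition \<alpha> n \<and> length \<alpha> = m}
      (\<lambda>(n, i, \<alpha>). mconst (C i \<alpha>) * (\<Prod>j<m. mvar j ^ (\<alpha> ! j)))) b =
    (if Poly_Mapping.keys b \<subseteq> {..<m} then \<Sum>t\<in>T. g t else 0)"
proof -
  define J where "J = {(n, i, \<alpha>). n \<ge> 1 \<and> i \<in> I \<and> composition \<alpha> n \<and> length \<alpha> = m}"
  define F where "F = (\<lambda>(n::nat, i, \<alpha>). mcoeff (mconst (C i \<alpha>) * (\<Prod>j<m. mvar j ^ (\<alpha> ! j))) b)"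
  define \<beta> where "\<beta> = map (Poly_Mapping.lookup b) [0..<m]"
  define N where "N = sum_list \<beta>"
  have \<beta>: "length \<beta> = m" "\<And>j. j < m \<Longrightarrow> \<beta> ! j = Poly_Mapping.lookup b j" by (simp_all add: \<beta>_def)
  have msum: "mcoeff (msum J (\<lambda>(n, i, \<alpha>). mconst (C i \<alpha>) * (\<Prod>j<m. mvar j ^ (\<alpha> ! j)))) b = (\<Sum>t\<in>{t\<in>J. F t \<noteq> 0}. F t)"
    unfolding msum_def mcoeff_Abs F_def by (rule sum.cong) (auto simp: case_prod_beta)
  have "(\<Sum>t\<in>{t\<in>J. F t \<noteq> 0}. F t) = (if Poly_Mapping.keys b \<subseteq> {..<m} then \<Sum>t\<in>T. g t else 0)"
  proof (cases "Poly_Mapping.keys b \<subseteq> {..<m}")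
    case False
    then have "F t = 0" for t by (simp add: F_def mcoeff_mvar_monomial case_prod_beta)
    then have "{t\<in>J. F t \<noteq> 0} = {}" by blast
    then show ?thesis using False by (simp only: sum.empty if_False)
  next
    case True
    have F: "F (n, i, \<alpha>) = (if \<alpha> = \<beta> then C i \<beta> else 0)" if "length \<alpha> = m" for n i \<alpha>
    proof -
      have "(\<forall>j<m. Poly_Mapping.lookup b j = \<alpha> ! j) \<longleftrightarrow> \<alpha> = \<beta>"
        using that \<beta> by (auto simp: list_eq_iff_nth_eq)
      then show ?thesis using True by (simp add: F_def mcoeff_mvar_monomial)
    qed
    have F\<beta>: "F (n, i, \<beta>) = C i \<beta>" for n i using F[OF \<beta>(1)] by simp
    show ?thesis
    proof (cases "\<forall>j<m. 0 < Poly_Mapping.lookup b j")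
      case False
      then obtain j where j: "j < m" "Poly_Mapping.lookup b j = 0" by auto
      have "F t = 0" if t: "t \<in> J" for t
      proof -
        obtain n i \<alpha> where t': "t = (n, i, \<alpha>)" by (cases t) auto
        then have a: "length \<alpha> = m" "\<forall>a\<in>set \<alpha>. 0 < a" using t by (auto simp: composition_def J_def)
        have "\<alpha> ! j \<noteq> \<beta> ! j" using a j \<beta>(2)[OF j(1)] nth_mem[of j \<alpha>] by auto
        then show ?thesis using F[OF a(1)] t' by auto
      qed
      then have "{t\<in>J. F t \<noteq> 0} = {}" by blast
      then show ?thesis using empty[OF j] by (simp only: sum.empty if_cancel)
    next
      case pos: True
      have N: "1 \<le> N"
      proof -
        have "\<beta> ! 0 \<in> set \<beta>" using m \<beta>(1) by (intro nth_mem) simp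
        moreover have "0 < \<beta> ! 0" using m \<beta>(2) pos by simp
        ultimately have "0 < N" unfolding N_def using member_le_sum_list[of "\<beta> ! 0" \<beta>] by linarith
        then show ?thesis by simp
      qed
      have "\<forall>a\<in>set \<beta>. 0 < a" using pos by (auto simp: \<beta>_def)
      then have J: "(n, i, \<beta>) \<in> J \<longleftrightarrow> n = N \<and> i \<in> I" for n i
        using \<beta>(1) N by (auto simp: J_def composition_def N_def)
      have CI: "C i \<beta> = (\<Sum>t\<in>{t\<in>T. ty t = i}. g t)" if "i \<in> I" for i
        using C[OF that pos] by (simp add: \<beta>_def)
      have "{t\<in>J. F t \<noteq> 0} = (\<lambda>i. (N, i, \<beta>)) ` {i\<in>I. C i \<beta> \<noteq> 0}"
      proof (intro equalityI subsetI)
        fix t assume t: "t \<in> {t\<in>J. F t \<noteq> 0}"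
        obtain n i \<alpha> where t': "t = (n, i, \<alpha>)" by (cases t) auto
        have tJ: "(n, i, \<alpha>) \<in> J" "F (n, i, \<alpha>) \<noteq> 0" using t unfolding t' by blast+
        have l: "length \<alpha> = m" using tJ(1) by (simp add: J_def)
        have "\<alpha> = \<beta>" "C i \<beta> \<noteq> 0" using tJ(2) unfolding F[OF l] by (simp_all split: if_splits)
        then show "t \<in> (\<lambda>i. (N, i, \<beta>)) ` {i\<in>I. C i \<beta> \<noteq> 0}" using tJ(1) J[of n i] t' by blast
      next
        fix t assume "t \<in> (\<lambda>i. (N, i, \<beta>)) ` {i\<in>I. C i \<beta> \<noteq> 0}"
        then obtain i where i: "t = (N, i, \<beta>)" "i \<in> I" "C i \<beta> \<noteq> 0" by blast
        have "t \<in> J" unfolding i(1) J using i(2) by simp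
        moreover have "F t \<noteq> 0" unfolding i(1) F\<beta> by (rule i(3))
        ultimately show "t \<in> {t\<in>J. F t \<noteq> 0}" by blast
      qed
      moreover have "inj_on (\<lambda>i. (N, i, \<beta>)) {i\<in>I. C i \<beta> \<noteq> 0}" by (simp add: inj_on_def)
      ultimately have "(\<Sum>t\<in>{t\<in>J. F t \<noteq> 0}. F t) = (\<Sum>i\<in>{i\<in>I. C i \<beta> \<noteq> 0}. C i \<beta>)"
        by (simp only: sum.reindex comp_def F\<beta>)
      also have "\<dots> = (\<Sum>i\<in>ty ` T. C i \<beta>)"
      proof (rule sum.mono_neutral_left)
        show "finite (ty ` T)" using T by simp
        show "{i\<in>I. C i \<beta> \<noteq> 0} \<subseteq> ty ` T"
        proof
          fix i assume i: "i \<in> {i\<in>I. C i \<beta> \<noteq> 0}"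
          then have "{t\<in>T. ty t = i} \<noteq> {}" using CI[of i] by (metis (mono_tags, lifting) mem_Collect_eq sum.empty)
          then show "i \<in> ty ` T" by blast
        qed
      qed (use ty in blast)
      also have "\<dots> = (\<Sum>i\<in>ty ` T. \<Sum>t\<in>{t\<in>T. ty t = i}. g t)" by (rule sum.cong) (use CI ty in blast)+
      also have "\<dots> = (\<Sum>t\<in>T. g t)" by (rule sum.group[OF T finite_imageI[OF T] subset_refl])
      finally show ?thesis using True by simp
    qed
  qed
  then show ?thesis using msum by (simp only: J_def)
qed

text \<open>Every label below m is attained, which rules out a class of size 0.\<close>

lemma FacS_empty:
  assumes "j < m" "a j = 0" "finite A" shows "FacS A m a = {}"
proof (rule ccontr)
  assume "FacS A m a \<noteq> {}"
  then obtain ss c where x: "(ss, c) \<in> FacS A m a" by fastforce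
  then have "c ` A = {..<m}" by (intro Fac_image[of ss c A m]) (simp add: FacS_def)
  then have "j \<in> c ` A" using assms(1) by simp
  then obtain y where "y \<in> A" "c y = j" by blast
  moreover have "card {x\<in>A. c x = j} = 0" using x assms(1,2) by (simp add: FacS_def)
  ultimately show False using assms(3) by auto
qed

lemma type_of_index: assumes "(ss, c) \<in> Fac A m" shows "s \<in> set ss \<Longrightarrow> 2 \<le> csize s" "type_of ss \<in> index_seqs"
proof -
  show csz: "2 \<le> csize s" if "s \<in> set ss" for s using assms that is_cyc_csize by (auto simp: Fac_def)
  then show "type_of ss \<in> index_seqs" by (auto simp: index_seqs_def keys_type_of)
qed

lemma ratc_fact_card: assumes "of_nat (fact n) * x = of_nat k" shows "x = ratc (1 / fact n) * of_nat k"
proof -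
  have "ratc (1 / fact n) * of_nat k = of_nat (fact n) * (ratc (1 / fact n) * x)"
    unfolding assms[symmetric] by (simp only: mult.left_commute)
  then show ?thesis by (simp only: ratc_fact_cancel)
qed

lemma sum_weight_term_type:
  assumes T: "T \<subseteq> Fac A m" and i: "i \<in> index_seqs"
  shows "of_nat (card {x\<in>T. has_type i (fst x)}) * (qmon i * uvar ^ rsize i * ratc (1 / fact (rsize i))) =
    (\<Sum>x\<in>{x\<in>T. type_of (fst x) = i}. weight_term (fst x))"
proof -
  have iff: "has_type i (fst x) \<longleftrightarrow> type_of (fst x) = i" if "x \<in> T" for x
    using has_type_iff[OF type_of_index(1)[of "fst x" "snd x" A m] i] T that by auto
  have "{x\<in>T. has_type i (fst x)} = {x\<in>T. type_of (fst x) = i}" using iff by blast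
  moreover have "weight_term (fst x) = qmon i * uvar ^ rsize i * ratc (1 / fact (rsize i))"
    if "x \<in> {x\<in>T. type_of (fst x) = i}" for x
    using that by (auto simp: weight_term_def qmon_type_of rsize_type_of)
  ultimately show ?thesis by simp
qed

text \<open>The denominators \<open>\<alpha> ! j\<close> in \<open>Psi\<close> cancel the choices of
  base points in \<open>H_num_eq\<close>, and only the division by n! remains.\<close>

lemma mcoeff_Psi:
  assumes m: "2 \<le> m"
  shows "mcoeff (Psi m) b = (if Poly_Mapping.keys b \<subseteq> {..<m} then psi m (Poly_Mapping.lookup b) else 0)"
proof -
  let ?a = "Poly_Mapping.lookup b"
  define n where "n = (\<Sum>j<m. ?a j)"
  define T where "T = FacS {1..n} m ?a"
  define \<beta> where "\<beta> = map ?a [0..<m]"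
  let ?w = "\<lambda>i. qmon i * uvar ^ rsize i * ratc (1 / fact (rsize i))"
  let ?C = "\<lambda>i \<alpha>. of_nat (H_num \<alpha> i) * qmon i * (\<Prod>j<m. ratc (1 / of_nat (\<alpha> ! j))) * uvar ^ rsize i * ratc (1 / fact (rsize i))"
  have T: "finite T" "T \<subseteq> Fac {1..n} m" unfolding T_def by (rule finite_FacS, simp) (auto simp: FacS_def)
  have Tm: "(ss, c) \<in> Fac {1..n} m" if "(ss, c) \<in> T" for ss c using that T(2) by blast
  have psi: "psi m ?a = (\<Sum>x\<in>T. ratc (1 / fact n) * weight_term (fst x))"
    by (simp add: psi_def T_def n_def sum_distrib_left case_prod_beta)
  have "mcoeff (Psi m) b = (if Poly_Mapping.keys b \<subseteq> {..<m} then \<Sum>x\<in>T. ratc (1 / fact n) * weight_term (fst x) else 0)"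
    unfolding Psi_def
  proof (rule msum_monomials[where ty = "\<lambda>x. type_of (fst x)" and C = ?C])
    show "type_of (fst x) \<in> index_seqs" if "x \<in> T" for x
      using type_of_index(2)[OF Tm[of "fst x" "snd x"]] that by simp
    show "T = {}" if "j < m" "?a j = 0" for j using FacS_empty[of j m ?a "{1..n}"] that by (simp add: T_def)
    fix i assume i: "i \<in> index_seqs" and pos: "\<forall>j<m. 0 < ?a j"
    have \<beta>: "length \<beta> = m" "\<And>j. j < m \<Longrightarrow> \<beta> ! j = ?a j" by (simp_all add: \<beta>_def)
    have sum: "sum_list \<beta> = n" by (simp add: \<beta>_def n_def interv_sum_list_conv_sum_set_nat atLeast0LessThan)
    have comp: "composition \<beta> n" using pos sum by (auto simp: composition_def \<beta>_def)
    have ft: "FacT m ((!) \<beta>) i = {x\<in>T. has_type i (fst x)}"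
    proof -
      have "FacS {1..n} m ((!) \<beta>) = T" unfolding T_def by (rule FacS_cong) (simp add: \<beta>(2))
      moreover have "(\<Sum>j<m. \<beta> ! j) = n" by (simp add: \<beta>(2) n_def)
      ultimately show ?thesis unfolding FacT_def by auto
    qed
    let ?P = "\<Prod>j<m. \<beta> ! j"
    let ?k = "card {x\<in>T. has_type i (fst x)}"
    have "fact n * H_num \<beta> i = ?P * ?k" using H_num_eq[OF comp \<beta>(1), of i] ft by simp
    then have h: "of_nat (fact n) * of_nat (H_num \<beta> i) = (of_nat ?P * of_nat ?k :: qu_poly)"
      by (simp only: of_nat_mult[symmetric])
    have R: "of_nat ?P * (\<Prod>j<m. ratc (1 / of_nat (\<beta> ! j))) = 1"
    proof -
      have "of_nat (\<beta> ! j) * ratc (1 / of_nat (\<beta> ! j)) = 1" if "j < m" for j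
      proof -
        have "\<beta> ! j \<noteq> 0" using pos that \<beta>(2) by simp
        then show ?thesis by (simp add: ratc_of_nat[symmetric] ratc_mult)
      qed
      then show ?thesis by (simp add: of_nat_prod prod.distrib[symmetric])
    qed
    have "of_nat (fact n) * (of_nat (H_num \<beta> i) * (\<Prod>j<m. ratc (1 / of_nat (\<beta> ! j)))) =
        (of_nat (fact n) * of_nat (H_num \<beta> i)) * (\<Prod>j<m. ratc (1 / of_nat (\<beta> ! j)))" by (simp only: mult.assoc)
    also have "\<dots> = of_nat ?k * (of_nat ?P * (\<Prod>j<m. ratc (1 / of_nat (\<beta> ! j))))"
      unfolding h by (simp only: mult_ac)
    finally have "of_nat (fact n) * (of_nat (H_num \<beta> i) * (\<Prod>j<m. ratc (1 / of_nat (\<beta> ! j)))) = of_nat ?k"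
      unfolding R mult_1_right .
    then have "of_nat (H_num \<beta> i) * (\<Prod>j<m. ratc (1 / of_nat (\<beta> ! j))) = ratc (1 / fact n) * of_nat ?k"
      by (rule ratc_fact_card)
    then have "?C i \<beta> = ratc (1 / fact n) * (of_nat ?k * ?w i)" by (simp add: mult_ac)
    also have "\<dots> = (\<Sum>x\<in>{x\<in>T. type_of (fst x) = i}. ratc (1 / fact n) * weight_term (fst x))"
      unfolding sum_weight_term_type[OF T(2) i] by (rule sum_distrib_left)
    finally show "?C i (map ?a [0..<m]) = (\<Sum>x\<in>{x\<in>T. type_of (fst x) = i}. ratc (1 / fact n) * weight_term (fst x))"
      unfolding \<beta>_def .
  qed (use m T in auto)
  then show ?thesis by (simp only: psi)
qed

lemma mcoeff_Gamma:
  assumes m: "2 \<le> m"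
  shows "mcoeff (Gamma m) b = (if Poly_Mapping.keys b \<subseteq> {..<m} then gam m (Poly_Mapping.lookup b) else 0)"
proof -
  let ?a = "Poly_Mapping.lookup b"
  define n where "n = (\<Sum>j<m. ?a j)"
  define T where "T = {(ss, c) \<in> FacS {1..n} m ?a. leaf_positions ss = {}}"
  define \<beta> where "\<beta> = map ?a [0..<m]"
  let ?w = "\<lambda>i. qmon i * uvar ^ rsize i * ratc (1 / fact (rsize i))"
  let ?C = "\<lambda>i \<alpha>. of_nat (S_num \<alpha> i) * qmon i * uvar ^ rsize i * ratc (1 / fact (rsize i))"
  have T: "finite T" "T \<subseteq> Fac {1..n} m"
    by (rule finite_subset[OF _ finite_FacS[of "{1..n}" m ?a]]) (auto simp: T_def FacS_def)
  have Tm: "(ss, c) \<in> Fac {1..n} m" if "(ss, c) \<in> T" for ss c using that T(2) by blast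
  have gam: "gam m ?a = (\<Sum>x\<in>T. ratc (1 / fact n) * weight_term (fst x))"
    by (simp add: gam_def T_def n_def sum_distrib_left case_prod_beta)
  have "mcoeff (Gamma m) b = (if Poly_Mapping.keys b \<subseteq> {..<m} then \<Sum>x\<in>T. ratc (1 / fact n) * weight_term (fst x) else 0)"
    unfolding Gamma_def
  proof (rule msum_monomials[where ty = "\<lambda>x. type_of (fst x)" and C = ?C])
    show "type_of (fst x) \<in> index_seqs" if "x \<in> T" for x
      using type_of_index(2)[OF Tm[of "fst x" "snd x"]] that by simp
    show "T = {}" if "j < m" "?a j = 0" for j using FacS_empty[of j m ?a "{1..n}"] that by (simp add: T_def)
    fix i assume i: "i \<in> index_seqs" and pos: "\<forall>j<m. 0 < ?a j"
    have \<beta>: "length \<beta> = m" "\<And>j. j < m \<Longrightarrow> \<beta> ! j = ?a j" by (simp_all add: \<beta>_def)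
    let ?k = "card {x\<in>T. has_type i (fst x)}"
    have s: "(\<Sum>j<m. \<beta> ! j) = n" by (simp add: \<beta>(2) n_def)
    have "FacS {1..n} m ((!) \<beta>) = FacS {1..n} m ?a" by (rule FacS_cong) (simp add: \<beta>(2))
    then have "SmT m ((!) \<beta>) i = {x\<in>T. has_type i (fst x)}" unfolding SmT_def FacT_def s T_def by auto
    then have "fact n * S_num \<beta> i = ?k" using S_num_eq[OF m \<beta>(1), of i] s by simp
    then have "of_nat (fact n) * of_nat (S_num \<beta> i) = (of_nat ?k :: qu_poly)"
      by (simp only: of_nat_mult[symmetric])
    then have "of_nat (S_num \<beta> i) = ratc (1 / fact n) * of_nat ?k" by (rule ratc_fact_card)
    then have "?C i \<beta> = ratc (1 / fact n) * (of_nat ?k * ?w i)" by (simp add: mult_ac)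
    also have "\<dots> = (\<Sum>x\<in>{x\<in>T. type_of (fst x) = i}. ratc (1 / fact n) * weight_term (fst x))"
      unfolding sum_weight_term_type[OF T(2) i] by (rule sum_distrib_left)
    finally show "?C i (map ?a [0..<m]) = (\<Sum>x\<in>{x\<in>T. type_of (fst x) = i}. ratc (1 / fact n) * weight_term (fst x))"
      unfolding \<beta>_def .
  qed (use m T in auto)
  then show ?thesis by (simp only: gam)
qed

theorem theorem3p5:
  fixes m :: nat
  assumes "m \<ge> 2"
  shows "Psi m = msubst (Gamma m) (\<lambda>j. fps_subst wser (mvar j))"
proof (rule mpser_eqI)
  fix b :: "nat \<Rightarrow>\<^sub>0 nat"
  let ?b = "Poly_Mapping.lookup b"
  \<comment> \<open>\<open>gam m a\<close> depends on the values of a below m only, which are those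
    that \<open>of_exponent\<close> keeps.\<close>
  have gam: "mcoeff (Gamma m) (of_exponent m a) = gam m a" for a
  proof -
    have k: "Poly_Mapping.keys (of_exponent m a) \<subseteq> {..<m}"
      by (auto simp: in_keys_iff lookup_of_exponent split: if_splits)
    have s: "(\<Sum>j<m. Poly_Mapping.lookup (of_exponent m a) j) = (\<Sum>j<m. a j)"
      by (rule sum.cong) (simp_all add: lookup_of_exponent)
    have "FacS A m (Poly_Mapping.lookup (of_exponent m a)) = FacS A m a" for A :: "nat set"
      by (rule FacS_cong) (simp add: lookup_of_exponent)
    then show ?thesis using k by (simp add: mcoeff_Gamma[OF assms] gam_def s)
  qed
  have "mcoeff (msubst (Gamma m) (\<lambda>j. fps_subst wser (mvar j))) b =
      (if Poly_Mapping.keys b \<subseteq> {..<m}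
       then \<Sum>a\<in>exponents m ?b. gam m a * (\<Prod>j<m. fps_nth (wser ^ a j) (?b j)) else 0)"
    unfolding fps_subst_mvar
    using mcoeff_msubst_uni[of m "Gamma m" wser b, OF _ wser_nth_0] unfolding gam by (simp add: mcoeff_Gamma[OF assms])
  also have "\<dots> = mcoeff (Psi m) b" by (simp add: psi_eq_gam[OF assms] mcoeff_Psi[OF assms])
  finally show "mcoeff (Psi m) b = mcoeff (msubst (Gamma m) (\<lambda>j. fps_subst wser (mvar j))) b" ..
qed

end
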